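(* As $n\to\infty$ through the even integers, $$A_n=\frac\pi4-\frac{5\pi^3}{48n^2}-\frac{q_*\pi^3}{n^3}+O(n^{-4}).$$ Moreover, if $$\overline A_n=\frac n2\sin\frac\pi n-\frac{n-1}2\tan\frac{\pi}{2n-2}$$ is the Foster–Szabó upper bound, then (as $n\to\infty$ through the even integers) $$\overline A_n-A_n=\left(q_*-\frac1{24}\right)\frac{\pi^3}{n^3}+O(n^{-4}).$$
   Context: A planar polygon is small if the distance between any two of its vertices is at most one; $A_n$ is the largest possible area of a small $n$-gon. Put $b(x)=\frac{x^3}{3}-4x+\frac{11}{3}$, $\psi(x,y)=\frac{(x+y)^3}{3}+\frac{2x^3}{3}-6x-4y+\frac{20}{3}$ and $\mathcal J(w)=b(w_0)+\sum_{j\ge0}\psi(w_j,w_{j+1})$. Let $w^*=(w_j^* )_{j\ge0}$ be the unique positive sequence with $3(w_0^* )^2+(w_0^*+w_1^* )^2=10$, $(w_{j-1}^*+w_j^* )^2+(w_j^*+w_{j+1}^* )^2+2(w_j^* )^2=10$ for $j\ge1$, and $w_j^*\to1$. Then $q_*:=\frac7{48}+\frac1{16}\mathcal J(w^* )$. *)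

theory Defs
  imports "HOL-Analysis.Analysis" "HOL-Library.Landau_Symbols"
begin

text \<open>The plane is modelled by the type of complex numbers. An \<open>n\<close>-gon is given by its vertices
  \<open>v 0, \<dots>, v (n - 1)\<close> in cyclic order; the values \<open>v i\<close> for \<open>i \<ge> n\<close> are irrelevant.\<close>

definition polygon_edge :: "nat \<Rightarrow> (nat \<Rightarrow> complex) \<Rightarrow> nat \<Rightarrow> complex set" where
  "polygon_edge n v i = closed_segment (v i) (v (Suc i mod n))"

text \<open>Polygons are simple: the vertices are distinct, and two different edges have at most a common
  endpoint in common. They need not be convex.\<close>

definition is_polygon :: "nat \<Rightarrow> (nat \<Rightarrow> complex) \<Rightarrow> bool" where
  "is_polygon n v \<longleftrightarrow> n \<ge> 3 \<and> inj_on v {..<n} \<and>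
     (\<forall>i<n. \<forall>j<n. i \<noteq> j \<longrightarrow>
        polygon_edge n v i \<inter> polygon_edge n v j \<subseteq>
          {v i, v (Suc i mod n)} \<inter> {v j, v (Suc j mod n)})"

definition small_polygon :: "nat \<Rightarrow> (nat \<Rightarrow> complex) \<Rightarrow> bool" where
  "small_polygon n v \<longleftrightarrow> is_polygon n v \<and> (\<forall>i<n. \<forall>j<n. dist (v i) (v j) \<le> 1)"

definition polygon_area :: "nat \<Rightarrow> (nat \<Rightarrow> complex) \<Rightarrow> real" where
  "polygon_area n v = measure lebesgue (inside (\<Union>i<n. polygon_edge n v i))"

definition max_small_area :: "nat \<Rightarrow> real" where
  "max_small_area n = (SUP v\<in>{v. small_polygon n v}. polygon_area n v)"

definition b_fun :: "real \<Rightarrow> real" where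
  "b_fun x = x ^ 3 / 3 - 4 * x + 11 / 3"

definition psi_fun :: "real \<Rightarrow> real \<Rightarrow> real" where
  "psi_fun x y = (x + y) ^ 3 / 3 + 2 * x ^ 3 / 3 - 6 * x - 4 * y + 20 / 3"

definition J_fun :: "(nat \<Rightarrow> real) \<Rightarrow> real" where
  "J_fun w = b_fun (w 0) + (\<Sum>j. psi_fun (w j) (w (Suc j)))"

definition w_star :: "nat \<Rightarrow> real" where
  "w_star = (THE w. (\<forall>j. w j > 0) \<and>
     3 * (w 0)\<^sup>2 + (w 0 + w 1)\<^sup>2 = 10 \<and>
     (\<forall>j\<ge>1. (w (j - 1) + w j)\<^sup>2 + (w j + w (j + 1))\<^sup>2 + 2 * (w j)\<^sup>2 = 10) \<and>
     w \<longlonglongrightarrow> 1)"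

definition q_star :: real where
  "q_star = 7 / 48 + J_fun w_star / 16"

definition Foster_Szabo_bound :: "nat \<Rightarrow> real" where
  "Foster_Szabo_bound n =
     real n / 2 * sin (pi / real n) - (real n - 1) / 2 * tan (pi / (2 * real n - 2))"

abbreviation even_at_top :: "nat filter" where
  "even_at_top \<equiv> inf at_top (principal {n. even n})"

end

theory Submission
  imports Defs "HOL-Analysis.Analysis" "HOL-Real_Asymp.Real_Asymp"
begin

text \<open>Both inequalities for the largest area come from one description of a convex polygon of diameter
at most one. Let two parallel supporting lines rotate by a half turn around the polygon. They touch
it in antipodal vertices \<open>P\<^sub>k\<close>, \<open>Q\<^sub>k\<close>, and at each of finitely many angles one of the two
contact points runs through a side. Put \<open>V\<^sub>k = (P\<^sub>k - Q\<^sub>k) / 2\<close> and \<open>W\<^sub>k = (P\<^sub>k + Q\<^sub>k) / 2\<close>. At the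
angle \<open>\<theta>\<^sub>k\<close> the vector \<open>V\<close> moves by \<open>m\<^sub>k\<close> and \<open>W\<close> by \<open>\<epsilon>\<^sub>k m\<^sub>k\<close>, with \<open>\<epsilon>\<^sub>k = \<plusminus>1\<close>, in the direction
\<open>cis \<theta>\<^sub>k\<close>. After a half turn \<open>V\<close> has changed its sign and \<open>W\<close> has returned. The area is the sum of
the signed areas of the two paths (the \<^emph>\<open>even\<close> area of \<open>V\<close> and the \<^emph>\<open>odd\<close> area of \<open>W\<close>), and
the diameter condition says that \<open>V\<close> stays in the disc of radius \<open>1/2\<close>.

The even area is at most \<open>\<pi>/4\<close>; how much is lost is a sum of explicit functions of the positions of
the sides relative to the feet of their perpendiculars. The odd area is never positive. If
\<open>p\<^sub>k\<^sub>+\<^sub>1 = p\<^sub>k + \<epsilon>\<^sub>k m\<^sub>k\<close>, antiperiodic, then a Wirtinger inequality (\<open>jump_path.odd_area_upper\<close>) bounds it by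
\<open>- \<Sum> p\<^sub>k\<^sub>+\<^sub>1\<^sup>2 (\<theta>\<^sub>k\<^sub>+\<^sub>1 - \<theta>\<^sub>k)\<close>, and this is sharp up to the square of the size of a primitive of \<open>p\<close>
(\<open>jump_path.odd_area_lower\<close>). With lengths measured in units of \<open>\<nu> = \<pi> / (4 n)\<close> the total loss becomes the
cost of a discrete chain (locale \<open>zigzag\<close>, \<open>caliper.area_deficit\<close>).

The chain \<open>x = p / \<nu>\<close> is antiperiodic with period \<open>n\<close>. A step from \<open>x\<^sub>k\<close> to \<open>x\<^sub>k\<^sub>+\<^sub>1\<close> of opposite sign costs
\<open>phi \<bar>x\<^sub>k\<bar> \<bar>x\<^sub>k\<^sub>+\<^sub>1\<bar> \<ge> 0\<close>, with equality only for \<open>\<bar>x\<^sub>k\<bar> = \<bar>x\<^sub>k\<^sub>+\<^sub>1\<bar> = 1\<close>. If every step changed the sign,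
then an even number of steps would give a periodic chain; so for even \<open>n\<close> the number of steps that keep the sign
is odd. Three of them are too expensive. If there is one, then the moduli \<open>\<bar>x\<^sub>k\<bar>\<close> on each side of this step form a
sequence that starts near the defect and relaxes to \<open>1\<close>. By convexity of \<open>phi\<close> the cheapest such
sequence is the solution \<open>w_star\<close> of the stationarity equations, and the cost is at least \<open>2 \<tau>\<close> up to
an error that is exponentially small in \<open>n\<close> (\<open>zigzag.cost_lower\<close>). Here \<open>\<tau>\<close> is the cost of \<open>w_star\<close>, and since
\<open>psi_fun\<close> and \<open>phi\<close> differ by a telescoping term, \<open>q_star = \<tau> / 16\<close> (\<open>q_star_eq\<close>). Together this gives
\<open>hull_area_upper\<close>.

For the lower bound \<open>V\<close> is put on the circle of radius \<open>1/2\<close>, with alternating signs \<open>\<epsilon>\<^sub>k\<close> and with gaps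
proportional to \<open>w\<^sub>k\<^sub>-\<^sub>1 + w\<^sub>k\<close>, mirrored at the middle; the angle of one vertex is shifted by
\<open>O(n\<^sup>-\<^sup>2)\<close> so that \<open>W\<close> closes up. The points \<open>W\<^sub>2\<^sub>i + V\<^sub>2\<^sub>i\<close> are then the vertices of a strictly convex polygon of
diameter at most one, and each inequality above loses only \<open>O(n\<^sup>-\<^sup>4)\<close> (\<open>small_polygon_lower\<close>).

Polygons are compared with convex hulls in both directions: the inside of any polygon lies in the hull of
its vertices (\<open>polygon_area_le_hull\<close>), and the vertices of a strictly convex polygon form a simple polygon
whose inside is the hull up to a null set (\<open>convex_polygon.region_le_polygon_area\<close>).\<close>

section \<open>The stationary profile\<close>

text \<open>The cost of two neighbouring moduli of a chain. It differs from \<open>psi_fun\<close> only by a telescoping term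
(\<open>psi_phi\<close>), but it is symmetric, convex on the quadrant, and vanishes there only at its minimum \<open>(1, 1)\<close>.\<close>

definition phi :: "real \<Rightarrow> real \<Rightarrow> real" where
  "phi x y = ((x + y) ^ 3 + x ^ 3 + y ^ 3) / 3 - 5 * (x + y) + 20 / 3"

lemma cube_tangent:
  fixes s c :: real
  assumes "s \<ge> 0" "c \<ge> 0"
  shows "s ^ 3 / 3 \<ge> c ^ 3 / 3 + c\<^sup>2 * (s - c)"
proof -
  have "s ^ 3 / 3 - c ^ 3 / 3 - c\<^sup>2 * (s - c) = (s - c)\<^sup>2 * (s + 2 * c) / 3"
    by (simp add: power2_eq_square power3_eq_cube field_simps)
  moreover have "(s - c)\<^sup>2 * (s + 2 * c) / 3 \<ge> 0" using assms by simp
  ultimately show ?thesis by linarith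
qed

text \<open>The partial derivative of \<open>phi\<close> in its second argument. By symmetry \<open>dphi b a\<close> is the one in the first
argument at the point \<open>(a, b)\<close>.\<close>

definition dphi :: "real \<Rightarrow> real \<Rightarrow> real" where
  "dphi a b = (a + b)\<^sup>2 + b\<^sup>2 - 5"

lemma phi_commute: "phi x y = phi y x"
  by (simp add: phi_def add.commute)

lemma phi_tangent:
  assumes "x \<ge> 0" "y \<ge> 0" "a \<ge> 0" "b \<ge> 0"
  shows "phi x y \<ge> phi a b + dphi b a * (x - a) + dphi a b * (y - b)"
proof -
  have "(x + y) ^ 3 / 3 \<ge> (a + b) ^ 3 / 3 + (a + b)\<^sup>2 * ((x + y) - (a + b))"
    using assms by (intro cube_tangent) auto
  moreover have "x ^ 3 / 3 \<ge> a ^ 3 / 3 + a\<^sup>2 * (x - a)" "y ^ 3 / 3 \<ge> b ^ 3 / 3 + b\<^sup>2 * (y - b)"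
    using assms by (intro cube_tangent; simp)+
  ultimately show ?thesis
    unfolding phi_def dphi_def by (simp add: algebra_simps add_divide_distrib)
qed

lemma phi_nonneg:
  assumes "x \<ge> 0" "y \<ge> 0" shows "phi x y \<ge> 0"
  using phi_tangent[OF assms, of 1 1] by (simp add: phi_def dphi_def)

definition balance :: "real \<Rightarrow> real \<Rightarrow> real \<Rightarrow> bool" where
  "balance a b c \<longleftrightarrow> (a + b)\<^sup>2 + (b + c)\<^sup>2 + 2 * b\<^sup>2 = 10"

text \<open>The equations that define \<open>w_star\<close> express stationarity: \<open>balance a b c\<close> holds if and only if the derivative of
\<open>phi a b + phi b c\<close> with respect to \<open>b\<close> vanishes.\<close>

lemma balance_dphi: "balance a b c \<longleftrightarrow> dphi a b + dphi c b = 0"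
  by (auto simp: balance_def dphi_def algebra_simps)

text \<open>Subtract the two equations and factor each difference of squares. This linear relation between the
three differences serves twice: it makes the iteration below a contraction, and it is the maximum
principle behind uniqueness.\<close>

lemma balance_diff:
  assumes "balance a b c" "balance a' b' c'"
    and "a \<ge> 0" "a' \<ge> 0" "c \<ge> 0" "c' \<ge> 0" "b > 0" "b' > 0"
  shows "\<bar>b - b'\<bar> * ((a + b + a' + b') + (b + c + b' + c') + 2 * (b + b'))
     \<le> (a + b + a' + b') * \<bar>a - a'\<bar> + (b + c + b' + c') * \<bar>c - c'\<bar>"
proof -
  let ?X = "a + b + a' + b'" and ?Y = "b + c + b' + c'"
  have "?X * ((a - a') + (b - b')) + ?Y * ((b - b') + (c - c')) + 2 * (b + b') * (b - b')
      = ((a + b)\<^sup>2 + (b + c)\<^sup>2 + 2 * b\<^sup>2) - ((a' + b')\<^sup>2 + (b' + c')\<^sup>2 + 2 * b'\<^sup>2)"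
    by (simp add: power2_eq_square algebra_simps)
  hence "(b - b') * (?X + ?Y + 2 * (b + b')) = - (?X * (a - a') + ?Y * (c - c'))"
    using assms(1,2) by (simp add: balance_def algebra_simps)
  hence "\<bar>b - b'\<bar> * \<bar>?X + ?Y + 2 * (b + b')\<bar> = \<bar>?X * (a - a') + ?Y * (c - c')\<bar>"
    by (metis abs_minus_cancel abs_mult)
  also have "\<dots> \<le> \<bar>?X * (a - a')\<bar> + \<bar>?Y * (c - c')\<bar>" by linarith
  also have "\<dots> = ?X * \<bar>a - a'\<bar> + ?Y * \<bar>c - c'\<bar>"
    using assms by (simp add: abs_mult)
  finally show ?thesis using assms by simp
qed

text \<open>A range for the profile that is mapped into itself by solving the stationarity equation for its middle
variable.\<close>

definition in_box :: "real \<Rightarrow> bool" where "in_box t \<longleftrightarrow> 7/10 \<le> t \<and> t \<le> 7/5"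

text \<open>Inside the box the weight \<open>2 (b + b')\<close> is at least a third of the sum of the two outer weights in
\<open>balance_diff\<close>; this is where the factor \<open>3/4\<close> comes from.\<close>

lemma balance_contract:
  assumes "balance a b c" "balance a' b' c'"
    and "0 \<le> a" "a \<le> 7/5" "0 \<le> a'" "a' \<le> 7/5" "in_box c" "in_box c'" "in_box b" "in_box b'"
    and "\<bar>a - a'\<bar> \<le> M" "\<bar>c - c'\<bar> \<le> M"
  shows "\<bar>b - b'\<bar> \<le> 3/4 * M"
proof -
  let ?X = "a + b + a' + b'" and ?Y = "b + c + b' + c'"
  have M: "M \<ge> 0" using assms(11) by linarith
  have p: "?X > 0" "?Y > 0" using assms by (auto simp: in_box_def)
  have z: "2 * (b + b') \<ge> (?X + ?Y) / 3" using assms by (simp add: in_box_def)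
  define S where "S = ?X + ?Y"
  have S: "S > 0" using p by (simp add: S_def)
  have "\<bar>b - b'\<bar> * ((?X + ?Y) * (4/3)) \<le> \<bar>b - b'\<bar> * (?X + ?Y + 2 * (b + b'))"
    using z by (intro mult_left_mono) auto
  also have "\<dots> \<le> ?X * \<bar>a - a'\<bar> + ?Y * \<bar>c - c'\<bar>"
    using balance_diff[OF assms(1,2)] assms by (auto simp: in_box_def)
  also have "\<dots> \<le> ?X * M + ?Y * M"
    using assms p by (intro add_mono mult_left_mono) auto
  also have "\<dots> = M * S" by (simp add: S_def algebra_simps)
  finally have "(\<bar>b - b'\<bar> * (4/3)) * S \<le> M * S" unfolding S_def[symmetric] by (simp add: mult_ac)
  hence "\<bar>b - b'\<bar> * (4/3) \<le> M" using S by (rule mult_right_le_imp_le)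
  thus ?thesis by simp
qed

text \<open>The positive root of \<open>balance a b c\<close>, a quadratic equation in \<open>b\<close>.\<close>

definition balance_root :: "real \<Rightarrow> real \<Rightarrow> real" where
  "balance_root a c = (sqrt (40 - 3 * a\<^sup>2 - 3 * c\<^sup>2 + 2 * a * c) - (a + c)) / 4"

lemma balance_root:
  assumes "a = 0 \<or> in_box a" "in_box c"
  shows "balance a (balance_root a c) c" "in_box (balance_root a c)"
proof -
  define D where "D = 40 - 3 * a\<^sup>2 - 3 * c\<^sup>2 + 2 * a * c"
  have a: "0 \<le> a" "a \<le> 7/5" and c: "7/10 \<le> c" "c \<le> 7/5" using assms by (auto simp: in_box_def)
  have sq: "a\<^sup>2 \<le> (7/5)\<^sup>2" "c\<^sup>2 \<le> (7/5)\<^sup>2" "c\<^sup>2 \<ge> (7/10)\<^sup>2"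
    using a c by (intro power_mono; simp)+
  have ac: "a * c \<ge> 0" using a c by simp
  have D: "D \<ge> 0" unfolding D_def using sq ac by (simp add: power2_eq_square)
  have ub: "sqrt D \<le> 28/5 + a + c"
  proof (rule real_le_lsqrt)
    have dec: "(28/5 + a + c)\<^sup>2 - D = 4 * a\<^sup>2 + 4 * c\<^sup>2 + 56/5 * (a + c) - 216/25"
      by (simp add: D_def power2_eq_square algebra_simps)
    have "c\<^sup>2 \<ge> 49/100" using sq(3) by (simp add: power_divide)
    moreover have "a\<^sup>2 \<ge> 0" by simp
    moreover have "a + c \<ge> 7/10" using a c by simp
    ultimately have "4 * a\<^sup>2 + 4 * c\<^sup>2 + 56/5 * (a + c) - 216/25 \<ge> 0" by argo
    hence "(28/5 + a + c)\<^sup>2 - D \<ge> 0" unfolding dec .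
    thus "D \<le> (28/5 + a + c)\<^sup>2" by simp
  qed (use a c in auto)
  have lb: "14/5 + a + c \<le> sqrt D"
  proof (rule real_le_rsqrt)
    show "(14/5 + a + c)\<^sup>2 \<le> D"
      using sq a c by (simp add: D_def power2_eq_square algebra_simps)
  qed
  show "in_box (balance_root a c)"
    using ub lb by (simp add: in_box_def balance_root_def D_def[symmetric])
  define b where "b = balance_root a c"
  have "4 * b + (a + c) = sqrt D" by (simp add: b_def balance_root_def D_def field_simps)
  hence "(4 * b + (a + c))\<^sup>2 = D" using D by simp
  hence "balance a b c"
    by (simp add: balance_def D_def power2_eq_square algebra_simps)
  thus "balance a (balance_root a c) c" by (simp add: b_def)
qed

lemma balance_one: "balance 1 1 1" by (simp add: balance_def)

text \<open>The left neighbour, with the value \<open>0\<close> in front of the sequence. With this convention the special equation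
for \<open>w 0\<close> is the general one.\<close>

definition prev0 :: "(nat \<Rightarrow> real) \<Rightarrow> nat \<Rightarrow> real" where
  "prev0 w j = (if j = 0 then 0 else w (j - 1))"

lemma prev0_simps [simp]: "prev0 w 0 = 0" "prev0 w (Suc j) = w j" by (auto simp: prev0_def)

text \<open>The profile is the limit of the iteration that solves all stationarity equations for their middle
variable simultaneously, with the neighbours taken from the previous step.\<close>

primrec w_iter :: "nat \<Rightarrow> nat \<Rightarrow> real" where
  "w_iter 0 = (\<lambda>j. 1)"
| "w_iter (Suc i) = (\<lambda>j. balance_root (prev0 (w_iter i) j) (w_iter i (Suc j)))"

lemma prev0_box: "(\<And>j. in_box (w j)) \<Longrightarrow> prev0 w j = 0 \<or> in_box (prev0 w j)"
  by (auto simp: prev0_def)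

lemma w_iter_box: "in_box (w_iter i j)"
proof (induction i arbitrary: j)
  case 0 show ?case by (simp add: in_box_def)
next
  case (Suc i)
  show ?case using balance_root(2)[OF prev0_box[of "w_iter i" j] Suc.IH[of "Suc j"]] Suc.IH by simp
qed

lemma w_iter_balance:
  "balance (prev0 (w_iter i) j) (w_iter (Suc i) j) (w_iter i (Suc j))"
  using balance_root(1)[OF prev0_box[of "w_iter i" j] w_iter_box[of i "Suc j"]] w_iter_box by simp

lemma in_boxD: "in_box t \<Longrightarrow> 7/10 \<le> t" "in_box t \<Longrightarrow> t \<le> 7/5" by (auto simp: in_box_def)

lemma prev0_bounds: "(\<And>j. in_box (w j)) \<Longrightarrow> 0 \<le> prev0 w j \<and> prev0 w j \<le> 7/5"
  using in_boxD[of "w (j-1)"] by (auto simp: prev0_def intro: order_trans[of 0 "7/10"])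

lemma w_iter_step: "\<bar>w_iter (Suc i) j - w_iter i j\<bar> \<le> (3/4) ^ i"
proof (induction i arbitrary: j)
  case 0
  show ?case using in_boxD[OF w_iter_box[of "Suc 0" j]] in_boxD[OF w_iter_box[of 0 j]] unfolding abs_le_iff power_0 by linarith
next
  case (Suc i)
  have "\<bar>w_iter (Suc (Suc i)) j - w_iter (Suc i) j\<bar> \<le> 3/4 * (3/4) ^ i"
  proof (rule balance_contract[OF w_iter_balance w_iter_balance])
    show "\<bar>prev0 (w_iter (Suc i)) j - prev0 (w_iter i) j\<bar> \<le> (3/4) ^ i"
      using Suc.IH[of "j - 1"] by (cases j) (auto simp del: w_iter.simps)
  qed (use w_iter_box prev0_bounds[of "w_iter (Suc i)"] prev0_bounds[of "w_iter i"] Suc.IH in \<open>auto simp del: w_iter.simps\<close>)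
  thus ?case by simp
qed

text \<open>The constant sequence \<open>1\<close> solves the equation at every index except the first, so the contraction
turns a bound by \<open>(3/4)\<^sup>j\<^sup>-\<^sup>1\<close> for both neighbours into a bound by \<open>(3/4)\<^sup>j\<close>: the rate is preserved by each
step of the iteration.\<close>

lemma w_iter_decay: "\<bar>w_iter i j - 1\<bar> \<le> (3/4) ^ j"
proof (induction i arbitrary: j)
  case 0 show ?case by simp
next
  case (Suc i)
  show ?case
  proof (cases j)
    case 0
    thus ?thesis using in_boxD[OF w_iter_box[of "Suc i" 0]] by (simp add: abs_le_iff del: w_iter.simps)
  next
    case (Suc k)
    have "\<bar>w_iter (Suc i) j - 1\<bar> \<le> 3/4 * (3/4) ^ k"
    proof (rule balance_contract[OF w_iter_balance balance_one])
      show "\<bar>prev0 (w_iter i) j - 1\<bar> \<le> (3/4) ^ k" using Suc Suc.IH[of k] by simp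
      have "\<bar>w_iter i (Suc j) - 1\<bar> \<le> (3/4) ^ Suc j" by (rule Suc.IH)
      also have "\<dots> \<le> (3/4) ^ k" using Suc by (intro power_decreasing) auto
      finally show "\<bar>w_iter i (Suc j) - 1\<bar> \<le> (3/4) ^ k" .
    qed (use w_iter_box prev0_bounds[of "w_iter i"] in \<open>auto simp: in_box_def simp del: w_iter.simps\<close>)
    thus ?thesis using Suc by simp
  qed
qed

lemma w_iter_convergent: "convergent (\<lambda>i. w_iter i j)"
proof -
  have "summable (\<lambda>i. w_iter (Suc i) j - w_iter i j)"
  proof (rule summable_comparison_test')
    show "summable (\<lambda>i. (3/4::real) ^ i)" by (rule summable_geometric) auto
  qed (use w_iter_step in auto)
  hence "convergent (\<lambda>N. \<Sum>i<N. w_iter (Suc i) j - w_iter i j)"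
    by (simp add: summable_iff_convergent)
  moreover have "(\<lambda>N. \<Sum>i<N. w_iter (Suc i) j - w_iter i j) = (\<lambda>N. w_iter N j - w_iter 0 j)"
    by (intro ext sum_lessThan_telescope)
  ultimately have "convergent (\<lambda>N. w_iter N j - w_iter 0 j)" by simp
  thus ?thesis using convergent_diff_const_right_iff by blast
qed

definition w_lim :: "nat \<Rightarrow> real" where "w_lim j = lim (\<lambda>i. w_iter i j)"

lemma w_lim: "(\<lambda>i. w_iter i j) \<longlonglongrightarrow> w_lim j"
  using w_iter_convergent by (simp add: w_lim_def convergent_LIMSEQ_iff)

lemma w_lim_box: "in_box (w_lim j)"
  unfolding in_box_def
  using LIMSEQ_le_const[OF w_lim, of "7/10" j] LIMSEQ_le_const2[OF w_lim, of j "7/5"] w_iter_box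
  by (auto simp: in_box_def)

lemma w_lim_decay: "\<bar>w_lim j - 1\<bar> \<le> (3/4) ^ j"
proof -
  have "(\<lambda>i. \<bar>w_iter i j - 1\<bar>) \<longlonglongrightarrow> \<bar>w_lim j - 1\<bar>" by (intro tendsto_intros w_lim)
  thus ?thesis by (rule LIMSEQ_le_const2) (use w_iter_decay in auto)
qed

lemma w_lim_balance: "balance (prev0 w_lim j) (w_lim j) (w_lim (Suc j))"
proof -
  have p: "(\<lambda>i. prev0 (w_iter i) j) \<longlonglongrightarrow> prev0 w_lim j"
    by (cases j) (auto intro: w_lim simp del: w_iter.simps)
  have "(\<lambda>i. (prev0 (w_iter i) j + w_iter (Suc i) j)\<^sup>2 + (w_iter (Suc i) j + w_iter i (Suc j))\<^sup>2
      + 2 * (w_iter (Suc i) j)\<^sup>2) \<longlonglongrightarrow>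
      (prev0 w_lim j + w_lim j)\<^sup>2 + (w_lim j + w_lim (Suc j))\<^sup>2 + 2 * (w_lim j)\<^sup>2"
    using LIMSEQ_Suc[OF w_lim] by (intro tendsto_intros p w_lim) auto
  moreover have "(\<lambda>i. (prev0 (w_iter i) j + w_iter (Suc i) j)\<^sup>2 + (w_iter (Suc i) j + w_iter i (Suc j))\<^sup>2
      + 2 * (w_iter (Suc i) j)\<^sup>2) = (\<lambda>i. 10)"
    using w_iter_balance unfolding balance_def by blast
  ultimately show ?thesis
    unfolding balance_def using LIMSEQ_unique tendsto_const by metis
qed

definition profile_eq :: "(nat \<Rightarrow> real) \<Rightarrow> bool" where
  "profile_eq w \<longleftrightarrow> (\<forall>j. w j > 0) \<and> (\<forall>j. balance (prev0 w j) (w j) (w (Suc j))) \<and> w \<longlonglongrightarrow> 1"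

lemma profile_eq_iff:
  "profile_eq w \<longleftrightarrow> (\<forall>j. w j > 0) \<and>
     3 * (w 0)\<^sup>2 + (w 0 + w 1)\<^sup>2 = 10 \<and>
     (\<forall>j\<ge>1. (w (j - 1) + w j)\<^sup>2 + (w j + w (j + 1))\<^sup>2 + 2 * (w j)\<^sup>2 = 10) \<and>
     w \<longlonglongrightarrow> 1"
proof -
  have "(\<forall>j. balance (prev0 w j) (w j) (w (Suc j))) \<longleftrightarrow>
    balance 0 (w 0) (w 1) \<and> (\<forall>j\<ge>1. balance (w (j - 1)) (w j) (w (j + 1)))"
    by (auto simp: prev0_def)
  thus ?thesis unfolding profile_eq_def by (auto simp: balance_def)
qed

text \<open>Two solutions have the same limit, so the modulus of their difference attains its maximum. At a
place where it does, \<open>balance_diff\<close> bounds the maximum by strictly less than itself.\<close>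

lemma profile_eq_unique:
  assumes "profile_eq w" "profile_eq w'" shows "w = w'"
proof (rule ccontr)
  assume "w \<noteq> w'"
  define D where "D = (\<lambda>j. \<bar>w j - w' j\<bar>)"
  obtain j0 where j0: "D j0 > 0" using \<open>w \<noteq> w'\<close> by (auto simp: D_def fun_eq_iff)
  have "(\<lambda>j. \<bar>w j - w' j\<bar>) \<longlonglongrightarrow> \<bar>1 - 1\<bar>"
    using assms by (intro tendsto_intros) (auto simp: profile_eq_def)
  hence "D \<longlonglongrightarrow> 0" by (simp add: D_def)
  hence "eventually (\<lambda>j. D j < D j0) sequentially" using j0 by (simp add: order_tendsto_iff)
  then obtain N where N: "\<And>j. j \<ge> N \<Longrightarrow> D j < D j0" by (auto simp: eventually_sequentially)
  \<comment> \<open>Beyond \<open>N\<close> the difference is smaller than at \<open>j0\<close>, so this is its maximum over all indices.\<close>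
  define M where "M = Max (D ` {..N})"
  have "j0 < N" using N[of j0] by (meson not_le less_irrefl)
  have "M \<in> D ` {..N}" unfolding M_def by (intro Max_in) auto
  then obtain j1 where j1: "D j1 = M" by auto
  have le: "D j \<le> M" for j
  proof (cases "j \<le> N")
    case True thus ?thesis unfolding M_def by (intro Max_ge) auto
  next
    case False
    hence "D j \<le> D j0" using N[of j] by simp
    also have "\<dots> \<le> M" unfolding M_def using \<open>j0 < N\<close> by (intro Max_ge) auto
    finally show ?thesis .
  qed
  have M: "M > 0" using le[of j0] j0 by linarith
  let ?a = "prev0 w j1" and ?a' = "prev0 w' j1" and ?b = "w j1" and ?b' = "w' j1"
    and ?c = "w (Suc j1)" and ?c' = "w' (Suc j1)"
  have nn: "?a \<ge> 0" "?a' \<ge> 0" using assms by (auto simp: prev0_def profile_eq_def less_imp_le)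
  have pos: "?b > 0" "?b' > 0" "?c > 0" "?c' > 0" using assms by (auto simp: profile_eq_def)
  have da: "\<bar>?a - ?a'\<bar> \<le> M" using le[of "j1 - 1"] M by (auto simp: prev0_def D_def)
  have dc: "\<bar>?c - ?c'\<bar> \<le> M" using le[of "Suc j1"] by (auto simp: D_def)
  have "M * ((?a + ?b + ?a' + ?b') + (?b + ?c + ?b' + ?c') + 2 * (?b + ?b'))
    \<le> (?a + ?b + ?a' + ?b') * \<bar>?a - ?a'\<bar> + (?b + ?c + ?b' + ?c') * \<bar>?c - ?c'\<bar>"
    using balance_diff[of ?a ?b ?c ?a' ?b' ?c'] assms nn pos j1
    by (auto simp: profile_eq_def D_def)
  also have "\<dots> \<le> (?a + ?b + ?a' + ?b') * M + (?b + ?c + ?b' + ?c') * M"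
    using da dc nn pos by (intro add_mono mult_left_mono) auto
  finally have "M * (2 * (?b + ?b')) \<le> 0" by (simp add: algebra_simps)
  thus False using M pos by (simp add: mult_le_0_iff)
qed

lemma geometric34: "(\<lambda>j. (3/4::real) ^ j) \<longlonglongrightarrow> 0"
  by (rule LIMSEQ_realpow_zero) auto

lemma profile_eq_w_lim: "profile_eq w_lim"
proof -
  have "(\<lambda>j. w_lim j - 1) \<longlonglongrightarrow> 0"
    by (rule Lim_null_comparison[OF _ geometric34]) (use w_lim_decay in auto)
  hence "w_lim \<longlonglongrightarrow> 1" by (simp add: LIM_zero_iff)
  moreover have "w_lim j > 0" for j using w_lim_box[of j] by (simp add: in_box_def)
  ultimately show ?thesis using w_lim_balance by (simp add: profile_eq_def)
qed

lemma w_star_eq: "w_star = w_lim"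
  unfolding w_star_def profile_eq_iff[symmetric]
  by (rule the_equality) (auto intro: profile_eq_w_lim profile_eq_unique)

lemmas w_star_box = w_lim_box[folded w_star_eq]
   and w_star_decay = w_lim_decay[folded w_star_eq]
   and w_star_balance = w_lim_balance[folded w_star_eq]

lemma w_star_bounds: "7/10 \<le> w_star j" "w_star j \<le> 7/5"
  using w_star_box by (auto simp: in_box_def)

section \<open>The cost of the profile\<close>

text \<open>The cost of the half-infinite sequence \<open>0, w\<^sub>0, w\<^sub>1, \<dots>\<close>. An optimal chain consists of two copies of it.\<close>

definition tau :: real where
  "tau = phi 0 (w_star 0) + (\<Sum>j. phi (w_star j) (w_star (Suc j)))"

lemma dphi_box_bound:
  assumes "0 \<le> a" "a \<le> 7/5" "0 \<le> b" "b \<le> 7/5"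
  shows "\<bar>dphi a b\<bar> \<le> 15"
proof -
  have "(a + b)\<^sup>2 \<le> (14/5)\<^sup>2" using assms by (intro power_mono) auto
  moreover have "b\<^sup>2 \<le> (7/5)\<^sup>2" using assms by (intro power_mono) auto
  moreover have "(a + b)\<^sup>2 \<ge> 0" "b\<^sup>2 \<ge> 0" by auto
  ultimately show ?thesis unfolding dphi_def power_divide abs_le_iff by (simp; linarith)
qed

lemma w_star_nonneg: "w_star j \<ge> 0"
  using w_star_bounds(1)[of j] by simp

text \<open>The tangent at \<open>(w\<^sub>j, w\<^sub>j\<^sub>+\<^sub>1)\<close> lies below \<open>phi\<close> at \<open>(1, 1)\<close>, where \<open>phi\<close> is zero. So the value is at most the
gradient times the distance from \<open>(1, 1)\<close>.\<close>

lemma phi_w_star_bound: "phi (w_star j) (w_star (Suc j)) \<le> 30 * (3/4) ^ j"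
proof -
  let ?x = "w_star j" and ?y = "w_star (Suc j)"
  have d: "\<bar>dphi ?y ?x\<bar> \<le> 15" "\<bar>dphi ?x ?y\<bar> \<le> 15"
    using w_star_nonneg w_star_bounds by (intro dphi_box_bound; simp)+
  have "\<bar>?y - 1\<bar> \<le> (3/4) ^ Suc j" by (rule w_star_decay)
  also have "\<dots> \<le> (3/4) ^ j" by (intro power_decreasing) auto
  finally have y: "\<bar>1 - ?y\<bar> \<le> (3/4) ^ j" by (simp add: abs_minus_commute)
  have x: "\<bar>1 - ?x\<bar> \<le> (3/4) ^ j" using w_star_decay[of j] by (simp add: abs_minus_commute)
  have "phi 1 1 \<ge> phi ?x ?y + dphi ?y ?x * (1 - ?x) + dphi ?x ?y * (1 - ?y)"
    by (intro phi_tangent w_star_nonneg) auto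
  moreover have "\<bar>dphi ?y ?x * (1 - ?x)\<bar> \<le> 15 * (3/4) ^ j"
    unfolding abs_mult using d x by (intro mult_mono) auto
  moreover have "\<bar>dphi ?x ?y * (1 - ?y)\<bar> \<le> 15 * (3/4) ^ j"
    unfolding abs_mult using d y by (intro mult_mono) auto
  ultimately show ?thesis by (simp add: phi_def)
qed

lemma phi_w_star_nonneg: "phi (w_star j) (w_star (Suc j)) \<ge> 0"
  by (intro phi_nonneg w_star_nonneg)

lemma summable_phi_w_star: "summable (\<lambda>j. phi (w_star j) (w_star (Suc j)))"
proof (rule summable_comparison_test')
  show "summable (\<lambda>j. 30 * (3/4::real) ^ j)" by (intro summable_mult summable_geometric) auto
  show "\<And>j. j \<ge> 0 \<Longrightarrow> norm (phi (w_star j) (w_star (Suc j))) \<le> 30 * (3/4) ^ j"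
    using phi_w_star_bound phi_w_star_nonneg by auto
qed

lemma tau_ge_partial:
  "phi 0 (w_star 0) + (\<Sum>j<N. phi (w_star j) (w_star (Suc j))) \<le> tau"
  unfolding tau_def by (intro add_left_mono sum_le_suminf summable_phi_w_star) (auto intro: phi_w_star_nonneg)

lemma tau_le_partial:
  "tau \<le> phi 0 (w_star 0) + (\<Sum>j<N. phi (w_star j) (w_star (Suc j))) + 120 * (3/4) ^ N"
proof -
  let ?f = "\<lambda>j. phi (w_star j) (w_star (Suc j))"
  have "(\<Sum>j. ?f (j + N)) \<le> (\<Sum>j. 30 * (3/4) ^ (j + N))"
  proof (rule suminf_le)
    show "summable (\<lambda>j. ?f (j + N))" by (rule summable_ignore_initial_segment[OF summable_phi_w_star])
    have "summable (\<lambda>j. 30 * (3/4::real) ^ j)" by (intro summable_mult summable_geometric) auto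
    thus "summable (\<lambda>j. 30 * (3/4::real) ^ (j + N))" by (rule summable_ignore_initial_segment)
  qed (rule phi_w_star_bound)
  also have "(\<lambda>j. 30 * (3/4::real) ^ (j + N)) = (\<lambda>j. (30 * (3/4) ^ N) * (3/4) ^ j)"
    by (simp add: power_add mult_ac)
  also have "(\<Sum>j. (30 * (3/4::real) ^ N) * (3/4) ^ j) = (30 * (3/4) ^ N) * (1 / (1 - 3/4))"
    by (subst suminf_mult) (auto simp: suminf_geometric intro: summable_geometric)
  finally show ?thesis
    using suminf_split_initial_segment[OF summable_phi_w_star, of N] by (simp add: tau_def)
qed

lemma psi_phi: "psi_fun x y = phi x y + ((x ^ 3 / 3 - x) - (y ^ 3 / 3 - y))"
  by (simp add: psi_fun_def phi_def field_simps)

lemma w_star_tendsto: "w_star \<longlonglongrightarrow> 1"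
  using profile_eq_w_lim by (simp add: w_star_eq profile_eq_def)

lemma q_star_eq: "q_star = tau / 16"
proof -
  define r where "r = (\<lambda>j. w_star j ^ 3 / 3 - w_star j)"
  have "r \<longlonglongrightarrow> 1 ^ 3 / 3 - 1" unfolding r_def by (intro tendsto_intros w_star_tendsto) auto
  hence "(\<lambda>j. r j - r (Suc j)) sums (r 0 - (1 ^ 3 / 3 - 1))"
    by (rule telescope_sums')
  hence "(\<lambda>j. phi (w_star j) (w_star (Suc j)) + (r j - r (Suc j))) sums
     ((\<Sum>j. phi (w_star j) (w_star (Suc j))) + (r 0 - (1 ^ 3 / 3 - 1)))"
    by (intro sums_add summable_sums summable_phi_w_star)
  hence "(\<Sum>j. psi_fun (w_star j) (w_star (Suc j))) =
     (\<Sum>j. phi (w_star j) (w_star (Suc j))) + (r 0 - (1 ^ 3 / 3 - 1))"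
    by (simp add: psi_phi r_def sums_iff)
  hence "J_fun w_star = tau - 7 / 3"
    by (simp add: J_fun_def tau_def b_fun_def phi_def r_def field_simps)
  thus ?thesis by (simp add: q_star_def field_simps)
qed

text \<open>Sum the tangent inequalities of \<open>phi\<close> along the profile. By stationarity the two terms that involve the same
interior index cancel, and only the two ends contribute.\<close>

lemma wing_bound:
  assumes "\<And>j. x j \<ge> 0"
  shows "(\<Sum>j<N. phi (x j) (x (Suc j))) \<ge> (\<Sum>j<N. phi (w_star j) (w_star (Suc j)))
     + dphi (prev0 w_star N) (w_star N) * (x N - w_star N) - dphi 0 (w_star 0) * (x 0 - w_star 0)"
proof (induction N)
  case 0 show ?case by simp
next
  case (Suc N)
  have "phi (x N) (x (Suc N)) \<ge> phi (w_star N) (w_star (Suc N))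
     + dphi (w_star (Suc N)) (w_star N) * (x N - w_star N)
     + dphi (w_star N) (w_star (Suc N)) * (x (Suc N) - w_star (Suc N))"
    by (intro phi_tangent assms w_star_nonneg)
  moreover have "dphi (prev0 w_star N) (w_star N) = - dphi (w_star (Suc N)) (w_star N)"
    using w_star_balance[of N] unfolding balance_dphi by simp
  ultimately show ?case using Suc.IH by simp
qed

lemma dphi_w_star_decay:
  "\<bar>dphi (prev0 w_star (Suc N)) (w_star (Suc N))\<bar> \<le> 12 * (3/4) ^ N"
proof -
  let ?a = "w_star N" and ?b = "w_star (Suc N)"
  have "\<bar>?b - 1\<bar> \<le> (3/4) ^ Suc N" by (rule w_star_decay)
  also have "\<dots> \<le> (3/4) ^ N" by (intro power_decreasing) auto
  finally have b: "\<bar>?b - 1\<bar> \<le> (3/4) ^ N" .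
  have a: "\<bar>?a - 1\<bar> \<le> (3/4) ^ N" by (rule w_star_decay)
  have "dphi ?a ?b = (?a + ?b + 2) * ((?a - 1) + (?b - 1)) + (?b + 1) * (?b - 1)"
    by (simp add: dphi_def power2_eq_square algebra_simps)
  also have "\<bar>\<dots>\<bar> \<le> \<bar>(?a + ?b + 2) * ((?a - 1) + (?b - 1))\<bar> + \<bar>(?b + 1) * (?b - 1)\<bar>" by (rule abs_triangle_ineq)
  also have "\<dots> \<le> 24/5 * (2 * (3/4) ^ N) + 12/5 * (3/4) ^ N"
    unfolding abs_mult using a b w_star_bounds[of N] w_star_bounds[of "Suc N"]
    by (intro add_mono mult_mono) auto
  also have "\<dots> = 12 * (3/4) ^ N" by simp
  finally show ?thesis by simp
qed

text \<open>Compare with the sequence \<open>5/4, 1, 1, \<dots>\<close>, whose cost is \<open>phi 0 (5/4) + phi (5/4) 1 = 23/12\<close>. The bound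
serves to exclude chains with three or more sign defects, and \<open>23/6 = 2 \<cdot> 23/12\<close> is the number to beat below.\<close>

lemma tau_le: "tau \<le> 23/12"
proof -
  define x where "x = (\<lambda>j::nat. if j = 0 then 5/4 else 1::real)"
  have S: "(\<Sum>j<Suc N. phi (x j) (x (Suc j))) = phi (5/4) 1" for N
    by (subst sum.lessThan_Suc_shift) (simp add: x_def phi_def)
  have "phi 0 (w_star 0) + (\<Sum>j<Suc N. phi (w_star j) (w_star (Suc j))) \<le> 23/12 + 12 * (3/4) ^ N" for N
  proof -
    let ?d = "dphi (prev0 w_star (Suc N)) (w_star (Suc N))"
    have "(\<Sum>j<Suc N. phi (x j) (x (Suc j))) \<ge> (\<Sum>j<Suc N. phi (w_star j) (w_star (Suc j)))
       + ?d * (x (Suc N) - w_star (Suc N)) - dphi 0 (w_star 0) * (x 0 - w_star 0)"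
      by (rule wing_bound) (simp add: x_def)
    moreover have "phi 0 (5/4) \<ge> phi 0 (w_star 0) + dphi (w_star 0) 0 * (0 - 0) + dphi 0 (w_star 0) * (5/4 - w_star 0)"
      by (intro phi_tangent w_star_nonneg) auto
    moreover have "\<bar>?d * (x (Suc N) - w_star (Suc N))\<bar> \<le> (12 * (3/4) ^ N) * 1"
      unfolding abs_mult using w_star_bounds[of "Suc N"] dphi_w_star_decay
      by (intro mult_mono) (auto simp: x_def abs_le_iff)
    moreover have "phi 0 (5/4) + phi (5/4) 1 = 23/12" by (simp add: phi_def power3_eq_cube)
    ultimately show ?thesis unfolding S by (simp add: x_def abs_le_iff)
  qed
  moreover have "(\<lambda>N. phi 0 (w_star 0) + (\<Sum>j<Suc N. phi (w_star j) (w_star (Suc j)))) \<longlonglongrightarrow> tau"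
    unfolding tau_def
    by (intro tendsto_add tendsto_const LIMSEQ_Suc summable_LIMSEQ summable_phi_w_star)
  moreover have "(\<lambda>N. 23/12 + 12 * (3/4::real) ^ N) \<longlonglongrightarrow> 23/12 + 12 * 0"
    by (intro tendsto_intros geometric34)
  ultimately have "tau \<le> 23/12 + 12 * 0"
    by (intro LIMSEQ_le[of _ tau _ "23/12 + 12 * 0"]) auto
  thus ?thesis by simp
qed

section \<open>Chains with a single sign defect\<close>

lemma cube_tangent_numeral:
  fixes s c :: real assumes "s \<ge> 0" "c \<ge> 0" shows "s ^ 3 \<ge> 3 * c\<^sup>2 * s - 2 * c ^ 3"
  using cube_tangent[OF assms] by (simp add: power2_eq_square power3_eq_cube algebra_simps)

text \<open>The tangent is taken close to the minimum, which lies at \<open>sqrt (5/2)\<close>, about \<open>1.5811\<close>.\<close>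

lemma cubic_min:
  fixes d :: real assumes "d \<ge> 0" shows "2/3 * d ^ 3 - 5 * d + 20/3 \<ge> 139/100"
proof -
  define D where "D = d ^ 3"
  have "D \<ge> 3 * (15812/10000)\<^sup>2 * d - 2 * (15812/10000) ^ 3"
    unfolding D_def using assms by (intro cube_tangent_numeral) auto
  hence "2/3 * D - 5 * d + 20/3 \<ge> 139/100"
    using assms by (simp add: power2_eq_square power3_eq_cube)
  thus ?thesis by (simp add: D_def)
qed

text \<open>This is \<open>phi X (- Y)\<close>: the cost of a step between values with the same sign and moduli \<open>X\<close> and \<open>Y\<close>.\<close>

definition phis :: "real \<Rightarrow> real \<Rightarrow> real" where
  "phis X Y = ((X - Y) ^ 3 + X ^ 3 - Y ^ 3) / 3 - 5 * (X - Y) + 20/3"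

lemma phis_ge:
  assumes "X \<ge> Y" "Y \<ge> 0" shows "phis X Y \<ge> 139/100"
proof -
  have "X ^ 3 - Y ^ 3 - (X - Y) ^ 3 = 3 * X * Y * (X - Y)"
    by (simp add: power3_eq_cube algebra_simps)
  moreover have "3 * X * Y * (X - Y) \<ge> 0" using assms by simp
  ultimately have "(X - Y) ^ 3 \<le> X ^ 3 - Y ^ 3" by argo
  hence "((X - Y) ^ 3 + X ^ 3 - Y ^ 3) / 3 \<ge> 2/3 * (X - Y) ^ 3" by argo
  thus ?thesis using cubic_min[of "X - Y"] assms unfolding phis_def by argo
qed

lemma merged_identity:
  fixes X Y u :: real defines "a \<equiv> 2 * X + u - Y"
  shows "phi u X + phis X Y - (Y - u) * (X - Y) * (X + u)
     = a ^ 3 / 6 - 5 * a + a * (u\<^sup>2 + Y\<^sup>2) / 2 + 40/3"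
  unfolding phi_def phis_def a_def by (simp add: power3_eq_cube power2_eq_square field_simps)

text \<open>For \<open>Y > u\<close> the sides before and at the defect act like one long side of length \<open>a\<close>. Their cost is
linear in \<open>q = u\<^sup>2 + Y\<^sup>2\<close>, so for \<open>q \<le> 1\<close> its minimum over \<open>a\<close> is at least the interpolation between
the minima for \<open>q = 0\<close> and \<open>q = 1\<close>. For small \<open>u\<close> and \<open>Y\<close> the missing cost is supplied by the
neighbouring atoms, because \<open>phi t s\<close> is bounded away from zero when \<open>t\<close> is small.\<close>

lemma merged_bound:
  fixes X Y u z v :: real
  assumes "u \<ge> 0" "Y > u" "X > Y" "z \<ge> 0" "v \<ge> 0"
  shows "phi v u + phi u X + phis X Y - (Y - u) * (X - Y) * (X + u) + phi Y z \<ge> 23/6"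
proof -
  define a where "a = 2 * X + u - Y"
  define q where "q = u\<^sup>2 + Y\<^sup>2"
  have a: "a \<ge> 0" using assms by (simp add: a_def)
  have q: "q \<ge> 0" by (simp add: q_def)
  have nn: "phi v u \<ge> 0" "phi Y z \<ge> 0" using assms by (auto intro!: phi_nonneg)
  have id: "phi u X + phis X Y - (Y - u) * (X - Y) * (X + u) = a ^ 3 / 6 - 5 * a + a * q / 2 + 40/3"
    using merged_identity[of u X Y] by (simp add: a_def q_def)
  have q1: "a ^ 3 / 6 - 5 * a + a / 2 \<ge> -9"
    using cube_tangent[of a 3] a by (simp add: power3_eq_cube)
  show ?thesis
  proof (cases "q \<ge> 1")
    case True
    have "a * q \<ge> a" using a True by (simp add: mult_le_cancel_left1)
    thus ?thesis using q1 nn id by linarith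
  next
    case False
    \<comment> \<open>The minimum lies at \<open>a = sqrt 10\<close>, about \<open>3.162\<close>.\<close>
    have q0: "a ^ 3 / 6 - 5 * a \<ge> - 1055/100"
    proof -
      define D where "D = a ^ 3"
      have "D \<ge> 3 * (3163/1000)\<^sup>2 * a - 2 * (3163/1000) ^ 3"
        unfolding D_def using a by (intro cube_tangent_numeral) auto
      hence "D / 6 - 5 * a \<ge> - 1055/100"
        using a by (simp add: power2_eq_square power3_eq_cube)
      thus ?thesis by (simp add: D_def)
    qed
    have "- 1055/100 + 155/100 * q = (1 - q) * (- 1055/100) + q * (-9)"
      by (simp add: field_simps)
    also have "\<dots> \<le> (1 - q) * (a ^ 3 / 6 - 5 * a) + q * (a ^ 3 / 6 - 5 * a + a / 2)"
      using q0 q1 q False by (intro add_mono mult_left_mono) auto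
    also have "\<dots> = a ^ 3 / 6 - 5 * a + a * q / 2" by (simp add: field_simps)
    finally have "phi u X + phis X Y - (Y - u) * (X - Y) * (X + u) \<ge> 40/3 - 1055/100 + 155/100 * q"
      unfolding id by simp
    moreover have "155/100 * q = 155/100 * u\<^sup>2 + 155/100 * Y\<^sup>2" by (simp add: q_def distrib_left)
    ultimately have m: "phi u X + phis X Y - (Y - u) * (X - Y) * (X + u)
        \<ge> 40/3 - 1055/100 + (155/100 * u\<^sup>2 + 155/100 * Y\<^sup>2)" by (simp only:)
    have wing: "phi t s \<ge> 108/100 - 14/10 * t" if "t \<ge> 0" "s \<ge> 0" for t s
    proof -
      \<comment> \<open>A point where the derivative in the second argument is exactly zero: \<open>31\<^sup>2 + 22\<^sup>2 = 5 \<cdot> 17\<^sup>2\<close>.\<close>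
      have "phi t s \<ge> phi (9/17) (22/17) + dphi (22/17) (9/17) * (t - 9/17) + dphi (9/17) (22/17) * (s - 22/17)"
        using that by (intro phi_tangent) auto
      moreover have "dphi (9/17) (22/17) = 0" by (simp add: dphi_def power2_eq_square)
      moreover have "dphi (22/17) (9/17) * t \<ge> - 14/10 * t"
        using that by (intro mult_right_mono) (auto simp: dphi_def power2_eq_square)
      moreover have "phi (9/17) (22/17) - dphi (22/17) (9/17) * (9/17) \<ge> 108/100"
        by (simp add: phi_def dphi_def power2_eq_square power3_eq_cube)
      ultimately show ?thesis by (simp add: algebra_simps)
    qed
    have sq: "155/100 * t\<^sup>2 - 14/10 * t \<ge> - 32/100" for t :: real
    proof -
      have "155/100 * t\<^sup>2 - 14/10 * t + 32/100 = 155/100 * (t - 70/155)\<^sup>2 + (32/100 - 49/155)"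
        by (simp add: power2_eq_square field_simps)
      also have "\<dots> \<ge> 0" by simp
      finally show ?thesis by simp
    qed
    have "phi v u \<ge> 108/100 - 14/10 * u" using wing[of u v] assms by (simp add: phi_commute)
    moreover have "phi Y z \<ge> 108/100 - 14/10 * Y" using wing[of Y z] assms by simp
    ultimately show ?thesis using m sq[of u] sq[of Y] by linarith
  qed
qed

text \<open>The terms \<open>(X - Y)\<^sup>3\<close>, \<open>(Y + z)\<^sup>3\<close>, \<open>X\<^sup>3\<close>, \<open>z\<^sup>3\<close> are replaced by their tangents at \<open>w\<close>. The \<open>Y\<close> in the first two
cancels, and the \<open>Y\<^sup>3\<close> of the two atoms cancels as well: at the defect the chain splits into two chains
that start at \<open>0\<close>.\<close>

lemma split_group_bound:
  assumes "X > Y" "Y \<ge> 0" "z \<ge> 0" "w \<ge> 0"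
  shows "phis X Y + phi Y z \<ge> 2 * phi 0 w + dphi 0 w * (X - w) + dphi 0 w * (z - w)"
proof -
  have "(X - Y) ^ 3 / 3 \<ge> w ^ 3 / 3 + w\<^sup>2 * ((X - Y) - w)"
    "(Y + z) ^ 3 / 3 \<ge> w ^ 3 / 3 + w\<^sup>2 * ((Y + z) - w)"
    "X ^ 3 / 3 \<ge> w ^ 3 / 3 + w\<^sup>2 * (X - w)"
    "z ^ 3 / 3 \<ge> w ^ 3 / 3 + w\<^sup>2 * (z - w)"
    using assms by (intro cube_tangent; simp)+
  thus ?thesis unfolding phis_def phi_def dphi_def
    by (simp add: algebra_simps add_divide_distrib diff_divide_distrib)
qed

text \<open>Cut the chain opposite to the defect and read the second half backwards.\<close>

lemma cycle_to_wings:
  fixes z :: "nat \<Rightarrow> real"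
  assumes "n = 2 + 2 * H"
  shows "(\<Sum>i<n - 1. phi (z i) (z (Suc i))) = phi (z 0) (z 1) + ((\<Sum>j<H. phi (z (Suc j)) (z (Suc (Suc j))))
        + (\<Sum>j<H. phi (z (n - 1 - j)) (z (n - 1 - Suc j))))"
proof -
  let ?q = "\<lambda>i. phi (z (Suc i)) (z (Suc (Suc i)))"
  have "n - 1 = Suc (2 * H)" using assms by simp
  hence "(\<Sum>i<n - 1. phi (z i) (z (Suc i))) = phi (z 0) (z 1) + (\<Sum>i<2 * H. ?q i)"
    by (simp only: sum.lessThan_Suc_shift One_nat_def)
  also have "(\<Sum>i<2 * H. ?q i) = (\<Sum>j<H. ?q j) + (\<Sum>j\<in>{H..<2*H}. ?q j)"
    by (subst sum.union_disjoint[symmetric]) (auto intro!: sum.cong)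
  also have "(\<Sum>j\<in>{H..<2*H}. ?q j) = (\<Sum>j<H. phi (z (n - 1 - j)) (z (n - 1 - Suc j)))"
  proof (rule sum.reindex_bij_witness[of _ "\<lambda>j. 2 * H - 1 - j" "\<lambda>j. 2 * H - 1 - j"])
    fix a assume a: "a \<in> {H..<2 * H}"
    hence "n - 1 - (2 * H - 1 - a) = Suc (Suc a)" "n - 1 - Suc (2 * H - 1 - a) = Suc a"
      using assms by auto
    thus "phi (z (n - 1 - (2 * H - 1 - a))) (z (n - 1 - Suc (2 * H - 1 - a))) = ?q a"
      by (simp only: phi_commute)
  qed auto
  finally show ?thesis .
qed

text \<open>The step from index \<open>n - 1\<close> to index \<open>0\<close> is the only one that keeps its sign, and \<open>g\<close> enters the cost linearly.
The only negative contribution of \<open>g\<close> is \<open>- Y g\<^sub>n\<^sub>-\<^sub>1\<close>. If \<open>Y \<le> u\<close>, where \<open>u\<close> is the modulus before the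
defect, then it is compensated by the term \<open>u g\<^sub>n\<^sub>-\<^sub>1\<close> of the previous atom, and
without \<open>g\<close> the chain is a pair of wings. If \<open>Y > u\<close>, then the hypothesis on the vertex between these two sides
bounds \<open>g\<^sub>n\<^sub>-\<^sub>1\<close> in terms of its neighbours, and \<open>merged_bound\<close> applies.\<close>

lemma single_defect_bound:
  fixes z g :: "nat \<Rightarrow> real" and h n :: nat
  defines "X \<equiv> z (n - 1)" and "Y \<equiv> z 0"
  assumes n: "n = 2 * h" and h: "h \<ge> 3"
    and z: "\<And>i. z i \<ge> 0" and g: "\<And>i. g i \<ge> 0" and XY: "X > Y"
    and vert: "(z (n - 2) + X) + (X - Y) + (g (n - 2) - g (n - 1)) / (z (n - 2) + X)
         - (g (n - 1) - g 0) / (X - Y) \<ge> 0"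
  shows "(\<Sum>i<n - 1. phi (z i) (z (Suc i)) + z (Suc i) * g i + z i * g (Suc i))
      + phis X Y + X * g 0 - Y * g (n - 1) \<ge> 2 * tau - 800 * (3/4) ^ h"
proof -
  let ?f = "\<lambda>i. phi (z i) (z (Suc i)) + z (Suc i) * g i + z i * g (Suc i)"
  let ?u = "z (n - 2)"
  have f0: "?f i \<ge> phi (z i) (z (Suc i))" for i using z g by simp
  have p0: "phi (z i) (z j) \<ge> 0" for i j using z by (intro phi_nonneg)
  have idx: "Suc (n - 2) = n - 1" "Suc (n - 3) = n - 2" using n h by auto
  have Y0: "Y \<ge> 0" using z by (simp add: Y_def)
  have S0: "phis X Y \<ge> 139/100" using XY Y0 by (intro phis_ge) auto
  have tau2: "2 * tau \<le> 23/6" using tau_le by simp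
  have pos: "800 * (3/4::real) ^ h \<ge> 0" by simp
  show ?thesis
  proof (cases "Y \<le> ?u")
    case True
    have "(\<Sum>i<n - 1. ?f i) = (\<Sum>i<n - 2. ?f i) + ?f (n - 2)"
      by (simp only: idx(1)[symmetric] sum.lessThan_Suc)
    also have "\<dots> \<ge> (\<Sum>i<n - 2. phi (z i) (z (Suc i))) + (phi ?u X + X * g (n - 2) + ?u * g (n - 1))"
      using f0 by (intro add_mono sum_mono) (auto simp: X_def idx)
    moreover have "(\<Sum>i<n - 1. phi (z i) (z (Suc i))) = (\<Sum>i<n - 2. phi (z i) (z (Suc i))) + phi ?u X"
      by (simp only: idx(1)[symmetric] sum.lessThan_Suc X_def)
    moreover have "?u * g (n - 1) \<ge> Y * g (n - 1)" using True g by (intro mult_right_mono)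
    moreover have "X * g (n - 2) \<ge> 0" "X * g 0 \<ge> 0" using z g by (auto simp: X_def)
    ultimately have F: "(\<Sum>i<n - 1. ?f i) + phis X Y + X * g 0 - Y * g (n - 1)
       \<ge> (\<Sum>i<n - 1. phi (z i) (z (Suc i))) + phis X Y" by linarith
    define H where "H = h - 1"
    have H: "h = Suc H" "n = 2 + 2 * H" "H \<ge> 2" using n h by (auto simp: H_def)
    have E: "(\<Sum>i<n - 1. phi (z i) (z (Suc i))) = phi Y (z 1) + ((\<Sum>j<H. phi (z (Suc j)) (z (Suc (Suc j))))
        + (\<Sum>j<H. phi (z (n - 1 - j)) (z (n - 1 - Suc j))))"
      unfolding Y_def by (rule cycle_to_wings[OF H(2)])
    let ?S = "\<Sum>j<H. phi (w_star j) (w_star (Suc j))"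
    let ?d = "dphi (prev0 w_star H) (w_star H)" and ?e = "dphi 0 (w_star 0)"
    \<comment> \<open>At the place opposite to the defect the tangent terms are harmless unless \<open>z h\<close> is large, and then a single atom is already too expensive.\<close>
    show ?thesis
    proof (cases "z h \<le> 10")
      case True
      have w1: "(\<Sum>j<H. phi (z (Suc j)) (z (Suc (Suc j)))) \<ge> ?S + ?d * (z h - w_star H) - ?e * (z 1 - w_star 0)"
        using wing_bound[of "\<lambda>j. z (Suc j)" H] z H by simp
      have w2: "(\<Sum>j<H. phi (z (n - 1 - j)) (z (n - 1 - Suc j))) \<ge> ?S + ?d * (z h - w_star H) - ?e * (X - w_star 0)"
        using wing_bound[of "\<lambda>j. z (n - 1 - j)" H] z H by (simp add: X_def)
      have gr: "phis X Y + phi Y (z 1) \<ge> 2 * phi 0 (w_star 0) + ?e * (X - w_star 0) + ?e * (z 1 - w_star 0)"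
        using XY Y0 z w_star_nonneg by (intro split_group_bound)
      have "\<bar>?d * (z h - w_star H)\<bar> \<le> 12 * (3/4) ^ (H - 1) * 10"
      proof -
        have "\<bar>?d\<bar> \<le> 12 * (3/4) ^ (H - 1)"
          using dphi_w_star_decay[of "H - 1"] H by simp
        moreover have "\<bar>z h - w_star H\<bar> \<le> 10"
          using True z[of h] w_star_bounds[of H] by (simp add: abs_le_iff)
        ultimately show ?thesis unfolding abs_mult by (intro mult_mono) auto
      qed
      hence d: "?d * (z h - w_star H) \<ge> - (120 * (3/4) ^ (H - 1))" by (simp add: abs_le_iff)
      have t: "tau \<le> phi 0 (w_star 0) + ?S + 120 * (3/4) ^ H" by (rule tau_le_partial)
      have pw: "(3/4::real) ^ h = 9/16 * (3/4) ^ (H - 1)" "(3/4::real) ^ H = 3/4 * (3/4) ^ (H - 1)"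
      proof -
        obtain K where "H = Suc K" using H(3) by (cases H) auto
        thus "(3/4::real) ^ h = 9/16 * (3/4) ^ (H - 1)" "(3/4::real) ^ H = 3/4 * (3/4) ^ (H - 1)"
          using H(1) by simp_all
      qed
      have "(3/4::real) ^ (H - 1) \<ge> 0" by simp
      thus ?thesis using F E w1 w2 gr d t pw by argo
    next
      case False
      have "phi (z (h - 1)) (z h) \<ge> phi 0 10 + dphi 10 0 * (z (h - 1) - 0) + dphi 0 10 * (z h - 10)"
        using z by (intro phi_tangent) auto
      moreover have "dphi 10 0 * (z (h - 1) - 0) \<ge> 0" "dphi 0 10 * (z h - 10) \<ge> 0"
        using z False by (auto simp: dphi_def)
      moreover have "phi 0 10 \<ge> 600" by (simp add: phi_def)
      moreover have "phi (z (h - 1)) (z (Suc (h - 1))) \<le> (\<Sum>i<n - 1. phi (z i) (z (Suc i)))"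
        using p0 n h by (intro member_le_sum) auto
      moreover have "Suc (h - 1) = h" using h by simp
      ultimately show ?thesis using F S0 tau2 pos by (simp only:)
    qed
  next
    case False
    hence Yu: "Y > ?u" by simp
    have "(\<Sum>i\<in>{0, n - 3, n - 2}. ?f i) \<le> (\<Sum>i<n - 1. ?f i)"
    proof (rule sum_mono2)
      show "\<And>b. b \<in> {..<n - 1} - {0, n - 3, n - 2} \<Longrightarrow> 0 \<le> ?f b"
        using order_trans[OF p0 f0] by simp
    qed (use n h in auto)
    moreover have "(\<Sum>i\<in>{0, n - 3, n - 2}. ?f i) = ?f 0 + (?f (n - 3) + ?f (n - 2))"
      using n h by simp
    moreover have "?f 0 \<ge> phi Y (z 1)" using f0[of 0] by (simp add: Y_def)
    moreover have "?f (n - 3) \<ge> phi (z (n - 3)) ?u" using f0[of "n - 3"] idx by simp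
    moreover have "?f (n - 2) = phi ?u X + X * g (n - 2) + ?u * g (n - 1)" using idx by (simp add: X_def)
    ultimately have F: "(\<Sum>i<n - 1. ?f i) \<ge> phi Y (z 1) + phi (z (n - 3)) ?u + phi ?u X + X * g (n - 2) + ?u * g (n - 1)"
      by linarith
    define m m' t where "m = X - Y" and "m' = ?u + X" and "t = Y - ?u"
    have m: "m > 0" "m' > 0" "t > 0" "t \<le> X" using XY Yu Y0 z[of "n-2"] by (auto simp: m_def m'_def t_def)
    have X0: "X > 0" using XY Y0 by simp
    have "m' + m + (g (n - 2) - g (n - 1)) / m' - (g (n - 1) - g 0) / m \<ge> 0"
      using vert by (simp add: m_def m'_def)
    hence "(m' + m + (g (n - 2) - g (n - 1)) / m' - (g (n - 1) - g 0) / m) * (m * m') \<ge> 0"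
      using m by simp
    also have "(m' + m + (g (n - 2) - g (n - 1)) / m' - (g (n - 1) - g 0) / m) * (m * m')
      = (m + m') * (m * m') + m * g (n - 2) + m' * g 0 - (m + m') * g (n - 1)"
      using m by (simp add: field_simps)
    finally have "t * ((m + m') * g (n - 1)) \<le> t * ((m + m') * (m * m') + m * g (n - 2) + m' * g 0)"
      using m by (intro mult_left_mono) auto
    also have "\<dots> \<le> (m + m') * (t * m * m' + X * g (n - 2) + X * g 0)"
    proof -
      have "t * m \<le> X * (m + m')" "t * m' \<le> X * (m + m')"
        using m X0 by (intro mult_mono; simp)+
      hence "(t * m) * g (n - 2) \<le> X * (m + m') * g (n - 2)" "(t * m') * g 0 \<le> X * (m + m') * g 0"
        using g by (intro mult_right_mono; simp)+
      thus ?thesis by (simp add: algebra_simps)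
    qed
    finally have "(m + m') * (t * g (n - 1)) \<le> (m + m') * (t * m * m' + X * g (n - 2) + X * g 0)"
      by (simp add: mult_ac)
    hence "t * g (n - 1) \<le> t * m * m' + X * g (n - 2) + X * g 0"
      using m by (simp add: mult_le_cancel_left_pos)
    hence "(Y - ?u) * g (n - 1) \<le> (Y - ?u) * (X - Y) * (X + ?u) + X * g (n - 2) + X * g 0"
      by (simp add: t_def m_def m'_def add.commute)
    moreover have "phi (z (n - 3)) ?u + phi ?u X + phis X Y - (Y - ?u) * (X - Y) * (X + ?u) + phi Y (z 1) \<ge> 23/6"
      using z Yu XY by (intro merged_bound) auto
    moreover have "(Y - ?u) * g (n - 1) = Y * g (n - 1) - ?u * g (n - 1)" by (rule left_diff_distrib)
    ultimately show ?thesis using F tau2 pos by linarith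
  qed
qed

section \<open>Crude bounds for the cost of a chain\<close>

text \<open>The portions of the two sides at a vertex have a nonnegative sum, but one of them may be negative. Moving
it to the other side, so that both become nonnegative, does not increase the cost: the change is
\<open>(A + B) A\<^sup>2\<close> or \<open>(A + B) B\<^sup>2\<close>.\<close>

lemma split_portions:
  fixes A B g S :: real
  assumes "A + B \<ge> 0" "g \<ge> 0"
  defines "a \<equiv> if A < 0 then 0 else if B < 0 then A + B else A"
    and "b \<equiv> if B < 0 then 0 else if A < 0 then A + B else B"
  shows "2/3 * (A ^ 3 + B ^ 3) + (g + S) * (A + B)
     \<ge> ((g + A\<^sup>2) * a - a ^ 3 / 3 + S * a) + ((g + B\<^sup>2) * b - b ^ 3 / 3 + S * b)"
proof -
  have id: "2/3 * (A ^ 3 + B ^ 3) + (g + S) * (A + B) - ((g + A\<^sup>2) * (A + B) - (A + B) ^ 3 / 3 + S * (A + B))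
     = (A + B) * B\<^sup>2" for A B :: real
    by (simp add: power2_eq_square power3_eq_cube field_simps)
  consider "A < 0" "B \<ge> 0" | "B < 0" "A \<ge> 0" | "A \<ge> 0" "B \<ge> 0" using assms(1) by linarith
  thus ?thesis
  proof cases
    case 1
    have "(A + B) * A\<^sup>2 \<ge> 0" using assms by simp
    thus ?thesis using id[of B A] 1 by (simp add: a_def b_def add.commute)
  next
    case 2
    have "(A + B) * B\<^sup>2 \<ge> 0" using assms by simp
    thus ?thesis using id[of A B] 2 by (simp add: a_def b_def)
  next
    case 3
    thus ?thesis by (simp add: a_def b_def power2_eq_square power3_eq_cube algebra_simps)
  qed
qed

lemma atom_opposite:
  fixes a b x x' G :: real
  assumes "a \<ge> 0" "b \<ge> 0" "G \<ge> a\<^sup>2" "G \<ge> b\<^sup>2" "\<bar>x\<bar> + \<bar>x'\<bar> \<ge> a + b"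
  shows "20/3 - 5 * (a + b) + (G * a - a ^ 3 / 3 + x'\<^sup>2 * a) + (G * b - b ^ 3 / 3 + x\<^sup>2 * b) \<ge> 0"
proof -
  have "x\<^sup>2 \<ge> 2 * a * \<bar>x\<bar> - a\<^sup>2" "x'\<^sup>2 \<ge> 2 * b * \<bar>x'\<bar> - b\<^sup>2"
    using zero_le_power2[of "\<bar>x\<bar> - a"] zero_le_power2[of "\<bar>x'\<bar> - b"]
    by (auto simp: power2_diff algebra_simps)
  hence "x\<^sup>2 * b \<ge> (2 * a * \<bar>x\<bar> - a\<^sup>2) * b" "x'\<^sup>2 * a \<ge> (2 * b * \<bar>x'\<bar> - b\<^sup>2) * a"
    using assms by (intro mult_right_mono; simp)+
  moreover have "(2 * a * \<bar>x\<bar> - a\<^sup>2) * b + (2 * b * \<bar>x'\<bar> - b\<^sup>2) * a = 2 * a * b * (\<bar>x\<bar> + \<bar>x'\<bar>) - a * b * (a + b)"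
    by (simp add: power2_eq_square algebra_simps)
  moreover have "2 * a * b * (\<bar>x\<bar> + \<bar>x'\<bar>) \<ge> 2 * a * b * (a + b)"
    using assms by (intro mult_left_mono) auto
  ultimately have xs: "x'\<^sup>2 * a + x\<^sup>2 * b \<ge> a * b * (a + b)" by linarith
  have key: "G * (a + b) \<ge> (a ^ 3 + b ^ 3) / 3 - a * b * (a + b) + 5/12 * (a + b) ^ 3"
    if "a \<ge> b" "a \<ge> 0" "b \<ge> 0" "G \<ge> a\<^sup>2" for a b :: real
  proof -
    have "a\<^sup>2 * (a + b) - ((a ^ 3 + b ^ 3) / 3 - a * b * (a + b) + 5/12 * (a + b) ^ 3)
       = (a - b) * (a + b) * (a + 3 * b) / 4"
      by (simp add: power2_eq_square power3_eq_cube field_simps)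
    moreover have "(a - b) * (a + b) * (a + 3 * b) / 4 \<ge> 0" using that by simp
    moreover have "G * (a + b) \<ge> a\<^sup>2 * (a + b)" using that by (intro mult_right_mono) auto
    ultimately show ?thesis by linarith
  qed
  have k: "G * (a + b) \<ge> (a ^ 3 + b ^ 3) / 3 - a * b * (a + b) + 5/12 * (a + b) ^ 3"
    using key[of a b] key[of b a] assms by (cases "a \<ge> b") (auto simp: add.commute mult.commute)
  have "20/3 - 5 * s + 5/12 * s ^ 3 \<ge> 0" if "s \<ge> 0" for s :: real
  proof -
    have eq: "20/3 - 5 * s + 5/12 * s ^ 3 = 5/12 * ((s - 2)\<^sup>2 * (s + 4))"
      by (simp add: power2_eq_square power3_eq_cube field_simps)
    show ?thesis unfolding eq using that by simp
  qed
  from this[of "a + b"] have "20/3 - 5 * (a + b) + 5/12 * (a + b) ^ 3 \<ge> 0" using assms by simp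
  with k xs show ?thesis by (simp add: algebra_simps add_divide_distrib)
qed

lemma atom_same_aux:
  fixes a b G S M :: real
  assumes "a \<ge> 0" "b \<ge> 0" "G \<ge> a\<^sup>2" "S \<ge> (a + b)\<^sup>2"
  shows "20/3 - 5 * (a + b) + (G * a - a ^ 3 / 3) + (G * b - b ^ 3 / 3 + S * b) \<ge> 139/100"
proof -
  have "G * (a + b) \<ge> a\<^sup>2 * (a + b)" "S * b \<ge> (a + b)\<^sup>2 * b" using assms by (intro mult_right_mono; simp)+
  moreover have "a\<^sup>2 * (a + b) + (a + b)\<^sup>2 * b - (a ^ 3 + b ^ 3) / 3 = 2/3 * (a + b) ^ 3"
    by (simp add: power2_eq_square power3_eq_cube field_simps)
  ultimately have "G * (a + b) + S * b - (a ^ 3 + b ^ 3) / 3 \<ge> 2/3 * (a + b) ^ 3" by linarith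
  with cubic_min[of "a + b"] assms show ?thesis by (simp add: algebra_simps add_divide_distrib)
qed

lemma atom_same:
  fixes a b x x' G :: real
  assumes "a \<ge> 0" "b \<ge> 0" "G \<ge> a\<^sup>2" "G \<ge> b\<^sup>2" "x * x' \<ge> 0" "\<bar>x' - x\<bar> \<ge> a + b"
  shows "20/3 - 5 * (a + b) + (G * a - a ^ 3 / 3 + x'\<^sup>2 * a) + (G * b - b ^ 3 / 3 + x\<^sup>2 * b) \<ge> 139/100"
proof -
  have "\<bar>x' - x\<bar> \<le> max \<bar>x\<bar> \<bar>x'\<bar>" using assms(5) by (auto simp: zero_le_mult_iff abs_if max_def)
  hence "\<bar>x\<bar> \<ge> a + b \<or> \<bar>x'\<bar> \<ge> a + b" using assms by linarith
  thus ?thesis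
  proof
    assume "\<bar>x\<bar> \<ge> a + b"
    hence "\<bar>x\<bar>\<^sup>2 \<ge> (a + b)\<^sup>2" using assms by (intro power_mono) auto
    hence "20/3 - 5 * (a + b) + (G * a - a ^ 3 / 3) + (G * b - b ^ 3 / 3 + x\<^sup>2 * b) \<ge> 139/100"
      using assms by (intro atom_same_aux) auto
    moreover have "x'\<^sup>2 * a \<ge> 0" using assms by simp
    ultimately show ?thesis by linarith
  next
    assume "\<bar>x'\<bar> \<ge> a + b"
    hence "\<bar>x'\<bar>\<^sup>2 \<ge> (b + a)\<^sup>2" using assms by (intro power_mono) auto
    hence "20/3 - 5 * (b + a) + (G * b - b ^ 3 / 3) + (G * a - a ^ 3 / 3 + x'\<^sup>2 * a) \<ge> 139/100"
      using assms by (intro atom_same_aux) auto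
    moreover have "x\<^sup>2 * b \<ge> 0" using assms by simp
    ultimately show ?thesis by (simp add: add.commute)
  qed
qed

lemma atom_one_sided:
  fixes b S G :: real
  assumes "b \<ge> 0" "G \<ge> b\<^sup>2" "S \<ge> 0"
  shows "20/3 - 5 * b + (G * b - b ^ 3 / 3 + S * b) \<ge> 139/100"
proof -
  have "G * b \<ge> b\<^sup>2 * b" using assms by (intro mult_right_mono) auto
  hence "G * b \<ge> b ^ 3" by (simp add: power2_eq_square power3_eq_cube)
  moreover have "S * b \<ge> 0" using assms by simp
  ultimately show ?thesis using cubic_min[of b] assms by linarith
qed

text \<open>The length \<open>A + B\<close> and the relation between \<open>g\<close> and \<open>g'\<close> determine \<open>A\<close> and \<open>B\<close>; after the elimination the cost
depends on \<open>g\<close> and \<open>g'\<close> linearly.\<close>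

lemma atom_exact:
  fixes A B g g' x x' :: real
  assumes "A + B = \<bar>x' - x\<bar>" "A + B > 0" "g + B\<^sup>2 = g' + A\<^sup>2"
  shows "20/3 - 5 * (A + B) + 2/3 * (A ^ 3 + B ^ 3) + (g' + x'\<^sup>2) * A + (g + x\<^sup>2) * B
    = 20/3 - 5 * \<bar>x' - x\<bar> + \<bar>x' - x\<bar> ^ 3 / 6 + \<bar>x' - x\<bar> * (x\<^sup>2 + x'\<^sup>2) / 2
      + sgn (x' - x) * (x' * g - x * g')"
proof -
  define m where "m = A + B"
  define d where "d = A - B"
  have gg: "g = g' + m * d" using assms(3) by (simp add: m_def d_def power2_eq_square algebra_simps)
  have AB: "A = (m + d) / 2" "B = (m - d) / 2" by (auto simp: m_def d_def)
  have m: "\<bar>x' - x\<bar> = m" "m > 0" using assms by (auto simp: m_def)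
  consider "x' = x + m" | "x' = x - m" using m by linarith
  thus ?thesis
  proof cases
    case 1
    hence "sgn (x' - x) = 1" "\<bar>x' - x\<bar> = m" using m by auto
    thus ?thesis unfolding m_def[symmetric] unfolding AB gg 1
      by (simp add: power2_eq_square power3_eq_cube field_simps)
  next
    case 2
    hence "sgn (x' - x) = -1" "\<bar>x' - x\<bar> = m" using m by auto
    thus ?thesis unfolding m_def[symmetric] unfolding AB gg 2
      by (simp add: power2_eq_square power3_eq_cube field_simps)
  qed
qed

lemma exact_opposite:
  fixes x x' :: real assumes "x * x' \<le> 0"
  shows "20/3 - 5 * \<bar>x' - x\<bar> + \<bar>x' - x\<bar> ^ 3 / 6 + \<bar>x' - x\<bar> * (x\<^sup>2 + x'\<^sup>2) / 2 = phi \<bar>x\<bar> \<bar>x'\<bar>"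
proof -
  have "\<bar>x' - x\<bar> = \<bar>x\<bar> + \<bar>x'\<bar>" using assms by (auto simp: mult_le_0_iff abs_if)
  moreover have "20/3 - 5 * (a + b) + (a + b) ^ 3 / 6 + (a + b) * (a\<^sup>2 + b\<^sup>2) / 2 = phi a b" for a b :: real
    by (simp add: phi_def power2_eq_square power3_eq_cube field_simps)
  from this[of "\<bar>x\<bar>" "\<bar>x'\<bar>"] show ?thesis unfolding calculation by simp
qed

lemma exact_same:
  fixes X Y :: real
  shows "20/3 - 5 * (X - Y) + (X - Y) ^ 3 / 6 + (X - Y) * (X\<^sup>2 + Y\<^sup>2) / 2 = phis X Y"
  by (simp add: phis_def power2_eq_square power3_eq_cube field_simps)

lemma sum_periodic_shift:
  fixes f :: "nat \<Rightarrow> 'a::ab_group_add"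
  assumes "\<And>k. f (k + n) = f k"
  shows "(\<Sum>k<n. f (k + j)) = (\<Sum>k<n. f k)"
proof (induction j)
  case 0 show ?case by simp
next
  case (Suc j)
  have "(\<Sum>k<Suc n. f (k + j)) = f (0 + j) + (\<Sum>k<n. f (Suc k + j))"
    by (rule sum.lessThan_Suc_shift)
  hence "(\<Sum>k<n. f (k + j)) + f (n + j) = f j + (\<Sum>k<n. f (k + Suc j))" by simp
  moreover have "f (n + j) = f j" using assms[of j] by (simp add: add.commute)
  ultimately show ?case using Suc.IH by (simp add: add.commute)
qed

text \<open>The data of a caliper, in the scale in which a typical side has length \<open>2\<close>. The side from \<open>k\<close> to \<open>k + 1\<close> has length
\<open>\<bar>x\<^sub>k\<^sub>+\<^sub>1 - x\<^sub>k\<bar>\<close>; the foot of the perpendicular from the origin divides it into portions \<open>B\<^sub>k\<close> (before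
the foot) and \<open>A\<^sub>k\<close> (after it), which may be negative. The number \<open>g\<^sub>k\<close> measures how far the vertex \<open>k\<close> is inside
the circle, so \<open>link\<close> is the theorem of Pythagoras for the two ends of a side. The last condition holds at a
convex vertex.\<close>

locale zigzag =
  fixes n :: nat and x g A B :: "nat \<Rightarrow> real"
  assumes n_pos: "n > 0"
    and x_anti: "x (k + n) = - x k"
    and g_per: "g (k + n) = g k" and A_per: "A (k + n) = A k" and B_per: "B (k + n) = B k"
    and AB: "A k + B k = \<bar>x (Suc k) - x k\<bar>" and AB_pos: "A k + B k > 0"
    and g_nonneg: "g k \<ge> 0"
    and link: "g k + (B k)\<^sup>2 = g (Suc k) + (A k)\<^sup>2"
    and vertex: "A k + B (Suc k) \<ge> 0"
begin

definition atom :: "nat \<Rightarrow> real" where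
  "atom k = 20/3 - 5 * (A k + B k) + 2/3 * (A k ^ 3 + B k ^ 3)
     + (g (Suc k) + (x (Suc k))\<^sup>2) * A k + (g k + (x k)\<^sup>2) * B k"

definition cost :: real where "cost = (\<Sum>k<n. atom k)"

text \<open>The portions after \<open>split_portions\<close> has been applied at every vertex: \<open>a k\<close> belongs to the end of side \<open>k\<close>, and
\<open>b (Suc k) = b' k\<close> to the start of the next one. The index in the definition of \<open>b\<close> is \<open>k - 1\<close> modulo \<open>n\<close>.\<close>

definition a :: "nat \<Rightarrow> real" where
  "a k = (if A k < 0 then 0 else if B (Suc k) < 0 then A k + B (Suc k) else A k)"
definition b' :: "nat \<Rightarrow> real" where
  "b' k = (if B (Suc k) < 0 then 0 else if A k < 0 then A k + B (Suc k) else B (Suc k))"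
definition b :: "nat \<Rightarrow> real" where "b k = b' (k + n - 1)"

lemma b_Suc: "b (Suc k) = b' k"
proof -
  have "A (k + n) = A k" "B (Suc (k + n)) = B (Suc k)" using A_per B_per[of "Suc k"] by auto
  thus ?thesis by (simp add: b_def b'_def)
qed

lemma x_Suc_per: "x (Suc (k + n)) = - x (Suc k)" "A (Suc (k + n)) = A (Suc k)"
  "B (Suc (k + n)) = B (Suc k)" "g (Suc (k + n)) = g (Suc k)"
  using x_anti[of "Suc k"] A_per[of "Suc k"] B_per[of "Suc k"] g_per[of "Suc k"] by auto

lemma b_per: "b (k + n) = b k"
proof (cases k)
  case 0
  obtain m where m: "n = Suc m" using n_pos by (cases n) auto
  have "b k = b' (n - 1)" using 0 by (simp add: b_def)
  moreover have "n - 1 = m" "k + n = Suc m" using m 0 by auto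
  ultimately show ?thesis using b_Suc[of m] by metis
next
  case (Suc j)
  have "b' (j + n) = b' j" using A_per[of j] x_Suc_per(3)[of j] by (simp add: b'_def)
  thus ?thesis using Suc b_Suc[of j] b_Suc[of "j + n"] by simp
qed

definition clamped :: "nat \<Rightarrow> real" where
  "clamped k = 20/3 - 5 * (a k + b k)
     + ((g (Suc k) + (A k)\<^sup>2) * a k - a k ^ 3 / 3 + (x (Suc k))\<^sup>2 * a k)
     + ((g (Suc k) + (A k)\<^sup>2) * b k - b k ^ 3 / 3 + (x k)\<^sup>2 * b k)"

lemma cost_ge_clamped: "cost \<ge> (\<Sum>k<n. clamped k)"
proof -
  let ?P = "\<lambda>k. 2/3 * B k ^ 3 + (g k + (x k)\<^sup>2) * B k - 5 * B k"
  let ?R = "\<lambda>k. (g k + (B k)\<^sup>2) * b k - b k ^ 3 / 3 + (x k)\<^sup>2 * b k - 5 * b k"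
  let ?L = "\<lambda>k. (g (Suc k) + (A k)\<^sup>2) * a k - a k ^ 3 / 3 + (x (Suc k))\<^sup>2 * a k - 5 * a k"
  let ?Q = "\<lambda>k. 2/3 * A k ^ 3 + (g (Suc k) + (x (Suc k))\<^sup>2) * A k - 5 * A k"
  have "(\<Sum>k<n. ?P (k + 1)) = (\<Sum>k<n. ?P k)"
    by (rule sum_periodic_shift) (simp add: B_per g_per x_anti)
  hence P: "(\<Sum>k<n. ?P k) = (\<Sum>k<n. ?P (Suc k))" unfolding Suc_eq_plus1 by (rule sym)
  have "(\<Sum>k<n. ?R (k + 1)) = (\<Sum>k<n. ?R k)"
    by (rule sum_periodic_shift) (simp add: B_per g_per x_anti b_per)
  hence R: "(\<Sum>k<n. ?R k) = (\<Sum>k<n. ?R (Suc k))" unfolding Suc_eq_plus1 by (rule sym)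
  have "cost = (\<Sum>k<n. 20/3 + ?Q k + ?P k)"
    unfolding cost_def atom_def by (intro sum.cong refl) (simp add: algebra_simps)
  also have "\<dots> = (\<Sum>k<n. 20/3 + ?Q k) + (\<Sum>k<n. ?P (Suc k))" unfolding P[symmetric] by (rule sum.distrib)
  also have "\<dots> = (\<Sum>k<n. 20/3 + (?Q k + ?P (Suc k)))" unfolding add.assoc[symmetric] by (rule sum.distrib[symmetric])
  also have "\<dots> \<ge> (\<Sum>k<n. 20/3 + (?L k + ?R (Suc k)))"
  proof (intro sum_mono add_left_mono)
    fix k
    have "?L k + ?R (Suc k) + 5 * (a k + b (Suc k)) \<le>
       2/3 * (A k ^ 3 + B (Suc k) ^ 3) + (g (Suc k) + (x (Suc k))\<^sup>2) * (A k + B (Suc k))"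
      using split_portions[OF vertex[of k] g_nonneg[of "Suc k"], of "(x (Suc k))\<^sup>2"]
      unfolding a_def b_Suc b'_def by (simp only: algebra_simps)
    moreover have "a k + b (Suc k) = A k + B (Suc k)"
      using vertex[of k] by (auto simp: a_def b_Suc b'_def)
    ultimately show "?L k + ?R (Suc k) \<le> ?Q k + ?P (Suc k)" by (simp add: algebra_simps)
  qed
  also have "(\<Sum>k<n. 20/3 + (?L k + ?R (Suc k))) = (\<Sum>k<n. 20/3 + ?L k) + (\<Sum>k<n. ?R (Suc k))"
    unfolding add.assoc[symmetric] by (rule sum.distrib)
  also have "\<dots> = (\<Sum>k<n. 20/3 + ?L k + ?R k)" unfolding R[symmetric] by (rule sum.distrib[symmetric])
  also have "\<dots> = (\<Sum>k<n. clamped k)"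
    by (intro sum.cong refl) (simp add: clamped_def link algebra_simps)
  finally show ?thesis by simp
qed

lemma a_b_facts: "a k \<ge> 0" "b k \<ge> 0" "a k \<le> \<bar>A k\<bar>" "b k \<le> \<bar>B k\<bar>"
  "A k \<ge> 0 \<Longrightarrow> a k \<le> A k" "B k \<ge> 0 \<Longrightarrow> b k \<le> B k" "A k < 0 \<Longrightarrow> a k = 0" "B k < 0 \<Longrightarrow> b k = 0"
proof -
  show "a k \<ge> 0" "a k \<le> \<bar>A k\<bar>" "A k \<ge> 0 \<Longrightarrow> a k \<le> A k" "A k < 0 \<Longrightarrow> a k = 0"
    using vertex[of k] by (auto simp: a_def)
  have *: "b (Suc j) \<ge> 0" "b (Suc j) \<le> \<bar>B (Suc j)\<bar>" "B (Suc j) \<ge> 0 \<Longrightarrow> b (Suc j) \<le> B (Suc j)"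
    "B (Suc j) < 0 \<Longrightarrow> b (Suc j) = 0" for j
    using vertex[of j] by (auto simp: b_Suc b'_def)
  obtain j where j: "k + n = Suc j" using n_pos by (cases "k + n") auto
  show "b k \<ge> 0" "b k \<le> \<bar>B k\<bar>" "B k \<ge> 0 \<Longrightarrow> b k \<le> B k" "B k < 0 \<Longrightarrow> b k = 0"
    using *[of j] unfolding j[symmetric] by (auto simp: b_per B_per)
qed

text \<open>If one original portion is negative, the clamped side has only one portion; otherwise the clamped portions add
up to at most the length of the side. In each case one of the three crude bounds applies.\<close>

lemma clamped_ge:
  shows "clamped k \<ge> 0" and "x k * x (Suc k) \<ge> 0 \<Longrightarrow> clamped k \<ge> 139/100"
proof -
  define G where "G = g (Suc k) + (A k)\<^sup>2"
  have G: "G \<ge> (A k)\<^sup>2" "G \<ge> (B k)\<^sup>2"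
    using g_nonneg[of k] g_nonneg[of "Suc k"] link[of k] by (auto simp: G_def)
  have sq: "(a k)\<^sup>2 \<le> (A k)\<^sup>2" "(b k)\<^sup>2 \<le> (B k)\<^sup>2"
    using a_b_facts[of k] power_mono[of "a k" "\<bar>A k\<bar>" 2] power_mono[of "b k" "\<bar>B k\<bar>" 2] by auto
  have Gab: "G \<ge> (a k)\<^sup>2" "G \<ge> (b k)\<^sup>2" using G sq by auto
  have c: "clamped k = 20/3 - 5 * (a k + b k)
     + (G * a k - a k ^ 3 / 3 + (x (Suc k))\<^sup>2 * a k) + (G * b k - b k ^ 3 / 3 + (x k)\<^sup>2 * b k)"
    by (simp add: clamped_def G_def)
  have "clamped k \<ge> 0 \<and> (x k * x (Suc k) \<ge> 0 \<longrightarrow> clamped k \<ge> 139/100)"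
  proof (cases "A k < 0 \<or> B k < 0")
    case True
    hence "clamped k \<ge> 139/100"
      using atom_one_sided[OF a_b_facts(2)[of k] Gab(2), of "(x k)\<^sup>2"]
        atom_one_sided[OF a_b_facts(1)[of k] Gab(1), of "(x (Suc k))\<^sup>2"] a_b_facts(7,8)[of k]
      by (auto simp: c)
    thus ?thesis by simp
  next
    case False
    hence le: "a k + b k \<le> \<bar>x (Suc k) - x k\<bar>"
      using a_b_facts(5,6)[of k] AB[of k] by linarith
    show ?thesis
    proof (cases "x k * x (Suc k) \<ge> 0")
      case True
      thus ?thesis using atom_same[OF a_b_facts(1,2) Gab True le] by (simp add: c)
    next
      case False
      have "a k + b k \<le> \<bar>x k\<bar> + \<bar>x (Suc k)\<bar>" using le by linarith
      thus ?thesis using atom_opposite[OF a_b_facts(1,2) Gab] False by (simp add: c)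
    qed
  qed
  thus "clamped k \<ge> 0" and "x k * x (Suc k) \<ge> 0 \<Longrightarrow> clamped k \<ge> 139/100" by auto
qed

lemma cost_nonneg: "cost \<ge> 0"
  using cost_ge_clamped clamped_ge(1) sum_nonneg[of "{..<n}" clamped] by force

lemma cost_ge_card:
  assumes "\<And>k. k \<in> S \<Longrightarrow> x k * x (Suc k) \<ge> 0" "S \<subseteq> {..<n}"
  shows "cost \<ge> 139/100 * card S"
proof -
  have "(\<Sum>k\<in>S. 139/100) \<le> (\<Sum>k\<in>S. clamped k)" using assms clamped_ge by (intro sum_mono) auto
  also have "\<dots> \<le> (\<Sum>k<n. clamped k)" using assms clamped_ge by (intro sum_mono2) auto
  finally show ?thesis using cost_ge_clamped by simp
qed

end

section \<open>The minimal cost of an antiperiodic chain of even length\<close>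

lemma half_sum: "(P + Q) / 2 + (R - S) / 2 \<ge> 0 \<Longrightarrow> P + R + Q - S \<ge> (0::real)"
  by argo

lemma flip_sum: "P + R + Q - S \<ge> 0 \<Longrightarrow> R = R' \<Longrightarrow> Q = - Q' \<Longrightarrow> S = - S' \<Longrightarrow> R' + P + S' - Q' \<ge> (0::real)"
  by simp

lemma assoc_sum: "a + b + c - d \<ge> t \<Longrightarrow> a + (b + c - d) \<ge> (t::real)"
  by simp

lemma abs_diff_opposite: "x * y \<le> 0 \<Longrightarrow> \<bar>y - x\<bar> = \<bar>x\<bar> + \<bar>y :: real\<bar>"
  by (auto simp: mult_le_0_iff abs_if)

context zigzag begin

lemma atom_per: "atom (k + n) = atom k"
  using x_anti[of k] x_Suc_per[of k] by (simp add: atom_def A_per B_per g_per)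

text \<open>The portions of a side in terms of its length and of the two values of \<open>g\<close>. This rewrites the vertex condition in
the form that \<open>single_defect_bound\<close> expects.\<close>

lemma AB_solve:
  defines "m \<equiv> \<lambda>k. \<bar>x (Suc k) - x k\<bar>"
  shows "m k > 0" "A k = (m k + (g k - g (Suc k)) / m k) / 2" "B k = (m k - (g k - g (Suc k)) / m k) / 2"
proof -
  have m: "A k + B k = m k" "m k > 0" using AB[of k] AB_pos[of k] by (auto simp: m_def)
  have "(A k - B k) * m k = g k - g (Suc k)"
    unfolding m(1)[symmetric] using link[of k] by (simp add: power2_eq_square algebra_simps)
  hence "A k - B k = (g k - g (Suc k)) / m k" using m(2) by (simp add: field_simps)
  thus "m k > 0" "A k = (m k + (g k - g (Suc k)) / m k) / 2" "B k = (m k - (g k - g (Suc k)) / m k) / 2"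
    using m by auto
qed

lemma atom_eq: "atom k = 20/3 - 5 * \<bar>x (Suc k) - x k\<bar> + \<bar>x (Suc k) - x k\<bar> ^ 3 / 6
   + \<bar>x (Suc k) - x k\<bar> * ((x k)\<^sup>2 + (x (Suc k))\<^sup>2) / 2
   + sgn (x (Suc k) - x k) * (x (Suc k) * g k - x k * g (Suc k))"
  unfolding atom_def by (rule atom_exact) (use AB AB_pos link in auto)

lemma atom_opp:
  assumes "x k * x (Suc k) \<le> 0"
  shows "atom k = phi \<bar>x k\<bar> \<bar>x (Suc k)\<bar> + \<bar>x (Suc k)\<bar> * g k + \<bar>x k\<bar> * g (Suc k)"
proof -
  have "sgn (x (Suc k) - x k) * (x (Suc k) * g k - x k * g (Suc k)) = \<bar>x (Suc k)\<bar> * g k + \<bar>x k\<bar> * g (Suc k)"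
    using assms AB_solve(1)[of k] by (auto simp: mult_le_0_iff sgn_if abs_if algebra_simps)
  thus ?thesis unfolding atom_eq exact_opposite[OF assms] by simp
qed

lemma atom_down:
  assumes "x k * x (Suc k) \<ge> 0" "\<bar>x (Suc k)\<bar> \<le> \<bar>x k\<bar>"
  shows "\<bar>x (Suc k) - x k\<bar> = \<bar>x k\<bar> - \<bar>x (Suc k)\<bar>" "\<bar>x k\<bar> > \<bar>x (Suc k)\<bar>"
    "atom k = phis \<bar>x k\<bar> \<bar>x (Suc k)\<bar> + \<bar>x k\<bar> * g (Suc k) - \<bar>x (Suc k)\<bar> * g k"
proof -
  show 1: "\<bar>x (Suc k) - x k\<bar> = \<bar>x k\<bar> - \<bar>x (Suc k)\<bar>"
    using assms by (auto simp: zero_le_mult_iff abs_if split: if_splits)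
  show 2: "\<bar>x k\<bar> > \<bar>x (Suc k)\<bar>" using 1 AB_solve(1)[of k] by linarith
  have "sgn (x (Suc k) - x k) * (x (Suc k) * g k - x k * g (Suc k)) = \<bar>x k\<bar> * g (Suc k) - \<bar>x (Suc k)\<bar> * g k"
    using assms 2 by (auto simp: zero_le_mult_iff sgn_if abs_if algebra_simps split: if_splits)
  thus "atom k = phis \<bar>x k\<bar> \<bar>x (Suc k)\<bar> + \<bar>x k\<bar> * g (Suc k) - \<bar>x (Suc k)\<bar> * g k"
    unfolding atom_eq 1 using exact_same[of "\<bar>x k\<bar>" "\<bar>x (Suc k)\<bar>"] by simp
qed

lemma atom_up:
  assumes "x k * x (Suc k) \<ge> 0" "\<bar>x k\<bar> \<le> \<bar>x (Suc k)\<bar>"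
  shows "\<bar>x (Suc k) - x k\<bar> = \<bar>x (Suc k)\<bar> - \<bar>x k\<bar>" "\<bar>x (Suc k)\<bar> > \<bar>x k\<bar>"
    "atom k = phis \<bar>x (Suc k)\<bar> \<bar>x k\<bar> + \<bar>x (Suc k)\<bar> * g k - \<bar>x k\<bar> * g (Suc k)"
proof -
  show 1: "\<bar>x (Suc k) - x k\<bar> = \<bar>x (Suc k)\<bar> - \<bar>x k\<bar>"
    using assms by (auto simp: zero_le_mult_iff abs_if split: if_splits)
  show 2: "\<bar>x (Suc k)\<bar> > \<bar>x k\<bar>" using 1 AB_solve(1)[of k] by linarith
  have "sgn (x (Suc k) - x k) * (x (Suc k) * g k - x k * g (Suc k)) = \<bar>x (Suc k)\<bar> * g k - \<bar>x k\<bar> * g (Suc k)"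
    using assms 2 by (auto simp: zero_le_mult_iff sgn_if abs_if algebra_simps split: if_splits)
  thus "atom k = phis \<bar>x (Suc k)\<bar> \<bar>x k\<bar> + \<bar>x (Suc k)\<bar> * g k - \<bar>x k\<bar> * g (Suc k)"
    unfolding atom_eq 1 using exact_same[of "\<bar>x (Suc k)\<bar>" "\<bar>x k\<bar>"] by (simp add: add.commute)
qed

text \<open>A choice of sign for every \<open>x k\<close>. A value \<open>0\<close> may get either sign; the choice is made in one period and
extended antiperiodically, so that counting sign changes remains meaningful.\<close>

definition upper :: "nat \<Rightarrow> bool" where
  "upper k = (if even (k div n) then x (k mod n) \<ge> 0 else \<not> x (k mod n) \<ge> 0)"

lemma x_mod: "x k = (-1) ^ (k div n) * x (k mod n)"
proof -
  have "x (r + q * n) = (-1) ^ q * x r" for q r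
  proof (induction q)
    case (Suc q)
    have "x (r + Suc q * n) = x ((r + q * n) + n)" by (simp add: algebra_simps)
    also have "\<dots> = - x (r + q * n)" by (rule x_anti)
    finally show ?case using Suc by simp
  qed simp
  from this[of "k mod n" "k div n"] show ?thesis by (simp add: add.commute)
qed

lemma upper_sign: "upper k \<Longrightarrow> x k \<ge> 0" "\<not> upper k \<Longrightarrow> x k \<le> 0"
  using x_mod[of k] by (auto simp: upper_def split: if_splits)

lemma upper_per: "upper (k + n) \<longleftrightarrow> \<not> upper k"
  using n_pos by (auto simp: upper_def)

definition same :: "nat \<Rightarrow> bool" where "same k \<longleftrightarrow> upper k = upper (Suc k)"

lemma same_per: "same (k + n) = same k"
  using upper_per[of k] upper_per[of "Suc k"] by (auto simp: same_def)

lemma same_sign: "same k \<Longrightarrow> x k * x (Suc k) \<ge> 0" "\<not> same k \<Longrightarrow> x k * x (Suc k) \<le> 0"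
  using upper_sign[of k] upper_sign[of "Suc k"] by (auto simp: same_def zero_le_mult_iff mult_le_0_iff)

lemma flips_parity: "even (card {k. k < N \<and> \<not> same k}) \<longleftrightarrow> upper N = upper 0"
proof (induction N)
  case (Suc N)
  have "{k. k < Suc N \<and> \<not> same k} = (if same N then {k. k < N \<and> \<not> same k} else insert N {k. k < N \<and> \<not> same k})"
    by (auto simp: less_Suc_eq)
  thus ?case using Suc by (auto simp: same_def)
qed simp

text \<open>After \<open>n\<close> steps the sign is reversed, so the number of sign changes is odd; as \<open>n\<close> is even, so is the
number of steps without a sign change.\<close>

lemma odd_same:
  assumes "even n" shows "odd (card {k. k < n \<and> same k})"
proof -
  have "card ({k. k < n \<and> same k} \<union> {k. k < n \<and> \<not> same k}) = card {k. k < n \<and> same k} + card {k. k < n \<and> \<not> same k}"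
    by (intro card_Un_disjoint) auto
  moreover have "{k. k < n \<and> same k} \<union> {k. k < n \<and> \<not> same k} = {..<n}" by auto
  ultimately have "card {k. k < n \<and> same k} + card {k. k < n \<and> \<not> same k} = n"
    by (metis card_lessThan)
  moreover have "odd (card {k. k < n \<and> \<not> same k})"
    using flips_parity[of n] upper_per[of 0] by auto
  ultimately show ?thesis using assms by (metis even_add)
qed

text \<open>The number of defects is odd. Three of them cost more than \<open>4.17 > 23/6\<close>. With a single defect the chain is
rotated so that the defect becomes the last step, and reversed if the modulus increases there.\<close>

theorem cost_lower:
  assumes n: "n = 2 * h" and h: "h \<ge> 3"
  shows "cost \<ge> 2 * tau - 800 * (3/4) ^ h"
proof -
  define S where "S = {k. k < n \<and> same k}"
  have "odd (card S)" using odd_same n by (simp add: S_def)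
  hence "card S \<noteq> 0" "card S \<noteq> 2" by (metis even_zero, metis dvd_refl)
  \<comment> \<open>An odd number is \<open>1\<close> or at least \<open>3\<close>.\<close>
  hence dich: "card S = 1 \<or> card S \<ge> 3" by linarith
  show ?thesis
  proof (cases "card S \<ge> 3")
    case c: True
    have "cost \<ge> 139/100 * card S"
      by (rule cost_ge_card) (auto simp: S_def intro: same_sign)
    moreover have "139/100 * real (card S) \<ge> 417/100" using c by simp
    moreover have "(3/4::real) ^ h \<ge> 0" by simp
    ultimately show ?thesis using tau_le by linarith
  next
    case False
    with dich have "card S = 1" by simp
    then obtain k0 where S: "S = {k0}" by (auto simp: card_1_singleton_iff)
    hence k0: "k0 < n" "same k0" by (auto simp: S_def)
    have uniq: "\<not> same (k0 + 1 + i)" if "i < n - 1" for i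
    proof
      assume sm: "same (k0 + 1 + i)"
      show False
      proof (cases "k0 + 1 + i < n")
        case True
        hence "k0 + 1 + i \<in> S" using sm unfolding S_def by simp
        thus ?thesis unfolding S by simp
      next
        case False
        define j where "j = k0 + 1 + i - n"
        have j: "k0 + 1 + i = j + n" "j < k0" using False that k0 unfolding j_def by linarith+
        have "same j" using sm unfolding j(1) same_per .
        hence "j \<in> S" using j(2) k0(1) unfolding S_def by simp
        thus ?thesis using j(2) unfolding S by simp
      qed
    qed
    define z where "z = (\<lambda>i. \<bar>x (k0 + 1 + i)\<bar>)"
    define G where "G = (\<lambda>i. g (k0 + 1 + i))"
    have n1: "Suc (n - 1) = n" using n_pos by simp
    have idx: "k0 + 1 + (n - 1) = k0 + n" "k0 + 1 + (n - 2) = k0 + n - 1" "Suc (k0 + n - 1) = k0 + n"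
      using n h by linarith+
    have z0: "z i \<ge> 0" and G0: "G i \<ge> 0" for i unfolding z_def G_def by (rule abs_ge_zero, rule g_nonneg)
    have zG1: "\<bar>x (k0 + n)\<bar> = z (n - 1)" "g (k0 + n) = G (n - 1)"
        "\<bar>x (k0 + n - 1)\<bar> = z (n - 2)" "g (k0 + n - 1) = G (n - 2)"
      unfolding z_def G_def idx by (rule refl)+
    have zG2: "\<bar>x (Suc (k0 + n))\<bar> = z 0" "g (Suc (k0 + n)) = G 0"
      unfolding z_def G_def x_Suc_per by simp_all
    note zG = zG1 zG2
    have "cost = (\<Sum>i<n. atom (i + (k0 + 1)))"
      unfolding cost_def by (rule sum_periodic_shift[symmetric]) (rule atom_per)
    also have "\<dots> = (\<Sum>i<Suc (n - 1). atom (k0 + 1 + i))"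
      unfolding n1 by (intro sum.cong refl arg_cong[where f=atom] add.commute)
    also have "\<dots> = (\<Sum>i<n - 1. atom (k0 + 1 + i)) + atom (k0 + n)"
      unfolding sum.lessThan_Suc idx by (rule refl)
    also have "(\<Sum>i<n - 1. atom (k0 + 1 + i)) = (\<Sum>i<n - 1. phi (z i) (z (Suc i)) + z (Suc i) * G i + z i * G (Suc i))"
    proof (rule sum.cong[OF refl])
      fix i assume "i \<in> {..<n - 1}"
      hence "\<not> same (k0 + 1 + i)" by (intro uniq) simp
      from atom_opp[OF same_sign(2)[OF this]]
      show "atom (k0 + 1 + i) = phi (z i) (z (Suc i)) + z (Suc i) * G i + z i * G (Suc i)"
        unfolding z_def G_def add_Suc_right .
    qed
    finally have cost: "cost = (\<Sum>i<n - 1. phi (z i) (z (Suc i)) + z (Suc i) * G i + z i * G (Suc i)) + atom (k0 + n)" .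
    have ss: "x (k0 + n) * x (Suc (k0 + n)) \<ge> 0" using same_sign(1)[of "k0 + n"] k0(2) unfolding same_per by blast
    show ?thesis
    proof (cases "z 0 \<le> z (n - 1)")
      case True
      have opp: "x (k0 + n - 1) * x (k0 + n) \<le> 0"
        using same_sign(2)[OF uniq[of "n - 2"]] n h unfolding idx by simp
      note down = atom_down[OF ss, unfolded zG, OF True]
      have m1: "\<bar>x (k0 + n) - x (k0 + n - 1)\<bar> = z (n - 2) + z (n - 1)"
        unfolding zG[symmetric] by (rule abs_diff_opposite[OF opp])
      have "A (k0 + n - 1) + B (k0 + n) \<ge> 0" using vertex[of "k0 + n - 1"] unfolding idx .
      hence v: "(z (n - 2) + z (n - 1)) + (z (n - 1) - z 0) + (G (n - 2) - G (n - 1)) / (z (n - 2) + z (n - 1))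
         - (G (n - 1) - G 0) / (z (n - 1) - z 0) \<ge> 0"
        unfolding AB_solve(2)[of "k0 + n - 1"] AB_solve(3)[of "k0 + n"] idx zG down(1) m1
        by (rule half_sum)
      show ?thesis unfolding cost down(3)
        by (rule assoc_sum, rule single_defect_bound[where z=z and g=G, OF n h z0 G0 down(2) v])
    next
      case False
      hence "z (n - 1) \<le> z 0" by simp
      note up = atom_up[OF ss, unfolded zG, OF this]
      have opp: "x (Suc k0) * x (Suc (Suc k0)) \<le> 0"
        using same_sign(2)[OF uniq[of 0]] n h by simp
      have m1: "\<bar>x (Suc (Suc k0)) - x (Suc k0)\<bar> = z 0 + z 1"
        using abs_diff_opposite[OF opp] by (simp add: z_def)
      have G1: "g (Suc k0) = G 0" "g (Suc (Suc k0)) = G 1" by (auto simp: G_def)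
      have "A (k0 + n) + B (Suc k0) \<ge> 0" using vertex[of "k0 + n"] x_Suc_per(3)[of k0] by simp
      hence raw: "(z 0 - z (n - 1)) + (z 0 + z 1) + (G (n - 1) - G 0) / (z 0 - z (n - 1))
         - (G 0 - G 1) / (z 0 + z 1) \<ge> 0"
        unfolding AB_solve(2)[of "k0 + n"] AB_solve(3)[of "Suc k0"] zG up(1) m1 G1
        by (rule half_sum)
      have neg: "(G (n - 1) - G 0) / (z 0 - z (n - 1)) = - ((G 0 - G (n - 1)) / (z 0 - z (n - 1)))"
        "(G 0 - G 1) / (z 0 + z 1) = - ((G 1 - G 0) / (z 1 + z 0))"
        by (simp_all only: minus_divide_left minus_diff_eq add.commute)
      have v: "(z 1 + z 0) + (z 0 - z (n - 1)) + (G 1 - G 0) / (z 1 + z 0)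
         - (G 0 - G (n - 1)) / (z 0 - z (n - 1)) \<ge> 0"
        by (rule flip_sum[OF raw add.commute neg])
      define z' where "z' = (\<lambda>i. z (n - 1 - i))"
      define G' where "G' = (\<lambda>i. G (n - 1 - i))"
      have e: "z' (n - 1) = z 0" "z' 0 = z (n - 1)" "z' (n - 2) = z 1"
        "G' (n - 1) = G 0" "G' 0 = G (n - 1)" "G' (n - 2) = G 1"
        using n h by (auto simp: z'_def G'_def intro: arg_cong[where f=z] arg_cong[where f=G])
      have "(\<Sum>i<n - 1. phi (z' i) (z' (Suc i)) + z' (Suc i) * G' i + z' i * G' (Suc i))
        + phis (z' (n - 1)) (z' 0) + z' (n - 1) * G' 0 - z' 0 * G' (n - 1) \<ge> 2 * tau - 800 * (3/4) ^ h"
      proof (rule single_defect_bound[where z=z' and g=G', OF n h])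
        show "z' i \<ge> 0" "G' i \<ge> 0" for i by (simp_all add: z'_def G'_def z0 G0)
        show "z' (n - 1) > z' 0" unfolding e using up(2) .
        show "(z' (n - 2) + z' (n - 1)) + (z' (n - 1) - z' 0) + (G' (n - 2) - G' (n - 1)) / (z' (n - 2) + z' (n - 1))
         - (G' (n - 1) - G' 0) / (z' (n - 1) - z' 0) \<ge> 0" unfolding e using v .
      qed
      moreover have "(\<Sum>i<n - 1. phi (z' i) (z' (Suc i)) + z' (Suc i) * G' i + z' i * G' (Suc i))
         = (\<Sum>i<n - 1. phi (z i) (z (Suc i)) + z (Suc i) * G i + z i * G (Suc i))"
      proof (rule sum.reindex_bij_witness[of _ "\<lambda>i. n - 2 - i" "\<lambda>i. n - 2 - i"])
        fix i assume i: "i \<in> {..<n - 1}"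
        hence j: "n - 1 - i = Suc (n - 2 - i)" "n - 1 - Suc i = n - 2 - i" by auto
        show "phi (z (n - 2 - i)) (z (Suc (n - 2 - i))) + z (Suc (n - 2 - i)) * G (n - 2 - i) + z (n - 2 - i) * G (Suc (n - 2 - i))
          = phi (z' i) (z' (Suc i)) + z' (Suc i) * G' i + z' i * G' (Suc i)"
          unfolding z'_def G'_def j by (simp add: phi_commute)
      qed auto
      ultimately show ?thesis unfolding cost up(3) e by (intro assoc_sum) (simp only: )
    qed
  qed
qed

end

section \<open>A Wirtinger inequality for paths with finitely many directions\<close>

definition cross :: "complex \<Rightarrow> complex \<Rightarrow> real" where
  "cross a b = Im (cnj a * b)"

lemma cross_altdef: "cross a b = Re a * Im b - Im a * Re b"
  by (simp add: cross_def)

text \<open>A closed path \<open>W\<close> whose steps have lengths \<open>\<mu>\<^sub>k\<close>, of either sign, and directions that turn through a half circle. The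
slope \<open>p\<close> jumps by \<open>\<mu>\<^sub>k\<close> at \<open>\<theta>\<^sub>k\<close> and is constant in between, \<open>v\<close> is its primitive, and both are
antiperiodic. The normalisation of \<open>W 0\<close> is a translation.\<close>

locale jump_path =
  fixes n :: nat and \<theta> \<mu> p v :: "nat \<Rightarrow> real" and W :: "nat \<Rightarrow> complex"
  assumes theta_mono: "k < n \<Longrightarrow> \<theta> k \<le> \<theta> (Suc k)"
    and theta_n: "\<theta> n = \<theta> 0 + pi"
    and W_Suc: "k < n \<Longrightarrow> W (Suc k) = W k + of_real (\<mu> k) * cis (\<theta> k)" and W_n: "W n = W 0"
    and p_Suc: "k < n \<Longrightarrow> p (Suc k) = p k + \<mu> k" and p_n: "p n = - p 0"
    and v_Suc: "k < n \<Longrightarrow> v (Suc k) = v k + p (Suc k) * (\<theta> (Suc k) - \<theta> k)" and v_n: "v n = - v 0"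
    and W_0: "W 0 = Complex (p 0) (- v 0) * cis (\<theta> 0)"
begin

text \<open>Between two nodes, as functions of an angle \<open>t\<close>: the primitive of the slope, the coordinates of \<open>W\<close> along the normal
(\<open>h0\<close>) and along the direction (\<open>h1\<close>) for the angle \<open>t\<close>, and the amounts \<open>u0\<close>, \<open>u1\<close> by which these
differ from the primitive and from the slope. As \<open>h1\<close> is the derivative of \<open>h0\<close>, \<open>u1\<close> is that of \<open>u0\<close>.
The increments of \<open>S\<close> between nodes add up to the difference between \<open>- \<Sum> p\<^sup>2 (\<theta>\<^sub>k\<^sub>+\<^sub>1 - \<theta>\<^sub>k)\<close> and the
signed area (\<open>sum_S\<close>), while the derivative of \<open>S\<close> is \<open>u1\<^sup>2 - u0\<^sup>2 + vv\<^sup>2\<close>. So everything is reduced to the sign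
and size of the integral of \<open>u1\<^sup>2 - u0\<^sup>2 + vv\<^sup>2\<close>, where \<open>u0\<close> vanishes at both ends of an interval of length \<open>\<pi>\<close>.\<close>

definition vv where "vv k t = v k + p (Suc k) * (t - \<theta> k)"
definition h0 where "h0 k t = Re (W (Suc k)) * sin t - Im (W (Suc k)) * cos t"
definition h1 where "h1 k t = Re (W (Suc k)) * cos t + Im (W (Suc k)) * sin t"
definition u0 where "u0 k t = h0 k t - vv k t"
definition u1 where "u1 k t = h1 k t - p (Suc k)"
definition S where "S k t = h0 k t * h1 k t - 2 * h1 k t * vv k t + (p (Suc k))\<^sup>2 * (t - \<theta> k)"

lemma derivs [derivative_intros]:
  "(vv k has_real_derivative p (Suc k)) (at t)"
  "(h0 k has_real_derivative h1 k t) (at t)"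
  "(h1 k has_real_derivative - h0 k t) (at t)"
  "(u0 k has_real_derivative u1 k t) (at t)"
  unfolding vv_def[abs_def] h0_def[abs_def] h1_def[abs_def] u0_def[abs_def] u1_def
  by (auto intro!: derivative_eq_intros)

lemma S_deriv: "(S k has_real_derivative (u1 k t)\<^sup>2 - (u0 k t)\<^sup>2 + (vv k t)\<^sup>2) (at t)"
  unfolding S_def[abs_def]
  by (auto intro!: derivative_eq_intros simp: u0_def u1_def power2_eq_square algebra_simps)

text \<open>The one-sided values of \<open>h0\<close> and \<open>h1\<close> at a node, before the jump.\<close>

definition N0 where "N0 k = - Im (W k * cis (- \<theta> k))"
definition N1 where "N1 k = Re (W k * cis (- \<theta> k))"

lemma node_values:
  assumes "k < n"
  shows "h0 k (\<theta> k) = N0 k" "h1 k (\<theta> k) = N1 k + \<mu> k" "h0 k (\<theta> (Suc k)) = N0 (Suc k)"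
    "h1 k (\<theta> (Suc k)) = N1 (Suc k)" "vv k (\<theta> k) = v k" "vv k (\<theta> (Suc k)) = v (Suc k)"
proof -
  have 1: "\<mu> k * cos (\<theta> k) * cos (\<theta> k) + \<mu> k * sin (\<theta> k) * sin (\<theta> k) = \<mu> k"
    using sin_cos_squared_add[of "\<theta> k"] by (metis distrib_left mult.assoc mult.right_neutral power2_eq_square add.commute)
  show "h0 k (\<theta> k) = N0 k" "h1 k (\<theta> k) = N1 k + \<mu> k"
    using 1 by (simp_all add: h0_def h1_def N0_def N1_def W_Suc[OF assms] algebra_simps)
  show "h0 k (\<theta> (Suc k)) = N0 (Suc k)" "h1 k (\<theta> (Suc k)) = N1 (Suc k)"
    by (simp_all add: h0_def h1_def N0_def N1_def algebra_simps)
  show "vv k (\<theta> k) = v k" "vv k (\<theta> (Suc k)) = v (Suc k)"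
    by (simp_all add: vv_def v_Suc[OF assms])
qed

lemma cross_step:
  assumes "k < n" shows "cross (W k) (W (Suc k)) = \<mu> k * N0 k"
  by (simp add: cross_altdef N0_def W_Suc[OF assms] algebra_simps)

lemma node_n: "N0 n = - N0 0" "N1 n = - N1 0"
proof -
  have "cis (- \<theta> n) = - cis (- \<theta> 0)"
    by (auto simp: theta_n complex_eq_iff sin_diff)
  thus "N0 n = - N0 0" "N1 n = - N1 0" by (simp_all add: N0_def N1_def W_n)
qed

text \<open>Summation by parts; the boundary term vanishes because \<open>p v\<close> is periodic.\<close>

lemma sum_p_sq: "(\<Sum>k<n. \<mu> k * v k) = - (\<Sum>k<n. (p (Suc k))\<^sup>2 * (\<theta> (Suc k) - \<theta> k))"
proof -
  have "(\<Sum>k<n. p (Suc k) * v (Suc k) - p k * v k) = 0"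
    by (subst sum_lessThan_telescope) (simp add: p_n v_n)
  moreover have "(\<Sum>k<n. p (Suc k) * v (Suc k) - p k * v k)
     = (\<Sum>k<n. \<mu> k * v k + (p (Suc k))\<^sup>2 * (\<theta> (Suc k) - \<theta> k))"
    by (rule sum.cong[OF refl]) (simp add: v_Suc p_Suc power2_eq_square algebra_simps)
  ultimately show ?thesis by (simp add: sum.distrib)
qed

lemma sum_S:
  "(\<Sum>k<n. S k (\<theta> (Suc k)) - S k (\<theta> k))
    = - (\<Sum>k<n. cross (W k) (W (Suc k))) - (\<Sum>k<n. (p (Suc k))\<^sup>2 * (\<theta> (Suc k) - \<theta> k))"
proof -
  define F where "F = (\<lambda>k. N0 k * N1 k - 2 * N1 k * v k)"
  have "(\<Sum>k<n. S k (\<theta> (Suc k)) - S k (\<theta> k))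
     = (\<Sum>k<n. (F (Suc k) - F k) + (- cross (W k) (W (Suc k))
          + (2 * (\<mu> k * v k) + (p (Suc k))\<^sup>2 * (\<theta> (Suc k) - \<theta> k))))"
    by (rule sum.cong[OF refl])
      (simp add: S_def node_values cross_step F_def algebra_simps)
  also have "\<dots> = (F n - F 0) + (- (\<Sum>k<n. cross (W k) (W (Suc k)))
      + (2 * (\<Sum>k<n. \<mu> k * v k) + (\<Sum>k<n. (p (Suc k))\<^sup>2 * (\<theta> (Suc k) - \<theta> k))))"
    using sum_lessThan_telescope[of F n] by (simp add: sum.distrib sum_subtractf sum_distrib_left)
  also have "F n = F 0" by (simp add: F_def node_n v_n)
  finally show ?thesis by (simp add: sum_p_sq)
qed

lemma theta_le: "i \<le> j \<Longrightarrow> j \<le> n \<Longrightarrow> \<theta> i \<le> \<theta> j"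
proof (induction j rule: dec_induct)
  case (step j) thus ?case using theta_mono[of j] by simp
qed simp

text \<open>The difference between \<open>W\<close> and the path that has the coordinates \<open>p\<close> and \<open>- v\<close> in the frame turned by \<open>t\<close>. It is
continuous through the nodes, it starts at \<open>0\<close>, its squared norm is \<open>u0\<^sup>2 + u1\<^sup>2\<close>, and its derivative is
\<open>- v cis t\<close>. Hence a bound for \<open>v\<close> gives a bound for \<open>u0\<close> and \<open>u1\<close>.\<close>

definition Y where "Y k t = W (Suc k) - Complex (p (Suc k)) (- vv k t) * cis t"
definition Yn where "Yn k = W k - Complex (p k) (- v k) * cis (\<theta> k)"

lemma Y_node:
  assumes "k < n" shows "Y k (\<theta> k) = Yn k" "Y k (\<theta> (Suc k)) = Yn (Suc k)"
  by (simp_all add: Y_def Yn_def node_values[OF assms] W_Suc[OF assms] p_Suc[OF assms] complex_eq_iff algebra_simps)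

lemma Yn_0: "Yn 0 = 0" by (simp add: Yn_def W_0)

lemma norm_Y: "(norm (Y k t))\<^sup>2 = (u0 k t)\<^sup>2 + (u1 k t)\<^sup>2"
proof -
  have "Y k t * cis (- t) = Complex (u1 k t) (- u0 k t)"
  proof -
    have "cis t * cis (- t) = 1" by (simp add: cis_mult)
    hence "Y k t * cis (- t) = W (Suc k) * cis (- t) - Complex (p (Suc k)) (- vv k t)"
      by (simp add: Y_def algebra_simps)
    also have "\<dots> = Complex (u1 k t) (- u0 k t)"
      by (simp add: complex_eq_iff u0_def u1_def h0_def h1_def algebra_simps)
    finally show ?thesis .
  qed
  hence "norm (Y k t) = norm (Complex (u1 k t) (- u0 k t))"
    by (metis norm_mult norm_cis mult.right_neutral)
  thus ?thesis by (simp add: complex_norm)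
qed

lemma u0_node:
  assumes "k < n" shows "u0 k (\<theta> k) = N0 k - v k" "u0 k (\<theta> (Suc k)) = N0 (Suc k) - v (Suc k)"
  using node_values[OF assms] by (auto simp: u0_def)

lemma node_0: "N0 0 = v 0" "N0 n = v n"
proof -
  have "W 0 * cis (- \<theta> 0) = Complex (p 0) (- v 0)" by (simp add: W_0 cis_mult mult.assoc)
  thus "N0 0 = v 0" by (simp add: N0_def)
  thus "N0 n = v n" by (simp add: node_n v_n)
qed

context
  fixes M :: real
  assumes v_bound: "\<And>k. k \<le> n \<Longrightarrow> \<bar>v k\<bar> \<le> M"
begin

lemma vv_bound:
  assumes "k < n" "\<theta> k \<le> t" "t \<le> \<theta> (Suc k)" shows "\<bar>vv k t\<bar> \<le> M"
proof (cases "\<theta> k = \<theta> (Suc k)")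
  case True
  thus ?thesis using assms v_bound[of k] by (simp add: vv_def)
next
  case False
  define s where "s = (t - \<theta> k) / (\<theta> (Suc k) - \<theta> k)"
  have d: "\<theta> (Suc k) - \<theta> k > 0" using False theta_mono[OF assms(1)] by simp
  have s: "0 \<le> s" "s \<le> 1" using assms d by (auto simp: s_def)
  have "t - \<theta> k = s * (\<theta> (Suc k) - \<theta> k)" using d by (simp add: s_def)
  hence "vv k t = v k + p (Suc k) * (s * (\<theta> (Suc k) - \<theta> k))" by (simp only: vv_def)
  also have "\<dots> = (1 - s) * v k + s * v (Suc k)"
    by (simp add: v_Suc[OF assms(1)] algebra_simps)
  also have "\<bar>\<dots>\<bar> \<le> (1 - s) * \<bar>v k\<bar> + s * \<bar>v (Suc k)\<bar>"
    using s by (intro order_trans[OF abs_triangle_ineq]) (simp add: abs_mult)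
  also have "\<dots> \<le> (1 - s) * M + s * M"
    using s v_bound[of k] v_bound[of "Suc k"] assms by (intro add_mono mult_left_mono) auto
  finally show ?thesis by (simp add: algebra_simps)
qed

lemma Y_deriv: "(Y k has_vector_derivative - of_real (vv k t) * cis t) (at t within A)"
proof -
  have "((\<lambda>t. W (Suc k) - Complex (p (Suc k)) (- vv k t) * cis t) has_vector_derivative
     (- (Complex 0 (- p (Suc k)) * cis t + Complex (p (Suc k)) (- vv k t) * (\<i> * cis t)))) (at t within A)"
  proof -
    have a: "((\<lambda>t. Complex (p (Suc k)) (- vv k t)) has_vector_derivative Complex 0 (- p (Suc k))) (at t within A)"
    proof -
      have "((\<lambda>t. of_real (p (Suc k)) - \<i> * of_real (vv k t)) has_vector_derivative (- \<i> * of_real (p (Suc k)))) (at t within A)"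
        using derivs(1)[of k t]
        by (auto intro!: derivative_eq_intros simp: has_real_derivative_iff_has_vector_derivative[symmetric] has_field_derivative_at_within)
      moreover have "(\<lambda>t. of_real (p (Suc k)) - \<i> * of_real (vv k t)) = (\<lambda>t. Complex (p (Suc k)) (- vv k t))"
        by (auto simp: complex_eq_iff)
      moreover have "(- \<i> * of_real (p (Suc k))) = Complex 0 (- p (Suc k))" by (simp add: complex_eq_iff)
      ultimately show ?thesis by simp
    qed
    have b: "(cis has_vector_derivative \<i> * cis t) (at t within A)"
      using has_derivative_cis[OF has_derivative_ident] by (simp add: has_vector_derivative_def)
    show ?thesis
      using has_vector_derivative_diff[OF has_vector_derivative_const has_vector_derivative_mult[OF a b]]
      by (simp add: algebra_simps)
  qed
  moreover have "(- (Complex 0 (- p (Suc k)) * cis t + Complex (p (Suc k)) (- vv k t) * (\<i> * cis t))) = - of_real (vv k t) * cis t"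
    by (simp add: complex_eq_iff algebra_simps)
  ultimately show ?thesis by (simp add: Y_def[abs_def])
qed

lemma Y_step:
  assumes "k < n" "\<theta> k \<le> t" "t \<le> \<theta> (Suc k)" shows "norm (Y k t - Yn k) \<le> M * (t - \<theta> k)"
proof -
  have "norm (Y k t - Y k (\<theta> k)) \<le> M * norm (t - \<theta> k)"
  proof (rule differentiable_bound[where S = "{\<theta> k..t}" and f' = "\<lambda>s h. h *\<^sub>R (- of_real (vv k s) * cis s)"])
    fix s assume s: "s \<in> {\<theta> k..t}"
    show "(Y k has_derivative (\<lambda>h. h *\<^sub>R (- of_real (vv k s) * cis s))) (at s within {\<theta> k..t})"
      using Y_deriv[of k s "{\<theta> k..t}"] by (simp add: has_vector_derivative_def)
    show "onorm (\<lambda>h. h *\<^sub>R (- of_real (vv k s) * cis s)) \<le> M"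
    proof (rule onorm_le)
      fix h :: real
      show "norm (h *\<^sub>R (- of_real (vv k s) * cis s)) \<le> M * norm h"
        using mult_right_mono[OF vv_bound[of k s] abs_ge_zero[of h]] s assms
        by (simp add: norm_mult mult.commute[of "\<bar>h\<bar>"])
    qed
  qed (use assms in auto)
  thus ?thesis using assms by (simp add: Y_node)
qed

lemma Yn_bound: "k \<le> n \<Longrightarrow> norm (Yn k) \<le> M * (\<theta> k - \<theta> 0)"
proof (induction k)
  case 0 show ?case by (simp add: Yn_0)
next
  case (Suc k)
  have "norm (Yn (Suc k)) \<le> norm (Yn k) + norm (Yn (Suc k) - Yn k)"
    by (metis add.commute diff_add_cancel norm_triangle_ineq)
  also have "norm (Yn (Suc k) - Yn k) \<le> M * (\<theta> (Suc k) - \<theta> k)"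
    using Y_step[of k "\<theta> (Suc k)"] Suc theta_mono[of k] by (simp add: Y_node)
  finally show ?case using Suc by (simp add: algebra_simps)
qed

lemma M_nonneg: "M \<ge> 0" using v_bound[of 0] by simp

lemma Y_bound:
  assumes "k < n" "\<theta> k \<le> t" "t \<le> \<theta> (Suc k)" shows "norm (Y k t) \<le> M * pi"
proof -
  have "norm (Y k t) \<le> norm (Yn k) + norm (Y k t - Yn k)"
    by (metis add.commute diff_add_cancel norm_triangle_ineq)
  also have "\<dots> \<le> M * (\<theta> k - \<theta> 0) + M * (t - \<theta> k)"
    using Yn_bound[of k] Y_step[OF assms] assms by simp
  also have "\<dots> = M * (t - \<theta> 0)" by (simp add: algebra_simps)
  also have "\<dots> \<le> M * pi"
    using theta_le[of "Suc k" n] assms M_nonneg by (intro mult_left_mono) (auto simp: theta_n)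
  finally show ?thesis .
qed

lemma u_bound:
  assumes "k < n" "\<theta> k \<le> t" "t \<le> \<theta> (Suc k)" shows "(u0 k t)\<^sup>2 + (u1 k t)\<^sup>2 \<le> M\<^sup>2 * pi\<^sup>2"
  using power_mono[OF Y_bound[OF assms], of 2] by (simp add: norm_Y power_mult_distrib)

lemma sum_S_le: "(\<Sum>k<n. S k (\<theta> (Suc k)) - S k (\<theta> k)) \<le> M\<^sup>2 * (pi\<^sup>2 + 1) * pi"
proof -
  have "S k (\<theta> (Suc k)) - S k (\<theta> k) \<le> M\<^sup>2 * (pi\<^sup>2 + 1) * (\<theta> (Suc k) - \<theta> k)" if k: "k < n" for k
  proof (cases "\<theta> k = \<theta> (Suc k)")
    case False
    hence lt: "\<theta> k < \<theta> (Suc k)" using theta_mono[OF k] by simp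
    obtain z where z: "\<theta> k < z" "z < \<theta> (Suc k)"
      "S k (\<theta> (Suc k)) - S k (\<theta> k) = (\<theta> (Suc k) - \<theta> k) * ((u1 k z)\<^sup>2 - (u0 k z)\<^sup>2 + (vv k z)\<^sup>2)"
      using MVT2[OF lt, of "S k" "\<lambda>z. (u1 k z)\<^sup>2 - (u0 k z)\<^sup>2 + (vv k z)\<^sup>2"] S_deriv by blast
    have "(u1 k z)\<^sup>2 - (u0 k z)\<^sup>2 + (vv k z)\<^sup>2 \<le> M\<^sup>2 * (pi\<^sup>2 + 1)"
    proof -
      have "(vv k z)\<^sup>2 \<le> M\<^sup>2" using vv_bound[OF k, of z] z by (intro abs_le_square_iff[THEN iffD1]) auto
      moreover have "(u0 k z)\<^sup>2 \<ge> 0" by simp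
      ultimately show ?thesis using u_bound[OF k, of z] z(1,2) by (simp only: distrib_left) linarith
    qed
    thus ?thesis using z lt by (simp add: mult.commute mult_right_mono)
  qed auto
  hence "(\<Sum>k<n. S k (\<theta> (Suc k)) - S k (\<theta> k)) \<le> (\<Sum>k<n. M\<^sup>2 * (pi\<^sup>2 + 1) * (\<theta> (Suc k) - \<theta> k))"
    by (intro sum_mono) auto
  also have "\<dots> = M\<^sup>2 * (pi\<^sup>2 + 1) * pi"
    by (simp add: sum_distrib_left[symmetric] sum_lessThan_telescope theta_n)
  finally show ?thesis .
qed

text \<open>Wirtinger's inequality through completion of the square. The function \<open>q = \<kappa> cot \<phi>\<close> satisfies \<open>q' = - \<kappa>\<^sup>2 - q\<^sup>2\<close>,
so \<open>u1\<^sup>2 - \<kappa>\<^sup>2 u0\<^sup>2\<close> is \<open>(u0\<^sup>2 q)'\<close> plus the square of \<open>u1 - u0 q\<close>. The factor \<open>\<kappa> < 1\<close> keeps the poles of the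
cotangent away from the ends of the interval; the price is the error term, which disappears for \<open>\<kappa> \<rightarrow> 1\<close>.\<close>

lemma sum_S_ge_aux:
  assumes kap: "0 < \<kappa>" "\<kappa> < 1"
  shows "(\<Sum>k<n. S k (\<theta> (Suc k)) - S k (\<theta> k)) \<ge> - ((1 - \<kappa>\<^sup>2) * (M\<^sup>2 * pi\<^sup>2) * pi)"
proof -
  define \<phi> where "\<phi> = (\<lambda>t. \<kappa> * (t - \<theta> 0) + (1 - \<kappa>) * pi / 2)"
  define q where "q = (\<lambda>t. \<kappa> * (cos (\<phi> t) / sin (\<phi> t)))"
  define C where "C = (1 - \<kappa>\<^sup>2) * (M\<^sup>2 * pi\<^sup>2)"
  have sinpos: "sin (\<phi> t) > 0" if "\<theta> 0 \<le> t" "t \<le> \<theta> n" for t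
  proof (rule sin_gt_zero)
    show "0 < \<phi> t" using that kap by (simp add: \<phi>_def add_nonneg_pos)
    have "\<kappa> * (t - \<theta> 0) \<le> \<kappa> * pi" using that kap by (intro mult_left_mono) (auto simp: theta_n)
    moreover have "(1 - \<kappa>) * pi / 2 < (1 - \<kappa>) * pi" using kap by simp
    ultimately show "\<phi> t < pi" unfolding \<phi>_def by (simp add: algebra_simps)
  qed
  have qder: "(q has_real_derivative - \<kappa>\<^sup>2 - (q t)\<^sup>2) (at t)" if t: "\<theta> 0 \<le> t" "t \<le> \<theta> n" for t
  proof -
    have s: "sin (\<phi> t) \<noteq> 0" using sinpos[OF t] by simp
    have "(\<phi> has_real_derivative \<kappa>) (at t)" unfolding \<phi>_def by (auto intro!: derivative_eq_intros)
    hence "(q has_real_derivative \<kappa> * ((- sin (\<phi> t) * \<kappa>) * sin (\<phi> t) - cos (\<phi> t) * (cos (\<phi> t) * \<kappa>)) / (sin (\<phi> t))\<^sup>2) (at t)"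
      unfolding q_def using s by (auto intro!: derivative_eq_intros simp: power2_eq_square field_simps)
    moreover have "\<kappa> * ((- sin (\<phi> t) * \<kappa>) * sin (\<phi> t) - cos (\<phi> t) * (cos (\<phi> t) * \<kappa>)) / (sin (\<phi> t))\<^sup>2
        = - \<kappa>\<^sup>2 - (q t)\<^sup>2"
      using s by (simp add: q_def power2_eq_square field_simps)
    ultimately show ?thesis by simp
  qed
  have step: "S k (\<theta> (Suc k)) - S k (\<theta> k) \<ge>
      ((u0 k (\<theta> (Suc k)))\<^sup>2 * q (\<theta> (Suc k)) - (u0 k (\<theta> k))\<^sup>2 * q (\<theta> k)) - C * (\<theta> (Suc k) - \<theta> k)"
    if k: "k < n" for k
  proof -
    let ?F = "\<lambda>t. S k t - (u0 k t)\<^sup>2 * q t + C * t"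
    have "?F (\<theta> k) \<le> ?F (\<theta> (Suc k))"
    proof (rule DERIV_nonneg_imp_nondecreasing[OF theta_mono[OF k]])
      fix t assume t: "\<theta> k \<le> t" "t \<le> \<theta> (Suc k)"
      have tt: "\<theta> 0 \<le> t" "t \<le> \<theta> n" using t theta_le[of 0 k] theta_le[of "Suc k" n] k by auto
      let ?d = "((u1 k t)\<^sup>2 - (u0 k t)\<^sup>2 + (vv k t)\<^sup>2) - (2 * u0 k t * u1 k t * q t + (u0 k t)\<^sup>2 * (- \<kappa>\<^sup>2 - (q t)\<^sup>2)) + C"
      have der: "(?F has_real_derivative ?d) (at t)"
        by (auto intro!: derivative_eq_intros S_deriv qder tt)
      have sq: "?d = (u1 k t - u0 k t * q t)\<^sup>2 + (vv k t)\<^sup>2 + (C - (1 - \<kappa>\<^sup>2) * (u0 k t)\<^sup>2)"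
        by (simp add: power2_eq_square algebra_simps)
      have "(1 - \<kappa>\<^sup>2) * (u0 k t)\<^sup>2 \<le> C"
        unfolding C_def
      proof (rule mult_left_mono)
        show "(u0 k t)\<^sup>2 \<le> M\<^sup>2 * pi\<^sup>2" using u_bound[OF k t] by (smt (verit) zero_le_power2)
        show "0 \<le> 1 - \<kappa>\<^sup>2" using kap by (simp add: power_le_one)
      qed
      hence "0 \<le> ?d" unfolding sq by simp
      with der show "\<exists>y. (?F has_real_derivative y) (at t) \<and> 0 \<le> y" by blast
    qed
    thus ?thesis by (simp add: algebra_simps)
  qed
  have "(\<Sum>k<n. S k (\<theta> (Suc k)) - S k (\<theta> k)) \<ge>
     (\<Sum>k<n. ((N0 (Suc k) - v (Suc k))\<^sup>2 * q (\<theta> (Suc k)) - (N0 k - v k)\<^sup>2 * q (\<theta> k)) - C * (\<theta> (Suc k) - \<theta> k))"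
    using step by (intro sum_mono) (simp add: u0_node)
  also have "(\<Sum>k<n. ((N0 (Suc k) - v (Suc k))\<^sup>2 * q (\<theta> (Suc k)) - (N0 k - v k)\<^sup>2 * q (\<theta> k)) - C * (\<theta> (Suc k) - \<theta> k))
     = ((N0 n - v n)\<^sup>2 * q (\<theta> n) - (N0 0 - v 0)\<^sup>2 * q (\<theta> 0)) - C * (\<theta> n - \<theta> 0)"
    unfolding sum_subtractf[of _ "\<lambda>k. C * (\<theta> (Suc k) - \<theta> k)"] sum_distrib_left[symmetric]
    by (simp only: sum_lessThan_telescope[of "\<lambda>k. (N0 k - v k)\<^sup>2 * q (\<theta> k)"] sum_lessThan_telescope)
  finally show ?thesis by (simp add: node_0 theta_n C_def)
qed

lemma sum_S_ge: "(\<Sum>k<n. S k (\<theta> (Suc k)) - S k (\<theta> k)) \<ge> 0"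
proof -
  have "((\<lambda>\<kappa>. - ((1 - \<kappa>\<^sup>2) * (M\<^sup>2 * pi\<^sup>2) * pi)) \<longlongrightarrow> - ((1 - 1\<^sup>2) * (M\<^sup>2 * pi\<^sup>2) * pi)) (at_left 1)"
    by (intro tendsto_intros)
  hence "((\<lambda>\<kappa>. - ((1 - \<kappa>\<^sup>2) * (M\<^sup>2 * pi\<^sup>2) * pi)) \<longlongrightarrow> 0) (at_left (1::real))" by simp
  moreover have "eventually (\<lambda>\<kappa>. \<kappa> \<in> {0<..<1}) (at_left (1::real))"
    by (rule eventually_at_left_real) simp
  hence "eventually (\<lambda>\<kappa>. - ((1 - \<kappa>\<^sup>2) * (M\<^sup>2 * pi\<^sup>2) * pi) \<le> (\<Sum>k<n. S k (\<theta> (Suc k)) - S k (\<theta> k))) (at_left (1::real))"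
    by eventually_elim (use sum_S_ge_aux in auto)
  ultimately show ?thesis by (rule tendsto_upperbound) simp
qed

end

theorem odd_area_upper:
  "(\<Sum>k<n. cross (W k) (W (Suc k))) \<le> - (\<Sum>k<n. (p (Suc k))\<^sup>2 * (\<theta> (Suc k) - \<theta> k))"
proof -
  have "(\<Sum>k<n. S k (\<theta> (Suc k)) - S k (\<theta> k)) \<ge> 0"
  proof (rule sum_S_ge)
    fix k assume "k \<le> n"
    thus "\<bar>v k\<bar> \<le> (\<Sum>k\<le>n. \<bar>v k\<bar>)" by (intro member_le_sum) auto
  qed
  thus ?thesis by (simp add: sum_S)
qed

theorem odd_area_lower:
  assumes "\<And>k. k \<le> n \<Longrightarrow> \<bar>v k\<bar> \<le> M"
  shows "(\<Sum>k<n. cross (W k) (W (Suc k)))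
    \<ge> - (\<Sum>k<n. (p (Suc k))\<^sup>2 * (\<theta> (Suc k) - \<theta> k)) - M\<^sup>2 * (pi\<^sup>2 + 1) * pi"
  using sum_S_le[OF assms] by (simp add: sum_S)

end

section \<open>The area of a caliper\<close>

text \<open>The derivative is \<open>(c - 1/2)\<^sup>2 (c + 1)\<close> with \<open>c = r cos s\<close>.\<close>

lemma mono_deficit:
  fixes r :: real assumes "0 \<le> r" "r \<le> 1/2" "s \<le> t"
  shows "s / 4 - r * sin s / 2 - (1/4 - r\<^sup>2) * (r * sin s) - (r * sin s) ^ 3 / 3
      \<le> t / 4 - r * sin t / 2 - (1/4 - r\<^sup>2) * (r * sin t) - (r * sin t) ^ 3 / 3"
proof (rule DERIV_nonneg_imp_nondecreasing[OF assms(3)])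
  fix z :: real
  define c where "c = r * cos z"
  have "((\<lambda>s. s / 4 - r * sin s / 2 - (1/4 - r\<^sup>2) * (r * sin s) - (r * sin s) ^ 3 / 3) has_real_derivative
     1/4 - r * cos z / 2 - (1/4 - r\<^sup>2) * (r * cos z) - (r * sin z)\<^sup>2 * (r * cos z)) (at z)"
    by (auto intro!: derivative_eq_intros simp: power2_eq_square)
  moreover have "(r * sin z)\<^sup>2 + c\<^sup>2 = r\<^sup>2"
    by (simp add: c_def power_mult_distrib distrib_left[symmetric])
  hence "(r * sin z)\<^sup>2 = r\<^sup>2 - c\<^sup>2" by simp
  hence "1/4 - r * cos z / 2 - (1/4 - r\<^sup>2) * (r * cos z) - (r * sin z)\<^sup>2 * (r * cos z)
      = 1/4 - c / 2 - (1/4 - r\<^sup>2) * c - (r\<^sup>2 - c\<^sup>2) * c" by (simp only: c_def)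
  hence "1/4 - r * cos z / 2 - (1/4 - r\<^sup>2) * (r * cos z) - (r * sin z)\<^sup>2 * (r * cos z) = (c - 1/2)\<^sup>2 * (c + 1)"
    by (simp add: power2_eq_square field_simps)
  moreover have "c + 1 \<ge> 0"
  proof -
    have "\<bar>c\<bar> \<le> 1/2 * 1" unfolding c_def abs_mult using assms by (intro mult_mono) auto
    thus ?thesis by simp
  qed
  ultimately show "\<exists>y. ((\<lambda>s. s / 4 - r * sin s / 2 - (1/4 - r\<^sup>2) * (r * sin s) - (r * sin s) ^ 3 / 3) has_real_derivative y) (at z) \<and> 0 \<le> y"
    by auto
qed

text \<open>At a vertex at distance \<open>r\<close> from the origin the adjacent sides make angles \<open>s\<close> and \<open>t\<close> with the
perpendicular to the radius, \<open>s + t\<close> is the exterior angle, and \<open>A\<close>, \<open>B\<close> are the portions of the sides at this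
vertex. Compare \<open>mono_deficit\<close> at \<open>- t\<close> and \<open>s\<close>.\<close>

lemma vertex_deficit:
  fixes r s t :: real assumes "0 \<le> r" "r \<le> 1/2" "s + t \<ge> 0"
  defines "A \<equiv> r * sin s" and "B \<equiv> r * sin t"
  shows "(s + t) / 4 \<ge> (A + B) / 2 + (1/4 - r\<^sup>2) * (A + B) + (A ^ 3 + B ^ 3) / 3"
  using mono_deficit[of r "-t" s] assms by (simp add: A_def B_def algebra_simps add_divide_distrib)

lemma vertex_deficit2:
  fixes r s t :: real assumes "0 \<le> r" "r \<le> 1/2" "s + t \<ge> 0"
  shows "s + t \<ge> 2 * (r * sin s + r * sin t)"
proof -
  have "- t - 2 * r * sin (- t) \<le> s - 2 * r * sin s"
  proof (rule DERIV_nonneg_imp_nondecreasing[where f = "\<lambda>s. s - 2 * r * sin s"])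
    show "- t \<le> s" using assms by simp
    fix z :: real
    have "((\<lambda>s. s - 2 * r * sin s) has_real_derivative 1 - 2 * r * cos z) (at z)"
      by (auto intro!: derivative_eq_intros)
    moreover have "2 * r * cos z \<le> 1 * 1"
      using assms mult_left_mono[OF cos_le_one[of z], of "2 * r"] by simp
    ultimately show "\<exists>y. ((\<lambda>s. s - 2 * r * sin s) has_real_derivative y) (at z) \<and> 0 \<le> y" by auto
  qed
  thus ?thesis by (simp add: algebra_simps)
qed

lemma cross_cis: "cross (cis a) (cis b) = sin (b - a)"
  by (simp add: cross_altdef sin_diff algebra_simps)

lemma cross_sum_left: "cross (sum f A) b = (\<Sum>i\<in>A. cross (f i) b)"
  by (simp add: cross_def cnj_sum sum_distrib_right Im_sum)

text \<open>The motion of \<open>V\<close> (half the difference) and \<open>W\<close> (half the sum) of a pair of antipodal contact points, extended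
beyond the half turn by the symmetry that exchanges the two points.\<close>

locale caliper =
  fixes n :: nat and \<theta> m \<epsilon> :: "nat \<Rightarrow> real" and V W :: "nat \<Rightarrow> complex"
  assumes n_pos: "n > 0"
    and theta_per: "\<theta> (k + n) = \<theta> k + pi" and m_per: "m (k + n) = m k" and m_pos: "m k > 0"
    and eps_per: "\<epsilon> (k + n) = - \<epsilon> k" and eps: "\<epsilon> k = 1 \<or> \<epsilon> k = -1"
    and theta_mono: "\<theta> k \<le> \<theta> (Suc k)" and theta_gap: "\<theta> (Suc k) < \<theta> k + pi"
    and V_Suc: "V (Suc k) = V k + of_real (m k) * cis (\<theta> k)" and V_per: "V (k + n) = - V k"
    and W_Suc: "W (Suc k) = W k + of_real (\<epsilon> k * m k) * cis (\<theta> k)" and W_per: "W (k + n) = W k"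
begin

text \<open>The constants make the slope \<open>p\<close> and its primitive \<open>v\<close> antiperiodic, and \<open>shift\<close> is the translation
that a \<open>jump_path\<close> starts with.\<close>

definition p where "p k = (\<Sum>j<k. \<epsilon> j * m j) - (\<Sum>j<n. \<epsilon> j * m j) / 2"

lemma p_Suc: "p (Suc k) = p k + \<epsilon> k * m k" by (simp add: p_def)

lemma p_per: "p (k + n) = - p k"
proof (induction k)
  case 0 show ?case by (simp add: p_def)
next
  case (Suc k) thus ?case using p_Suc[of "k + n"] p_Suc[of k] by (simp add: eps_per m_per)
qed

definition v where "v k = (\<Sum>j<k. p (Suc j) * (\<theta> (Suc j) - \<theta> j)) - (\<Sum>j<n. p (Suc j) * (\<theta> (Suc j) - \<theta> j)) / 2"

definition shift where "shift = Complex (p 0) (- v 0) * cis (\<theta> 0) - W 0"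

lemma jump: "jump_path n \<theta> (\<lambda>k. \<epsilon> k * m k) p v (\<lambda>k. W k + shift)"
proof
  fix k
  show "\<theta> k \<le> \<theta> (Suc k)" by (rule theta_mono)
  show "\<theta> n = \<theta> 0 + pi" using theta_per[of 0] by simp
  show "W (Suc k) + shift = W k + shift + of_real (\<epsilon> k * m k) * cis (\<theta> k)" by (simp add: W_Suc)
  show "W n + shift = W 0 + shift" using W_per[of 0] by simp
  show "p (Suc k) = p k + \<epsilon> k * m k" by (rule p_Suc)
  show "p n = - p 0" using p_per[of 0] by simp
  show "v (Suc k) = v k + p (Suc k) * (\<theta> (Suc k) - \<theta> k)" by (simp add: v_def)
  show "v n = - v 0" by (simp add: v_def)
  show "W 0 + shift = Complex (p 0) (- v 0) * cis (\<theta> 0)" by (simp add: shift_def)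
qed

definition odd_area where "odd_area = (\<Sum>k<n. cross (W k) (W (Suc k)))"
definition even_area where "even_area = (\<Sum>k<n. cross (V k) (V (Suc k)))"
definition slope_energy where "slope_energy = (\<Sum>k<n. (p (Suc k))\<^sup>2 * (\<theta> (Suc k) - \<theta> k))"

lemma odd_area_shift: "odd_area = (\<Sum>k<n. cross (W k + c) (W (Suc k) + c))"
proof -
  have "(\<Sum>k<n. cross (W k + c) (W (Suc k) + c)) = (\<Sum>k<n. cross (W k) (W (Suc k)) + (cross c (W (Suc k)) - cross c (W k)))"
    by (rule sum.cong[OF refl]) (simp add: cross_altdef algebra_simps)
  also have "\<dots> = odd_area + (cross c (W n) - cross c (W 0))"
    using sum_lessThan_telescope[of "\<lambda>k. cross c (W k)" n] by (simp add: sum.distrib odd_area_def)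
  finally show ?thesis using W_per[of 0] by simp
qed

lemma odd_area_le: "odd_area \<le> - slope_energy"
  unfolding odd_area_shift[of shift] slope_energy_def by (rule jump_path.odd_area_upper[OF jump])

lemma odd_area_ge:
  assumes "\<And>k. k \<le> n \<Longrightarrow> \<bar>v k\<bar> \<le> M"
  shows "odd_area \<ge> - slope_energy - M\<^sup>2 * (pi\<^sup>2 + 1) * pi"
  unfolding odd_area_shift[of shift] slope_energy_def by (rule jump_path.odd_area_lower[OF jump assms])

text \<open>The line that contains side \<open>k\<close> of the path \<open>V\<close> has distance \<open>e k\<close> from the origin, and the foot of the perpendicular
divides the side into \<open>B k\<close> and \<open>A k\<close>.\<close>

definition e where "e k = cross (V k) (cis (\<theta> k))"
definition A where "A k = Re (cnj (V (Suc k)) * cis (\<theta> k))"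
definition B where "B k = - Re (cnj (V k) * cis (\<theta> k))"
definition g where "g k = 1/4 - (norm (V k))\<^sup>2"

lemma sc: "cos t * cos t + sin t * sin t = (1::real)"
  using sin_cos_squared_add[of t] by (simp add: power2_eq_square add.commute)

lemma e_alt: "cross (V (Suc k)) (cis (\<theta> k)) = e k"
  by (simp add: e_def V_Suc cross_altdef algebra_simps)

lemma A_B: "A k + B k = m k"
proof -
  have "A k + B k = m k * (cos (\<theta> k) * cos (\<theta> k)) + m k * (sin (\<theta> k) * sin (\<theta> k))"
    unfolding A_def B_def V_Suc by (simp add: algebra_simps)
  also have "\<dots> = m k * (cos (\<theta> k) * cos (\<theta> k) + sin (\<theta> k) * sin (\<theta> k))"
    by (simp only: distrib_left)
  finally show ?thesis by (simp only: sc mult_1_right)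
qed

lemma norm_split: "(Re (cnj z * cis t))\<^sup>2 + (cross z (cis t))\<^sup>2 = (norm z)\<^sup>2"
  using norm_mult[of "cnj z" "cis t"] by (simp only: cross_def cmod_power2[symmetric] complex_mod_cnj norm_cis mult_1_right)

lemma e_A: "(e k)\<^sup>2 + (A k)\<^sup>2 = (norm (V (Suc k)))\<^sup>2"
  using norm_split[of "V (Suc k)" "\<theta> k"] by (simp add: A_def e_alt add.commute)

lemma e_B: "(e k)\<^sup>2 + (B k)\<^sup>2 = (norm (V k))\<^sup>2"
  using norm_split[of "V k" "\<theta> k"] by (simp only: B_def e_def power2_minus add.commute)

lemma theta_le: "i \<le> j \<Longrightarrow> \<theta> i \<le> \<theta> j"
  using theta_mono by (rule lift_Suc_mono_le)

lemma V_sum: "V (k + j) = V k + (\<Sum>i<j. of_real (m (k + i)) * cis (\<theta> (k + i)))"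
  by (induction j) (simp_all add: V_Suc)

text \<open>By antiperiodicity \<open>V k\<close> is minus half the sum of the next \<open>n\<close> steps, all of which point to the left of \<open>cis (\<theta> k)\<close>,
and not all of them in its direction.\<close>

lemma e_pos: "e k > 0"
proof -
  have V: "V k = - (\<Sum>i<n. of_real (m (k + i)) * cis (\<theta> (k + i))) / 2"
  proof -
    define S where "S = (\<Sum>i<n. of_real (m (k + i)) * cis (\<theta> (k + i)))"
    have "- V k = V k + S" using V_sum[of k n] V_per[of k] unfolding S_def by metis
    hence "V k = - S / 2" by (simp add: field_simps eq_neg_iff_add_eq_0 neg_eq_iff_add_eq_0)
    thus ?thesis by (simp only: S_def)
  qed
  have "e k = (\<Sum>i<n. m (k + i) * sin (\<theta> (k + i) - \<theta> k)) / 2"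
  proof -
    have "e k = - (\<Sum>i<n. cross (of_real (m (k + i)) * cis (\<theta> (k + i))) (cis (\<theta> k))) / 2"
      unfolding e_def V by (simp add: cross_sum_left[symmetric]) (simp add: cross_def)
    also have "(\<Sum>i<n. cross (of_real (m (k + i)) * cis (\<theta> (k + i))) (cis (\<theta> k))) = (\<Sum>i<n. - (m (k + i) * sin (\<theta> (k + i) - \<theta> k)))"
      by (rule sum.cong[OF refl]) (simp add: cross_altdef sin_diff algebra_simps)
    finally show ?thesis by (simp add: sum_negf)
  qed
  moreover have "(\<Sum>i<n. m (k + i) * sin (\<theta> (k + i) - \<theta> k)) > 0"
  proof -
    \<comment> \<open>The first step in a new direction: it turns by less than \<open>\<pi>\<close>, so its term is positive.\<close>
    define j where "j = (LEAST j. \<theta> (k + j) > \<theta> k)"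
    have "\<theta> (k + n) > \<theta> k" by (simp add: theta_per)
    hence j: "\<theta> (k + j) > \<theta> k" "j \<le> n" unfolding j_def by (auto intro: LeastI Least_le)
    have "j \<noteq> 0" using j(1) by (cases j) auto
    then obtain i where i: "j = Suc i" by (cases j) auto
    have "\<not> \<theta> (k + i) > \<theta> k" using i not_less_Least[of i "\<lambda>j. \<theta> (k + j) > \<theta> k"] unfolding j_def by simp
    hence "\<theta> (k + i) = \<theta> k" using theta_le[of k "k + i"] by simp
    hence lt: "\<theta> (k + j) < \<theta> k + pi" using theta_gap[of "k + i"] i by simp
    have jn: "j < n" using j(2) lt theta_per[of k] by (cases "j = n") auto
    show ?thesis
    proof (rule sum_pos2[where i=j])
      show "0 < m (k + j) * sin (\<theta> (k + j) - \<theta> k)"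
        using lt j m_pos by (intro mult_pos_pos sin_gt_zero) auto
      fix i assume i: "i \<in> {..<n}"
      hence "\<theta> (k + i) \<le> \<theta> (k + n)" by (intro theta_le) auto
      thus "0 \<le> m (k + i) * sin (\<theta> (k + i) - \<theta> k)"
        using theta_le[of k "k + i"] m_pos[of "k + i"] theta_per[of k]
        by (intro mult_nonneg_nonneg sin_ge_zero) auto
    qed (use jn in auto)
  qed
  ultimately show ?thesis by simp
qed

text \<open>Polar coordinates of both adjacent sides relative to the vertex. The two angles add up to \<open>\<theta>\<^sub>k\<^sub>+\<^sub>1 - \<theta>\<^sub>k\<close> modulo \<open>2 \<pi>\<close>,
and by the size of the three angles no multiple of \<open>2 \<pi>\<close> occurs.\<close>

lemma vertex_angles:
  obtains s t r where "r > 0" "r = norm (V (Suc k))" "A k = r * sin s" "B (Suc k) = r * sin t"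
    "\<theta> (Suc k) - \<theta> k = s + t" "\<bar>s\<bar> \<le> pi/2" "\<bar>t\<bar> \<le> pi/2"
proof -
  define r where "r = norm (V (Suc k))"
  have "(e k)\<^sup>2 > 0" using e_pos[of k] by simp
  hence "r\<^sup>2 > 0" using e_A[of k] zero_le_power2[of "A k"] unfolding r_def by linarith
  hence r: "r > 0" by (simp add: r_def)
  have pol: "\<exists>s. a = r * sin s \<and> b = r * cos s \<and> \<bar>s\<bar> < pi/2" if ab: "b\<^sup>2 + a\<^sup>2 = r\<^sup>2" "b > 0" for a b
  proof -
    have "b\<^sup>2 > 0" using ab(2) by simp
    hence "\<bar>a\<bar>\<^sup>2 < r\<^sup>2" using ab(1) unfolding power2_abs by linarith
    hence ar: "\<bar>a\<bar> < r" by (rule power2_less_imp_less) (use r in simp)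
    hence q: "-1 < a / r" "a / r < 1" using r by (auto simp: field_simps abs_less_iff)
    define s where "s = arcsin (a / r)"
    have "cos s = sqrt (1 - (a / r)\<^sup>2)" unfolding s_def using q by (intro cos_arcsin) auto
    also have "1 - (a / r)\<^sup>2 = (b / r)\<^sup>2" using ab(1) r by (simp add: field_simps power2_eq_square)
    finally have "cos s = b / r" using ab(2) r by simp
    moreover have "sin s = a / r" unfolding s_def using q by simp
    moreover have "\<bar>s\<bar> < pi/2" unfolding s_def abs_less_iff using arcsin_lt_bounded[OF q] by auto
    ultimately show ?thesis using r by (intro exI[of _ s]) auto
  qed
  obtain s where s: "A k = r * sin s" "e k = r * cos s" "\<bar>s\<bar> < pi/2"
    using pol[of "e k" "A k"] e_A[of k] e_pos[of k] by (auto simp: r_def)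
  obtain t where t: "B (Suc k) = r * sin t" "e (Suc k) = r * cos t" "\<bar>t\<bar> < pi/2"
    using pol[of "e (Suc k)" "B (Suc k)"] e_B[of "Suc k"] e_pos[of "Suc k"] by (auto simp: r_def)
  have 1: "cnj (V (Suc k)) * cis (\<theta> k) = of_real r * \<i> * cis (- s)"
    using s e_alt[of k] by (simp add: complex_eq_iff A_def cross_def)
  have 2: "cnj (V (Suc k)) * cis (\<theta> (Suc k)) = of_real r * \<i> * cis t"
    using t by (simp add: complex_eq_iff B_def cross_def e_def)
  define L where "L = \<theta> (Suc k) - \<theta> k"
  have "cis (\<theta> (Suc k)) = cis (\<theta> k) * cis L" by (simp add: cis_mult L_def)
  hence "of_real r * \<i> * cis t = of_real r * \<i> * cis (- s) * cis L"
    using 1 2 by (metis mult.assoc)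
  hence "cis t = cis (- s) * cis L" using r by simp
  hence "cis (L - s - t) = 1"
    by (simp add: cis_mult cis_divide[symmetric] diff_diff_eq[symmetric])
  hence "cos (L - s - t) = 1" by (metis cis.sel(1) one_complex.sel(1))
  then obtain j :: int where j: "L - s - t = of_int j * 2 * pi" using cos_one_2pi_int by blast
  have "0 \<le> L" "L < pi" using theta_mono[of k] theta_gap[of k] by (auto simp: L_def)
  hence "-pi < of_int j * 2 * pi" "of_int j * 2 * pi < 2 * pi" using s t j by linarith+
  hence "(of_int j * 2 + 1) * pi > 0" "(1 - of_int j) * pi > 0" by (simp_all add: algebra_simps)
  hence "of_int j * 2 + (1::real) > 0" "1 - of_int j > (0::real)" by (simp_all only: zero_less_mult_pos2 pi_gt_zero)
  hence "j = 0" by linarith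
  hence "L = s + t" using j by simp
  thus ?thesis using that[of r s t] r s t by (simp add: r_def L_def)
qed

lemma per_shifts: "A (k + n) = A k" "B (k + n) = B k" "g (k + n) = g k" "e (k + n) = e k"
proof -
  have c: "cis (\<theta> (k + n)) = - cis (\<theta> k)" by (simp add: theta_per complex_eq_iff)
  have V': "V (Suc (k + n)) = - V (Suc k)" using V_per[of "Suc k"] by simp
  show "A (k + n) = A k" "B (k + n) = B k" "g (k + n) = g k" "e (k + n) = e k"
    by (simp_all add: A_def B_def g_def e_def c V' V_per cross_def)
qed

lemma link: "g k + (B k)\<^sup>2 = g (Suc k) + (A k)\<^sup>2"
  using e_A[of k] e_B[of k] by (simp add: g_def)

lemma cross_V: "cross (V k) (V (Suc k)) = m k * e k"
  by (simp add: V_Suc e_def cross_altdef algebra_simps)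

context
  assumes small: "\<And>k. norm (V k) \<le> 1/2"
begin

lemma g_nonneg: "g k \<ge> 0"
  using power_mono[OF small[of k], of 2] by (simp add: g_def power2_eq_square)

lemma vertex_facts:
  shows "A k + B (Suc k) \<ge> 0"
    and "\<theta> (Suc k) - \<theta> k \<ge> 2 * (A k + B (Suc k))"
    and "(\<theta> (Suc k) - \<theta> k) / 4 \<ge> (A k + B (Suc k)) / 2 + g (Suc k) * (A k + B (Suc k)) + (A k ^ 3 + B (Suc k) ^ 3) / 3"
proof -
  obtain s t r where st: "r > 0" "r = norm (V (Suc k))" "A k = r * sin s" "B (Suc k) = r * sin t"
    "\<theta> (Suc k) - \<theta> k = s + t" "\<bar>s\<bar> \<le> pi/2" "\<bar>t\<bar> \<le> pi/2" by (rule vertex_angles)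
  have st0: "s + t \<ge> 0" using st(5) theta_mono[of k] by simp
  have r: "0 \<le> r" "r \<le> 1/2" using st(1,2) small[of "Suc k"] by auto
  have "sin (- t) \<le> sin s" by (rule sin_monotone_2pi_le) (use st st0 in auto)
  hence "r * (sin s + sin t) \<ge> 0" using r by simp
  thus "A k + B (Suc k) \<ge> 0" by (simp add: st distrib_left)
  show "\<theta> (Suc k) - \<theta> k \<ge> 2 * (A k + B (Suc k))"
    unfolding st(3-5) by (rule vertex_deficit2[OF r st0])
  show "(\<theta> (Suc k) - \<theta> k) / 4 \<ge> (A k + B (Suc k)) / 2 + g (Suc k) * (A k + B (Suc k)) + (A k ^ 3 + B (Suc k) ^ 3) / 3"
    unfolding st(3-5) g_def st(2)[symmetric] by (rule vertex_deficit[OF r st0])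
qed

lemma zigzag_scaled:
  assumes "\<nu> > 0"
  shows "zigzag n (\<lambda>k. p k / \<nu>) (\<lambda>k. g k / \<nu>\<^sup>2) (\<lambda>k. A k / \<nu>) (\<lambda>k. B k / \<nu>)"
proof
  fix k
  have AB: "A k / \<nu> + B k / \<nu> = m k / \<nu>" by (simp add: add_divide_distrib[symmetric] A_B)
  have "\<bar>p (Suc k) / \<nu> - p k / \<nu>\<bar> = \<bar>\<epsilon> k * m k\<bar> / \<nu>" using assms by (simp add: p_Suc diff_divide_distrib[symmetric])
  also have "\<bar>\<epsilon> k * m k\<bar> = m k" using eps[of k] m_pos[of k] by auto
  finally show "A k / \<nu> + B k / \<nu> = \<bar>p (Suc k) / \<nu> - p k / \<nu>\<bar>" using AB by simp
  show "A k / \<nu> + B k / \<nu> > 0" unfolding AB using m_pos[of k] assms by simp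
  show "g k / \<nu>\<^sup>2 + (B k / \<nu>)\<^sup>2 = g (Suc k) / \<nu>\<^sup>2 + (A k / \<nu>)\<^sup>2"
    using link[of k] by (simp add: power_divide add_divide_distrib[symmetric])
  show "A k / \<nu> + B (Suc k) / \<nu> \<ge> 0"
    using vertex_facts(1)[of k] assms by (simp add: add_divide_distrib[symmetric])
qed (use n_pos g_nonneg assms in \<open>simp_all add: p_per per_shifts\<close>)

lemma e_le: "e k \<le> 1/2 - (1/4 - (e k)\<^sup>2)"
proof -
  have "0 \<le> (e k - 1/2)\<^sup>2" by simp
  thus ?thesis by (simp add: power2_eq_square algebra_simps)
qed

definition raw_cost where
  "raw_cost = (\<Sum>k<n. 2/3 * (A k ^ 3 + B k ^ 3) + (g (Suc k) + (p (Suc k))\<^sup>2) * A k + (g k + (p k)\<^sup>2) * B k)"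

lemma cost_scaled:
  assumes "\<nu> > 0"
  shows "\<nu> ^ 3 * zigzag.cost n (\<lambda>k. p k / \<nu>) (\<lambda>k. g k / \<nu>\<^sup>2) (\<lambda>k. A k / \<nu>) (\<lambda>k. B k / \<nu>)
    = 20/3 * n * \<nu> ^ 3 - 5 * \<nu>\<^sup>2 * (\<Sum>k<n. m k) + raw_cost"
proof -
  have "\<nu> ^ 3 * zigzag.cost n (\<lambda>k. p k / \<nu>) (\<lambda>k. g k / \<nu>\<^sup>2) (\<lambda>k. A k / \<nu>) (\<lambda>k. B k / \<nu>)
    = (\<Sum>k<n. 20/3 * \<nu> ^ 3 - 5 * \<nu>\<^sup>2 * m k +
        (2/3 * (A k ^ 3 + B k ^ 3) + (g (Suc k) + (p (Suc k))\<^sup>2) * A k + (g k + (p k)\<^sup>2) * B k))"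
    unfolding zigzag.cost_def[OF zigzag_scaled[OF assms]] zigzag.atom_def[OF zigzag_scaled[OF assms]] sum_distrib_left
  proof (rule sum.cong[OF refl])
    fix k
    show "\<nu> ^ 3 * (20 / 3 - 5 * (A k / \<nu> + B k / \<nu>) + 2 / 3 * ((A k / \<nu>) ^ 3 + (B k / \<nu>) ^ 3) +
           (g (Suc k) / \<nu>\<^sup>2 + (p (Suc k) / \<nu>)\<^sup>2) * (A k / \<nu>) + (g k / \<nu>\<^sup>2 + (p k / \<nu>)\<^sup>2) * (B k / \<nu>))
     = 20/3 * \<nu> ^ 3 - 5 * \<nu>\<^sup>2 * m k +
        (2/3 * (A k ^ 3 + B k ^ 3) + (g (Suc k) + (p (Suc k))\<^sup>2) * A k + (g k + (p k)\<^sup>2) * B k)"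
      unfolding A_B[symmetric] using assms
      by (simp add: field_simps power2_eq_square power3_eq_cube)
  qed
  thus ?thesis by (simp add: sum.distrib sum_subtractf sum_distrib_left raw_cost_def)
qed

text \<open>The losses at the vertices (\<open>vertex_facts\<close>), along the sides (\<open>e_le\<close>) and in the odd area (\<open>odd_area_le\<close>) add
up to at least twice the \<open>raw_cost\<close>. In the cost of the chain the sum of the lengths
appears in place of \<open>\<pi>/2\<close>; replacing one by the other changes the bound by \<open>5 \<nu>\<^sup>2 D\<close>, which is absorbed by the
factor \<open>1 + 20 \<nu>\<^sup>2\<close>.\<close>

theorem area_deficit:
  assumes "\<nu> > 0"
  shows "(pi / 4 - (even_area + odd_area)) * (1 + 20 * \<nu>\<^sup>2) \<ge>
    2 * \<nu> ^ 3 * zigzag.cost n (\<lambda>k. p k / \<nu>) (\<lambda>k. g k / \<nu>\<^sup>2) (\<lambda>k. A k / \<nu>) (\<lambda>k. B k / \<nu>)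
      - 40/3 * n * \<nu> ^ 3 + 5 * \<nu>\<^sup>2 * pi"
proof -
  define D where "D = pi - 2 * (\<Sum>k<n. m k)"
  define \<Gamma> where "\<Gamma> = (\<lambda>k. 1/4 - (e k)\<^sup>2)"
  have G1: "\<Gamma> k = g k + (B k)\<^sup>2" "\<Gamma> k = g (Suc k) + (A k)\<^sup>2" for k
    using e_A[of k] e_B[of k] by (auto simp: \<Gamma>_def g_def)
  have G0: "\<Gamma> k \<ge> 0" for k using G1(1)[of k] g_nonneg[of k] by simp
  have shiftB: "(\<Sum>k<n. f (B (Suc k)) (Suc k)) = (\<Sum>k<n. f (B k) k)" if "\<And>k. f (B (k + n)) (k + n) = f (B k) k"
    for f :: "real \<Rightarrow> nat \<Rightarrow> real"
    using sum_periodic_shift[of "\<lambda>k. f (B k) k" n 1] that by simp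
  have sumL: "(\<Sum>k<n. \<theta> (Suc k) - \<theta> k) = pi"
    using sum_lessThan_telescope[of \<theta> n] theta_per[of 0] by simp
  have sB: "(\<Sum>k<n. B (Suc k)) = (\<Sum>k<n. B k)"
    using shiftB[of "\<lambda>b k. b"] by (simp add: per_shifts)
  have sum_m: "(\<Sum>k<n. A k + B (Suc k)) = (\<Sum>k<n. m k)"
    by (simp add: sum.distrib sB A_B[symmetric])
  define Dl where "Dl = (\<Sum>k<n. g (Suc k) * (A k + B (Suc k)) + (A k ^ 3 + B (Suc k) ^ 3) / 3)"
  define R where "R = (\<Sum>k<n. \<Gamma> k * m k) + (\<Sum>k<n. 2 * (p (Suc k))\<^sup>2 * (A k + B (Suc k)))"
  have "(\<Sum>k<n. (\<theta> (Suc k) - \<theta> k) / 4) \<ge> (\<Sum>k<n. (A k + B (Suc k)) / 2 + (g (Suc k) * (A k + B (Suc k)) + (A k ^ 3 + B (Suc k) ^ 3) / 3))"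
    using vertex_facts(3) by (intro sum_mono) (simp add: add.assoc)
  hence "pi / 4 \<ge> (\<Sum>k<n. m k) / 2 + Dl"
    by (simp only: sum.distrib[of "\<lambda>k. (A k + B (Suc k)) / 2"] sum_divide_distrib[symmetric] sumL sum_m Dl_def)
  hence DDl: "D / 4 \<ge> Dl" by (simp add: D_def field_simps)
  have "\<Gamma> k * m k \<ge> 0" for k using G0[of k] m_pos[of k] by simp
  moreover have "2 * (p (Suc k))\<^sup>2 * (A k + B (Suc k)) \<ge> 0" for k using vertex_facts(1)[of k] by simp
  ultimately have R0: "R \<ge> 0" unfolding R_def by (intro add_nonneg_nonneg sum_nonneg)
  have "even_area \<le> (\<Sum>k<n. m k / 2 - \<Gamma> k * m k)"
    unfolding even_area_def cross_V
  proof (rule sum_mono)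
    fix k
    have "m k * e k \<le> m k * (1/2 - \<Gamma> k)" using e_le[of k] m_pos[of k] unfolding \<Gamma>_def by (intro mult_left_mono) auto
    thus "m k * e k \<le> m k / 2 - \<Gamma> k * m k" by (simp add: algebra_simps)
  qed
  hence ev: "even_area \<le> (\<Sum>k<n. m k) / 2 - (\<Sum>k<n. \<Gamma> k * m k)"
    by (simp add: sum_subtractf sum_divide_distrib)
  have "slope_energy \<ge> (\<Sum>k<n. 2 * (p (Suc k))\<^sup>2 * (A k + B (Suc k)))"
    unfolding slope_energy_def
  proof (rule sum_mono)
    fix k
    show "2 * (p (Suc k))\<^sup>2 * (A k + B (Suc k)) \<le> (p (Suc k))\<^sup>2 * (\<theta> (Suc k) - \<theta> k)"
      using mult_left_mono[OF vertex_facts(2)[of k] zero_le_power2[of "p (Suc k)"]] by (simp add: algebra_simps)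
  qed
  hence P: "pi / 4 - (even_area + odd_area) \<ge> D / 4 + R"
    using ev odd_area_le by (simp add: D_def R_def field_simps)
  have DR: "Dl + R = 2 * raw_cost"
  proof -
    have 1: "(\<Sum>k<n. g (Suc k) * B (Suc k)) = (\<Sum>k<n. g k * B k)"
      using shiftB[of "\<lambda>b k. g k * b"] by (simp add: per_shifts)
    have 2: "(\<Sum>k<n. B (Suc k) ^ 3) = (\<Sum>k<n. B k ^ 3)"
      using shiftB[of "\<lambda>b k. b ^ 3"] by (simp add: per_shifts)
    have 3: "(\<Sum>k<n. (p (Suc k))\<^sup>2 * B (Suc k)) = (\<Sum>k<n. (p k)\<^sup>2 * B k)"
      using shiftB[of "\<lambda>b k. (p k)\<^sup>2 * b"] by (simp add: per_shifts p_per)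
    have 4: "(\<Sum>k<n. \<Gamma> k * m k) = (\<Sum>k<n. g (Suc k) * A k + A k ^ 3 + g k * B k + B k ^ 3)"
    proof (rule sum.cong[OF refl])
      fix k
      have "\<Gamma> k * m k = \<Gamma> k * A k + \<Gamma> k * B k" by (simp add: A_B[symmetric] distrib_left)
      also have "\<Gamma> k * A k = (g (Suc k) + (A k)\<^sup>2) * A k" by (simp only: G1(2)[of k])
      also have "\<Gamma> k * B k = (g k + (B k)\<^sup>2) * B k" by (simp only: G1(1)[of k])
      finally show "\<Gamma> k * m k = g (Suc k) * A k + A k ^ 3 + g k * B k + B k ^ 3"
        by (simp add: algebra_simps power2_eq_square power3_eq_cube)
    qed
    have "Dl = (\<Sum>k<n. g (Suc k) * A k) + (\<Sum>k<n. g k * B k) + ((\<Sum>k<n. A k ^ 3) + (\<Sum>k<n. B k ^ 3)) / 3"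
      by (simp add: Dl_def sum.distrib distrib_left 1 2 sum_divide_distrib[symmetric] add_divide_distrib)
    moreover have "(\<Sum>k<n. 2 * (p (Suc k))\<^sup>2 * (A k + B (Suc k))) = 2 * (\<Sum>k<n. (p (Suc k))\<^sup>2 * A k) + 2 * (\<Sum>k<n. (p k)\<^sup>2 * B k)"
      by (simp add: distrib_left sum.distrib 3[symmetric] sum_distrib_left mult.assoc)
    moreover have "raw_cost = 2/3 * ((\<Sum>k<n. A k ^ 3) + (\<Sum>k<n. B k ^ 3)) + (\<Sum>k<n. g (Suc k) * A k) + (\<Sum>k<n. (p (Suc k))\<^sup>2 * A k)
        + (\<Sum>k<n. g k * B k) + (\<Sum>k<n. (p k)\<^sup>2 * B k)"
      by (simp add: raw_cost_def sum.distrib sum_distrib_left distrib_left distrib_right)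
    ultimately show ?thesis by (simp add: R_def 4 sum.distrib)
  qed
  define K where "K = 2 * \<nu> ^ 3 * zigzag.cost n (\<lambda>k. p k / \<nu>) (\<lambda>k. g k / \<nu>\<^sup>2) (\<lambda>k. A k / \<nu>) (\<lambda>k. B k / \<nu>)
      - 40/3 * n * \<nu> ^ 3 + 5 * \<nu>\<^sup>2 * pi"
  have "2 * raw_cost = K - 5 * \<nu>\<^sup>2 * D"
    using cost_scaled[OF assms] by (simp add: K_def D_def algebra_simps)
  hence "K = Dl + R + 5 * \<nu>\<^sup>2 * D" using DR by simp
  also have "\<dots> \<le> D / 4 + R + 20 * \<nu>\<^sup>2 * (D / 4 + R)" using DDl mult_nonneg_nonneg[OF R0, of "\<nu>\<^sup>2 * 20"] by (simp add: algebra_simps)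
  also have "\<dots> = (D / 4 + R) * (1 + 20 * \<nu>\<^sup>2)" by (simp add: algebra_simps)
  also have "\<dots> \<le> (pi / 4 - (even_area + odd_area)) * (1 + 20 * \<nu>\<^sup>2)"
    using P by (intro mult_right_mono) auto
  finally show ?thesis by (simp add: K_def)
qed

end

end

section \<open>The area of a strictly convex polygon\<close>

text \<open>The area of a triangle is known in \<open>real ^ 2\<close>; this linear isometry carries it over to the complex plane.\<close>

definition to_vec :: "complex \<Rightarrow> real ^ 2" where "to_vec z = vector [Re z, Im z]"

lemma to_vec_nth [simp]: "to_vec z $ 1 = Re z" "to_vec z $ 2 = Im z"
  by (simp_all add: to_vec_def)

lemma linear_to_vec: "linear to_vec"
  by (rule linearI) (simp_all add: vec_eq_iff forall_2)

lemma bij_to_vec: "bij to_vec"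
proof (rule bijI')
  show "to_vec x = to_vec y \<longleftrightarrow> x = y" for x y
    by (auto simp: vec_eq_iff forall_2 complex_eq_iff)
  show "\<exists>x. y = to_vec x" for y
    by (rule exI[of _ "Complex (y $ 1) (y $ 2)"]) (simp add: vec_eq_iff forall_2)
qed

lemma distr_to_vec: "lborel = distr lborel borel to_vec"
proof (rule lborel_eqI)
  have m: "to_vec \<in> borel_measurable borel"
    by (intro borel_measurable_continuous_onI linear_continuous_on linear_conv_bounded_linear[THEN iffD1] linear_to_vec)
  fix l u :: "real ^ 2"
  assume le: "\<And>b. b \<in> Basis \<Longrightarrow> l \<bullet> b \<le> u \<bullet> b"
  have le': "l $ i \<le> u $ i" for i using le[of "axis i 1"] by (simp add: inner_axis)
  have "to_vec -` box l u = box (Complex (l $ 1) (l $ 2)) (Complex (u $ 1) (u $ 2))"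
    by (auto simp: mem_box_cart forall_2 in_box_complex_iff)
  hence "emeasure (distr lborel borel to_vec) (box l u) = emeasure lborel (box (Complex (l $ 1) (l $ 2)) (Complex (u $ 1) (u $ 2)))"
    using m by (subst emeasure_distr) auto
  also have "\<dots> = ennreal (\<Prod>b\<in>Basis. (Complex (u $ 1) (u $ 2) - Complex (l $ 1) (l $ 2)) \<bullet> b)"
    using le' by (subst emeasure_lborel_box) (auto simp: Basis_complex_def)
  also have "(\<Prod>b\<in>Basis. (Complex (u $ 1) (u $ 2) - Complex (l $ 1) (l $ 2)) \<bullet> b) = (u $ 1 - l $ 1) * (u $ 2 - l $ 2)"
    by (simp add: Basis_complex_def)
  also have "\<dots> = (\<Prod>b\<in>Basis. (u - l) \<bullet> b)"
  proof -
    have "(\<Prod>b\<in>Basis. (u - l) \<bullet> b) = (\<Prod>i\<in>UNIV. (u - l) \<bullet> axis i 1)"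
      by (rule prod.reindex_bij_witness[of _ "\<lambda>i. axis i 1" "\<lambda>b. THE i. b = axis i 1"])
        (auto simp: Basis_vec_def axis_eq_axis)
    thus ?thesis by (simp add: UNIV_2 inner_axis)
  qed
  finally show "emeasure (distr lborel borel to_vec) (box l u) = (\<Prod>b\<in>Basis. (u - l) \<bullet> b)" .
qed simp

lemma closed_triangle: "closed (convex hull {a, b, c :: 'a::euclidean_space})"
  by (intro compact_imp_closed finite_imp_compact_convex_hull) auto

lemma area_triangle:
  "measure lebesgue (convex hull {a, b, c}) = \<bar>cross (b - a) (c - a)\<bar> / 2"
proof -
  have m: "to_vec \<in> borel_measurable borel"
    by (intro borel_measurable_continuous_onI linear_continuous_on linear_conv_bounded_linear[THEN iffD1] linear_to_vec)
  have "to_vec -` (to_vec ` (convex hull {a, b, c})) = convex hull {a, b, c}"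
    by (rule inj_vimage_image_eq[OF bij_is_inj[OF bij_to_vec]])
  moreover have "to_vec ` (convex hull {a, b, c}) = convex hull {to_vec a, to_vec b, to_vec c}"
    by (subst convex_hull_linear_image[OF linear_to_vec]) simp
  ultimately have eq: "to_vec -` (convex hull {to_vec a, to_vec b, to_vec c}) = convex hull {a, b, c}"
    by simp
  have "measure lebesgue (convex hull {a, b, c}) = measure lborel (convex hull {a, b, c})"
    by (intro measure_completion) (simp add: borel_closed closed_triangle)
  also have "\<dots> = measure lborel (to_vec -` (convex hull {to_vec a, to_vec b, to_vec c}))"
    by (simp only: eq)
  also have "\<dots>
      = measure (distr lborel borel to_vec) (convex hull {to_vec a, to_vec b, to_vec c})"
    using m by (subst measure_distr) (auto intro: borel_closed closed_triangle)
  also have "\<dots> = measure lborel (convex hull {to_vec a, to_vec b, to_vec c})"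
    by (simp add: distr_to_vec[symmetric])
  also have "\<dots> = \<bar>cross (b - a) (c - a)\<bar> / 2"
    by (subst content_triangle) (simp add: cross_altdef algebra_simps abs_minus_commute)
  finally show ?thesis .
qed

lemma cross_simps:
  "cross (a + b) c = cross a c + cross b c" "cross a (b + c) = cross a b + cross a c"
  "cross (a - b) c = cross a c - cross b c" "cross a (b - c) = cross a b - cross a c"
  "cross (r *\<^sub>R a) b = r * cross a b" "cross a (r *\<^sub>R b) = r * cross a b"
  "cross (- a) b = - cross a b" "cross a (- b) = - cross a b" "cross a a = 0" "cross 0 a = 0" "cross a 0 = 0"
  by (simp_all add: cross_altdef algebra_simps)

lemma cross_commute: "cross a b = - cross b a"
  by (simp add: cross_altdef)

lemma linear_cross: "linear (cross a)"
  by (rule linearI) (simp_all add: cross_simps)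

lemma convex_left_side: "convex {x. cross a (x - b) \<ge> 0}"
proof -
  have "{x. cross a (x - b) \<ge> 0} = {x. (\<i> * a) \<bullet> x \<ge> cross a b}"
    by (auto simp: cross_altdef inner_complex_def algebra_simps)
  thus ?thesis by (simp add: convex_halfspace_ge)
qed

lemma hull_left_side:
  assumes "\<And>x. x \<in> S \<Longrightarrow> cross a (x - b) \<ge> 0" "x \<in> convex hull S"
  shows "cross a (x - b) \<ge> 0"
proof -
  have "convex hull S \<subseteq> {x. cross a (x - b) \<ge> 0}"
    using assms by (intro hull_minimal convex_left_side) auto
  thus ?thesis using assms by auto
qed

lemma cross_solve:
  assumes "cross a b \<noteq> 0"
  shows "x = (cross x b / cross a b) *\<^sub>R a + (cross a x / cross a b) *\<^sub>R b"
proof -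
  have "cross a b *\<^sub>R x = cross x b *\<^sub>R a + cross a x *\<^sub>R b"
    by (simp add: complex_eq_iff cross_altdef algebra_simps)
  hence "(1 / cross a b) *\<^sub>R (cross a b *\<^sub>R x) = (1 / cross a b) *\<^sub>R (cross x b *\<^sub>R a + cross a x *\<^sub>R b)"
    by (rule arg_cong)
  thus ?thesis using assms by (simp only: scaleR_add_right scaleR_scaleR) simp
qed

lemma in_triangle:
  assumes D: "cross a b > 0" and "cross x b \<ge> 0" "cross a x \<ge> 0" "cross x b + cross a x \<le> cross a b"
  shows "c + x \<in> convex hull {c, c + a, c + b}"
proof -
  define s t where "s = cross x b / cross a b" and "t = cross a x / cross a b"
  have x: "x = s *\<^sub>R a + t *\<^sub>R b"
    unfolding s_def t_def by (rule cross_solve) (use D in simp)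
  have "c + (s *\<^sub>R a + t *\<^sub>R b) = (1 - s - t) *\<^sub>R c + s *\<^sub>R (c + a) + t *\<^sub>R (c + b)"
    by (simp add: algebra_simps)
  hence e: "c + x = (1 - s - t) *\<^sub>R c + s *\<^sub>R (c + a) + t *\<^sub>R (c + b)"
    by (simp only: x[symmetric])
  have "s + t \<le> 1" "s \<ge> 0" "t \<ge> 0" using assms by (auto simp: s_def t_def add_divide_distrib[symmetric])
  thus ?thesis unfolding convex_hull_3
    by (intro CollectI exI[of _ "1 - s - t"] exI[of _ s] exI[of _ t] conjI) (use e in auto)
qed

text \<open>Three vectors in a half-plane bounded by the direction of \<open>u\<close> are ordered by their angle. The identity behind
it is the Pluecker relation between four vectors of the plane.\<close>

lemma cross_trans:
  assumes "cross u a \<ge> 0" "cross u b > 0" "cross u c > 0" "cross a b > 0" "cross b c > 0"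
  shows "cross a c > 0"
proof -
  have "cross u b * cross a c = cross u a * cross b c + cross u c * cross a b"
    by (simp add: cross_altdef algebra_simps)
  moreover have "cross u a * cross b c + cross u c * cross a b > 0"
    using assms by (intro add_nonneg_pos) auto
  ultimately have "0 < cross u b * cross a c" by simp
  thus ?thesis using assms(2) by (rule zero_less_mult_pos)
qed

text \<open>A closed polygon for which every vertex outside an edge lies strictly to the left of this edge.\<close>

locale convex_polygon =
  fixes K :: nat and v :: "nat \<Rightarrow> complex"
  assumes K: "K \<ge> 3" and v_K: "v K = v 0"
    and left: "i < K \<Longrightarrow> j < K \<Longrightarrow> j \<noteq> i \<Longrightarrow> j \<noteq> Suc i mod K \<Longrightarrow> cross (v (Suc i) - v i) (v j - v i) > 0"
begin

lemma v_Suc_mod: "i < K \<Longrightarrow> v (Suc i mod K) = v (Suc i)"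
  using v_K K by (cases "Suc i = K") auto

lemma left_weak:
  assumes "i < K" "j \<le> K" shows "cross (v (Suc i) - v i) (v j - v i) \<ge> 0"
proof -
  have *: "cross (v (Suc i) - v i) (v j - v i) \<ge> 0" if "j < K" for j
  proof -
    consider "j = i" | "j = Suc i mod K" | "j \<noteq> i" "j \<noteq> Suc i mod K" by blast
    thus ?thesis
    proof cases
      case 2 thus ?thesis using v_Suc_mod[OF assms(1)] by (simp add: cross_simps)
    qed (use left[OF assms(1) that] in \<open>auto simp: cross_simps\<close>)
  qed
  show ?thesis
  proof (cases "j = K")
    case True thus ?thesis using *[of 0] K v_K by simp
  qed (use *[of j] assms in auto)
qed

text \<open>The vertices are seen from \<open>v 0\<close> in the order of their indices: first for neighbours, in \<open>fan\<close> for all pairs.\<close>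

lemma fan_step: "1 \<le> i \<Longrightarrow> Suc i < K \<Longrightarrow> cross (v i - v 0) (v (Suc i) - v 0) > 0"
  using left[of i 0] by (simp add: cross_altdef algebra_simps)

lemma fan:
  assumes "1 \<le> i" "i < j" "j < K" shows "cross (v i - v 0) (v j - v 0) > 0"
  using assms(2,3)
proof (induction j rule: less_induct)
  case (less j)
  show ?case
  proof (cases "j = Suc i")
    case True thus ?thesis using fan_step[of i] less assms by simp
  next
    case False
    then obtain j' where j: "j = Suc j'" "i < j'" using less.prems by (cases j) auto
    have "cross (v i - v 0) (v j' - v 0) > 0" using less j by auto
    moreover have "cross (v j' - v 0) (v j - v 0) > 0" using fan_step[of j'] less.prems j assms by simp
    moreover have "cross (v (Suc 0) - v 0) (v i - v 0) \<ge> 0" using left_weak[of 0 i] K assms less by simp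
    moreover have "cross (v (Suc 0) - v 0) (v j' - v 0) > 0" "cross (v (Suc 0) - v 0) (v j - v 0) > 0"
      using left[of 0 j'] left[of 0 j] K j assms less.prems by simp_all
    ultimately show ?thesis using cross_trans[of "v (Suc 0) - v 0"] by blast
  qed
qed

definition region where "region = convex hull (v ` {..<K})"
definition shoelace where "shoelace = (\<Sum>i<K. cross (v i) (v (Suc i)))"

lemma shoelace_fan:
  "shoelace = (\<Sum>i\<in>{1..<K - 1}. cross (v i - v 0) (v (Suc i) - v 0))"
proof -
  have "(\<Sum>i<K. cross (v i - v 0) (v (Suc i) - v 0)) = (\<Sum>i<K. cross (v i) (v (Suc i)) - (cross (v 0) (v (Suc i)) - cross (v 0) (v i)))"
    by (rule sum.cong[OF refl]) (simp add: cross_altdef algebra_simps)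
  also have "\<dots> = shoelace - (cross (v 0) (v K) - cross (v 0) (v 0))"
    using sum_lessThan_telescope[of "\<lambda>i. cross (v 0) (v i)" K] by (simp only: sum_subtractf shoelace_def)
  also have "\<dots> = shoelace" by (simp add: v_K)
  finally have "shoelace = (\<Sum>i<K. cross (v i - v 0) (v (Suc i) - v 0))" by simp
  also have "\<dots> = (\<Sum>i\<in>{1..<K - 1}. cross (v i - v 0) (v (Suc i) - v 0))"
  proof (rule sum.mono_neutral_right)
    show "\<forall>i\<in>{..<K} - {1..<K - 1}. cross (v i - v 0) (v (Suc i) - v 0) = 0"
    proof
      fix i assume "i \<in> {..<K} - {1..<K - 1}"
      hence "i = 0 \<or> Suc i = K" by auto
      thus "cross (v i - v 0) (v (Suc i) - v 0) = 0" using v_K by (auto simp: cross_simps)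
    qed
  qed auto
  finally show ?thesis .
qed

lemma compact_region: "compact region"
  unfolding region_def by (intro finite_imp_compact_convex_hull) auto

lemma lmeasurable_region: "region \<in> lmeasurable"
  using compact_region by (rule lmeasurable_compact)

definition tri where "tri i = convex hull {v 0, v i, v (Suc i)}"

lemma lmeasurable_tri: "tri i \<in> lmeasurable"
  unfolding tri_def by (intro lmeasurable_compact finite_imp_compact_convex_hull) auto

lemma area_tri: "1 \<le> i \<Longrightarrow> i < K - 1 \<Longrightarrow> measure lebesgue (tri i) = cross (v i - v 0) (v (Suc i) - v 0) / 2"
  unfolding tri_def area_triangle using fan_step[of i] by (simp add: less_diff_conv)

text \<open>A point that is to the left of all edges lies in the triangle of the fan at \<open>v 0\<close> between whose
legs it is seen from \<open>v 0\<close>. The index of this triangle is the last one whose leg has the point on its left.\<close>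

lemma halfplanes_subset_fan:
  assumes hl: "\<And>i. i < K \<Longrightarrow> cross (v (Suc i) - v i) (x - v i) \<ge> 0"
  shows "x \<in> (\<Union>i\<in>{1..<K - 1}. tri i)"
proof -
  define c where "c = (\<lambda>i. cross (v i - v 0) (x - v 0))"
  have c1: "c 1 \<ge> 0" using hl[of 0] K by (simp add: c_def)
  have cN: "c (K - 1) \<le> 0"
  proof -
    have "Suc (K - 1) = K" using K by simp
    hence "cross (v 0 - v (K - 1)) (x - v (K - 1)) \<ge> 0" using hl[of "K - 1"] K v_K by simp
    thus ?thesis by (simp add: c_def cross_altdef algebra_simps)
  qed
  define I where "I = {i. 1 \<le> i \<and> i < K - 1 \<and> c i \<ge> 0}"
  have fin: "finite I" "I \<noteq> {}" using c1 K by (auto simp: I_def intro!: exI[of _ 1])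
  define i where "i = Max I"
  have i: "1 \<le> i" "i < K - 1" "c i \<ge> 0" using Max_in[OF fin] by (auto simp: i_def I_def)
  have ci: "c (Suc i) \<le> 0"
  proof (cases "Suc i = K - 1")
    case True thus ?thesis using cN by simp
  next
    case False
    hence "Suc i \<notin> I" using Max_ge[OF fin(1), of "Suc i"] by (auto simp: i_def[symmetric])
    thus ?thesis using False i by (auto simp: I_def)
  qed
  have "v 0 + (x - v 0) \<in> convex hull {v 0, v 0 + (v i - v 0), v 0 + (v (Suc i) - v 0)}"
  proof (rule in_triangle)
    show "0 < cross (v i - v 0) (v (Suc i) - v 0)" using fan_step[of i] i by simp
    show "0 \<le> cross (x - v 0) (v (Suc i) - v 0)" using ci cross_commute[of "x - v 0"] by (simp add: c_def)
    show "0 \<le> cross (v i - v 0) (x - v 0)" using i by (simp add: c_def)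
    show "cross (x - v 0) (v (Suc i) - v 0) + cross (v i - v 0) (x - v 0) \<le> cross (v i - v 0) (v (Suc i) - v 0)"
      using hl[of i] i by (simp add: cross_altdef algebra_simps)
  qed
  hence "x \<in> tri i" by (simp add: tri_def)
  thus ?thesis using i by auto
qed

lemma hull_subset_fan: "region \<subseteq> (\<Union>i\<in>{1..<K - 1}. tri i)"
proof
  fix x assume x: "x \<in> region"
  show "x \<in> (\<Union>i\<in>{1..<K - 1}. tri i)"
  proof (rule halfplanes_subset_fan)
    fix i assume "i < K"
    thus "cross (v (Suc i) - v i) (x - v i) \<ge> 0"
      by (intro hull_left_side[OF _ x[unfolded region_def]]) (use left_weak in auto)
  qed
qed

lemma area_hull_le: "measure lebesgue region \<le> shoelace / 2"
proof -
  have "measure lebesgue region \<le> measure lebesgue (\<Union>i\<in>{1..<K - 1}. tri i)"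
    using lmeasurable_region lmeasurable_tri
    by (intro measure_mono_fmeasurable hull_subset_fan fmeasurable.finite_UN fmeasurableD) simp_all
  also have "\<dots> \<le> (\<Sum>i\<in>{1..<K - 1}. measure lebesgue (tri i))"
    by (intro measure_UNION_le) (use lmeasurable_tri in auto)
  also have "\<dots> = shoelace / 2"
    unfolding shoelace_fan sum_divide_distrib by (intro sum.cong refl area_tri) auto
  finally show ?thesis .
qed

text \<open>The hull is built up by adding one vertex at a time. The new triangle of the fan lies on the other side of the
line through \<open>v 0\<close> and the previous vertex, so it meets the old hull in a null set.\<close>

lemma area_hull_ge: "measure lebesgue region \<ge> shoelace / 2"
proof -
  have *: "measure lebesgue (convex hull (v ` {..N})) \<ge> (\<Sum>i\<in>{1..<N}. cross (v i - v 0) (v (Suc i) - v 0)) / 2"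
    if "1 \<le> N" "N < K" for N
    using that
  proof (induction N rule: dec_induct)
    case base show ?case by simp
  next
    case (step N)
    let ?H = "convex hull (v ` {..N})" and ?T = "tri N"
    have mH: "?H \<in> lmeasurable" by (intro lmeasurable_compact finite_imp_compact_convex_hull) auto
    have sub: "?H \<union> ?T \<subseteq> convex hull (v ` {..Suc N})"
      unfolding tri_def by (intro Un_least hull_mono image_mono) auto
    define a where "a = v N - v 0"
    have aN: "cross a (v (Suc N) - v 0) > 0" using fan_step[of N] step by (simp add: a_def)
    hence "a \<noteq> 0" by (auto simp: cross_simps)
    have "?H \<inter> ?T \<subseteq> {x. (\<i> * a) \<bullet> x = cross a (v 0)}"
    proof
      fix x assume x: "x \<in> ?H \<inter> ?T"
      have "cross (- a) (x - v 0) \<ge> 0"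
      proof (rule hull_left_side)
        fix y assume "y \<in> v ` {..N}"
        then obtain j where j: "y = v j" "j \<le> N" by auto
        consider "j = 0" | "j = N" | "1 \<le> j" "j < N" using j by linarith
        thus "0 \<le> cross (- a) (y - v 0)"
        proof cases
          case 2
          hence "y - v 0 = a" using j by (simp add: a_def)
          thus ?thesis by (simp add: cross_simps)
        next
          case 3
          hence "cross (v j - v 0) a > 0" using fan[of j N] step(2) \<open>Suc N < K\<close> by (simp add: a_def)
          thus ?thesis using cross_commute[of "v j - v 0" a] j by (simp only: cross_simps(7))
        qed (simp add: j cross_simps)
      qed (use x in simp)
      moreover have "cross a (x - v 0) \<ge> 0"
      proof (rule hull_left_side)
        fix y assume "y \<in> {v 0, v N, v (Suc N)}"
        then consider "y - v 0 = 0" | "y - v 0 = a" | "y = v (Suc N)" by (auto simp: a_def)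
        thus "0 \<le> cross a (y - v 0)"
        proof cases
          case 3 thus ?thesis using aN by simp
        qed (simp_all add: cross_simps)
      qed (use x in \<open>simp add: tri_def\<close>)
      ultimately have "cross a (x - v 0) = 0" by (simp add: cross_simps)
      thus "x \<in> {x. (\<i> * a) \<bullet> x = cross a (v 0)}"
        by (simp add: cross_altdef inner_complex_def algebra_simps)
    qed
    moreover have "negligible {x. (\<i> * a) \<bullet> x = cross a (v 0)}"
      using \<open>a \<noteq> 0\<close> by (intro negligible_hyperplane) auto
    ultimately have neg: "negligible (?H \<inter> ?T)" by (rule negligible_subset[rotated])
    have "measure lebesgue ?H + measure lebesgue ?T = measure lebesgue (?H \<union> ?T)"
      using measure_Un3[OF mH lmeasurable_tri] negligible_imp_measure0[OF neg] by simp
    also have "\<dots> \<le> measure lebesgue (convex hull (v ` {..Suc N}))"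
      by (rule measure_mono_fmeasurable[OF sub fmeasurableD[OF fmeasurable.Un[OF mH lmeasurable_tri]]])
        (intro lmeasurable_compact finite_imp_compact_convex_hull, simp)
    finally show ?case
      using step.IH step.prems step.hyps area_tri[of N] sum.atLeastLessThan_Suc[OF step.hyps(1), of "\<lambda>i. cross (v i - v 0) (v (Suc i) - v 0)"]
      by (simp only: add_divide_distrib) linarith
  qed
  have "{..<K} = {..K - 1}" using K by auto
  hence "region = convex hull (v ` {..K - 1})" by (simp only: region_def)
  moreover have "(\<Sum>i\<in>{1..<K - 1}. cross (v i - v 0) (v (Suc i) - v 0)) / 2 \<le> measure lebesgue (convex hull (v ` {..K - 1}))"
    by (rule *) (use K in linarith)+
  ultimately show ?thesis by (simp only: shoelace_fan)
qed

end

section \<open>Finite sets of points span convex polygons\<close>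

text \<open>The positive half of the lexicographic order of the plane. A finite set has a lexicographically smallest
point, all others are seen from there in directions with an argument in \<open>(- \<pi>/2, \<pi>/2]\<close>, and in this range the sign
of \<open>cross\<close> compares arguments.\<close>

definition lexpos :: "complex \<Rightarrow> bool" where
  "lexpos z \<longleftrightarrow> Re z > 0 \<or> (Re z = 0 \<and> Im z > 0)"

lemma lexpos_or: "z \<noteq> 0 \<Longrightarrow> lexpos z \<or> lexpos (- z)"
  by (auto simp: lexpos_def complex_eq_iff)

lemma lexpos_not: "lexpos z \<Longrightarrow> \<not> lexpos (- z)" "\<not> lexpos 0"
  by (auto simp: lexpos_def)

lemma lexpos_nonzero: "lexpos z \<Longrightarrow> z \<noteq> 0"
  by (auto simp: lexpos_def)

lemma lexpos_add: "lexpos a \<Longrightarrow> lexpos b \<Longrightarrow> lexpos (a + b)"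
  by (auto simp: lexpos_def)

lemma lexpos_comb:
  assumes "lexpos a" "lexpos b" "s \<ge> 0" "t \<ge> 0" "s *\<^sub>R a + t *\<^sub>R b \<noteq> 0"
  shows "lexpos (s *\<^sub>R a + t *\<^sub>R b)"
proof -
  have sc: "lexpos (r *\<^sub>R z)" if "r > 0" "lexpos z" for r z
    using that by (auto simp: lexpos_def)
  consider "s = 0" "t > 0" | "s > 0" "t = 0" | "s > 0" "t > 0" using assms(3-5) by fastforce
  thus ?thesis by cases (use sc assms(1,2) in \<open>auto intro: lexpos_add\<close>)
qed

lemma Arg_lexpos: assumes "lexpos z" shows "- pi/2 < Arg z" "Arg z \<le> pi/2"
proof -
  have z: "z \<noteq> 0" using lexpos_nonzero[OF assms] .
  have "\<bar>Im (Ln z)\<bar> \<le> pi/2" using z assms by (subst Re_Ln_pos_le) (auto simp: lexpos_def)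
  hence b: "- (pi/2) \<le> Arg z" "Arg z \<le> pi/2" using z by (auto simp: Arg_eq_Im_Ln abs_le_iff)
  thus "Arg z \<le> pi/2" by simp
  have "Arg z \<noteq> - (pi/2)"
  proof
    assume a: "Arg z = - (pi/2)"
    have "z = of_real (norm z) * cis (Arg z)" using z by (simp add: cis_Arg sgn_eq)
    also have "\<dots> = of_real (norm z) * (- \<i>)" unfolding a by (simp add: complex_eq_iff)
    finally have zz: "z = of_real (norm z) * (- \<i>)" .
    have "Re z = 0 \<and> Im z = - norm z"
      using arg_cong[OF zz, of Re] arg_cong[OF zz, of Im] by simp
    thus False using assms norm_ge_zero[of z] by (auto simp: lexpos_def)
  qed
  with b show "- pi/2 < Arg z" by simp
qed

lemma polar_Arg: "z \<noteq> 0 \<Longrightarrow> z = of_real (norm z) * cis (Arg z)"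
  by (simp add: cis_Arg sgn_eq)

lemma cross_polar:
  assumes "a \<noteq> 0" "b \<noteq> 0" shows "cross a b = norm a * norm b * sin (Arg b - Arg a)"
proof -
  have "cross a b = cross (of_real (norm a) * cis (Arg a)) (of_real (norm b) * cis (Arg b))"
    using polar_Arg[OF assms(1)] polar_Arg[OF assms(2)] by simp
  also have "\<dots> = norm a * norm b * cross (cis (Arg a)) (cis (Arg b))"
    by (simp add: cross_altdef algebra_simps)
  finally show ?thesis by (simp add: cross_cis)
qed

lemma cross_pos_iff_Arg:
  assumes "lexpos a" "lexpos b" shows "cross a b > 0 \<longleftrightarrow> Arg a < Arg b"
proof -
  have nz: "a \<noteq> 0" "b \<noteq> 0" using assms by (auto dest: lexpos_nonzero)
  have r: "\<bar>Arg b - Arg a\<bar> < pi" using Arg_lexpos[OF assms(1)] Arg_lexpos[OF assms(2)] by linarith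
  have "norm a * norm b > 0" using nz by simp
  hence "cross a b > 0 \<longleftrightarrow> sin (Arg b - Arg a) > 0"
    unfolding cross_polar[OF nz] by (metis zero_less_mult_pos mult_pos_pos)
  also have "\<dots> \<longleftrightarrow> Arg a < Arg b"
  proof (cases "Arg a < Arg b")
    case True thus ?thesis using r sin_gt_zero[of "Arg b - Arg a"] by simp
  next
    case False
    hence "sin (Arg a - Arg b) \<ge> 0" using r by (intro sin_ge_zero) auto
    thus ?thesis using False sin_minus[of "Arg a - Arg b"] by simp
  qed
  finally show ?thesis .
qed

lemma exists_lexmin:
  assumes "finite X" "X \<noteq> {}"
  obtains a where "a \<in> X" "\<And>x. x \<in> X \<Longrightarrow> x \<noteq> a \<Longrightarrow> lexpos (x - a)"
proof -
  define r where "r = Min (Re ` X)"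
  have r: "r \<in> Re ` X" "\<And>x. x \<in> X \<Longrightarrow> r \<le> Re x" using assms by (auto simp: r_def)
  define X' where "X' = {x \<in> X. Re x = r}"
  have X': "finite X'" "X' \<noteq> {}" using assms r by (auto simp: X'_def)
  define s where "s = Min (Im ` X')"
  have s: "s \<in> Im ` X'" "\<And>x. x \<in> X' \<Longrightarrow> s \<le> Im x" using X' by (auto simp: s_def)
  obtain a where a: "a \<in> X'" "Im a = s" using s(1) by auto
  show ?thesis
  proof
    show "a \<in> X" using a by (simp add: X'_def)
    fix x assume x: "x \<in> X" "x \<noteq> a"
    have ra: "Re a = r" using a by (simp add: X'_def)
    show "lexpos (x - a)"
    proof (cases "Re x = r")
      case True
      hence "s \<le> Im x" using x s by (simp add: X'_def)
      moreover have "Im x \<noteq> s" using True x ra a by (auto simp: complex_eq_iff)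
      ultimately show ?thesis using True ra a by (simp add: lexpos_def)
    next
      case False thus ?thesis using r(2)[OF x(1)] ra by (simp add: lexpos_def)
    qed
  qed
qed

lemma extreme_not_in_hull:
  assumes "x extreme_point_of T" "F \<subseteq> T" "convex T" "x \<in> convex hull F" shows "x \<in> F"
proof -
  have "convex hull F \<subseteq> T" using assms by (simp add: hull_minimal)
  hence "x extreme_point_of (convex hull F)" using assms unfolding extreme_point_of_def by blast
  thus ?thesis by (rule extreme_point_of_convex_hull)
qed

text \<open>The vertices are the extreme points of the hull, sorted by their argument as seen from the lexicographically smallest
one. No two have the same argument, since the nearer one would be between the other one and the first point. If
some vertex were not strictly to the left of an edge, then an endpoint of this edge would lie in a triangle
formed by other extreme points.\<close>

lemma polygon_of_points:
  fixes S :: "complex set"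
  assumes fin: "finite S"
  obtains "measure lebesgue (convex hull S) = 0"
  | K v where "convex_polygon K v" "K \<le> card S" "v ` {..<K} \<subseteq> S" "convex hull (v ` {..<K}) = convex hull S"
      "\<And>j. 0 < j \<Longrightarrow> j < K \<Longrightarrow> lexpos (v j - v 0)"
proof -
  define T where "T = convex hull S"
  define X where "X = {x. x extreme_point_of T}"
  have XS: "X \<subseteq> S" unfolding X_def T_def by (auto intro: extreme_point_of_convex_hull)
  have finX: "finite X" using XS fin finite_subset by blast
  have cT: "convex T" "compact T" unfolding T_def by (auto intro: finite_imp_compact_convex_hull fin)
  have hX: "convex hull X = T" unfolding X_def using Krein_Milman_Minkowski[OF cT(2,1)] by simp
  have XT: "X \<subseteq> T" unfolding X_def extreme_point_of_def by auto
  define K where "K = card X"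
  show ?thesis
  proof (cases "K \<ge> 3")
    case False
    have "measure lebesgue (convex hull X) = 0"
    proof -
      have "\<exists>a b. X \<subseteq> {a, b}"
      proof -
        consider "K = 0" | "K = 1" | "K = 2" using False by linarith
        thus ?thesis
        proof cases
          case 1 thus ?thesis using finX by (auto simp: K_def)
        next
          case 2 thus ?thesis by (auto simp: K_def card_1_singleton_iff)
        next
          case 3 thus ?thesis by (auto simp: K_def card_2_iff)
        qed
      qed
      then obtain a b where ab: "X \<subseteq> {a, b, b}" by auto
      have "measure lebesgue (convex hull X) \<le> measure lebesgue (convex hull {a, b, b})"
        by (intro measure_mono_fmeasurable hull_mono ab fmeasurableD lmeasurable_compact finite_imp_compact_convex_hull finX) auto
      also have "\<dots> = 0" by (subst area_triangle) (simp add: cross_simps(9) del: insert_absorb2)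
      finally show ?thesis using measure_nonneg[of lebesgue "convex hull X"] by simp
    qed
    thus ?thesis using that(1) hX by (simp add: T_def)
  next
    case K3: True
    hence "X \<noteq> {}" by (auto simp: K_def)
    then obtain v0 where v0: "v0 \<in> X" "\<And>x. x \<in> X \<Longrightarrow> x \<noteq> v0 \<Longrightarrow> lexpos (x - v0)"
      using exists_lexmin[OF finX] by blast
    define X1 where "X1 = X - {v0}"
    have fin1: "finite X1" and card1: "card X1 = K - 1" using finX v0 by (auto simp: X1_def K_def)
    define key where "key = (\<lambda>x. Arg (x - v0))"
    have lp: "lexpos (x - v0)" if "x \<in> X1" for x using v0 that by (auto simp: X1_def)
    have inj: "inj_on key X1"
    proof -
      have False if xy: "x \<in> X1" "y \<in> X1" "key x = key y" "norm (x - v0) < norm (y - v0)" for x y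
      proof -
        define r where "r = norm (x - v0) / norm (y - v0)"
        have nz: "x - v0 \<noteq> 0" "y - v0 \<noteq> 0" using lp xy lexpos_nonzero by blast+
        have "x - v0 = r *\<^sub>R (y - v0)"
        proof -
          have p: "x - v0 = of_real (norm (x - v0)) * cis (key x)" "y - v0 = of_real (norm (y - v0)) * cis (key x)"
            using polar_Arg[OF nz(1)] polar_Arg[OF nz(2)] xy(3) by (simp_all add: key_def)
          have "r *\<^sub>R (y - v0) = of_real (r * norm (y - v0)) * cis (key x)"
            by (subst p(2)) (simp add: scaleR_conv_of_real)
          also have "r * norm (y - v0) = norm (x - v0)" using nz by (simp add: r_def)
          finally show ?thesis using p(1) by simp
        qed
        hence "x = (1 - r) *\<^sub>R v0 + r *\<^sub>R y" by (simp add: algebra_simps)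
        moreover have "0 < r" "r < 1" using nz xy(4) by (auto simp: r_def)
        moreover have "v0 \<noteq> y" using nz by auto
        ultimately have "x \<in> open_segment v0 y" unfolding in_segment by blast
        moreover have "x extreme_point_of T" "v0 \<in> T" "y \<in> T"
          using xy v0 XT by (auto simp: X1_def X_def)
        ultimately show False unfolding extreme_point_of_def by blast
      qed
      note * = this
      show ?thesis
      proof (rule inj_onI)
        fix x y assume xy: "x \<in> X1" "y \<in> X1" "key x = key y"
        have "norm (x - v0) = norm (y - v0)" using *[of x y] *[of y x] xy by fastforce
        moreover have "x - v0 \<noteq> 0" "y - v0 \<noteq> 0" using lp xy lexpos_nonzero by blast+
        ultimately have "x - v0 = y - v0" using polar_Arg xy(3) unfolding key_def by metis
        thus "x = y" by simp
      qed
    qed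
    define ts where "ts = sorted_list_of_set (key ` X1)"
    have len: "length ts = K - 1" using inj fin1 card1 by (simp add: ts_def card_image)
    have set_ts: "set ts = key ` X1" using fin1 by (simp add: ts_def)
    have srt: "ts ! i < ts ! j" if "i < j" "j < K - 1" for i j
      using strict_sorted_list_of_set[of "key ` X1"] that len unfolding ts_def[symmetric]
      by (simp add: sorted_wrt_iff_nth_less)
    define v where "v = (\<lambda>i. if i = 0 \<or> i \<ge> K then v0 else inv_into X1 key (ts ! (i - 1)))"
    have vi: "v i \<in> X1" "key (v i) = ts ! (i - 1)" if "0 < i" "i < K" for i
    proof -
      have "ts ! (i - 1) \<in> set ts" using that len by (intro nth_mem) linarith
      hence "ts ! (i - 1) \<in> key ` X1" by (simp only: set_ts)
      thus "v i \<in> X1" "key (v i) = ts ! (i - 1)"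
        using that by (simp_all add: v_def inv_into_into f_inv_into_f)
    qed
    have v00: "v 0 = v0" "v K = v0" by (auto simp: v_def)
    have img: "v ` {..<K} = X"
    proof
      show "v ` {..<K} \<subseteq> X"
      proof
        fix y assume "y \<in> v ` {..<K}"
        then obtain i where "y = v i" "i < K" by auto
        thus "y \<in> X" using vi[of i] v0 v00 by (cases "i = 0") (auto simp: X1_def)
      qed
      show "X \<subseteq> v ` {..<K}"
      proof
        fix y assume y: "y \<in> X"
        show "y \<in> v ` {..<K}"
        proof (cases "y = v0")
          case True thus ?thesis using v00 K3 by (intro image_eqI[of _ _ 0]) auto
        next
          case False
          hence y1: "y \<in> X1" using y by (simp add: X1_def)
          hence "key y \<in> set ts" using set_ts by simp
          then obtain i where i: "i < K - 1" "ts ! i = key y" using len by (auto simp: in_set_conv_nth)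
          have "\<not> Suc i \<ge> K" using i by linarith
          hence "v (Suc i) = y" using i inv_into_f_f[OF inj y1] by (simp add: v_def)
          thus ?thesis using i by (intro image_eqI[of _ _ "Suc i"]) auto
        qed
      qed
    qed
    have fan: "cross (v i - v0) (v j - v0) > 0" if "0 < i" "i < j" "j < K" for i j
    proof (subst cross_pos_iff_Arg)
      show "lexpos (v i - v0)" "lexpos (v j - v0)" using lp vi that by auto
      have "key (v i) < key (v j)" using vi[of i] vi[of j] that srt[of "i - 1" "j - 1"] by auto
      thus "Arg (v i - v0) < Arg (v j - v0)" by (simp add: key_def)
    qed
    have ext: "False" if "0 < i" "i < K" "v i \<in> convex hull {v0, v j, v k}" "0 < j" "j < K" "0 < k" "k < K" "j \<noteq> i" "k \<noteq> i" for i j k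
    proof -
      have "v i extreme_point_of T" using vi[of i] that by (simp add: X1_def X_def)
      moreover have "{v0, v j, v k} \<subseteq> T" using vi[of j] vi[of k] v0 XT that by (auto simp: X1_def)
      ultimately have "v i \<in> {v0, v j, v k}" using extreme_not_in_hull cT(1) that(3) by blast
      moreover have "v i \<noteq> v0" using vi[of i] that by (auto simp: X1_def)
      moreover have "v i \<noteq> v j'" if "0 < j'" "j' < K" "j' \<noteq> i" for j'
        using fan[of i j'] fan[of j' i] that \<open>0 < i\<close> \<open>i < K\<close> by (cases "i < j'") (auto simp: cross_simps(9))
      ultimately show False using that by auto
    qed
    have "convex_polygon K v"
    proof
      show "3 \<le> K" by (rule K3)
      show "v K = v 0" by (simp add: v00)
      fix i j assume ij: "i < K" "j < K" "j \<noteq> i" "j \<noteq> Suc i mod K"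
      consider "i = 0" | "Suc i = K" | "0 < i" "Suc i < K" using ij by linarith
      thus "cross (v (Suc i) - v i) (v j - v i) > 0"
      proof cases
        case 1
        hence "1 < j" using ij K3 by auto
        thus ?thesis using fan[of 1 j] ij 1 by (simp add: v00)
      next
        case 2
        hence j: "0 < j" "j < i" using ij K3 by auto
        have "cross (v (Suc i) - v i) (v j - v i) = cross (v j - v0) (v i - v0)"
          using 2 v00 by (simp add: cross_altdef algebra_simps)
        thus ?thesis using fan[of j i] j ij by simp
      next
        case 3
        have Suc_ne: "j \<noteq> Suc i" using ij 3 by auto
        consider "j = 0" | "j > Suc i" | "0 < j" "j < i" using Suc_ne ij by linarith
        thus ?thesis
        proof cases
          case 1
          have "cross (v (Suc i) - v i) (v j - v i) = cross (v i - v0) (v (Suc i) - v0)"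
            using 1 v00 by (simp add: cross_altdef algebra_simps)
          thus ?thesis using fan[of i "Suc i"] 3 by simp
        next
          case j: 2
          show ?thesis
          proof (rule ccontr)
            assume n: "\<not> ?thesis"
            have "v0 + (v (Suc i) - v0) \<in> convex hull {v0, v0 + (v i - v0), v0 + (v j - v0)}"
            proof (rule in_triangle)
              show "0 < cross (v i - v0) (v j - v0)" using fan[of i j] j 3 ij by simp
              show "0 \<le> cross (v (Suc i) - v0) (v j - v0)" using fan[of "Suc i" j] j 3 ij by simp
              show "0 \<le> cross (v i - v0) (v (Suc i) - v0)" using fan[of i "Suc i"] j 3 ij by simp
              show "cross (v (Suc i) - v0) (v j - v0) + cross (v i - v0) (v (Suc i) - v0) \<le> cross (v i - v0) (v j - v0)"
                using n by (simp add: cross_altdef algebra_simps)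
            qed
            thus False using ext[of "Suc i" i j] j 3 ij by simp
          qed
        next
          case j: 3
          show ?thesis
          proof (rule ccontr)
            assume n: "\<not> ?thesis"
            have "v0 + (v i - v0) \<in> convex hull {v0, v0 + (v j - v0), v0 + (v (Suc i) - v0)}"
            proof (rule in_triangle)
              show "0 < cross (v j - v0) (v (Suc i) - v0)" using fan[of j "Suc i"] j 3 ij by simp
              show "0 \<le> cross (v i - v0) (v (Suc i) - v0)" using fan[of i "Suc i"] j 3 ij by simp
              show "0 \<le> cross (v j - v0) (v i - v0)" using fan[of j i] j 3 ij by simp
              show "cross (v i - v0) (v (Suc i) - v0) + cross (v j - v0) (v i - v0) \<le> cross (v j - v0) (v (Suc i) - v0)"
                using n by (simp add: cross_altdef algebra_simps)
            qed
            thus False using ext[of i j "Suc i"] j 3 ij by simp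
          qed
        qed
      qed
    qed
    moreover have "K \<le> card S" unfolding K_def using XS fin by (rule card_mono[rotated])
    moreover have "lexpos (v j - v 0)" if "0 < j" "j < K" for j using lp vi(1)[OF that] by (simp add: v00)
    ultimately show ?thesis using that(2)[of K v] img XS hX T_def by blast
  qed
qed

section \<open>The caliper of a convex polygon\<close>

text \<open>The data of one half turn determine a caliper by periodicity and antiperiodicity.\<close>

lemma caliper_extend:
  fixes n :: nat and th ms es :: "nat \<Rightarrow> real" and V W :: "nat \<Rightarrow> complex"
  assumes n: "n > 0"
    and ms: "\<And>k. k < n \<Longrightarrow> ms k > 0" and es: "\<And>k. k < n \<Longrightarrow> es k = 1 \<or> es k = -1"
    and mono: "\<And>k. Suc k < n \<Longrightarrow> th k \<le> th (Suc k)"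
    and range: "th 0 < th (n - 1)" "th (n - 1) < th 0 + pi"
    and V: "\<And>k. k < n \<Longrightarrow> V (Suc k) = V k + of_real (ms k) * cis (th k)" "V n = - V 0"
    and W: "\<And>k. k < n \<Longrightarrow> W (Suc k) = W k + of_real (es k * ms k) * cis (th k)" "W n = W 0"
  shows "caliper n (\<lambda>k. th (k mod n) + pi * (k div n)) (\<lambda>k. ms (k mod n)) (\<lambda>k. (-1) ^ (k div n) * es (k mod n))
     (\<lambda>k. (-1) ^ (k div n) * V (k mod n)) (\<lambda>k. W (k mod n))"
proof
  fix k
  have r: "k mod n < n" using n by simp
  have le: "th i \<le> th j" if "i \<le> j" "j < n" for i j
    using that
  proof (induction j rule: dec_induct)
    case (step j) thus ?case using mono[of j] by simp
  qed simp
  show "n > 0" by (rule n)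
  show "th ((k + n) mod n) + pi * real ((k + n) div n) = th (k mod n) + pi * real (k div n) + pi"
    using n by (simp add: algebra_simps)
  show "ms ((k + n) mod n) = ms (k mod n)" by simp
  show "ms (k mod n) > 0" using ms r by simp
  show "(-1) ^ ((k + n) div n) * es ((k + n) mod n) = - ((-1) ^ (k div n) * es (k mod n))" using n by simp
  show "(-1) ^ (k div n) * es (k mod n) = 1 \<or> (-1) ^ (k div n) * es (k mod n) = -1"
    using es[OF r] by (cases "even (k div n)") auto
  show "(-1) ^ ((k + n) div n) * V ((k + n) mod n) = - ((-1) ^ (k div n) * V (k mod n))" using n by simp
  show "W ((k + n) mod n) = W (k mod n)" by simp
  have sc: "(Suc (k mod n) = n \<and> Suc k mod n = 0 \<and> Suc k div n = Suc (k div n)) \<or>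
        (Suc (k mod n) < n \<and> Suc k mod n = Suc (k mod n) \<and> Suc k div n = k div n)"
    using n Suc_lessI[OF r] by (auto simp: mod_Suc div_Suc)
  have th0: "th 0 \<le> th (k mod n)" "th (k mod n) \<le> th (n - 1)" using le r by auto
  show "th (k mod n) + pi * real (k div n) \<le> th (Suc k mod n) + pi * real (Suc k div n)"
    using sc th0 range mono[of "k mod n"] by (auto simp: algebra_simps)
  show "th (Suc k mod n) + pi * real (Suc k div n) < th (k mod n) + pi * real (k div n) + pi"
  proof (cases "Suc (k mod n) = n")
    case True
    hence "k mod n = n - 1" by linarith
    thus ?thesis using sc range True by (auto simp: algebra_simps)
  next
    case False
    hence "th (Suc k mod n) \<le> th (n - 1)" using sc le[of "Suc (k mod n)" "n - 1"] by auto
    thus ?thesis using sc False range th0 by auto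
  qed
  have c: "cis (th (k mod n) + pi * real (k div n)) = (-1) ^ (k div n) * cis (th (k mod n))"
  proof -
    have "cis (t + pi * real q) = (-1) ^ q * cis t" for t q
      by (induction q) (auto simp: algebra_simps complex_eq_iff)
    thus ?thesis .
  qed
  show "(-1) ^ (Suc k div n) * V (Suc k mod n) = (-1) ^ (k div n) * V (k mod n)
     + of_real (ms (k mod n)) * cis (th (k mod n) + pi * real (k div n))"
  proof -
    have "(-1) ^ (Suc k div n) * V (Suc k mod n) = (-1) ^ (k div n) * V (Suc (k mod n))"
      using sc V(2) by auto
    thus ?thesis unfolding c V(1)[OF r] by (simp add: algebra_simps)
  qed
  have sq: "(-1::complex) ^ q * (-1) ^ q = 1" for q by (simp add: power_mult_distrib[symmetric])
  show "W (Suc k mod n) = W (k mod n) + of_real ((-1) ^ (k div n) * es (k mod n) * ms (k mod n)) * cis (th (k mod n) + pi * real (k div n))"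
  proof -
    have "of_real ((-1) ^ (k div n) * es (k mod n) * ms (k mod n)) * cis (th (k mod n) + pi * real (k div n))
       = ((-1) ^ (k div n) * (-1) ^ (k div n)) * (of_real (es (k mod n) * ms (k mod n)) * cis (th (k mod n)))"
      unfolding c by (simp add: mult_ac)
    also have "\<dots> = of_real (es (k mod n) * ms (k mod n)) * cis (th (k mod n))" by (simp only: sq mult_1)
    finally show ?thesis using sc W(1)[OF r] W(2) by auto
  qed
qed

lemma filter_take_nth:
  assumes "k < length zs" "P (zs ! k)"
  shows "filter P zs ! length (filter P (take k zs)) = zs ! k" "length (filter P (take k zs)) < length (filter P zs)"
proof -
  have "zs = take k zs @ zs ! k # drop (Suc k) zs" using assms(1) by (rule id_take_nth_drop)
  hence e: "filter P zs = filter P (take k zs) @ zs ! k # filter P (drop (Suc k) zs)"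
    using assms(2) by (metis filter.simps(2) filter_append)
  show "filter P zs ! length (filter P (take k zs)) = zs ! k" by (subst e) simp
  show "length (filter P (take k zs)) < length (filter P zs)"
    using arg_cong[OF e, of length] by simp
qed

context convex_polygon begin

definition edge where "edge i = v (Suc i) - v i"

lemma edge_turn:
  assumes "Suc i < K" shows "cross (edge i) (edge (Suc i)) > 0"
proof -
  have "cross (edge i) (v (Suc (Suc i)) - v i) > 0"
  proof (cases "Suc (Suc i) = K")
    case True
    thus ?thesis using left[of i 0] v_K K by (simp add: edge_def)
  next
    case False
    thus ?thesis using left[of i "Suc (Suc i)"] assms by (simp add: edge_def)
  qed
  thus ?thesis by (simp add: edge_def cross_altdef algebra_simps)
qed

lemma edge_nonzero: "i < K \<Longrightarrow> edge i \<noteq> 0"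
  using edge_turn[of i] edge_turn[of "i - 1"] K by (cases "Suc i < K") (auto simp: cross_simps)

text \<open>The factor \<open>s\<close>, which will be \<open>1\<close> or \<open>- 1\<close>, treats the lower and the upper chain of the polygon at once.\<close>

lemma lexpos_path:
  assumes "i < j" "\<And>l. i \<le> l \<Longrightarrow> l < j \<Longrightarrow> lexpos (s *\<^sub>R edge l)"
  shows "lexpos (s *\<^sub>R (v j - v i))"
  using assms
proof (induction j rule: less_induct)
  case (less j)
  then obtain j' where j: "j = Suc j'" "i \<le> j'" by (cases j) auto
  have e: "s *\<^sub>R (v j - v i) = s *\<^sub>R edge j' + s *\<^sub>R (v j' - v i)"
    by (simp add: j edge_def algebra_simps)
  have l: "lexpos (s *\<^sub>R edge j')" using less.prems j by simp
  show ?case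
  proof (cases "i = j'")
    case True thus ?thesis unfolding e using l by simp
  next
    case False
    hence "lexpos (s *\<^sub>R (v j' - v i))" using less j by auto
    thus ?thesis unfolding e using l by (intro lexpos_add)
  qed
qed

text \<open>If both neighbours of a vertex come after it in the lexicographic order (before it, for \<open>s = - 1\<close>), then so does every
other vertex, because the polygon lies in the cone spanned by the two edges.\<close>

lemma corner:
  assumes "Suc k < K" "lexpos (s *\<^sub>R (- edge k))" "lexpos (s *\<^sub>R edge (Suc k))" "j < K" "v j \<noteq> v (Suc k)" "s = 1 \<or> s = -1"
  shows "lexpos (s *\<^sub>R (v j - v (Suc k)))"
proof -
  let ?a = "- edge k" and ?b = "edge (Suc k)" and ?x = "v j - v (Suc k)"
  have ab: "cross ?b ?a > 0" using edge_turn[OF assms(1)] cross_commute[of "edge k"] by (simp add: cross_simps)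
  have "cross (edge k) (v j - v k) \<ge> 0" using left_weak[of k j] assms by (simp add: edge_def)
  hence 1: "cross ?x ?a \<ge> 0" by (simp add: edge_def cross_altdef algebra_simps)
  have 2: "cross ?b ?x \<ge> 0" using left_weak[of "Suc k" j] assms by (simp add: edge_def)
  have x: "?x = (cross ?x ?a / cross ?b ?a) *\<^sub>R ?b + (cross ?b ?x / cross ?b ?a) *\<^sub>R ?a"
    by (rule cross_solve) (use ab in simp)
  define c d where "c = cross ?x ?a / cross ?b ?a" and "d = cross ?b ?x / cross ?b ?a"
  have cd: "c \<ge> 0" "d \<ge> 0" using ab 1 2 by (auto simp: c_def d_def)
  have x': "?x = c *\<^sub>R ?b + d *\<^sub>R ?a" unfolding c_def d_def by (rule x)
  have e: "s *\<^sub>R ?x = c *\<^sub>R (s *\<^sub>R ?b) + d *\<^sub>R (s *\<^sub>R ?a)"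
    by (subst x') (simp add: algebra_simps)
  have "s *\<^sub>R ?x \<noteq> 0" using assms(5,6) by auto
  thus ?thesis unfolding e using cd assms by (intro lexpos_comb) auto
qed

context
  assumes lexmin: "\<And>j. 0 < j \<Longrightarrow> j < K \<Longrightarrow> lexpos (v j - v 0)"
begin

lemma v_inj: "i < K \<Longrightarrow> j < K \<Longrightarrow> i \<noteq> j \<Longrightarrow> v i \<noteq> v j"
proof -
  have *: "v i \<noteq> v j" if "i < j" "j < K" for i j
  proof (cases "i = 0")
    case True thus ?thesis using lexmin[of j] that by (auto simp: lexpos_def)
  next
    case False thus ?thesis using fan[of i j] that by (auto simp: cross_simps(9))
  qed
  show "i < K \<Longrightarrow> j < K \<Longrightarrow> i \<noteq> j \<Longrightarrow> v i \<noteq> v j" using *[of i j] *[of j i] by (metis linorder_neqE_nat)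
qed

lemma lexmax_exists: "\<exists>M. 0 < M \<and> M < K \<and> (\<forall>j<K. j \<noteq> M \<longrightarrow> lexpos (v M - v j))"
proof -
  have "0 \<in> {..<K}" using K by simp
  hence "finite ((\<lambda>i. - v i) ` {..<K})" "(\<lambda>i. - v i) ` {..<K} \<noteq> {}" by blast+
  then obtain a where a: "a \<in> (\<lambda>i. - v i) ` {..<K}" "\<And>x. x \<in> (\<lambda>i. - v i) ` {..<K} \<Longrightarrow> x \<noteq> a \<Longrightarrow> lexpos (x - a)"
    using exists_lexmin by metis
  then obtain M where M: "M < K" "a = - v M" by auto
  have *: "lexpos (v M - v j)" if "j < K" "j \<noteq> M" for j
    using a(2)[of "- v j"] v_inj[of j M] that M by auto
  have "M \<noteq> 0"
  proof
    assume "M = 0"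
    thus False using *[of 1] lexmin[of 1] lexpos_not(1)[of "v 1 - v 0"] K by simp
  qed
  thus ?thesis using * M by blast
qed

text \<open>The index of the lexicographically largest vertex.\<close>

definition M where "M = (SOME M. 0 < M \<and> M < K \<and> (\<forall>j<K. j \<noteq> M \<longrightarrow> lexpos (v M - v j)))"

lemma M: "0 < M" "M < K" "\<And>j. j < K \<Longrightarrow> j \<noteq> M \<Longrightarrow> lexpos (v M - v j)"
  using someI_ex[OF lexmax_exists] unfolding M_def by auto

text \<open>From the smallest to the largest vertex every edge points forward: otherwise there is a vertex where the direction
changes from backward to forward, by \<open>corner\<close> this is the smallest vertex, and that is \<open>v 0\<close>. The
statement for the way back is symmetric.\<close>

lemma lower_edge:
  assumes "i < M" shows "lexpos (edge i)"
proof (rule ccontr)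
  assume n: "\<not> lexpos (edge i)"
  have "\<exists>l. i \<le> l \<and> l < M \<and> lexpos (edge l)"
  proof (rule ccontr)
    assume no: "\<not> ?thesis"
    have "lexpos ((-1) *\<^sub>R edge l)" if "i \<le> l" "l < M" for l
      using no that lexpos_or[OF edge_nonzero[of l]] M by auto
    hence "lexpos ((-1) *\<^sub>R (v M - v i))" by (rule lexpos_path[OF assms])
    moreover have "lexpos (v M - v i)" using M assms by auto
    ultimately show False using lexpos_not(1) by fastforce
  qed
  then obtain l where l: "i \<le> l" "l < M" "lexpos (edge l)" by blast
  define k where "k = (LEAST l. i \<le> l \<and> lexpos (edge l))"
  have k: "i \<le> k" "lexpos (edge k)" "k \<le> l"
    using LeastI[of "\<lambda>l. i \<le> l \<and> lexpos (edge l)" l] Least_le[of "\<lambda>l. i \<le> l \<and> lexpos (edge l)" l] l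
    unfolding k_def by auto
  have "k \<noteq> i" using k n by auto
  then obtain k' where k': "k = Suc k'" "i \<le> k'" using k by (cases k) auto
  have "\<not> lexpos (edge k')"
    using not_less_Least[of k' "\<lambda>l. i \<le> l \<and> lexpos (edge l)"] k' unfolding k_def by auto
  hence "lexpos (1 *\<^sub>R (- edge k'))" using lexpos_or[OF edge_nonzero[of k']] k' k l M by auto
  hence "lexpos (1 *\<^sub>R (v 0 - v (Suc k')))"
    using k k' l M v_inj[of 0 k] by (intro corner) auto
  moreover have "lexpos (v k - v 0)" using lexmin[of k] k k' l M by auto
  ultimately show False using lexpos_not(1)[of "v k - v 0"] k' by simp
qed

lemma upper_edge:
  assumes "M \<le> i" "i < K" shows "lexpos (- edge i)"
proof (rule ccontr)
  assume n: "\<not> lexpos (- edge i)"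
  have "\<exists>l. i \<le> l \<and> l < K \<and> lexpos (- edge l)"
  proof (rule ccontr)
    assume no: "\<not> ?thesis"
    have "lexpos (1 *\<^sub>R edge l)" if "i \<le> l" "l < K" for l
      using no that lexpos_or[OF edge_nonzero[of l]] by auto
    hence "lexpos (1 *\<^sub>R (v K - v i))" by (rule lexpos_path[OF assms(2)])
    moreover have "lexpos (v i - v 0)" using M assms lexmin[of i] by auto
    ultimately show False using lexpos_not(1)[of "v i - v 0"] v_K by simp
  qed
  then obtain l where l: "i \<le> l" "l < K" "lexpos (- edge l)" by blast
  define k where "k = (LEAST l. i \<le> l \<and> lexpos (- edge l))"
  have k: "i \<le> k" "lexpos (- edge k)" "k \<le> l"
    using LeastI[of "\<lambda>l. i \<le> l \<and> lexpos (- edge l)" l] Least_le[of "\<lambda>l. i \<le> l \<and> lexpos (- edge l)" l] l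
    unfolding k_def by auto
  have "k \<noteq> i" using k n by auto
  then obtain k' where k': "k = Suc k'" "i \<le> k'" using k by (cases k) auto
  have "\<not> lexpos (- edge k')"
    using not_less_Least[of k' "\<lambda>l. i \<le> l \<and> lexpos (- edge l)"] k' unfolding k_def by auto
  hence "lexpos ((-1) *\<^sub>R (- edge k'))" using lexpos_or[OF edge_nonzero[of k']] k' k l by auto
  hence "lexpos ((-1) *\<^sub>R (v M - v (Suc k')))"
    using k k' l M assms v_inj[of M k] by (intro corner) auto
  moreover have "lexpos (v M - v k)" using M(3)[of k] k k' l assms by auto
  ultimately show False using lexpos_not(1)[of "v M - v k"] k' by simp
qed

end
end

context convex_polygon begin

text \<open>Half edges of the lower chain and reversed half edges of the upper chain, marked by the chain they come from. All point
forward, and \<open>zs\<close> merges the two chains by argument: this is the order in which rotating supporting lines meet the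
sides. After \<open>k\<close> events the contact points are \<open>P k\<close> on the lower and \<open>Q k\<close> on the upper chain.\<close>

definition low where "low = map (\<lambda>i. (edge i / 2, True)) [0..<M]"
definition upp where "upp = map (\<lambda>i. (- edge i / 2, False)) [M..<K]"
definition akey :: "complex \<times> bool \<Rightarrow> real" where "akey z = Arg (fst z)"
definition zs where "zs = sort_key akey (low @ upp)"
definition ic where "ic k = length (filter snd (take k zs))"
definition jc where "jc k = length (filter (\<lambda>z. \<not> snd z) (take k zs))"
definition P where "P k = v (ic k)"
definition Q where "Q k = v (M + jc k)"
definition VV where "VV k = (P k - Q k) / 2"
definition WW where "WW k = (P k + Q k) / 2"
definition th where "th k = akey (zs ! k)"
definition ms where "ms k = norm (fst (zs ! k))"
definition es :: "nat \<Rightarrow> real" where "es k = (if snd (zs ! k) then 1 else -1)"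

context
  assumes lexmin: "\<And>j. 0 < j \<Longrightarrow> j < K \<Longrightarrow> lexpos (v j - v 0)"
begin

lemmas Mf = M[OF lexmin]

lemma lexpos_half: "lexpos z \<Longrightarrow> lexpos (z / 2)" "lexpos (- z) \<Longrightarrow> lexpos (- (z / 2))"
  by (auto simp: lexpos_def)

lemma cross_half: "cross (a / 2) (b / 2) = cross a b / 4"
  by (simp add: cross_altdef algebra_simps)

lemma akey_low: "Suc i < M \<Longrightarrow> akey (low ! i) < akey (low ! Suc i)"
proof -
  assume i: "Suc i < M"
  have l: "lexpos (edge i / 2)" "lexpos (edge (Suc i) / 2)"
    using lower_edge[OF lexmin] i by (auto intro!: lexpos_half)
  have "cross (edge i / 2) (edge (Suc i) / 2) > 0"
    unfolding cross_half using edge_turn[of i] i Mf by simp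
  thus ?thesis unfolding cross_pos_iff_Arg[OF l] using i by (simp add: low_def akey_def)
qed

lemma akey_upp: "Suc i < K - M \<Longrightarrow> akey (upp ! i) < akey (upp ! Suc i)"
proof -
  assume i: "Suc i < K - M"
  have l: "lexpos (- edge (M + i) / 2)" "lexpos (- edge (M + Suc i) / 2)"
    using upper_edge[OF lexmin] i by (auto intro!: lexpos_half)
  have "cross (- edge (M + i) / 2) (- edge (M + Suc i) / 2) > 0"
    unfolding cross_half using edge_turn[of "M + i"] i by (simp add: cross_simps)
  thus ?thesis unfolding cross_pos_iff_Arg[OF l] using i by (simp add: upp_def akey_def)
qed

lemma len: "length low = M" "length upp = K - M" "length zs = K"
  using Mf by (auto simp: low_def upp_def zs_def)

text \<open>Both chains are sorted by convexity, so merging them by a stable sort keeps their internal order.\<close>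

lemma filters: "filter snd zs = low" "filter (\<lambda>z. \<not> snd z) zs = upp"
proof -
  have s: "sorted (map akey low)" "sorted (map akey upp)"
    unfolding sorted_iff_nth_Suc using akey_low akey_upp len by (auto simp: less_imp_le)
  have f: "filter snd (low @ upp) = low" "filter (\<lambda>z. \<not> snd z) (low @ upp) = upp"
    by (auto simp: low_def upp_def filter_empty_conv intro!: filter_True)
  show "filter snd zs = low" "filter (\<lambda>z. \<not> snd z) zs = upp"
    unfolding zs_def filter_sort f by (intro sort_key_id_if_sorted s)+
qed

lemma lexpos_zs: "k < K \<Longrightarrow> lexpos (fst (zs ! k))"
proof -
  assume "k < K"
  hence "zs ! k \<in> set zs" using len by simp
  hence "zs ! k \<in> set low \<union> set upp" by (simp add: zs_def)
  thus ?thesis using lower_edge[OF lexmin] upper_edge[OF lexmin] by (auto simp: low_def upp_def intro!: lexpos_half)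
qed

lemma th_mono: "i \<le> j \<Longrightarrow> j < K \<Longrightarrow> th i \<le> th j"
  using sorted_nth_mono[of "map akey zs" i j] len by (simp add: th_def zs_def)

lemma th_range: "th 0 < th (K - 1)" "th (K - 1) < th 0 + pi"
proof -
  have sz: "set zs = set low \<union> set upp" by (simp add: zs_def)
  have "\<exists>a b. a \<in> set zs \<and> b \<in> set zs \<and> akey a < akey b"
  proof (cases "1 < M")
    case True
    have "low ! 0 \<in> set low" "low ! 1 \<in> set low" using True len by (auto intro!: nth_mem)
    thus ?thesis using akey_low[of 0] True sz by (intro exI[of _ "low ! 0"] exI[of _ "low ! 1"]) auto
  next
    case False
    hence "1 < K - M" using K by auto
    moreover from this have "upp ! 0 \<in> set upp" "upp ! 1 \<in> set upp" using len by (auto intro!: nth_mem)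
    ultimately show ?thesis using akey_upp[of 0] sz by (intro exI[of _ "upp ! 0"] exI[of _ "upp ! 1"]) auto
  qed
  then obtain a b where ab: "a \<in> set zs" "b \<in> set zs" "akey a < akey b" by blast
  then obtain i j where "i < K" "zs ! i = a" "j < K" "zs ! j = b" using len by (metis in_set_conv_nth)
  hence "th 0 \<le> akey a" "akey b \<le> th (K - 1)" using th_mono[of 0 i] th_mono[of j "K - 1"] by (auto simp: th_def)
  thus "th 0 < th (K - 1)" using ab by simp
  have "lexpos (fst (zs ! 0))" "lexpos (fst (zs ! (K - 1)))" using lexpos_zs K by auto
  thus "th (K - 1) < th 0 + pi"
    using Arg_lexpos[of "fst (zs ! 0)"] Arg_lexpos[of "fst (zs ! (K - 1))"] by (simp add: th_def akey_def)
qed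

lemma counts: "k \<le> K \<Longrightarrow> ic k \<le> M" "k \<le> K \<Longrightarrow> jc k \<le> K - M" "ic K = M" "jc K = K - M" "ic 0 = 0" "jc 0 = 0"
proof -
  have a: "length (filter R (take k xs)) \<le> length (filter R xs)" for R k and xs :: "(complex \<times> bool) list"
    by (metis append_take_drop_id filter_append length_append le_add1)
  show "ic k \<le> M" "jc k \<le> K - M"
    using a[where R=snd and xs=zs] a[where R="\<lambda>z. \<not> snd z" and xs=zs] filters len
    by (auto simp: ic_def jc_def)
  show "ic K = M" "jc K = K - M" "ic 0 = 0" "jc 0 = 0"
    using filters len by (auto simp: ic_def jc_def)
qed

lemma step_low:
  assumes "k < K" "snd (zs ! k)"
  shows "ic (Suc k) = Suc (ic k)" "jc (Suc k) = jc k" "edge (ic k) = 2 * fst (zs ! k)"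
proof -
  have t: "take (Suc k) zs = take k zs @ [zs ! k]" using assms len by (simp add: take_Suc_conv_app_nth)
  show "ic (Suc k) = Suc (ic k)" "jc (Suc k) = jc k" using assms by (auto simp: ic_def jc_def t)
  have "low ! ic k = zs ! k" "ic k < M"
    using filter_take_nth[of k zs snd] assms len filters by (auto simp: ic_def)
  thus "edge (ic k) = 2 * fst (zs ! k)" by (auto simp: low_def dest!: arg_cong[of _ "zs ! k" fst])
qed

lemma step_upp:
  assumes "k < K" "\<not> snd (zs ! k)"
  shows "ic (Suc k) = ic k" "jc (Suc k) = Suc (jc k)" "edge (M + jc k) = - 2 * fst (zs ! k)"
proof -
  have t: "take (Suc k) zs = take k zs @ [zs ! k]" using assms len by (simp add: take_Suc_conv_app_nth)
  show "ic (Suc k) = ic k" "jc (Suc k) = Suc (jc k)" using assms by (auto simp: ic_def jc_def t)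
  have "upp ! jc k = zs ! k" "jc k < K - M"
    using filter_take_nth[of k zs "\<lambda>z. \<not> snd z"] assms len filters by (auto simp: jc_def)
  hence "fst (zs ! k) = - edge (M + jc k) / 2" by (auto simp: upp_def dest!: arg_cong[of _ "zs ! k" fst])
  thus "edge (M + jc k) = - 2 * fst (zs ! k)" by simp
qed

lemma polar: "k < K \<Longrightarrow> fst (zs ! k) = of_real (ms k) * cis (th k)"
  unfolding ms_def th_def akey_def by (rule polar_Arg) (use lexpos_zs lexpos_nonzero in blast)

lemma PQ_step:
  assumes "k < K"
  shows "VV (Suc k) = VV k + of_real (ms k) * cis (th k)"
    "WW (Suc k) = WW k + of_real (es k * ms k) * cis (th k)"
proof -
  have "VV (Suc k) = VV k + fst (zs ! k) \<and> WW (Suc k) = WW k + of_real (es k) * fst (zs ! k)"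
  proof (cases "snd (zs ! k)")
    case True
    note s = step_low[OF assms True]
    have p: "P (Suc k) = P k + 2 * fst (zs ! k)" using s(3) by (simp add: P_def s(1) edge_def algebra_simps)
    have q: "Q (Suc k) = Q k" by (simp add: Q_def s(2))
    show ?thesis using True by (simp add: VV_def WW_def p q es_def field_simps)
  next
    case False
    note s = step_upp[OF assms False]
    have p: "P (Suc k) = P k" by (simp add: P_def s(1))
    have q: "Q (Suc k) = Q k - 2 * fst (zs ! k)" using s(3) by (simp add: Q_def s(2) edge_def algebra_simps)
    show ?thesis using False by (simp add: VV_def WW_def p q es_def field_simps)
  qed
  thus "VV (Suc k) = VV k + of_real (ms k) * cis (th k)"
    "WW (Suc k) = WW k + of_real (es k * ms k) * cis (th k)"
    using polar[OF assms] by (simp_all add: mult.assoc)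
qed

lemma wrap: "VV K = - VV 0" "WW K = WW 0"
proof -
  have "M + (K - M) = K" using Mf by simp
  thus "VV K = - VV 0" "WW K = WW 0"
    by (simp_all add: VV_def WW_def P_def Q_def counts v_K minus_divide_left add.commute)
qed

definition cV :: "nat \<Rightarrow> complex" where "cV k = (-1) ^ (k div K) * VV (k mod K)"
definition cW where "cW k = WW (k mod K)"
definition cth where "cth k = th (k mod K) + pi * real (k div K)"
definition cms where "cms k = ms (k mod K)"
definition ces where "ces k = (-1) ^ (k div K) * es (k mod K)"

lemma caliper: "caliper K cth cms ces cV cW"
  unfolding cV_def[abs_def] cW_def[abs_def] cth_def[abs_def] cms_def[abs_def] ces_def[abs_def]
proof (rule caliper_extend)
  show "K > 0" using K by simp
  show "ms k > 0" if "k < K" for k using lexpos_zs[OF that] lexpos_nonzero by (simp add: ms_def)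
  show "es k = 1 \<or> es k = -1" for k by (simp add: es_def)
  show "th k \<le> th (Suc k)" if "Suc k < K" for k using th_mono[of k "Suc k"] that by simp
qed (use th_range PQ_step wrap in auto)

text \<open>The polygon is the union of the two chains, and every event moves exactly one of the points \<open>P\<close> and \<open>Q\<close> along an edge.\<close>

lemma area_sum: "caliper.even_area K cV + caliper.odd_area K cW = shoelace / 2"
proof -
  have per: "cV (Suc k) = VV (Suc k)" "cW (Suc k) = WW (Suc k)" "cV k = VV k" "cW k = WW k" if "k < K" for k
    using that wrap by (cases "Suc k = K"; simp add: cV_def cW_def)+
  have "caliper.even_area K cV + caliper.odd_area K cW
    = (\<Sum>k<K. cross (VV k) (VV (Suc k)) + cross (WW k) (WW (Suc k)))"
    unfolding caliper.even_area_def[OF caliper] caliper.odd_area_def[OF caliper] sum.distrib[symmetric]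
    by (rule sum.cong) (auto simp: per)
  also have "\<dots> = (\<Sum>k<K. (cross (P k) (P (Suc k)) + cross (Q k) (Q (Suc k))) / 2)"
    by (rule sum.cong[OF refl]) (simp add: VV_def WW_def cross_altdef field_simps)
  also have "\<dots> = (\<Sum>k<K. cross (P k) (P (Suc k)) + cross (Q k) (Q (Suc k))) / 2"
    by (rule sum_divide_distrib[symmetric])
  also have "(\<Sum>k<N. cross (P k) (P (Suc k)) + cross (Q k) (Q (Suc k)))
     = (\<Sum>i<ic N. cross (v i) (v (Suc i))) + (\<Sum>j<jc N. cross (v (M + j)) (v (M + Suc j)))" if "N \<le> K" for N
    using that
  proof (induction N)
    case 0 show ?case by (simp add: counts)
  next
    case (Suc N)
    show ?case
    proof (cases "snd (zs ! N)")
      case True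
      thus ?thesis using Suc step_low[of N] by (simp add: P_def Q_def cross_simps(9))
    next
      case False
      thus ?thesis using Suc step_upp[of N] by (simp add: P_def Q_def cross_simps(9))
    qed
  qed
  from this[of K] have "(\<Sum>k<K. cross (P k) (P (Suc k)) + cross (Q k) (Q (Suc k)))
     = (\<Sum>i<M. cross (v i) (v (Suc i))) + (\<Sum>j<K - M. cross (v (M + j)) (v (M + Suc j)))"
    by (simp only: counts order_refl)
  also have "(\<Sum>j<K - M. cross (v (M + j)) (v (M + Suc j))) = (\<Sum>i\<in>{M..<K}. cross (v i) (v (Suc i)))"
    by (rule sum.reindex_bij_witness[of _ "\<lambda>i. i - M" "\<lambda>j. M + j"]) auto
  also have "(\<Sum>i<M. cross (v i) (v (Suc i))) + (\<Sum>i\<in>{M..<K}. cross (v i) (v (Suc i))) = shoelace"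
    unfolding shoelace_def using Mf by (subst sum.union_disjoint[symmetric]) (auto intro!: sum.cong)
  finally show ?thesis .
qed

lemma deficit:
  assumes small: "\<And>i j. i < K \<Longrightarrow> j < K \<Longrightarrow> dist (v i) (v j) \<le> 1" and nu: "\<nu> > 0"
  shows "\<exists>c\<ge>0. (\<forall>h\<ge>3. K = 2 * h \<longrightarrow> c \<ge> 2 * tau - 800 * (3/4) ^ h) \<and>
    (pi / 4 - shoelace / 2) * (1 + 20 * \<nu>\<^sup>2) \<ge> 2 * \<nu> ^ 3 * c - 40/3 * K * \<nu> ^ 3 + 5 * \<nu>\<^sup>2 * pi"
proof -
  have d: "dist (v i) (v j) \<le> 1" if "i \<le> K" "j \<le> K" for i j
  proof -
    have r: "\<exists>i'<K. v i' = v i" if "i \<le> K" for i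
    proof (cases "i = K")
      case True thus ?thesis using v_K K by (intro exI[of _ 0]) auto
    next
      case False thus ?thesis using that by (intro exI[of _ i]) auto
    qed
    thus ?thesis using small that by metis
  qed
  have cs: "norm (cV k) \<le> 1/2" for k
  proof -
    define r where "r = k mod K"
    have r: "r \<le> K" using K by (simp add: r_def less_imp_le)
    have "norm (cV k) = norm (VV r)" by (simp add: cV_def norm_mult norm_power r_def)
    also have "\<dots> = dist (P r) (Q r) / 2" by (simp add: VV_def dist_norm norm_divide)
    also have "dist (P r) (Q r) \<le> 1" unfolding P_def Q_def
      using counts(1,2)[OF r] Mf by (intro d) auto
    finally show ?thesis by simp
  qed
  let ?z = "zigzag.cost K (\<lambda>k. caliper.p K cms ces k / \<nu>) (\<lambda>k. caliper.g cV k / \<nu>\<^sup>2)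
     (\<lambda>k. caliper.A cth cV k / \<nu>) (\<lambda>k. caliper.B cth cV k / \<nu>)"
  note zz = caliper.zigzag_scaled[OF caliper cs nu]
  show ?thesis
  proof (intro exI[of _ ?z] conjI allI impI)
    show "?z \<ge> 0" by (rule zigzag.cost_nonneg[OF zz])
    show "?z \<ge> 2 * tau - 800 * (3/4) ^ h" if "3 \<le> h" "K = 2 * h" for h
      by (rule zigzag.cost_lower[OF zz that(2,1)])
    show "(pi / 4 - shoelace / 2) * (1 + 20 * \<nu>\<^sup>2) \<ge> 2 * \<nu> ^ 3 * ?z - 40/3 * K * \<nu> ^ 3 + 5 * \<nu>\<^sup>2 * pi"
      using caliper.area_deficit[OF caliper cs nu] unfolding area_sum .
  qed
qed

end
end

text \<open>If the hull has \<open>K < n\<close> vertices, then the missing \<open>n - K\<close> sides enter the bound with \<open>20/3\<close> each, which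
is more than \<open>2 \<tau>\<close>, and a nonnegative cost suffices. So the case of even \<open>K = n\<close> decides.\<close>

section \<open>The upper bound for hulls of finite sets of diameter one\<close>

theorem hull_area_upper:
  fixes S :: "complex set"
  assumes S: "finite S" "card S \<le> n" "\<And>x y. x \<in> S \<Longrightarrow> y \<in> S \<Longrightarrow> dist x y \<le> 1"
    and n: "n = 2 * h" "h \<ge> 3" and nu: "\<nu> > 0"
  shows "measure lebesgue (convex hull S) = 0 \<or>
    (pi / 4 - measure lebesgue (convex hull S)) * (1 + 20 * \<nu>\<^sup>2)
       \<ge> 2 * \<nu> ^ 3 * (2 * tau - 800 * (3/4) ^ h) - 40/3 * n * \<nu> ^ 3 + 5 * \<nu>\<^sup>2 * pi"
proof (cases rule: polygon_of_points[OF S(1)])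
  case 1 thus ?thesis by simp
next
  case (2 K v)
  interpret convex_polygon K v by (rule 2(1))
  have small: "dist (v i) (v j) \<le> 1" if "i < K" "j < K" for i j
    using S(3) 2(3) that by blast
  obtain c where c: "c \<ge> 0" "\<And>h. h \<ge> 3 \<Longrightarrow> K = 2 * h \<Longrightarrow> c \<ge> 2 * tau - 800 * (3/4) ^ h"
    "(pi / 4 - shoelace / 2) * (1 + 20 * \<nu>\<^sup>2) \<ge> 2 * \<nu> ^ 3 * c - 40/3 * K * \<nu> ^ 3 + 5 * \<nu>\<^sup>2 * pi"
    using deficit[OF 2(5) small nu] by blast
  have Kn: "K \<le> n" using 2(2) S(2) by simp
  have pw: "(3/4::real) ^ h \<ge> 0" by simp
  have key: "c + 20/3 * (real n - real K) \<ge> 2 * tau - 800 * (3/4) ^ h"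
  proof (cases "K = n")
    case True
    hence "K = 2 * h" using n(1) by simp
    thus ?thesis using c(2)[OF n(2)] True by simp
  next
    case False
    define d where "d = real n - real K"
    have "d \<ge> 1" using False Kn unfolding d_def by linarith
    hence "20/3 * d \<ge> 20/3" by simp
    moreover have "2 * tau \<le> 23/6" using tau_le by simp
    ultimately have "2 * tau \<le> c + 20/3 * d" using c(1) by argo
    hence "2 * tau \<le> c + 20/3 * (real n - real K)" by (simp only: d_def)
    moreover have "2 * tau - 800 * (3/4) ^ h \<le> 2 * tau" using pw by simp
    ultimately show ?thesis by (rule order_trans[rotated])
  qed
  have "2 * \<nu> ^ 3 * (2 * tau - 800 * (3/4) ^ h) - 40/3 * n * \<nu> ^ 3 + 5 * \<nu>\<^sup>2 * pi
     \<le> 2 * \<nu> ^ 3 * (c + 20/3 * (real n - real K)) - 40/3 * n * \<nu> ^ 3 + 5 * \<nu>\<^sup>2 * pi"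
    using key nu by simp
  also have "\<dots> = 2 * \<nu> ^ 3 * c - 40/3 * K * \<nu> ^ 3 + 5 * \<nu>\<^sup>2 * pi" by (simp add: field_simps)
  also have "\<dots> \<le> (pi / 4 - shoelace / 2) * (1 + 20 * \<nu>\<^sup>2)" by (rule c(3))
  also have "\<dots> \<le> (pi / 4 - measure lebesgue (convex hull S)) * (1 + 20 * \<nu>\<^sup>2)"
    using area_hull_le 2(4) by (intro mult_right_mono) (auto simp: region_def add_nonneg_nonneg)
  finally show ?thesis by simp
qed

section \<open>Simple polygons and their convex hulls\<close>

context convex_polygon begin

lemma tri_subset_region: "i < K - 1 \<Longrightarrow> tri i \<subseteq> region"
  unfolding tri_def region_def using K by (intro hull_mono) auto

lemma halfplanes_subset_region:
  "(\<And>i. i < K \<Longrightarrow> cross (v (Suc i) - v i) (x - v i) \<ge> 0) \<Longrightarrow> x \<in> region"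
  using halfplanes_subset_fan[of x] tri_subset_region by fastforce

text \<open>The strict half-planes form an open set inside the region.\<close>

lemma interior_region:
  assumes "\<And>i. i < K \<Longrightarrow> cross (v (Suc i) - v i) (x - v i) > 0"
  shows "x \<in> interior region"
proof (rule interiorI)
  define U where "U = (\<Inter>i\<in>{..<K}. {x. cross (v (Suc i) - v i) (x - v i) > 0})"
  have "open {x. cross (v (Suc i) - v i) (x - v i) > 0}" for i
  proof -
    have "continuous_on UNIV (\<lambda>x. cross (v (Suc i) - v i) (x - v i))"
      unfolding cross_def by (intro continuous_intros)
    thus ?thesis by (intro open_Collect_less continuous_on_const)
  qed
  thus "open U" unfolding U_def by (intro open_INT) simp_all
  show "x \<in> U" unfolding U_def using assms by simp
  show "U \<subseteq> region"
  proof
    fix y assume y: "y \<in> U"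
    show "y \<in> region"
    proof (rule halfplanes_subset_region)
      fix i assume "i < K"
      hence "cross (v (Suc i) - v i) (y - v i) > 0" using y unfolding U_def by simp
      thus "cross (v (Suc i) - v i) (y - v i) \<ge> 0" by (rule less_imp_le)
    qed
  qed
qed

text \<open>In a convex combination of the vertices the distance from an edge is the combination of the distances of the
vertices. If it vanishes, only the two ends of the edge have positive weights.\<close>

lemma face_point:
  assumes x: "x \<in> region" and i: "i < K" and z: "cross (v (Suc i) - v i) (x - v i) = 0"
  shows "x \<in> closed_segment (v i) (v (Suc i mod K))"
proof -
  define i' where "i' = Suc i mod K"
  have i': "i' < K" "i' \<noteq> i" "v i' = v (Suc i)"
  proof -
    show "i' < K" using K by (simp add: i'_def)
    show "v i' = v (Suc i)" using v_Suc_mod[OF i] by (simp add: i'_def)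
    show "i' \<noteq> i" using i K by (cases "Suc i = K") (auto simp: i'_def)
  qed
  have fin: "finite (v ` {..<K})" by simp
  obtain c where c: "\<And>y. y \<in> v ` {..<K} \<Longrightarrow> c y \<ge> 0" "sum c (v ` {..<K}) = 1" "(\<Sum>y\<in>v ` {..<K}. c y *\<^sub>R y) = x"
    using x unfolding region_def convex_hull_finite[OF fin] by blast
  let ?X = "v ` {..<K}"
  have "(\<Sum>y\<in>?X. c y * cross (v (Suc i) - v i) (y - v i)) = cross (v (Suc i) - v i) (\<Sum>y\<in>?X. c y *\<^sub>R (y - v i))"
    by (simp only: linear_sum[OF linear_cross] cross_simps(6))
  also have "(\<Sum>y\<in>?X. c y *\<^sub>R (y - v i)) = x - v i"
  proof -
    have "(\<Sum>y\<in>?X. c y *\<^sub>R (y - v i)) = (\<Sum>y\<in>?X. c y *\<^sub>R y) - (\<Sum>y\<in>?X. c y) *\<^sub>R v i"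
      by (simp only: scaleR_diff_right sum_subtractf scaleR_left.sum)
    thus ?thesis by (simp only: c(2,3) scaleR_one)
  qed
  finally have s0: "(\<Sum>y\<in>?X. c y * cross (v (Suc i) - v i) (y - v i)) = 0" using z by simp
  have nn: "c y * cross (v (Suc i) - v i) (y - v i) \<ge> 0" if "y \<in> ?X" for y
  proof -
    from that obtain j where "j < K" "y = v j" by blast
    thus ?thesis using c(1)[OF that] left_weak[OF i, of j] by simp
  qed
  have zero: "c y = 0" if "y \<in> ?X" "y \<noteq> v i" "y \<noteq> v i'" for y
  proof -
    from that(1) obtain j where j: "j < K" "y = v j" by auto
    hence "j \<noteq> i" "j \<noteq> i'" using that(2,3) by blast+
    hence "cross (v (Suc i) - v i) (y - v i) > 0" using left[OF i j(1)] j(2) by (simp add: i'_def)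
    moreover have "\<forall>y\<in>?X. c y * cross (v (Suc i) - v i) (y - v i) = 0"
      by (rule iffD1[OF sum_nonneg_eq_0_iff[OF fin] s0]) (rule nn)
    hence "c y * cross (v (Suc i) - v i) (y - v i) = 0" using that(1) by blast
    ultimately show ?thesis by simp
  qed
  have sub: "{v i, v i'} \<subseteq> ?X" using i i'(1) by blast
  have "sum c {v i, v i'} = 1" "(\<Sum>y\<in>{v i, v i'}. c y *\<^sub>R y) = x"
  proof -
    have "sum c {v i, v i'} = sum c ?X"
      by (rule sum.mono_neutral_left[OF fin sub]) (use zero in blast)
    thus "sum c {v i, v i'} = 1" by (simp only: c(2))
    have "(\<Sum>y\<in>{v i, v i'}. c y *\<^sub>R y) = (\<Sum>y\<in>?X. c y *\<^sub>R y)"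
      by (rule sum.mono_neutral_left[OF fin sub]) (use zero in simp)
    thus "(\<Sum>y\<in>{v i, v i'}. c y *\<^sub>R y) = x" by (simp only: c(3))
  qed
  moreover have f2: "finite {v i, v i'}" by simp
  moreover have "\<forall>y\<in>{v i, v i'}. 0 \<le> c y" using c(1) sub by blast
  ultimately have "x \<in> convex hull {v i, v i'}"
    unfolding convex_hull_finite[OF f2] by blast
  thus ?thesis by (simp add: segment_convex_hull i'_def)
qed

lemma frontier_region: "frontier region \<subseteq> (\<Union>i<K. polygon_edge K v i)"
proof
  fix x assume x: "x \<in> frontier region"
  hence xr: "x \<in> region" "x \<notin> interior region"
    using compact_imp_closed[OF compact_region] by (auto simp: frontier_def)
  have "cross (v (Suc i) - v i) (x - v i) \<ge> 0" if "i < K" for i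
    by (rule hull_left_side[OF _ xr(1)[unfolded region_def]]) (use left_weak[OF that] in auto)
  moreover have "\<not> (\<forall>i<K. cross (v (Suc i) - v i) (x - v i) > 0)"
    using interior_region[of x] xr(2) by blast
  ultimately obtain i where "i < K" "cross (v (Suc i) - v i) (x - v i) = 0"
    by (metis order_le_less)
  thus "x \<in> (\<Union>i<K. polygon_edge K v i)" using face_point[OF xr(1)] by (auto simp: polygon_edge_def)
qed

text \<open>The union \<open>E\<close> of the edges contains the frontier of the region, so a point of the region outside \<open>E\<close> cannot be
connected to infinity in the complement of \<open>E\<close> without crossing the frontier. Hence the region
is covered by the inside of \<open>E\<close> and the null set \<open>E\<close>.\<close>

lemma region_le_polygon_area: "measure lebesgue region \<le> polygon_area K v"
proof -
  define E where "E = (\<Union>i<K. polygon_edge K v i)"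
  have comp: "compact E" unfolding E_def by (intro compact_UN) (auto simp: polygon_edge_def)
  have br: "bounded region" using compact_region by (rule compact_imp_bounded)
  have Esub: "E \<subseteq> region"
  proof -
    have cv: "convex region" by (simp add: region_def)
    have vr: "v i \<in> region" if "i < K" for i
      unfolding region_def by (rule hull_inc) (use that in simp)
    have "polygon_edge K v i \<subseteq> region" if "i < K" for i
      unfolding polygon_edge_def
      by (rule closed_segment_subset[OF vr[OF that] vr cv]) (use K in simp)
    thus ?thesis unfolding E_def by (rule UN_least) simp
  qed
  have sub: "region \<subseteq> inside E \<union> E"
  proof
    fix x assume x: "x \<in> region"
    show "x \<in> inside E \<union> E"
    proof (rule ccontr)
      assume n: "x \<notin> inside E \<union> E"
      hence xE: "x \<in> - E" by auto
      let ?C = "connected_component_set (- E) x"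
      have "\<not> bounded ?C" using n xE unfolding inside_def by blast
      hence "\<not> ?C \<subseteq> region" using br bounded_subset by blast
      moreover have "x \<in> ?C" using xE by (simp add: connected_component_refl)
      ultimately have "?C \<inter> frontier region \<noteq> {}"
        using x by (intro connected_Int_frontier connected_connected_component) blast+
      moreover have "?C \<subseteq> - E" by (rule connected_component_subset)
      ultimately show False using frontier_region unfolding E_def by blast
    qed
  qed
  have mE: "E \<in> lmeasurable" using comp by (rule lmeasurable_compact)
  have mI: "inside E \<in> lmeasurable"
    by (rule lmeasurable_open[OF bounded_inside[OF compact_imp_bounded[OF comp]] open_inside[OF compact_imp_closed[OF comp]]])
  have "measure lebesgue E \<le> (\<Sum>i<K. measure lebesgue (polygon_edge K v i))"
    unfolding E_def by (rule measure_UNION_le) (simp_all add: polygon_edge_def fmeasurableD lmeasurable_compact)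
  also have "\<dots> = 0"
  proof (rule sum.neutral, rule ballI)
    fix i
    have "measure lebesgue (convex hull {v i, v (Suc i mod K), v (Suc i mod K)}) = 0"
      by (subst area_triangle) (simp add: cross_simps(9) del: insert_absorb2)
    thus "measure lebesgue (polygon_edge K v i) = 0" by (simp add: polygon_edge_def segment_convex_hull)
  qed
  finally have E0: "measure lebesgue E \<le> 0" .
  have "measure lebesgue region \<le> measure lebesgue (inside E \<union> E)"
    by (rule measure_mono_fmeasurable[OF sub fmeasurableD[OF lmeasurable_region] fmeasurable.Un[OF mI mE]])
  also have "\<dots> \<le> measure lebesgue (inside E) + measure lebesgue E"
    by (rule measure_Un_le[OF fmeasurableD[OF mI] fmeasurableD[OF mE]])
  finally show ?thesis using E0 by (simp add: polygon_area_def E_def)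
qed

lemma vertices_inj: "inj_on v {..<K}"
proof -
  have *: "v i \<noteq> v j" if "i < j" "j < K" for i j
  proof
    assume e: "v i = v j"
    show False
    proof (cases "j = Suc i")
      case False
      hence "j \<noteq> Suc i mod K" using that by simp
      thus False using left[of i j] that e by (simp add: cross_simps)
    next
      case True
      hence "i \<noteq> Suc j mod K" using that K by (cases "Suc j = K") auto
      thus False using left[of j i] that e by (simp add: cross_simps)
    qed
  qed
  show ?thesis by (rule inj_onI) (metis * lessThan_iff linorder_neqE_nat)
qed

text \<open>On the line of one edge all other vertices are strictly to one side. A common point with another edge is therefore
an end of that edge, and this end is also an end of the first one.\<close>

lemma is_polygon: "is_polygon K v"
  unfolding is_polygon_def
proof (intro conjI allI impI)
  show "3 \<le> K" by (rule K)
  show "inj_on v {..<K}" by (rule vertices_inj)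
  fix i j assume ij: "i < K" "j < K" "i \<noteq> j"
  show "polygon_edge K v i \<inter> polygon_edge K v j \<subseteq> {v i, v (Suc i mod K)} \<inter> {v j, v (Suc j mod K)}"
  proof
    fix x assume x: "x \<in> polygon_edge K v i \<inter> polygon_edge K v j"
    define l where "l = (\<lambda>z. cross (v (Suc i) - v i) (z - v i))"
    obtain t where t: "0 \<le> t" "t \<le> 1" "x = (1 - t) *\<^sub>R v j + t *\<^sub>R v (Suc j mod K)"
      using x by (auto simp: polygon_edge_def in_segment)
    obtain r where r: "x = (1 - r) *\<^sub>R v i + r *\<^sub>R v (Suc i)"
      using x v_Suc_mod[OF ij(1)] by (auto simp: polygon_edge_def in_segment)
    have "x - v i = r *\<^sub>R (v (Suc i) - v i)" by (subst r) (simp add: algebra_simps)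
    hence l0: "l x = 0" by (simp add: l_def cross_simps(5) cross_simps(6) cross_simps(9))
    define j' where "j' = Suc j mod K"
    have j'K: "j' < K" using K by (simp add: j'_def)
    have "x - v i = (1 - t) *\<^sub>R (v j - v i) + t *\<^sub>R (v j' - v i)"
      by (subst t(3)) (simp add: algebra_simps j'_def)
    hence lx: "(1 - t) * l (v j) + t * l (v j') = 0"
      using l0 by (simp add: l_def cross_simps(2) cross_simps(6))
    have pos: "l (v k) > 0" if "k < K" "k \<noteq> i" "k \<noteq> Suc i mod K" for k
      unfolding l_def using left[of i k] ij that by simp
    have ge: "l (v k) \<ge> 0" if "k < K" for k
      unfolding l_def using left_weak[of i k] ij that by simp
    have nn: "(1 - t) * l (v j) \<ge> 0" "t * l (v j') \<ge> 0" using t ge[OF ij(2)] ge[OF j'K] by auto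
    have z: "(1 - t) * l (v j) = 0" "t * l (v j') = 0" using lx nn by linarith+
    show "x \<in> {v i, v (Suc i mod K)} \<inter> {v j, v (Suc j mod K)}"
    proof (cases "j = Suc i mod K")
      case False
      hence "l (v j) > 0" using pos ij by auto
      hence t1: "t = 1" using z(1) by auto
      hence xe: "x = v j'" using t(3) by (simp add: j'_def)
      have "\<not> l (v j') > 0" using z(2) t1 by auto
      hence "j' = i \<or> j' = Suc i mod K" using pos[OF j'K] by blast
      thus ?thesis using xe by (auto simp: j'_def)
    next
      case True
      have "j' \<noteq> i \<and> j' \<noteq> Suc i mod K"
      proof -
        consider "Suc i = K" | "Suc i < K" "Suc (Suc i) = K" | "Suc (Suc i) < K" using ij by linarith
        thus ?thesis
        proof cases
          case 1 thus ?thesis using True K ij by (auto simp: j'_def)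
        next
          case 2 thus ?thesis using True K ij by (auto simp: j'_def)
        next
          case 3 thus ?thesis using True K ij by (auto simp: j'_def)
        qed
      qed
      hence "l (v j') > 0" using pos[OF j'K] by blast
      hence "t = 0" using z(2) by auto
      hence "x = v j" using t(3) by simp
      thus ?thesis using True by simp
    qed
  qed
qed

end

text \<open>A bounded component of the complement of the edges cannot leave a convex set that contains the edges.\<close>

lemma polygon_area_le_hull: "polygon_area n v \<le> measure lebesgue (convex hull (v ` {..<n}))"
proof -
  define E where "E = (\<Union>i<n. polygon_edge n v i)"
  define H where "H = convex hull (v ` {..<n})"
  have cvx: "convex H" by (simp add: H_def)
  have vH: "v i \<in> H" if "i < n" for i
    unfolding H_def by (rule hull_inc) (use that in simp)
  have "polygon_edge n v i \<subseteq> H" if "i < n" for i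
    unfolding polygon_edge_def
    by (rule closed_segment_subset[OF vH[OF that] vH cvx]) (use that in simp)
  hence "E \<subseteq> H" unfolding E_def by (intro UN_least) simp
  hence sub: "inside E \<subseteq> H" using inside_mono[of E H] inside_convex[OF cvx] by blast
  have comp: "compact E" unfolding E_def by (intro compact_UN) (auto simp: polygon_edge_def)
  have mI: "inside E \<in> lmeasurable"
    by (rule lmeasurable_open[OF bounded_inside[OF compact_imp_bounded[OF comp]] open_inside[OF compact_imp_closed[OF comp]]])
  have "H \<in> lmeasurable"
    unfolding H_def by (intro lmeasurable_compact finite_imp_compact_convex_hull) simp
  hence "measure lebesgue (inside E) \<le> measure lebesgue H"
    by (rule measure_mono_fmeasurable[OF sub fmeasurableD[OF mI]])
  thus ?thesis by (simp add: polygon_area_def E_def H_def)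
qed

section \<open>Small polygons from alternating calipers\<close>

text \<open>As a function of \<open>q\<close>, the distance of vertex \<open>i + q\<close> from the line of edge \<open>i\<close> first increases, while the
directions of the edges are within a half turn, and then decreases. It returns to \<open>0\<close> after the full turn, so it is
positive in between.\<close>

lemma convex_polygon_of_edges:
  fixes r t :: "nat \<Rightarrow> real"
  assumes n: "n \<ge> 3" and step: "\<And>i. v (Suc i) = v i + of_real (r i) * cis (t i)"
    and per: "\<And>i. v (i + n) = v i" and pos: "\<And>i. r i > 0"
    and inc: "\<And>i. t i < t (Suc i)" "\<And>i. t (Suc i) < t i + pi" and turn: "\<And>i. t (i + n) = t i + 2 * pi"
  shows "convex_polygon n v"
proof
  show "n \<ge> 3" by (rule n)
  show "v n = v 0" using per[of 0] by simp
  fix i j assume ij: "i < n" "j < n" "j \<noteq> i" "j \<noteq> Suc i mod n"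
  have mono: "strict_mono t" by (simp add: strict_mono_Suc_iff inc)
  define c where "c = (\<lambda>l. r i * (r l * sin (t l - t i)))"
  have diff: "cross (v (Suc i) - v i) (v (i + q) - v i) = (\<Sum>l<q. c (i + l))" for q
  proof (induction q)
    case 0 show ?case by (simp add: cross_simps)
  next
    case (Suc q)
    have "v (i + Suc q) - v i = (v (i + q) - v i) + (v (Suc (i + q)) - v (i + q))" by simp
    hence "cross (v (Suc i) - v i) (v (i + Suc q) - v i)
       = cross (v (Suc i) - v i) (v (i + q) - v i) + cross (v (Suc i) - v i) (v (Suc (i + q)) - v (i + q))"
      by (simp only: cross_simps(2))
    also have "cross (v (Suc i) - v i) (v (Suc (i + q)) - v (i + q)) = c (i + q)"
      by (simp add: step c_def scaleR_conv_of_real[symmetric] cross_simps cross_cis)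
    finally show ?case by (simp add: Suc.IH)
  qed
  have pos_c: "c (i + l) > 0" if "1 \<le> l" "t (i + l) - t i < pi" for l
    unfolding c_def using that pos strict_monoD[OF mono, of i "i + l"] by (intro mult_pos_pos sin_gt_zero) auto
  have nonneg_c: "c (i + l) \<ge> 0" if "t (i + l) - t i \<le> pi" for l
    unfolding c_def using that pos[THEN less_imp_le] strict_mono_mono[OF mono, THEN monoD, of i "i + l"]
    by (intro mult_nonneg_nonneg sin_ge_zero) auto
  have neg_c: "c (i + l) < 0" if "l < n" "t (i + l) - t i > pi" for l
  proof -
    have "t (i + l) < t (i + n)" using strict_monoD[OF mono, of "i + l" "i + n"] that by simp
    hence "sin (t (i + l) - t i) < 0" using that turn[of i] by (intro sin_lt_zero) auto
    thus ?thesis unfolding c_def using pos by (intro mult_pos_neg) auto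
  qed
  obtain q where q: "v j = v (i + q)" "2 \<le> q" "q < n"
  proof (cases "i < j")
    case True
    hence "j \<noteq> Suc i" using ij by auto
    thus ?thesis using True ij that[of "j - i"] by auto
  next
    case False
    hence ji: "j < i" using ij by simp
    have "\<not> (j = 0 \<and> Suc i = n)" using ij by auto
    hence "i + 2 \<le> j + n" using ij ji by linarith
    thus ?thesis using ji ij that[of "j + n - i"] per[of j] by auto
  qed
  have "0 < (\<Sum>l<q. c (i + l))"
  proof (cases "t (i + (q - 1)) - t i \<le> pi")
    case True
    have le: "t (i + l) - t i \<le> pi" if "l < q" for l
    proof -
      have "i + l \<le> i + (q - 1)" using that by linarith
      hence "t (i + l) \<le> t (i + (q - 1))" by (rule monoD[OF strict_mono_mono[OF mono]])
      thus ?thesis using True by linarith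
    qed
    show ?thesis
    proof (rule sum_pos2[of _ 1])
      show "0 < c (i + 1)" using pos_c[of 1] inc[of i] by simp
    qed (use q nonneg_c le in auto)
  next
    case False
    have gt: "t (i + l) - t i > pi" if "q \<le> l" for l
    proof -
      have "i + (q - 1) \<le> i + l" using that by linarith
      hence "t (i + (q - 1)) \<le> t (i + l)" by (rule monoD[OF strict_mono_mono[OF mono]])
      thus ?thesis using False by linarith
    qed
    have "(\<Sum>l<n. c (i + l)) = 0" using diff[of n] per by (simp add: cross_simps)
    moreover have "(\<Sum>l<n. c (i + l)) = (\<Sum>l<q. c (i + l)) + (\<Sum>l\<in>{q..<n}. c (i + l))"
      using q by (subst sum.union_disjoint[symmetric]) (auto simp: ivl_disj_un)
    moreover have "(\<Sum>l\<in>{q..<n}. c (i + l)) < 0"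
      using sum_strict_mono[of "{q..<n}" "\<lambda>l. c (i + l)" "\<lambda>_. 0"] q neg_c gt by simp
    ultimately show ?thesis by linarith
  qed
  thus "cross (v (Suc i) - v i) (v j - v i) > 0" by (simp only: q(1) diff)
qed

text \<open>Contact points move alternately: of the events \<open>2 i\<close> and \<open>2 i + 1\<close> exactly one moves the point \<open>P = W + V\<close>. So
\<open>P\<close> is at every second index at a new vertex of the polygon.\<close>

locale alternating_caliper = caliper +
  assumes n_ge: "n \<ge> 4"
    and theta_strict: "\<theta> k < \<theta> (Suc k)"
    and eps_alt: "\<epsilon> (Suc (2 * i)) = - \<epsilon> (2 * i)"
begin

definition P where "P k = W k + V k"
definition vertex where "vertex i = P (2 * i)"

lemma P_Suc: "P (Suc k) = P k + of_real ((1 + \<epsilon> k) * m k) * cis (\<theta> k)"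
  by (simp add: P_def V_Suc W_Suc algebra_simps)

lemma P_opposite: "P (k + n) = W k - V k"
  by (simp add: P_def V_per W_per)

lemma P_per: "P (k + 2 * n) = P k"
  using V_per[of "k + n"] W_per[of "k + n"] by (simp add: P_def V_per W_per mult_2 add.assoc[symmetric])

lemma convex_polygon_vertex: "convex_polygon n vertex"
proof -
  define \<kappa> where "\<kappa> = (\<lambda>i. if \<epsilon> (2 * i) = 1 then 2 * i else Suc (2 * i))"
  have smono: "strict_mono \<theta>" by (simp add: strict_mono_Suc_iff theta_strict)
  have theta_three: "\<theta> (k + 3) < \<theta> k + pi" for k
    using strict_monoD[OF smono, of "k + 3" "k + n"] theta_per[of k] n_ge by simp
  have kap: "2 * i \<le> \<kappa> i" "\<kappa> i \<le> 2 * i + 1" for i by (auto simp: \<kappa>_def)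
  show ?thesis
  proof (rule convex_polygon_of_edges[where r = "\<lambda>i. 2 * m (\<kappa> i)" and t = "\<lambda>i. \<theta> (\<kappa> i)"])
    fix i
    show "vertex (Suc i) = vertex i + of_real (2 * m (\<kappa> i)) * cis (\<theta> (\<kappa> i))"
      using eps[of "2 * i"] eps_alt[of i]
      by (auto simp: vertex_def P_Suc \<kappa>_def)
    show "vertex (i + n) = vertex i" using P_per[of "2 * i"] by (simp add: vertex_def algebra_simps)
    show "2 * m (\<kappa> i) > 0" using m_pos by simp
    show "\<theta> (\<kappa> i) < \<theta> (\<kappa> (Suc i))" using kap[of i] kap[of "Suc i"] by (intro strict_monoD[OF smono]) simp
    have "\<theta> (\<kappa> (Suc i)) \<le> \<theta> (2 * i + 3)" "\<theta> (2 * i) \<le> \<theta> (\<kappa> i)"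
      using kap[of i] kap[of "Suc i"] by (auto intro!: monoD[OF strict_mono_mono[OF smono]])
    thus "\<theta> (\<kappa> (Suc i)) < \<theta> (\<kappa> i) + pi" using theta_three[of "2 * i"] by linarith
    have "\<epsilon> (2 * (i + n)) = \<epsilon> (2 * i)" using eps_per[of "2 * i"] eps_per[of "2 * i + n"]
      by (simp add: algebra_simps mult_2)
    hence "\<kappa> (i + n) = \<kappa> i + n + n" by (simp add: \<kappa>_def)
    thus "\<theta> (\<kappa> (i + n)) = \<theta> (\<kappa> i) + 2 * pi" by (simp add: theta_per)
  qed (use n_ge in simp)
qed

lemma shoelace_vertex: "convex_polygon.shoelace n vertex = 2 * (odd_area + even_area)"
proof -
  have two: "cross (vertex i) (vertex (Suc i)) = cross (P (2 * i)) (P (Suc (2 * i))) + cross (P (Suc (2 * i))) (P (Suc (Suc (2 * i))))" for i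
    using eps[of "2 * i"] eps_alt[of i] by (auto simp: vertex_def P_Suc cross_simps)
  have pair: "(\<Sum>k<2 * N. f k) = (\<Sum>i<N. f (2 * i) + f (Suc (2 * i)))" for f :: "nat \<Rightarrow> real" and N
    by (induction N) (simp_all add: algebra_simps)
  have split: "(\<Sum>k<n + N. f k) = (\<Sum>k<n. f k) + (\<Sum>k<N. f (k + n))" for f :: "nat \<Rightarrow> real" and N
    by (induction N) (simp_all add: algebra_simps)
  have "convex_polygon.shoelace n vertex = (\<Sum>i<n. cross (vertex i) (vertex (Suc i)))"
    by (rule convex_polygon.shoelace_def[OF convex_polygon_vertex])
  also have "\<dots> = (\<Sum>k<2 * n. cross (P k) (P (Suc k)))" by (simp only: two pair)
  also have "\<dots> = (\<Sum>k<n. cross (P k) (P (Suc k))) + (\<Sum>k<n. cross (P (k + n)) (P (Suc k + n)))"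
    using split[of "\<lambda>k. cross (P k) (P (Suc k))" n] by (simp add: mult_2)
  also have "\<dots> = (\<Sum>k<n. cross (P k) (P (Suc k)) + cross (P (k + n)) (P (Suc k + n)))"
    by (simp only: sum.distrib)
  also have "\<dots> = (\<Sum>k<n. 2 * (cross (W k) (W (Suc k)) + cross (V k) (V (Suc k))))"
    by (rule sum.cong[OF refl]) (unfold P_opposite, simp add: P_def cross_simps)
  finally show ?thesis by (simp only: sum_distrib_left[symmetric] sum.distrib odd_area_def even_area_def)
qed

text \<open>In the direction \<open>\<alpha>\<close> the point \<open>P\<close> moves forward for half a turn and backward for the other half. The turning points are
opposite indices \<open>r\<close> and \<open>r + n\<close>, and \<open>P\<^sub>r\<^sub>+\<^sub>n - P\<^sub>r = - 2 V\<^sub>r\<close>. So the width in every direction is at most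
\<open>2 \<bar>V\<^sub>r\<bar>\<close>, which bounds the diameter in \<open>P_dist\<close>.\<close>

lemma width_extremes:
  obtains r where "\<And>k. r \<le> k \<Longrightarrow> k \<le> r + 2 * n \<Longrightarrow>
     Re (cnj (cis \<alpha>) * P r) \<le> Re (cnj (cis \<alpha>) * P k) \<and> Re (cnj (cis \<alpha>) * P k) \<le> Re (cnj (cis \<alpha>) * P (r + n))"
proof -
  have smono: "strict_mono \<theta>" by (simp add: strict_mono_Suc_iff theta_strict)
  obtain q :: nat where q: "real q > (\<theta> 0 - \<alpha> + pi / 2) / (2 * pi)" using reals_Archimedean2 by blast
  \<comment> \<open>Move \<open>\<alpha>\<close> by full turns beyond the first angle, so that the index \<open>r - 1\<close> below exists.\<close>
  define a where "a = \<alpha> + 2 * pi * real q"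
  have a0: "a - pi / 2 > \<theta> 0" using q by (simp add: a_def divide_less_eq algebra_simps)
  have cisa: "cis \<alpha> = cis a"
    using cis_mult[of \<alpha> "2 * pi * real q"] cis_multiple_2pi[of "real q"] by (simp add: a_def)
  have th_mult: "\<theta> (0 + N * n) = \<theta> 0 + pi * real N" for N
  proof (induction N)
    case (Suc N) thus ?case using theta_per[of "N * n"] by (simp add: algebra_simps)
  qed simp
  obtain N :: nat where "real N > (a - \<theta> 0) / pi" using reals_Archimedean2 by blast
  hence "\<theta> 0 + pi * real N > a" by (simp add: divide_less_eq algebra_simps)
  hence "\<theta> (N * n) \<ge> a - pi / 2" using th_mult[of N, unfolded add_0] pi_gt_zero by linarith
  hence ex: "\<exists>k. \<theta> k \<ge> a - pi / 2" ..
  \<comment> \<open>The first side that makes an acute angle with the direction.\<close>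
  define r where "r = (LEAST k. \<theta> k \<ge> a - pi / 2)"
  have r: "\<theta> r \<ge> a - pi / 2" unfolding r_def using ex by (rule LeastI_ex)
  have r0: "r > 0" using r a0 by (cases r) auto
  have r1: "\<theta> (r - 1) < a - pi / 2"
    using not_less_Least[of "r - 1" "\<lambda>k. \<theta> k \<ge> a - pi / 2"] r0 by (simp add: r_def)
  have Re_step: "Re (cnj (cis \<alpha>) * P (Suc k)) = Re (cnj (cis \<alpha>) * P k) + ((1 + \<epsilon> k) * m k) * cos (\<theta> k - a)" for k
  proof -
    have "cos \<alpha> = cos a" "sin \<alpha> = sin a" using cisa by (auto simp: complex_eq_iff)
    thus ?thesis by (simp add: P_Suc cos_diff algebra_simps)
  qed
  have coef: "(1 + \<epsilon> k) * m k \<ge> 0" for k using eps[of k] m_pos[of k] by auto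
  have th_le: "\<theta> k \<le> \<theta> l" if "k \<le> l" for k l using that by (rule theta_le)
  have up: "Re (cnj (cis \<alpha>) * P k) \<le> Re (cnj (cis \<alpha>) * P (Suc k))" if "r \<le> k" "k < r + n" for k
  proof -
    have "\<theta> k \<le> \<theta> (r - 1 + n)" using that r0 by (intro th_le) simp
    hence "\<theta> k < a + pi / 2" using theta_per[of "r - 1"] r1 by simp
    hence "cos (\<theta> k - a) \<ge> 0" using th_le[OF that(1)] r by (intro cos_ge_zero) auto
    thus ?thesis unfolding Re_step using coef[of k] mult_nonneg_nonneg by simp
  qed
  have down: "Re (cnj (cis \<alpha>) * P k) \<ge> Re (cnj (cis \<alpha>) * P (Suc k))" if "r + n \<le> k" "k < r + n + n" for k
  proof -
    have "\<theta> k \<le> \<theta> (r - 1 + n + n)" using that r0 by (intro th_le) simp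
    hence "\<theta> k < a + pi / 2 + pi" using theta_per[of "r - 1"] theta_per[of "r - 1 + n"] r1 by simp
    moreover have "\<theta> k \<ge> a + pi / 2" using th_le[OF that(1)] theta_per[of r] r by simp
    ultimately have "cos (\<theta> k - a - pi) \<ge> 0" by (intro cos_ge_zero) auto
    hence "cos (\<theta> k - a) \<le> 0" using cos_diff[of "\<theta> k - a" pi] by simp
    hence "(1 + \<epsilon> k) * m k * cos (\<theta> k - a) \<le> 0" using coef[of k] by (intro mult_nonneg_nonpos)
    thus ?thesis unfolding Re_step by linarith
  qed
  let ?f = "\<lambda>k. Re (cnj (cis \<alpha>) * P k)"
  have up': "?f k \<le> ?f l" if "r \<le> k" "k \<le> l" "l \<le> r + n" for k l
    using that(2,3)
  proof (induction l rule: dec_induct)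
    case (step l) thus ?case using up[of l] that(1) by simp
  qed simp
  have down': "?f l \<le> ?f k" if "r + n \<le> k" "k \<le> l" "l \<le> r + n + n" for k l
    using that(2,3)
  proof (induction l rule: dec_induct)
    case (step l) thus ?case using down[of l] that(1) by simp
  qed simp
  show ?thesis
  proof (rule that)
    fix k assume k: "r \<le> k" "k \<le> r + 2 * n"
    show "?f r \<le> ?f k \<and> ?f k \<le> ?f (r + n)"
    proof (cases "k \<le> r + n")
      case True thus ?thesis using up'[of r k] up'[of k "r + n"] k by simp
    next
      case False thus ?thesis using down'[of "r + n" k] down'[of k "r + 2 * n"] k P_per[of r] by simp
    qed
  qed
qed

lemma P_dist:
  assumes small: "\<And>k. norm (V k) \<le> 1/2"
  shows "dist (P k) (P l) \<le> 1"
proof -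
  define \<alpha> where "\<alpha> = Arg (P k - P l)"
  let ?f = "\<lambda>k. Re (cnj (cis \<alpha>) * P k)"
  obtain r where r: "\<And>k. r \<le> k \<Longrightarrow> k \<le> r + 2 * n \<Longrightarrow> ?f r \<le> ?f k \<and> ?f k \<le> ?f (r + n)"
    using width_extremes[of \<alpha>] by blast
  have per: "P (k + 2 * n * N) = P k" for k N
  proof (induction N)
    case (Suc N) thus ?case using P_per[of "k + 2 * n * N"] by (simp add: algebra_simps)
  qed simp
  have all: "?f r \<le> ?f k \<and> ?f k \<le> ?f (r + n)" for k
  proof -
    \<comment> \<open>Reduce the index to the window from \<open>r\<close> to \<open>r + 2 n\<close>.\<close>
    define k' where "k' = k + 2 * n * r"
    define s where "s = r + (k' - r) mod (2 * n)"
    have "r \<le> k'" using n_pos by (simp add: k'_def trans_le_add2)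
    hence "k' = s + 2 * n * ((k' - r) div (2 * n))"
      using mod_mult_div_eq[of "k' - r" "2 * n"] by (simp add: s_def)
    hence "P k' = P s" using per[of s "(k' - r) div (2 * n)"] by metis
    hence "P k = P s" by (simp add: k'_def per)
    moreover have "s \<le> r + 2 * n" unfolding s_def using n_pos mod_less_divisor[of "2 * n" "k' - r"] by simp
    ultimately show ?thesis using r[of s] by (simp add: s_def)
  qed
  have "P k - P l = of_real (dist (P k) (P l)) * cis \<alpha>"
    using rcis_cmod_Arg[of "P k - P l"] by (simp add: \<alpha>_def rcis_def dist_norm)
  hence "cnj (cis \<alpha>) * (P k - P l) = of_real (dist (P k) (P l)) * (cnj (cis \<alpha>) * cis \<alpha>)" by simp
  also have "cnj (cis \<alpha>) * cis \<alpha> = 1" by (simp add: cis_cnj cis_mult)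
  finally have "dist (P k) (P l) = Re (cnj (cis \<alpha>) * (P k - P l))" by simp
  also have "\<dots> = ?f k - ?f l" by (simp only: right_diff_distrib minus_complex.sel)
  also have "\<dots> \<le> ?f (r + n) - ?f r" using all[of k] all[of l] by linarith
  also have "\<dots> = Re (cnj (cis \<alpha>) * (P (r + n) - P r))" by (simp only: right_diff_distrib minus_complex.sel)
  also have "\<dots> \<le> norm (cnj (cis \<alpha>) * (P (r + n) - P r))" by (rule complex_Re_le_cmod)
  also have "\<dots> = norm (- 2 * V r)" unfolding P_opposite by (simp add: norm_mult P_def)
  also have "\<dots> \<le> 1" using small[of r] by (simp add: norm_mult)
  finally show ?thesis .
qed

theorem small_polygon_vertex:
  assumes small: "\<And>k. norm (V k) \<le> 1/2"
  shows "small_polygon n vertex" "polygon_area n vertex \<ge> odd_area + even_area"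
proof -
  interpret cp: convex_polygon n vertex by (rule convex_polygon_vertex)
  show "small_polygon n vertex"
    unfolding small_polygon_def using cp.is_polygon P_dist[OF small] by (auto simp: vertex_def)
  show "polygon_area n vertex \<ge> odd_area + even_area"
    using order_trans[OF cp.area_hull_ge cp.region_le_polygon_area] by (simp add: shoelace_vertex)
qed

end

section \<open>Small polygons from symmetric sequences of angles\<close>

lemma sum_reflect:
  fixes F :: "nat \<Rightarrow> 'a :: comm_semiring_1"
  assumes "\<And>k. k < h \<Longrightarrow> F (2 * h - 1 - k) = F k"
  shows "(\<Sum>k<2 * h. F k) = 2 * (\<Sum>k<h. F k)"
proof -
  have "(\<Sum>k<2 * h. F k) = (\<Sum>k<h. F k) + (\<Sum>k\<in>{h..<2 * h}. F k)"
    by (subst sum.union_disjoint[symmetric]) (auto simp: ivl_disj_un)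
  also have "(\<Sum>k\<in>{h..<2 * h}. F k) = (\<Sum>k<h. F (2 * h - 1 - k))"
    by (rule sum.reindex_bij_witness[of _ "\<lambda>k. 2 * h - 1 - k" "\<lambda>k. 2 * h - 1 - k"]) auto
  also have "\<dots> = (\<Sum>k<h. F k)" by (rule sum.cong) (use assms in auto)
  finally show ?thesis by (simp add: mult_2)
qed

lemma cis_chord: "(cis b - cis a) / 2 = of_real (sin ((b - a) / 2)) * cis ((a + b) / 2 + pi / 2)"
proof -
  have "sin (b / 2 + a / 2) * sin (b / 2 - a / 2) * 2 = cos a - cos b"
    "cos (b / 2 + a / 2) * sin (b / 2 - a / 2) * 2 = sin b - sin a"
    using cos_diff_cos[of a b] sin_diff_sin[of b a] by (simp_all add: add_divide_distrib diff_divide_distrib add.commute mult.commute)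
  thus ?thesis
    by (simp add: complex_eq_iff cos_add[of _ "pi / 2"] sin_add[of _ "pi / 2"] add_divide_distrib diff_divide_distrib) (simp add: algebra_simps)
qed

text \<open>Angles \<open>\<alpha>\<^sub>k\<close> between consecutive points \<open>V\<^sub>k\<close> on the circle of radius \<open>1/2\<close>, symmetric with respect to the middle. By the
symmetry the closing condition for the path \<open>W\<close> with alternating signs holds automatically in one coordinate; the other
coordinate is the assumption \<open>closure\<close>.\<close>

locale symmetric_gaps =
  fixes h :: nat and \<alpha> :: "nat \<Rightarrow> real"
  assumes h_ge: "h \<ge> 2"
    and gap_pos: "k < 2 * h \<Longrightarrow> \<alpha> k > 0"
    and gap_sym: "k < 2 * h \<Longrightarrow> \<alpha> (2 * h - 1 - k) = \<alpha> k"
    and gap_sum: "(\<Sum>k<h. \<alpha> k) = pi / 2"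
    and closure: "(\<Sum>k<h. (-1) ^ k * (sin (\<Sum>j<Suc k. \<alpha> j) - sin (\<Sum>j<k. \<alpha> j))) = 0"
begin

text \<open>The angle of \<open>V\<^sub>k\<close>, and the slope \<open>p\<close> of the caliper that belongs to it.\<close>

definition s where "s k = (\<Sum>j<k. \<alpha> j)"
definition slope where "slope k = (\<Sum>j<k. (-1) ^ Suc j * sin (\<alpha> j / 2))"

lemma s_Suc: "s (Suc k) = s k + \<alpha> k" by (simp add: s_def)
lemma s_0: "s 0 = 0" by (simp add: s_def)
lemma slope_Suc: "slope (Suc k) = slope k + (-1) ^ Suc k * sin (\<alpha> k / 2)" by (simp add: slope_def)
lemma slope_0: "slope 0 = 0" by (simp add: slope_def)

lemma s_2h: "s (2 * h) = pi"
  unfolding s_def using sum_reflect[of h \<alpha>] gap_sym gap_sum by simp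

lemma s_reflect: "k \<le> 2 * h \<Longrightarrow> s (2 * h - k) = pi - s k"
proof (induction k)
  case 0 show ?case by (simp add: s_2h s_0)
next
  case (Suc k)
  have "2 * h - k = Suc (2 * h - Suc k)" using Suc.prems by simp
  hence "s (2 * h - k) = s (2 * h - Suc k) + \<alpha> (2 * h - 1 - k)" by (simp add: s_Suc)
  thus ?case using Suc gap_sym[of k] by (simp add: s_Suc)
qed

lemma s_strict: "i < j \<Longrightarrow> j \<le> 2 * h \<Longrightarrow> s i < s j"
proof (induction j)
  case (Suc j)
  have "s i \<le> s j" using Suc by (cases "i = j") auto
  thus ?case using gap_pos[of j] Suc.prems by (simp add: s_Suc)
qed simp

lemma slope_2h: "slope (2 * h) = 0"
proof -
  let ?F = "\<lambda>j. (-1) ^ Suc j * sin (\<alpha> j / 2)"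
  have "(\<Sum>j<2 * h. ?F j) = (\<Sum>j<2 * h. ?F (2 * h - 1 - j))"
    by (rule sum.reindex_bij_witness[of _ "\<lambda>k. 2 * h - 1 - k" "\<lambda>k. 2 * h - 1 - k"]) auto
  also have "\<dots> = (\<Sum>j<2 * h. - ?F j)"
  proof (rule sum.cong[OF refl])
    fix j assume j: "j \<in> {..<2 * h}"
    have "even (2 * h - 1 - j) \<longleftrightarrow> odd j" using j by simp
    thus "?F (2 * h - 1 - j) = - ?F j" using gap_sym[of j] j by (simp add: minus_one_power_iff)
  qed
  finally show ?thesis by (simp add: slope_def sum_negf)
qed

lemma slope_reflect: "k \<le> 2 * h \<Longrightarrow> slope (2 * h - k) = slope k"
proof (induction k)
  case 0 show ?case by (simp add: slope_2h slope_0)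
next
  case (Suc k)
  have e: "2 * h - k = Suc (2 * h - Suc k)" using Suc.prems by simp
  have "slope (2 * h - k) = slope (2 * h - Suc k) + (-1) ^ Suc (2 * h - Suc k) * sin (\<alpha> (2 * h - 1 - k) / 2)"
    by (subst e) (simp add: slope_Suc)
  moreover have "even (2 * h - Suc k) \<longleftrightarrow> odd k" using Suc.prems by simp
  ultimately show ?case using Suc gap_sym[of k] by (simp add: slope_Suc minus_one_power_iff)
qed

definition angle where "angle k = (s k + s (Suc k)) / 2 + pi / 2"
definition side where "side k = sin (\<alpha> k / 2)"
definition sgn_seq where "sgn_seq k = ((-1) ^ Suc k :: real)"
definition Vc where "Vc k = cis (s k) / 2"
definition Wc where "Wc k = (\<Sum>j<k. of_real (sgn_seq j * side j) * cis (angle j))"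

lemma gap_lt: "k < 2 * h \<Longrightarrow> \<alpha> k < 2 * pi"
proof -
  assume k: "k < 2 * h"
  have "s 0 \<le> s k" using s_strict[of 0 k] k by (cases "k = 0") auto
  moreover have "s (Suc k) \<le> s (2 * h)" using s_strict[of "Suc k" "2 * h"] k by (cases "Suc k = 2 * h") auto
  ultimately show ?thesis using s_2h s_0 s_Suc[of k] pi_gt_zero by linarith
qed

lemma side_pos: "k < 2 * h \<Longrightarrow> side k > 0"
  unfolding side_def using gap_pos[of k] gap_lt[of k] by (intro sin_gt_zero) auto

lemma Vc_Suc: "Vc (Suc k) = Vc k + of_real (side k) * cis (angle k)"
  using cis_chord[of "s (Suc k)" "s k"] by (simp add: Vc_def side_def angle_def s_Suc diff_divide_distrib algebra_simps)

lemma Vc_reflect: "k \<le> 2 * h \<Longrightarrow> Vc (2 * h - k) = - cnj (Vc k)"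
  by (simp add: Vc_def s_reflect complex_eq_iff)

text \<open>Reflection maps the sum to minus its conjugate, so its real part vanishes; its imaginary part is a multiple of
the sum in \<open>closure\<close>.\<close>

lemma Wc_closed: "Wc (2 * h) = 0"
proof -
  define Z where "Z = (\<lambda>k. (-1) ^ Suc k * (Vc (Suc k) - Vc k))"
  have Z: "Wc (2 * h) = (\<Sum>k<2 * h. Z k)"
    unfolding Wc_def Z_def by (rule sum.cong[OF refl]) (simp add: Vc_Suc sgn_seq_def)
  have ref: "Z (2 * h - 1 - k) = - cnj (Z k)" if "k < 2 * h" for k
  proof -
    have "Suc (2 * h - 1 - k) = 2 * h - k" "2 * h - 1 - k = 2 * h - Suc k" using that by auto
    moreover have "even (2 * h - k) \<longleftrightarrow> even k" using that by simp
    ultimately show ?thesis unfolding Z_def using that Vc_reflect[of k] Vc_reflect[of "Suc k"]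
      by (simp add: minus_one_power_iff)
  qed
  have "(\<Sum>k<2 * h. Re (Z k)) = 0"
  proof -
    have "(\<Sum>k<2 * h. Re (Z k)) = (\<Sum>k<2 * h. Re (Z (2 * h - 1 - k)))"
      by (rule sum.reindex_bij_witness[of _ "\<lambda>k. 2 * h - 1 - k" "\<lambda>k. 2 * h - 1 - k"]) auto
    also have "\<dots> = (\<Sum>k<2 * h. - Re (Z k))"
    proof (rule sum.cong[OF refl])
      fix k assume "k \<in> {..<2 * h}"
      thus "Re (Z (2 * h - 1 - k)) = - Re (Z k)" using ref[of k] by simp
    qed
    finally show ?thesis by (simp add: sum_negf)
  qed
  moreover have "(\<Sum>k<2 * h. Im (Z k)) = 0"
  proof -
    have "(\<Sum>k<2 * h. Im (Z k)) = 2 * (\<Sum>k<h. Im (Z k))"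
    proof (rule sum_reflect)
      fix k assume "k < h"
      thus "Im (Z (2 * h - 1 - k)) = Im (Z k)" using ref[of k] by simp
    qed
    also have "(\<Sum>k<h. Im (Z k)) = (\<Sum>k<h. (- 1 / 2) * ((-1) ^ k * (sin (s (Suc k)) - sin (s k))))"
      by (rule sum.cong[OF refl]) (simp add: Z_def Vc_def minus_one_power_iff diff_divide_distrib)
    also have "\<dots> = 0" using closure by (simp only: sum_distrib_left[symmetric] s_def mult_zero_right)
    finally show ?thesis by simp
  qed
  ultimately show ?thesis by (simp add: Z complex_eq_iff)
qed

text \<open>The extension of one half turn to a caliper, as in \<open>caliper_extend\<close>.\<close>

definition \<theta>' where "\<theta>' k = angle (k mod (2 * h)) + pi * real (k div (2 * h))"
definition m' where "m' k = side (k mod (2 * h))"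
definition \<epsilon>' where "\<epsilon>' k = (-1) ^ (k div (2 * h)) * sgn_seq (k mod (2 * h))"
definition V' where "V' k = (-1) ^ (k div (2 * h)) * Vc (k mod (2 * h))"
definition W' where "W' k = Wc (k mod (2 * h))"

lemma angle_strict: "Suc k < 2 * h \<Longrightarrow> angle k < angle (Suc k)"
  using s_strict[of k "Suc k"] s_strict[of "Suc k" "Suc (Suc k)"] by (simp add: angle_def)

lemma angle_last: "angle (2 * h - 1) = angle 0 + pi - \<alpha> 0"
proof -
  have "s (2 * h - 1) = pi - \<alpha> 0" using s_reflect[of 1] h_ge by (simp add: s_def)
  moreover have "Suc (2 * h - 1) = 2 * h" using h_ge by simp
  ultimately show ?thesis by (simp add: angle_def s_2h s_0 s_Suc add_divide_distrib diff_divide_distrib)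
qed

lemma caliper: "caliper (2 * h) \<theta>' m' \<epsilon>' V' W'"
proof -
  have r: "angle 0 < angle (2 * h - 1)" "angle (2 * h - 1) < angle 0 + pi"
  proof -
    have "\<alpha> 0 < pi" using s_strict[of "Suc 0" "2 * h"] s_2h h_ge by (simp add: s_def)
    thus "angle 0 < angle (2 * h - 1)" "angle (2 * h - 1) < angle 0 + pi"
      using angle_last gap_pos[of 0] h_ge by auto
  qed
  show ?thesis unfolding \<theta>'_def[abs_def] m'_def[abs_def] \<epsilon>'_def[abs_def] V'_def[abs_def] W'_def[abs_def]
  proof (rule caliper_extend)
    show "Vc (2 * h) = - Vc 0" by (simp add: Vc_def s_2h s_0 complex_eq_iff)
    show "Wc (2 * h) = Wc 0" by (simp add: Wc_closed) (simp add: Wc_def)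
  qed (use h_ge side_pos angle_strict r in \<open>auto simp: Vc_Suc Wc_def sgn_seq_def minus_one_power_iff less_imp_le\<close>)
qed

lemma alternating: "alternating_caliper (2 * h) \<theta>' m' \<epsilon>' V' W'"
proof -
  interpret caliper "2 * h" \<theta>' m' \<epsilon>' V' W' by (rule caliper)
  show ?thesis
  proof
    show "4 \<le> 2 * h" using h_ge by simp
    fix k
    show "\<theta>' k < \<theta>' (Suc k)"
    proof (cases "Suc (k mod (2 * h)) = 2 * h")
      case True
      hence "Suc k mod (2 * h) = 0" "Suc k div (2 * h) = Suc (k div (2 * h))" by (simp_all add: mod_Suc div_Suc)
      moreover have "k mod (2 * h) = 2 * h - 1" using True by linarith
      ultimately show ?thesis using angle_last gap_pos[of 0] h_ge by (simp add: \<theta>'_def algebra_simps)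
    next
      case False
      have "k mod (2 * h) < 2 * h" using h_ge by simp
      hence "Suc (k mod (2 * h)) < 2 * h" using False by linarith
      moreover have "Suc k mod (2 * h) = Suc (k mod (2 * h))" "Suc k div (2 * h) = k div (2 * h)"
        using False by (simp_all add: mod_Suc div_Suc)
      ultimately show ?thesis using angle_strict by (simp add: \<theta>'_def)
    qed
    show "\<epsilon>' (Suc (2 * k)) = - \<epsilon>' (2 * k)"
    proof -
      have odd: "Suc (2 * i) \<noteq> 2 * h" for i by presburger
      have "Suc (2 * k) mod (2 * h) = Suc (2 * (k mod h))" "2 * k mod (2 * h) = 2 * (k mod h)"
        "Suc (2 * k) div (2 * h) = k div h" "2 * k div (2 * h) = k div h"
        using h_ge odd by (auto simp: mod_Suc div_Suc)
      thus ?thesis by (simp add: \<epsilon>'_def sgn_seq_def)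
    qed
  qed
qed

text \<open>The even area is exact, since \<open>V\<close> lies on a circle, and the odd area is estimated by \<open>caliper.odd_area_ge\<close>. The sums over the
whole half turn reduce to the first quarter turn by symmetry; there the energy takes the form of a sum over
sides because \<open>\<theta>\<^sub>k\<^sub>+\<^sub>1 - \<theta>\<^sub>k\<close> is the mean of two neighbouring gaps.\<close>

theorem polygon:
  assumes M: "\<And>k. k < 2 * h \<Longrightarrow> \<bar>\<Sum>j<k. slope (Suc j) * ((\<alpha> j + \<alpha> (Suc j)) / 2)\<bar> \<le> M"
  obtains P where "small_polygon (2 * h) P"
    "polygon_area (2 * h) P \<ge> (\<Sum>k<h. sin (\<alpha> k)) / 2
       - (\<Sum>k<h. \<alpha> k * ((slope k)\<^sup>2 + (slope (Suc k))\<^sup>2)) - (3 / 2 * M)\<^sup>2 * (pi\<^sup>2 + 1) * pi"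
proof -
  interpret ac: alternating_caliper "2 * h" \<theta>' m' \<epsilon>' V' W' by (rule alternating)
  have emk: "\<epsilon>' k * m' k = (-1) ^ Suc k * sin (\<alpha> k / 2)" if "k < 2 * h" for k
    using that by (simp add: \<epsilon>'_def m'_def sgn_seq_def side_def)
  have emk_sum: "(\<Sum>j<k. \<epsilon>' j * m' j) = slope k" if "k \<le> 2 * h" for k
    unfolding slope_def by (rule sum.cong[OF refl]) (use emk that in auto)
  have p: "ac.p k = slope k" if "k \<le> 2 * h" for k
    using that by (simp add: ac.p_def emk_sum slope_2h)
  have gap: "\<theta>' (Suc k) - \<theta>' k = (\<alpha> k + \<alpha> (Suc k)) / 2" if "Suc k < 2 * h" for k
    using that by (simp add: \<theta>'_def angle_def s_Suc field_simps)
  have last: "Suc (2 * h - 1) = 2 * h" using h_ge by simp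
  have part: "(\<Sum>j<k. ac.p (Suc j) * (\<theta>' (Suc j) - \<theta>' j)) = (\<Sum>j<k. slope (Suc j) * ((\<alpha> j + \<alpha> (Suc j)) / 2))"
    if "k < 2 * h" for k
    by (rule sum.cong[OF refl]) (use p gap that in auto)
  have S: "\<bar>\<Sum>j<k. ac.p (Suc j) * (\<theta>' (Suc j) - \<theta>' j)\<bar> \<le> M" if "k \<le> 2 * h" for k
  proof (cases "k = 2 * h")
    case True
    have "(\<Sum>j<2 * h. ac.p (Suc j) * (\<theta>' (Suc j) - \<theta>' j)) = (\<Sum>j<2 * h - 1. ac.p (Suc j) * (\<theta>' (Suc j) - \<theta>' j))"
      using sum.lessThan_Suc[of "\<lambda>j. ac.p (Suc j) * (\<theta>' (Suc j) - \<theta>' j)" "2 * h - 1"] p[of "2 * h"] slope_2h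
      unfolding last by simp
    thus ?thesis using part[of "2 * h - 1"] M[of "2 * h - 1"] h_ge True by simp
  next
    case False thus ?thesis using part[of k] M[of k] that by simp
  qed
  have vM: "\<bar>ac.v k\<bar> \<le> 3 / 2 * M" if "k \<le> 2 * h" for k
    unfolding ac.v_def using S[OF that] S[OF order_refl] by linarith
  have odd: "ac.odd_area \<ge> - ac.slope_energy - (3 / 2 * M)\<^sup>2 * (pi\<^sup>2 + 1) * pi"
    by (rule ac.odd_area_ge[OF vM])
  have even: "ac.even_area = (\<Sum>k<h. sin (\<alpha> k)) / 2"
  proof -
    have "cross (V' k) (V' (Suc k)) = sin (\<alpha> k) / 4" if "k < 2 * h" for k
    proof -
      have "V' (Suc k) = Vc (Suc k)"
        using that by (cases "Suc k = 2 * h") (auto simp: V'_def Vc_def s_2h s_0 complex_eq_iff)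
      moreover have "V' k = Vc k" using that by (simp add: V'_def)
      moreover have "cross (Vc k) (Vc (Suc k)) = cross (cis (s k)) (cis (s (Suc k))) / 4"
        by (simp add: Vc_def cross_altdef)
      ultimately show ?thesis by (simp add: cross_cis s_Suc)
    qed
    hence "ac.even_area = (\<Sum>k<2 * h. sin (\<alpha> k) / 4)"
      unfolding ac.even_area_def by (intro sum.cong refl) auto
    also have "\<dots> = 2 * (\<Sum>k<h. sin (\<alpha> k) / 4)" 
    proof (rule sum_reflect)
      fix k assume "k < h"
      thus "sin (\<alpha> (2 * h - 1 - k)) / 4 = sin (\<alpha> k) / 4" using gap_sym[of k] by simp
    qed
    finally show ?thesis by (simp add: sum_divide_distrib[symmetric])
  qed
  have energy: "ac.slope_energy = (\<Sum>k<h. \<alpha> k * ((slope k)\<^sup>2 + (slope (Suc k))\<^sup>2))"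
  proof -
    have "(ac.p (Suc k))\<^sup>2 * (\<theta>' (Suc k) - \<theta>' k) = (slope (Suc k))\<^sup>2 * ((\<alpha> k + \<alpha> (Suc k)) / 2)"
      if "k < 2 * h" for k
      using that p[of "Suc k"] gap[of k] slope_2h by (cases "Suc k = 2 * h") auto
    hence "ac.slope_energy = (\<Sum>k<2 * h. (slope (Suc k))\<^sup>2 * ((\<alpha> k + \<alpha> (Suc k)) / 2))"
      unfolding ac.slope_energy_def by (intro sum.cong refl) auto
    also have "\<dots> = (\<Sum>k<2 * h. \<alpha> k * (slope (Suc k))\<^sup>2 / 2) + (\<Sum>k<2 * h. \<alpha> (Suc k) * (slope (Suc k))\<^sup>2 / 2)"
      by (simp only: sum.distrib[symmetric]) (rule sum.cong[OF refl], simp add: field_simps)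
    also have "(\<Sum>k<2 * h. \<alpha> (Suc k) * (slope (Suc k))\<^sup>2 / 2) = (\<Sum>k<2 * h. \<alpha> k * (slope k)\<^sup>2 / 2)"
      using sum.lessThan_Suc_shift[of "\<lambda>k. \<alpha> k * (slope k)\<^sup>2 / 2" "2 * h"] by (simp add: slope_0 slope_2h)
    also have "(\<Sum>k<2 * h. \<alpha> k * (slope (Suc k))\<^sup>2 / 2) + (\<Sum>k<2 * h. \<alpha> k * (slope k)\<^sup>2 / 2)
        = (\<Sum>k<2 * h. \<alpha> k * ((slope k)\<^sup>2 + (slope (Suc k))\<^sup>2) / 2)"
      by (simp only: sum.distrib[symmetric]) (rule sum.cong[OF refl], simp add: field_simps)
    also have "\<dots> = 2 * (\<Sum>k<h. \<alpha> k * ((slope k)\<^sup>2 + (slope (Suc k))\<^sup>2) / 2)"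
    proof (rule sum_reflect)
      fix k assume k: "k < h"
      hence "Suc (2 * h - 1 - k) = 2 * h - k" "2 * h - 1 - k = 2 * h - Suc k" by auto
      thus "\<alpha> (2 * h - 1 - k) * ((slope (2 * h - 1 - k))\<^sup>2 + (slope (Suc (2 * h - 1 - k)))\<^sup>2) / 2
         = \<alpha> k * ((slope k)\<^sup>2 + (slope (Suc k))\<^sup>2) / 2"
        using k gap_sym[of k] slope_reflect[of k] slope_reflect[of "Suc k"] by (simp add: add.commute)
    qed
    finally show ?thesis by (simp add: sum_divide_distrib[symmetric])
  qed
  have small: "norm (V' k) \<le> 1 / 2" for k by (simp add: V'_def Vc_def norm_mult norm_power)
  have "polygon_area (2 * h) ac.vertex \<ge> ac.odd_area + ac.even_area"
    using ac.small_polygon_vertex(2) small by blast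
  hence "polygon_area (2 * h) ac.vertex \<ge> (\<Sum>k<h. sin (\<alpha> k)) / 2
       - (\<Sum>k<h. \<alpha> k * ((slope k)\<^sup>2 + (slope (Suc k))\<^sup>2)) - (3 / 2 * M)\<^sup>2 * (pi\<^sup>2 + 1) * pi"
    using odd unfolding even energy by linarith
  with ac.small_polygon_vertex(1)[OF small] show ?thesis by (rule that)
qed

end

section \<open>Estimates for sines and for the profile\<close>

lemma sum_geometric34: "(\<Sum>j<N. (3 / 4 :: real) ^ j) \<le> 4"
  by (simp add: sum_gp_strict)

lemma one_minus_cos_bound: "0 \<le> 1 - cos t" "1 - cos t \<le> t\<^sup>2 / 2" for t :: real
proof -
  have "1 - cos t = 2 * (sin (t / 2))\<^sup>2" using cos_double_sin[of "t / 2"] by simp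
  moreover have "(sin (t / 2))\<^sup>2 \<le> (t / 2)\<^sup>2" using abs_sin_x_le_abs_x[of "t / 2"] by (simp only: abs_le_square_iff)
  ultimately show "0 \<le> 1 - cos t" "1 - cos t \<le> t\<^sup>2 / 2" by (auto simp: power2_eq_square)
qed

lemma diff_sin_lipschitz:
  fixes u v X :: real
  assumes "0 \<le> u" "u \<le> X" "0 \<le> v" "v \<le> X"
  shows "\<bar>(u - sin u) - (v - sin v)\<bar> \<le> X\<^sup>2 / 2 * \<bar>u - v\<bar>"
proof -
  have "norm ((\<lambda>z. z - sin z) u - (\<lambda>z. z - sin z) v) \<le> X\<^sup>2 / 2 * norm (u - v)"
  proof (rule field_differentiable_bound[of "{0..X}" _ "\<lambda>z. 1 - cos z"])
    fix z assume z: "z \<in> {0..X}"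
    show "((\<lambda>z. z - sin z) has_field_derivative 1 - cos z) (at z within {0..X})"
      by (auto intro!: derivative_eq_intros)
    have "z\<^sup>2 \<le> X\<^sup>2" using z by (intro power_mono) auto
    thus "norm (1 - cos z) \<le> X\<^sup>2 / 2" using one_minus_cos_bound[of z] by simp
  qed (use assms in auto)
  thus ?thesis by simp
qed

lemma sin_cubic_lower: "0 \<le> x \<Longrightarrow> sin x \<ge> x - x ^ 3 / 6" for x :: real
proof -
  assume x: "0 \<le> x"
  have "(\<lambda>x. sin x - (x - x ^ 3 / 6)) 0 \<le> (\<lambda>x. sin x - (x - x ^ 3 / 6)) x"
  proof (rule DERIV_nonneg_imp_nondecreasing[OF x])
    fix z :: real
    have "((\<lambda>x. sin x - (x - x ^ 3 / 6)) has_real_derivative cos z - (1 - z\<^sup>2 / 2)) (at z)"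
      by (auto intro!: derivative_eq_intros simp: power2_eq_square)
    thus "\<exists>y. ((\<lambda>x. sin x - (x - x ^ 3 / 6)) has_real_derivative y) (at z) \<and> 0 \<le> y"
      using one_minus_cos_bound(2)[of z] by (intro exI[of _ "cos z - (1 - z\<^sup>2 / 2)"]) auto
  qed
  thus ?thesis by simp
qed

lemma sin_cubic_abs: "0 \<le> x \<Longrightarrow> \<bar>sin x - x\<bar> \<le> x ^ 3 / 6" for x :: real
  using sin_cubic_lower[of x] sin_x_le_x[of x] by simp

lemma cos_quartic:
  fixes t :: real assumes t: "0 \<le> t" "t \<le> 1"
  shows "\<bar>cos t - 1 + t\<^sup>2 / 2\<bar> \<le> t ^ 3 / 24"
proof -
  define r where "r = t / 2"
  have r: "0 \<le> r" "r \<le> 1/2" using t by (auto simp: r_def)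
  have "1 - cos t = 2 * (sin r)\<^sup>2" using cos_double_sin[of r] by (simp add: r_def)
  hence e: "cos t - 1 + t\<^sup>2 / 2 = 2 * ((r - sin r) * (r + sin r))"
    by (simp add: r_def power2_eq_square algebra_simps)
  have s: "0 \<le> sin r" "sin r \<le> r" using r pi_gt3 by (auto intro!: sin_ge_zero sin_x_le_x)
  have "(r - sin r) * (r + sin r) \<le> (r ^ 3 / 6) * 1"
    using s r sin_cubic_abs[of r] by (intro mult_mono) auto
  moreover have "(r - sin r) * (r + sin r) \<ge> 0" using s r by simp
  moreover have "r ^ 3 = t ^ 3 / 8" by (simp add: r_def power_divide)
  ultimately show ?thesis unfolding e by simp
qed

text \<open>Up to an error of third order, the increment of the sine over the angle \<open>\<alpha> = 2 \<mu> (x + y)\<close> is the combination of the cosines at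
its ends with the weights \<open>2 \<mu> x\<close> and \<open>2 \<mu> y\<close>. The second-order term is proportional to \<open>y - x\<close>. Along the
profile these differences decay geometrically, and an alternating sum of the main terms telescopes.\<close>

lemma sine_increment_error:
  fixes s x y \<mu> :: real
  defines "\<alpha> \<equiv> 2 * \<mu> * (x + y)"
  assumes nn: "x \<ge> 0" "y \<ge> 0" "\<mu> \<ge> 0" and le: "\<alpha> \<le> 1"
  shows "\<bar>sin (s + \<alpha>) - sin s - 2 * \<mu> * (y * cos (s + \<alpha>) + x * cos s)\<bar> \<le> \<alpha> * \<mu> * \<bar>y - x\<bar> + \<alpha> ^ 3"
proof -
  define z where "z = 2 * \<mu> * y"
  have a0: "0 \<le> \<alpha>" using nn by (simp add: \<alpha>_def)
  have z: "0 \<le> z" "z \<le> \<alpha>" using nn by (auto simp: z_def \<alpha>_def distrib_left)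
  have zx: "2 * \<mu> * x = \<alpha> - z" by (simp add: z_def \<alpha>_def algebra_simps)
  define P where "P = (cos \<alpha> - 1 + \<alpha>\<^sup>2 / 2) + z * (sin \<alpha> - \<alpha>) + \<alpha> * (z - \<alpha> / 2)"
  define Q where "Q = (sin \<alpha> - \<alpha>) + z * (1 - cos \<alpha>)"
  have "2 * \<mu> * (y * cos (s + \<alpha>) + x * cos s) = z * cos (s + \<alpha>) + (\<alpha> - z) * cos s"
  proof -
    have "2 * \<mu> * (y * cos (s + \<alpha>) + x * cos s) = (2 * \<mu> * y) * cos (s + \<alpha>) + (2 * \<mu> * x) * cos s"
      by (simp only: distrib_left mult.assoc)
    thus ?thesis unfolding zx z_def[symmetric] .
  qed
  hence "sin (s + \<alpha>) - sin s - 2 * \<mu> * (y * cos (s + \<alpha>) + x * cos s) = sin s * P + cos s * Q"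
    unfolding P_def Q_def by (simp add: sin_add cos_add power2_eq_square algebra_simps)
  moreover have "\<bar>sin s * P\<bar> \<le> 1 * \<bar>P\<bar>" "\<bar>cos s * Q\<bar> \<le> 1 * \<bar>Q\<bar>"
    unfolding abs_mult by (intro mult_right_mono; simp)+
  moreover have "\<bar>P\<bar> \<le> \<alpha> ^ 3 / 24 + \<alpha> ^ 3 / 6 + \<alpha> * (\<mu> * \<bar>y - x\<bar>)"
  proof -
    have "\<bar>z * (sin \<alpha> - \<alpha>)\<bar> \<le> 1 * (\<alpha> ^ 3 / 6)"
      unfolding abs_mult using z le a0 sin_cubic_abs[OF a0] by (intro mult_mono) auto
    moreover have "z - \<alpha> / 2 = \<mu> * (y - x)" by (simp add: z_def \<alpha>_def algebra_simps)
    hence "\<bar>\<alpha> * (z - \<alpha> / 2)\<bar> = \<alpha> * (\<mu> * \<bar>y - x\<bar>)" using a0 nn by (simp add: abs_mult)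
    ultimately show ?thesis unfolding P_def using cos_quartic[OF a0 le] by linarith
  qed
  moreover have "\<bar>Q\<bar> \<le> \<alpha> ^ 3 / 6 + \<alpha> ^ 3 / 2"
  proof -
    have "\<bar>z * (1 - cos \<alpha>)\<bar> \<le> \<alpha> * (\<alpha>\<^sup>2 / 2)"
      unfolding abs_mult using z a0 one_minus_cos_bound[of \<alpha>] by (intro mult_mono) auto
    also have "\<dots> = \<alpha> ^ 3 / 2" by (simp add: power2_eq_square power3_eq_cube)
    finally show ?thesis unfolding Q_def using sin_cubic_abs[OF a0] by linarith
  qed
  moreover have "\<alpha> ^ 3 \<ge> 0" using a0 by simp
  ultimately show ?thesis by (simp only: mult.assoc)
qed

text \<open>On \<open>[- 1, 1]\<close> the sine grows at least half as fast as the identity; apply the intermediate value theorem.\<close>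

lemma sin_perturb:
  fixes x e :: real
  assumes x: "\<bar>x\<bar> \<le> 1/4" and e: "\<bar>e\<bar> \<le> 1/4"
  obtains d where "\<bar>d\<bar> \<le> 2 * \<bar>e\<bar>" "sin (x + d) = sin x + e"
proof -
  define E where "E = 2 * \<bar>e\<bar>"
  have E: "0 \<le> E" "E \<le> 1/2" using e by (auto simp: E_def)
  have c: "cos z \<ge> 1/2" if "\<bar>z\<bar> \<le> 1" for z :: real
  proof -
    have "z\<^sup>2 \<le> 1" using that by (simp add: abs_square_le_1)
    thus ?thesis using one_minus_cos_bound(2)[of z] by simp
  qed
  define f where "f = (\<lambda>z. sin z - z / 2 :: real)"
  have mono: "f u \<le> f v" if "u \<le> v" "-1 \<le> u" "v \<le> 1" for u v
  proof (rule DERIV_nonneg_imp_nondecreasing[OF that(1)])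
    fix z assume "u \<le> z" "z \<le> v"
    hence "cos z \<ge> 1/2" using that by (intro c) auto
    moreover have "(f has_real_derivative cos z - 1 / 2) (at z)"
      unfolding f_def by (auto intro!: derivative_eq_intros)
    ultimately show "\<exists>y. (f has_real_derivative y) (at z) \<and> 0 \<le> y" by (intro exI[of _ "cos z - 1/2"]) auto
  qed
  have "sin (x - E) \<le> sin x + e" "sin x + e \<le> sin (x + E)"
  proof -
    have "f (x - E) \<le> f x" "f x \<le> f (x + E)" by (rule mono; use x E in linarith)+
    thus "sin (x - E) \<le> sin x + e" "sin x + e \<le> sin (x + E)"
      unfolding f_def E_def diff_divide_distrib add_divide_distrib by linarith+
  qed
  moreover have "continuous_on {x - E..x + E} sin" by (intro continuous_intros)
  moreover have "x - E \<le> x + E" using E by simp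
  ultimately obtain z where "x - E \<le> z" "z \<le> x + E" "sin z = sin x + e"
    using IVT'[of sin "x - E" "sin x + e" "x + E"] by blast
  thus ?thesis by (intro that[of "z - x"]) (auto simp: E_def)
qed

lemma alternating_sum_bound:
  fixes b :: "nat \<Rightarrow> real"
  shows "\<bar>\<Sum>j<k. (-1) ^ j * b j\<bar> \<le> \<bar>\<beta>\<bar> + (\<Sum>j<k. \<bar>b j - \<beta>\<bar>)"
proof -
  have "(\<Sum>j<k. (-1) ^ j * b j) = (\<Sum>j<k. (-1) ^ j * \<beta>) + (\<Sum>j<k. (-1) ^ j * (b j - \<beta>))"
    by (simp add: sum.distrib[symmetric] algebra_simps)
  moreover have "\<bar>\<Sum>j<k. (-1) ^ j * \<beta>\<bar> \<le> \<bar>\<beta>\<bar>"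
  proof -
    have "(\<Sum>j<k. (-1) ^ j * \<beta>) = (if even k then 0 else \<beta>)" by (induction k) auto
    thus ?thesis by simp
  qed
  moreover have "\<bar>\<Sum>j<k. (-1) ^ j * (b j - \<beta>)\<bar> \<le> (\<Sum>j<k. \<bar>b j - \<beta>\<bar>)"
    by (rule order_trans[OF sum_abs]) (simp add: abs_mult power_abs)
  ultimately show ?thesis by linarith
qed

text \<open>The gaps between the vertices of the competitor and their partial sums, before scaling. The first gap is \<open>w\<^sub>0\<close>, and all
others are close to \<open>2\<close>.\<close>

definition w_gap :: "nat \<Rightarrow> real" where "w_gap k = prev0 w_star k + w_star k"
definition w_node :: "nat \<Rightarrow> real" where "w_node k = (\<Sum>j<k. w_gap j)"

lemma prev0_w: "0 \<le> prev0 w_star k" "prev0 w_star k \<le> 7/5"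
  using w_star_bounds by (cases k; simp add: w_star_nonneg)+

lemma w_diff: "\<bar>w_star k - prev0 w_star k\<bar> \<le> 7/3 * (3/4) ^ k"
proof (cases k)
  case 0 thus ?thesis using w_star_bounds[of 0] by simp
next
  case (Suc j)
  thus ?thesis using w_star_decay[of k] w_star_decay[of j] unfolding Suc prev0_simps power_Suc by linarith
qed

lemma w_gap_diff: "\<bar>w_gap k - 2\<bar> \<le> 7/3 * (3/4) ^ k"
proof (cases k)
  case 0 thus ?thesis using w_star_bounds[of 0] by (simp add: w_gap_def)
next
  case (Suc j)
  thus ?thesis using w_star_decay[of k] w_star_decay[of j] unfolding w_gap_def Suc prev0_simps power_Suc by linarith
qed

lemma w_gap_bounds: "7/10 \<le> w_gap k" "w_gap k \<le> 14/5"
  using w_star_bounds[of k] prev0_w[of k] by (auto simp: w_gap_def)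

lemma w_node_bounds: "\<bar>w_node k - 2 * real k\<bar> \<le> 10" "w_node k \<le> 14/5 * real k"
proof -
  have "\<bar>w_node k - 2 * real k\<bar> = \<bar>\<Sum>j<k. w_gap j - 2\<bar>" by (simp add: w_node_def sum_subtractf mult.commute)
  also have "\<dots> \<le> (\<Sum>j<k. 7/3 * (3/4) ^ j)"
    by (rule order_trans[OF sum_abs]) (rule sum_mono, rule w_gap_diff)
  also have "\<dots> \<le> 7/3 * 4" unfolding sum_distrib_left[symmetric] by (rule mult_left_mono[OF sum_geometric34]) simp
  finally show "\<bar>w_node k - 2 * real k\<bar> \<le> 10" by linarith
  show "w_node k \<le> 14/5 * real k" unfolding w_node_def using sum_bounded_above[of "{..<k}" w_gap "14/5"] w_gap_bounds(2) by simp
qed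

lemma tau_ge_atoms: "(\<Sum>k<h. phi (prev0 w_star k) (w_star k)) \<le> tau"
proof (cases h)
  case 0
  thus ?thesis using tau_ge_partial[of 0] phi_nonneg[of 0 "w_star 0"] w_star_nonneg by simp
next
  case (Suc N)
  show ?thesis unfolding Suc using tau_ge_partial[of N] by (subst sum.lessThan_Suc_shift) simp
qed

section \<open>The competitor\<close>

text \<open>The polygon with \<open>n = 2 h\<close> vertices. The bound for \<open>h\<close> makes the correction terms, with their explicit constants, small
compared to the main terms.\<close>

locale competitor =
  fixes h :: nat
  assumes h_large: "h \<ge> 10000"
begin

definition H where "H = 1 / real h"
definition \<mu> where "\<mu> = pi / (4 * w_node h)"

lemma H: "0 < H" "H \<le> 1/10000" "real h * H = 1"
  using h_large by (auto simp: H_def divide_simps)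

lemma H_powers: "H ^ 3 \<le> H\<^sup>2 / 10000" "H\<^sup>2 \<le> H / 10000" "H ^ 4 \<le> H ^ 3 / 10000"
proof -
  have *: "H ^ Suc k \<le> H ^ k / 10000" for k
    using mult_right_mono[OF H(2), of "H ^ k"] H(1) by simp
  show "H ^ 3 \<le> H\<^sup>2 / 10000" "H\<^sup>2 \<le> H / 10000" "H ^ 4 \<le> H ^ 3 / 10000"
    using *[of 2] *[of 1] *[of 3] by (simp_all add: numeral_eq_Suc)
qed

lemma w_node_h: "real h \<le> w_node h" "w_node h \<ge> 2 * real h - 10"
proof -
  have "2 * real h - w_node h \<le> 10" using w_node_bounds(1)[of h] by linarith
  thus "w_node h \<ge> 2 * real h - 10" "real h \<le> w_node h" using h_large by linarith+
qed

lemma mu: "0 < \<mu>" "\<mu> \<le> H" "H / 4 \<le> \<mu>" "2 * \<mu> * w_node h = pi / 2"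
proof -
  have y: "real h > 0" "w_node h > 0" using w_node_h(1) h_large by linarith+
  show "0 < \<mu>" using y by (simp add: \<mu>_def)
  have "pi * real h \<le> 4 * w_node h" using pi_less_4 w_node_h(1) y by (intro mult_mono) auto
  thus "\<mu> \<le> H" using y by (simp add: \<mu>_def H_def divide_simps mult.commute)
  have "w_node h \<le> 14/5 * real h" by (rule w_node_bounds)
  also have "\<dots> \<le> pi * real h" using pi_gt3 y by (intro mult_right_mono) auto
  finally show "H / 4 \<le> \<mu>" using y by (simp add: \<mu>_def H_def divide_simps mult.commute)
  show "2 * \<mu> * w_node h = pi / 2" using y by (simp add: \<mu>_def)
qed

lemma base_gap: "0 < 2 * \<mu> * w_gap k" "2 * \<mu> * w_gap k \<le> 28/5 * H" "2 * \<mu> * w_gap k \<ge> 7/20 * H" "2 * \<mu> * w_gap k \<le> 1"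
proof -
  show "0 < 2 * \<mu> * w_gap k" using mu(1) w_gap_bounds(1)[of k] by simp
  have "\<mu> * w_gap k \<le> H * (14/5)" using mu w_gap_bounds[of k] by (intro mult_mono) auto
  thus *: "2 * \<mu> * w_gap k \<le> 28/5 * H" unfolding mult.assoc[of 2] by linarith
  have "(H / 4) * (7/10) \<le> \<mu> * w_gap k" using mu(1,3) H(1) w_gap_bounds[of k] by (intro mult_mono) auto
  thus "2 * \<mu> * w_gap k \<ge> 7/20 * H" unfolding mult.assoc[of 2] by linarith
  show "2 * \<mu> * w_gap k \<le> 1" using * H(2) by linarith
qed

text \<open>The amount by which the path \<open>W\<close> fails to close if the gaps are exactly \<open>2 \<mu> (w\<^sub>k\<^sub>-\<^sub>1 + w\<^sub>k)\<close>.\<close>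

definition defect where "defect = (\<Sum>k<h. (-1) ^ k * (sin (2 * \<mu> * w_node (Suc k)) - sin (2 * \<mu> * w_node k)))"

text \<open>With the weights of \<open>sine_increment_error\<close> the alternating sum telescopes to the boundary terms \<open>G h\<close> and \<open>G 0\<close>. Both
vanish: the first because \<open>cos (\<pi>/2) = 0\<close>, the second because the value in front of the profile is \<open>0\<close>.\<close>

lemma defect_bound: "\<bar>defect\<bar> \<le> 230 * H\<^sup>2"
proof -
  define G where "G = (\<lambda>k. - ((-1) ^ k * (2 * \<mu> * prev0 w_star k * cos (2 * \<mu> * w_node k))))"
  define T where "T = (\<lambda>k. sin (2 * \<mu> * w_node (Suc k)) - sin (2 * \<mu> * w_node k)
      - 2 * \<mu> * (w_star k * cos (2 * \<mu> * w_node (Suc k)) + prev0 w_star k * cos (2 * \<mu> * w_node k)))"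
  have "(\<Sum>k<h. G (Suc k) - G k) = G h - G 0" by (rule sum_lessThan_telescope)
  also have "\<dots> = 0" by (simp add: G_def mu(4))
  finally have G0: "(\<Sum>k<h. G (Suc k) - G k) = 0" .
  have "defect = (\<Sum>k<h. (-1) ^ k * T k + (G (Suc k) - G k))"
    unfolding defect_def by (rule sum.cong[OF refl]) (simp add: T_def G_def algebra_simps)
  hence e: "defect = (\<Sum>k<h. (-1) ^ k * T k)" by (simp only: sum.distrib G0 add_0_right)
  have T: "\<bar>T k\<bar> \<le> 196/15 * H\<^sup>2 * (3/4) ^ k + 176 * H ^ 3" for k
  proof -
    have yS: "2 * \<mu> * w_node (Suc k) = 2 * \<mu> * w_node k + 2 * \<mu> * (prev0 w_star k + w_star k)"
      by (simp add: w_node_def w_gap_def distrib_left)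
    have "\<bar>T k\<bar> \<le> (2 * \<mu> * w_gap k) * \<mu> * \<bar>w_star k - prev0 w_star k\<bar> + (2 * \<mu> * w_gap k) ^ 3"
      unfolding T_def yS w_gap_def
      by (rule sine_increment_error) (use mu(1) prev0_w w_star_nonneg base_gap(4)[of k] in \<open>auto simp: w_gap_def\<close>)
    also have "\<dots> \<le> (28/5 * H) * H * (7/3 * (3/4) ^ k) + (28/5 * H) ^ 3"
    proof -
      define g where "g = 2 * \<mu> * w_gap k"
      have g: "0 \<le> g" "g \<le> 28/5 * H" using base_gap(1,2)[of k] by (auto simp: g_def)
      show ?thesis unfolding g_def[symmetric]
        by (intro add_mono mult_mono power_mono mult_nonneg_nonneg) (use g mu(1,2) H(1) w_diff[of k] in auto)
    qed
    also have "\<dots> \<le> 196/15 * H\<^sup>2 * (3/4) ^ k + 176 * H ^ 3"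
    proof -
      have "(28/5 * H) ^ 3 \<le> 176 * H ^ 3" using H(1) by (simp add: power_mult_distrib power_divide)
      moreover have "(28/5 * H) * H * (7/3 * (3/4) ^ k) = 196/15 * H\<^sup>2 * (3/4) ^ k"
        by (simp add: power2_eq_square)
      ultimately show ?thesis by linarith
    qed
    finally show ?thesis .
  qed
  have "\<bar>defect\<bar> \<le> (\<Sum>k<h. \<bar>T k\<bar>)"
    unfolding e by (rule order_trans[OF sum_abs]) (simp add: abs_mult power_abs)
  also have "\<dots> \<le> (\<Sum>k<h. 196/15 * H\<^sup>2 * (3/4) ^ k + 176 * H ^ 3)" by (rule sum_mono) (rule T)
  also have "\<dots> = 196/15 * H\<^sup>2 * (\<Sum>k<h. (3/4) ^ k) + 176 * (real h * H) * H\<^sup>2"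
    by (simp add: sum.distrib sum_distrib_left power2_eq_square power3_eq_cube)
  also have "\<dots> \<le> 196/15 * H\<^sup>2 * 4 + 176 * H\<^sup>2"
    using mult_left_mono[OF sum_geometric34[of h], of "196/15 * H\<^sup>2"] by (simp add: H(3))
  also have "\<dots> \<le> 230 * H\<^sup>2" by simp
  finally show ?thesis .
qed

lemma ex_shift: "\<exists>d. \<bar>d\<bar> \<le> 230 * H\<^sup>2 \<and> sin (2 * \<mu> * w_node 1 + d) = sin (2 * \<mu> * w_node 1) - defect / 2"
proof -
  have y1: "w_node 1 = w_gap 0" by (simp add: w_node_def)
  have "\<bar>2 * \<mu> * w_node 1\<bar> \<le> 1/4" unfolding y1 using base_gap(1,2)[of 0] H(2) by linarith
  moreover have "\<bar>- defect / 2\<bar> \<le> 1/4" using defect_bound H_powers(2) H(2) by linarith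
  ultimately obtain d where "\<bar>d\<bar> \<le> 2 * \<bar>- defect / 2\<bar>" "sin (2 * \<mu> * w_node 1 + d) = sin (2 * \<mu> * w_node 1) + (- defect / 2)"
    by (rule sin_perturb)
  thus ?thesis using defect_bound by (intro exI[of _ d]) auto
qed

text \<open>Moving the vertex \<open>1\<close> by the angle \<open>\<delta>\<close> closes the path; the first gap grows by \<open>\<delta>\<close> and the second shrinks by \<open>\<delta>\<close>.\<close>

definition \<delta> where "\<delta> = (SOME d. \<bar>d\<bar> \<le> 230 * H\<^sup>2 \<and> sin (2 * \<mu> * w_node 1 + d) = sin (2 * \<mu> * w_node 1) - defect / 2)"

lemma delta: "\<bar>\<delta>\<bar> \<le> 230 * H\<^sup>2" "sin (2 * \<mu> * w_node 1 + \<delta>) = sin (2 * \<mu> * w_node 1) - defect / 2"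
  using someI_ex[OF ex_shift] unfolding \<delta>_def by auto

definition \<gamma> where "\<gamma> k = (if k = 0 then \<delta> else if k = 1 then - \<delta> else 0)"
definition gap where "gap k = 2 * \<mu> * w_gap k + \<gamma> k"
definition \<alpha> where "\<alpha> k = (if k < h then gap k else gap (2 * h - 1 - k))"

lemma \<alpha>_eq: "k < h \<Longrightarrow> \<alpha> k = gap k" by (simp add: \<alpha>_def)

lemma gamma: "\<bar>\<gamma> k\<bar> \<le> 230 * H\<^sup>2" "\<bar>\<gamma> k\<bar> \<le> 307 * H\<^sup>2 * (3/4) ^ k"
  using delta(1) H(1) by (auto simp: \<gamma>_def)

lemma gap_bounds: "0 < gap k" "gap k \<le> 6 * H"
  unfolding gap_def using base_gap(2,3)[of k] gamma(1)[of k] H_powers(2) H(1) by linarith+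

lemma gap_near: "\<bar>gap k - 4 * \<mu>\<bar> \<le> 24/5 * H * (3/4) ^ k"
proof -
  have "gap k - 4 * \<mu> = 2 * \<mu> * (w_gap k - 2) + \<gamma> k" by (simp add: gap_def algebra_simps)
  moreover have "\<bar>2 * \<mu> * (w_gap k - 2)\<bar> \<le> (2 * H) * (7/3 * (3/4) ^ k)"
    unfolding abs_mult using mu(1,2) H(1) w_gap_diff[of k] by (intro mult_mono) auto
  moreover have "307 * H\<^sup>2 * (3/4) ^ k \<le> 307 * (H / 10000) * (3/4) ^ k"
    using H_powers(2) H(1) by (intro mult_mono) auto
  ultimately have "\<bar>gap k - 4 * \<mu>\<bar> \<le> (2 * H) * (7/3 * (3/4) ^ k) + 307 * (H / 10000) * (3/4) ^ k"
    using gamma(2)[of k] by linarith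
  also have "\<dots> \<le> 24/5 * H * (3/4) ^ k" using H(1) by simp
  finally show ?thesis .
qed

lemma partial_gaps: "k \<le> h \<Longrightarrow> (\<Sum>j<k. \<alpha> j) = 2 * \<mu> * w_node k + (if k = 1 then \<delta> else 0)"
proof (induction k)
  case (Suc k) thus ?case by (auto simp: \<alpha>_def gap_def \<gamma>_def w_node_def algebra_simps)
qed (simp add: w_node_def)

sublocale symmetric_gaps h \<alpha>
proof
  show "h \<ge> 2" using h_large by simp
  show "\<alpha> k > 0" if "k < 2 * h" for k using gap_bounds(1) by (simp add: \<alpha>_def)
  show "\<alpha> (2 * h - 1 - k) = \<alpha> k" if "k < 2 * h" for k
    using that by (auto simp: \<alpha>_def)
  show "(\<Sum>k<h. \<alpha> k) = pi / 2" using partial_gaps[of h] h_large mu(4) by simp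
  show "(\<Sum>k<h. (-1) ^ k * (sin (\<Sum>j<Suc k. \<alpha> j) - sin (\<Sum>j<k. \<alpha> j))) = 0"
  proof -
    \<comment> \<open>The shift changes the sine at the node \<open>1\<close> only, and this node occurs in two consecutive increments with opposite signs.\<close>
    define u where "u = (\<lambda>k::nat. if k = 1 then - defect / 2 else 0)"
    have S: "sin (\<Sum>j<k. \<alpha> j) = sin (2 * \<mu> * w_node k) + u k" if "k \<le> h" for k
      using partial_gaps[OF that] delta(2) by (auto simp: u_def)
    have "(\<Sum>k<h. (-1) ^ k * (sin (\<Sum>j<Suc k. \<alpha> j) - sin (\<Sum>j<k. \<alpha> j)))
        = (\<Sum>k<h. (-1) ^ k * (sin (2 * \<mu> * w_node (Suc k)) - sin (2 * \<mu> * w_node k)) + (-1) ^ k * (u (Suc k) - u k))"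
    proof (rule sum.cong[OF refl])
      fix k assume "k \<in> {..<h}"
      hence "Suc k \<le> h" "k \<le> h" by auto
      show "(-1) ^ k * (sin (\<Sum>j<Suc k. \<alpha> j) - sin (\<Sum>j<k. \<alpha> j))
        = (-1) ^ k * (sin (2 * \<mu> * w_node (Suc k)) - sin (2 * \<mu> * w_node k)) + (-1) ^ k * (u (Suc k) - u k)"
        unfolding S[OF \<open>Suc k \<le> h\<close>] S[OF \<open>k \<le> h\<close>] by (simp only: right_diff_distrib distrib_left)
    qed
    also have "\<dots> = defect + (\<Sum>k<h. (-1) ^ k * (u (Suc k) - u k))" by (simp only: sum.distrib defect_def)
    also have "(\<Sum>k<h. (-1) ^ k * (u (Suc k) - u k)) = - defect"
    proof -
      have "(\<Sum>k<h. (-1) ^ k * (u (Suc k) - u k)) = (\<Sum>k\<in>{0, 1}. (-1) ^ k * (u (Suc k) - u k))"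
        by (rule sum.mono_neutral_right) (use h_large in \<open>auto simp: u_def\<close>)
      thus ?thesis by (simp add: u_def)
    qed
    finally show ?thesis by simp
  qed
qed

text \<open>The slopes follow the signed profile \<open>(- 1)\<^sup>k \<mu> w\<^sub>k\<^sub>-\<^sub>1\<close>, with a constant offset \<open>- \<delta>\<close> that is caused by the displaced
vertex; \<open>rem\<close> is what remains.\<close>

definition rem where "rem k = slope k - (-1) ^ k * \<mu> * prev0 w_star k + \<delta>"

text \<open>If sines were equal to their arguments, then the alternating sum would telescope to the signed profile. The differences
\<open>t - sin t\<close> are of order \<open>h\<^sup>-\<^sup>3\<close> and almost constant, so their alternating sums are of order \<open>h\<^sup>-\<^sup>3\<close>,
too. The second term of the bound covers the first two indices.\<close>

lemma rem_bound:
  assumes "k \<le> h" shows "\<bar>rem k\<bar> \<le> 46 * H ^ 3 + 307 * H\<^sup>2 * (3/4) ^ k"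
proof -
  define b where "b = (\<lambda>j. gap j / 2 - sin (gap j / 2))"
  define \<beta> where "\<beta> = 2 * \<mu> - sin (2 * \<mu>)"
  define c where "c = (if k = 0 then \<delta> else if k = 1 then \<delta> / 2 else 0)"
  have id: "slope k = (-1) ^ k * \<mu> * prev0 w_star k - \<delta> + (if k = 0 then \<delta> else if k = 1 then \<delta> / 2 else 0)
       + (\<Sum>j<k. (-1) ^ j * b j)" if "k \<le> h" for k
    using that
  proof (induction k)
    case 0 thus ?case by (simp add: slope_0)
  next
    case (Suc k)
    hence "slope (Suc k) = (-1) ^ k * \<mu> * prev0 w_star k - \<delta> + (if k = 0 then \<delta> else if k = 1 then \<delta> / 2 else 0)
       + (\<Sum>j<k. (-1) ^ j * b j) - (-1) ^ k * (gap k / 2 - b k)"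
      using \<alpha>_eq[of k] by (simp add: slope_Suc b_def)
    moreover have "gap k / 2 = \<mu> * prev0 w_star k + \<mu> * w_star k + \<gamma> k / 2"
      by (simp add: gap_def w_gap_def algebra_simps)
    ultimately show ?case
      by (cases "k = 0"; cases "k = 1") (auto simp: \<gamma>_def algebra_simps add_divide_distrib)
  qed
  have rem_eq: "rem k = c + (\<Sum>j<k. (-1) ^ j * b j)" by (simp add: rem_def id[OF assms] c_def)
  have "\<bar>b j - \<beta>\<bar> \<le> 54/5 * H ^ 3 * (3/4) ^ j" for j
  proof -
    have "\<bar>b j - \<beta>\<bar> \<le> (3 * H)\<^sup>2 / 2 * \<bar>gap j / 2 - 2 * \<mu>\<bar>"
      unfolding b_def \<beta>_def
      by (rule diff_sin_lipschitz) (use gap_bounds[of j] mu H(1) in auto)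
    also have "\<bar>gap j / 2 - 2 * \<mu>\<bar> \<le> 12/5 * H * (3/4) ^ j" using gap_near[of j] by linarith
    hence "(3 * H)\<^sup>2 / 2 * \<bar>gap j / 2 - 2 * \<mu>\<bar> \<le> (3 * H)\<^sup>2 / 2 * (12/5 * H * (3/4) ^ j)"
      by (rule mult_left_mono) simp
    also have "\<dots> = 54/5 * H ^ 3 * (3/4) ^ j" by (simp add: power2_eq_square power3_eq_cube)
    finally show ?thesis .
  qed
  hence "(\<Sum>j<k. \<bar>b j - \<beta>\<bar>) \<le> (\<Sum>j<k. 54/5 * H ^ 3 * (3/4) ^ j)" by (intro sum_mono)
  also have "\<dots> \<le> 54/5 * H ^ 3 * 4"
    unfolding sum_distrib_left[symmetric] by (rule mult_left_mono[OF sum_geometric34]) (use H(1) in simp)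
  finally have s: "(\<Sum>j<k. \<bar>b j - \<beta>\<bar>) \<le> 216/5 * H ^ 3" by simp
  have "\<bar>\<beta>\<bar> \<le> (2 * \<mu>) ^ 3 / 6" unfolding \<beta>_def using sin_cubic_abs[of "2 * \<mu>"] mu(1) by linarith
  also have "\<dots> \<le> (2 * H) ^ 3 / 6" using mu by (intro divide_right_mono power_mono) auto
  also have "\<dots> = 4/3 * H ^ 3" by (simp add: power_mult_distrib)
  finally have "\<bar>\<Sum>j<k. (-1) ^ j * b j\<bar> \<le> 46 * H ^ 3"
    using alternating_sum_bound[of b k \<beta>] s zero_le_power[of H 3] H(1) by linarith
  moreover have "\<bar>c\<bar> \<le> 307 * H\<^sup>2 * (3/4) ^ k" using delta(1) H(1) by (auto simp: c_def)
  ultimately show ?thesis unfolding rem_eq by linarith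
qed

lemma rem_delta: "k \<le> h \<Longrightarrow> \<bar>rem k - \<delta>\<bar> \<le> 538 * H\<^sup>2"
proof -
  assume "k \<le> h"
  moreover have "307 * H\<^sup>2 * (3/4) ^ k \<le> 307 * H\<^sup>2 * 1" by (intro mult_left_mono power_le_one) auto
  ultimately show ?thesis using rem_bound[of k] delta(1) H_powers(1) zero_le_power2[of H] by linarith
qed

lemma slope_eq: "slope k = (-1) ^ k * \<mu> * prev0 w_star k + (rem k - \<delta>)"
  by (simp add: rem_def)

end

section \<open>The area of the competitor\<close>

context competitor begin

lemma slope_near: "Suc j \<le> h \<Longrightarrow> \<bar>slope (Suc j) - (-1) ^ Suc j * \<mu>\<bar> \<le> H * (3/4) ^ j + 538 * H\<^sup>2"
proof -
  assume j: "Suc j \<le> h"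
  have "slope (Suc j) - (-1) ^ Suc j * \<mu> = (-1) ^ Suc j * (\<mu> * (w_star j - 1)) + (rem (Suc j) - \<delta>)"
    unfolding slope_eq by (simp add: algebra_simps)
  moreover have "\<bar>(-1) ^ Suc j * (\<mu> * (w_star j - 1))\<bar> \<le> H * (3/4) ^ j"
  proof -
    have "\<bar>(-1) ^ Suc j * (\<mu> * (w_star j - 1))\<bar> = \<mu> * \<bar>w_star j - 1\<bar>"
      using mu(1) by (simp add: abs_mult power_abs)
    also have "\<dots> \<le> H * (3/4) ^ j" using mu(1,2) H(1) w_star_decay[of j] by (intro mult_mono) auto
    finally show ?thesis .
  qed
  ultimately show ?thesis using rem_delta[OF j] by linarith
qed

text \<open>The increments of the primitive of the slope.\<close>

definition drift where "drift j = slope (Suc j) * ((\<alpha> j + \<alpha> (Suc j)) / 2)"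

lemma drift_near: "j < h \<Longrightarrow> \<bar>drift j - (-1) ^ Suc j * (4 * \<mu>\<^sup>2)\<bar> \<le> 11 * H\<^sup>2 * (3/4) ^ j + 3228 * H ^ 3"
proof -
  assume j: "j < h"
  define L where "L = (\<alpha> j + \<alpha> (Suc j)) / 2"
  define D where "D = slope (Suc j) - (-1) ^ Suc j * \<mu>"
  have a: "\<alpha> j = gap j" using j by (rule \<alpha>_eq)
  have q: "(3/4 :: real) ^ Suc j \<le> (3/4) ^ j" by simp
  have a': "\<bar>\<alpha> (Suc j) - 4 * \<mu>\<bar> \<le> 24/5 * H * (3/4) ^ j" "0 < \<alpha> (Suc j)" "\<alpha> (Suc j) \<le> 6 * H"
  proof -
    have "\<alpha> (Suc j) = gap (Suc j) \<or> \<alpha> (Suc j) = gap j"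
    proof (cases "Suc j = h")
      case True
      hence "2 * h - 1 - Suc j = j" by simp
      thus ?thesis using True by (simp add: \<alpha>_def)
    next
      case False thus ?thesis using j by (simp add: \<alpha>_eq)
    qed
    moreover have "24/5 * H * (3/4) ^ Suc j \<le> 24/5 * H * (3/4) ^ j" using q H(1) by (intro mult_left_mono) auto
    hence "\<bar>gap (Suc j) - 4 * \<mu>\<bar> \<le> 24/5 * H * (3/4) ^ j" using gap_near[of "Suc j"] by linarith
    ultimately show "\<bar>\<alpha> (Suc j) - 4 * \<mu>\<bar> \<le> 24/5 * H * (3/4) ^ j" "0 < \<alpha> (Suc j)" "\<alpha> (Suc j) \<le> 6 * H"
      using gap_near[of j] gap_bounds[of j] gap_bounds[of "Suc j"] by metis+
  qed
  have L: "\<bar>L - 4 * \<mu>\<bar> \<le> 24/5 * H * (3/4) ^ j" "0 \<le> L" "L \<le> 6 * H"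
  proof -
    define c where "c = 24/5 * H * (3/4) ^ j"
    have "\<bar>gap j - 4 * \<mu>\<bar> \<le> c" "\<bar>\<alpha> (Suc j) - 4 * \<mu>\<bar> \<le> c" unfolding c_def by (rule gap_near, rule a')
    moreover have "L = gap j / 2 + \<alpha> (Suc j) / 2" by (simp add: L_def a add_divide_distrib)
    ultimately show "\<bar>L - 4 * \<mu>\<bar> \<le> 24/5 * H * (3/4) ^ j" "0 \<le> L" "L \<le> 6 * H"
      using a'(2,3) gap_bounds[of j] unfolding c_def[symmetric] by linarith+
  qed
  have D: "\<bar>D\<bar> \<le> H * (3/4) ^ j + 538 * H\<^sup>2" unfolding D_def using j by (intro slope_near) simp
  have "drift j - (-1) ^ Suc j * (4 * \<mu>\<^sup>2) = D * L + (-1) ^ Suc j * (\<mu> * (L - 4 * \<mu>))"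
    unfolding drift_def L_def[symmetric] D_def by (simp add: power2_eq_square algebra_simps)
  moreover have "\<bar>D * L\<bar> \<le> (H * (3/4) ^ j + 538 * H\<^sup>2) * (6 * H)"
    unfolding abs_mult using D L H(1) by (intro mult_mono) auto
  moreover have "\<bar>(-1) ^ Suc j * (\<mu> * (L - 4 * \<mu>))\<bar> \<le> H * (24/5 * H * (3/4) ^ j)"
  proof -
    have "\<bar>(-1) ^ Suc j * (\<mu> * (L - 4 * \<mu>))\<bar> = \<mu> * \<bar>L - 4 * \<mu>\<bar>"
      using mu(1) by (simp add: abs_mult power_abs)
    also have "\<dots> \<le> H * (24/5 * H * (3/4) ^ j)" using mu(1,2) H(1) L(1) by (intro mult_mono) auto
    finally show ?thesis .
  qed
  moreover have "(H * (3/4) ^ j + 538 * H\<^sup>2) * (6 * H) + H * (24/5 * H * (3/4) ^ j)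
     = 54/5 * (H\<^sup>2 * (3/4) ^ j) + 3228 * H ^ 3"
    by (simp add: power2_eq_square power3_eq_cube algebra_simps)
  moreover have "0 \<le> H\<^sup>2 * (3/4) ^ j" by simp
  ultimately show ?thesis by linarith
qed

lemma drift_reflect: "j < 2 * h - 1 \<Longrightarrow> drift (2 * h - 2 - j) = drift j"
proof -
  assume j: "j < 2 * h - 1"
  have "Suc (2 * h - 2 - j) = 2 * h - Suc j" using j by simp
  moreover have "\<alpha> (2 * h - 2 - j) = \<alpha> (Suc j)" using gap_sym[of "Suc j"] j by simp
  moreover have "\<alpha> (2 * h - Suc j) = \<alpha> j" using gap_sym[of j] j by simp
  moreover have "slope (2 * h - Suc j) = slope (Suc j)" using slope_reflect[of "Suc j"] j by simp
  ultimately show ?thesis unfolding drift_def by (simp only: add.commute)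
qed

text \<open>Up to deviations whose sum is of order \<open>h\<^sup>-\<^sup>2\<close> the drift alternates between \<open>4 \<mu>\<^sup>2\<close> and \<open>- 4 \<mu>\<^sup>2\<close>. The deviations are estimated
in the first quarter turn and reflected to the second.\<close>

lemma drift_bound:
  assumes "k < 2 * h" shows "\<bar>\<Sum>j<k. drift j\<bar> \<le> 6600 * H\<^sup>2"
proof -
  define b where "b = (\<lambda>j. - ((-1) ^ j * drift j))"
  define e where "e = (\<lambda>j. \<bar>b j - 4 * \<mu>\<^sup>2\<bar>)"
  have sq: "(-1::real) ^ j * (-1) ^ j = 1" for j by (simp add: power_mult_distrib[symmetric])
  have e_eq: "e j = \<bar>drift j - (-1) ^ Suc j * (4 * \<mu>\<^sup>2)\<bar>" for j
  proof -
    have "b j - 4 * \<mu>\<^sup>2 = - ((-1) ^ j * (drift j + ((-1) ^ j * (4 * \<mu>\<^sup>2))))"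
      using sq[of j] by (simp add: b_def distrib_left mult.assoc[symmetric])
    thus ?thesis by (simp add: e_def abs_mult power_abs)
  qed
  have half: "(\<Sum>j<h. e j) \<le> 3272 * H\<^sup>2"
  proof -
    have "(\<Sum>j<h. e j) \<le> (\<Sum>j<h. 11 * H\<^sup>2 * (3/4) ^ j + 3228 * H ^ 3)"
      unfolding e_eq by (intro sum_mono drift_near) auto
    also have "\<dots> = 11 * H\<^sup>2 * (\<Sum>j<h. (3/4) ^ j) + 3228 * (real h * H) * H\<^sup>2"
      by (simp add: sum.distrib sum_distrib_left power2_eq_square power3_eq_cube)
    also have "\<dots> \<le> 11 * H\<^sup>2 * 4 + 3228 * H\<^sup>2"
      using mult_left_mono[OF sum_geometric34[of h], of "11 * H\<^sup>2"] by (simp add: H(3))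
    finally show ?thesis by simp
  qed
  have mirror: "e (2 * h - 2 - j) = e j" if "j < 2 * h - 1" for j
  proof -
    have "2 * h - 2 - j + j = 2 * (h - 1)" using that by simp
    hence "even (2 * h - 2 - j) \<longleftrightarrow> even j" by (metis dvd_triv_left even_add)
    thus ?thesis unfolding e_eq using drift_reflect[OF that] by (simp add: minus_one_power_iff)
  qed
  have "(\<Sum>j<k. e j) \<le> (\<Sum>j<2 * h - 1. e j)" using assms by (intro sum_mono2) (auto simp: e_def)
  also have "\<dots> = (\<Sum>j<h. e j) + (\<Sum>j\<in>{h..<2 * h - 1}. e j)"
    using h_large by (subst sum.union_disjoint[symmetric]) (auto simp: ivl_disj_un)
  also have "(\<Sum>j\<in>{h..<2 * h - 1}. e j) = (\<Sum>j<h - 1. e (2 * h - 2 - j))"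
  proof (rule sum.reindex_bij_witness[of _ "\<lambda>j. 2 * h - 2 - j" "\<lambda>j. 2 * h - 2 - j"])
    fix a assume "a \<in> {h..<2 * h - 1}"
    hence "a \<le> 2 * h - 2" by auto
    hence "2 * h - 2 - (2 * h - 2 - a) = a" by (rule diff_diff_cancel)
    thus "2 * h - 2 - (2 * h - 2 - a) = a" "e (2 * h - 2 - (2 * h - 2 - a)) = e a" by simp_all
  qed auto
  also have "\<dots> = (\<Sum>j<h - 1. e j)"
  proof (rule sum.cong[OF refl])
    fix j assume "j \<in> {..<h - 1}"
    thus "e (2 * h - 2 - j) = e j" using mirror[of j] by simp
  qed
  also have "\<dots> \<le> (\<Sum>j<h. e j)" by (intro sum_mono2) (auto simp: e_def)
  finally have "(\<Sum>j<k. e j) \<le> 6544 * H\<^sup>2" using half by linarith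
  moreover have "\<bar>\<Sum>j<k. (-1) ^ j * b j\<bar> \<le> \<bar>4 * \<mu>\<^sup>2\<bar> + (\<Sum>j<k. e j)"
    unfolding e_def by (rule alternating_sum_bound)
  moreover have "(\<Sum>j<k. (-1) ^ j * b j) = - (\<Sum>j<k. drift j)"
    using sq by (simp add: b_def sum_negf mult.assoc[symmetric])
  moreover have "\<mu>\<^sup>2 \<le> H\<^sup>2" using mu by (intro power_mono) auto
  ultimately show ?thesis using zero_le_power2[of H] by simp
qed

text \<open>The terms of the order of \<open>\<mu> \<delta>\<close> would be too large, but neighbouring slopes have opposite signs, so \<open>\<delta>\<close> is
multiplied by the difference of two consecutive values of the profile, which decays geometrically.\<close>

lemma slope_squares:
  assumes k: "k < h"
  shows "(slope k)\<^sup>2 + (slope (Suc k))\<^sup>2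
    \<le> \<mu>\<^sup>2 * ((prev0 w_star k)\<^sup>2 + (w_star k)\<^sup>2) + 2580 * H ^ 3 * (3/4) ^ k + 579200 * H ^ 4"
proof -
  define x y where "x = prev0 w_star k" and "y = w_star k"
  define r r' where "r = rem k" and "r' = rem (Suc k)"
  define q where "q = (3/4 :: real) ^ k"
  have q: "0 \<le> q" by (simp add: q_def)
  have xy: "0 \<le> x" "x \<le> 7/5" "0 \<le> y" "y \<le> 7/5" "\<bar>y - x\<bar> \<le> 7/3 * q"
    using prev0_w[of k] w_star_nonneg[of k] w_star_bounds[of k] w_diff[of k] by (auto simp: x_def y_def q_def)
  have r: "\<bar>r\<bar> \<le> 46 * H ^ 3 + 307 * H\<^sup>2 * q" "\<bar>r'\<bar> \<le> 46 * H ^ 3 + 307 * H\<^sup>2 * (3/4 * q)"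
    "\<bar>r - \<delta>\<bar> \<le> 538 * H\<^sup>2" "\<bar>r' - \<delta>\<bar> \<le> 538 * H\<^sup>2"
    using rem_bound[of k] rem_bound[of "Suc k"] rem_delta[of k] rem_delta[of "Suc k"] k
    by (auto simp: r_def r'_def q_def)
  define s where "s = (-1::real) ^ k"
  have s: "s * s = 1" "\<bar>s\<bar> = 1" by (simp_all add: s_def power_mult_distrib[symmetric] power_abs)
  define X where "X = x * r - y * r' + \<delta> * (y - x)"
  have e: "slope k = s * \<mu> * x + (r - \<delta>)" "slope (Suc k) = - s * \<mu> * y + (r' - \<delta>)"
    by (simp_all add: slope_eq r_def r'_def s_def x_def y_def)
  have "(slope k)\<^sup>2 + (slope (Suc k))\<^sup>2
     = (s * s) * (\<mu>\<^sup>2 * (x\<^sup>2 + y\<^sup>2)) + 2 * (s * (\<mu> * X)) + (r - \<delta>)\<^sup>2 + (r' - \<delta>)\<^sup>2"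
    unfolding e X_def by (simp add: power2_eq_square algebra_simps)
  hence eq: "(slope k)\<^sup>2 + (slope (Suc k))\<^sup>2
     = \<mu>\<^sup>2 * (x\<^sup>2 + y\<^sup>2) + 2 * (s * (\<mu> * X)) + (r - \<delta>)\<^sup>2 + (r' - \<delta>)\<^sup>2" by (simp only: s mult_1)
  have X: "\<bar>X\<bar> \<le> 129 * H ^ 3 + 1290 * (H\<^sup>2 * q)"
  proof -
    have "\<bar>x * r\<bar> \<le> 7/5 * (46 * H ^ 3 + 307 * H\<^sup>2 * q)" unfolding abs_mult using xy r by (intro mult_mono) auto
    moreover have "\<bar>y * r'\<bar> \<le> 7/5 * (46 * H ^ 3 + 307 * H\<^sup>2 * (3/4 * q))"
      unfolding abs_mult using xy r by (intro mult_mono) auto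
    moreover have "\<bar>\<delta> * (y - x)\<bar> \<le> 230 * H\<^sup>2 * (7/3 * q)"
      unfolding abs_mult using xy delta(1) by (intro mult_mono) auto
    moreover have "H\<^sup>2 * q \<ge> 0" "H ^ 3 \<ge> 0" using q H(1) by auto
    moreover have "7/5 * (46 * H ^ 3 + 307 * H\<^sup>2 * q) + 7/5 * (46 * H ^ 3 + 307 * H\<^sup>2 * (3/4 * q)) + 230 * H\<^sup>2 * (7/3 * q)
      = 644/5 * H ^ 3 + 77329/60 * (H\<^sup>2 * q)" by (simp add: algebra_simps)
    moreover have "\<bar>X\<bar> \<le> \<bar>x * r\<bar> + \<bar>y * r'\<bar> + \<bar>\<delta> * (y - x)\<bar>" unfolding X_def by linarith
    ultimately show ?thesis by linarith
  qed
  have "\<bar>s * (\<mu> * X)\<bar> \<le> H * (129 * H ^ 3 + 1290 * (H\<^sup>2 * q))"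
    unfolding abs_mult s(2) mult_1 using X mu(1,2) H(1) by (intro mult_mono) auto
  also have "\<dots> = 129 * H ^ 4 + 1290 * H ^ 3 * q"
    by (simp add: power2_eq_square power3_eq_cube power4_eq_xxxx algebra_simps)
  finally have "s * (\<mu> * X) \<le> 129 * H ^ 4 + 1290 * H ^ 3 * q" by linarith
  moreover have "(r - \<delta>)\<^sup>2 \<le> (538 * H\<^sup>2)\<^sup>2" "(r' - \<delta>)\<^sup>2 \<le> (538 * H\<^sup>2)\<^sup>2"
    using power_mono[OF r(3), of 2] power_mono[OF r(4), of 2] by (simp_all only: abs_ge_zero power2_abs simp_thms)
  moreover have "(538 * H\<^sup>2)\<^sup>2 = 289444 * H ^ 4" by (simp add: power_mult_distrib)
  moreover have "H ^ 4 \<ge> 0" by simp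
  ultimately show ?thesis unfolding eq x_def[symmetric] y_def[symmetric] q_def[symmetric] by linarith
qed

text \<open>To leading order the cost of a side is a cubic polynomial in the profile, which equals
\<open>4 phi x y + 20 (x + y) - 80/3\<close>.\<close>

lemma gap_cost:
  assumes k: "k < h"
  shows "gap k ^ 3 / 12 + gap k * ((slope k)\<^sup>2 + (slope (Suc k))\<^sup>2)
     \<le> \<mu> ^ 3 * (4 * phi (prev0 w_star k) (w_star k) + 20 * w_gap k - 80 / 3)
       + 20000 * H ^ 4 * (3/4) ^ k + 3475200 * H ^ 5"
proof -
  define x y where "x = prev0 w_star k" and "y = w_star k"
  define q where "q = (3/4 :: real) ^ k"
  define g where "g = 2 * \<mu> * w_gap k"
  define S where "S = \<mu>\<^sup>2 * (x\<^sup>2 + y\<^sup>2)"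
  have q: "0 \<le> q" by (simp add: q_def)
  have xy: "0 \<le> x" "x \<le> 7/5" "0 \<le> y" "y \<le> 7/5" "w_gap k = x + y"
    using prev0_w[of k] w_star_nonneg[of k] w_star_bounds[of k] by (auto simp: x_def y_def w_gap_def)
  have g: "0 \<le> g" "g \<le> 6 * H" "gap k = g + \<gamma> k" using base_gap[of k] H(1) by (auto simp: g_def gap_def)
  have gam: "\<bar>\<gamma> k\<bar> \<le> 307 * H\<^sup>2 * q" using gamma(2) by (simp add: q_def)
  have gp: "0 \<le> gap k" "gap k \<le> 6 * H" using gap_bounds[of k] by auto
  have q4: "H\<^sup>2 * q * H\<^sup>2 = H ^ 4 * q" by (simp add: power2_eq_square power4_eq_xxxx)
  have main: "g ^ 3 / 12 + g * S = \<mu> ^ 3 * (4 * phi x y + 20 * w_gap k - 80 / 3)"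
    unfolding g_def S_def xy(5) phi_def by (simp add: power2_eq_square power3_eq_cube field_simps)
  have 1: "gap k ^ 3 - g ^ 3 \<le> 33156 * (H ^ 4 * q)"
  proof -
    have "gap k ^ 3 - g ^ 3 = \<gamma> k * ((gap k)\<^sup>2 + gap k * g + g\<^sup>2)"
      unfolding g(3) by (simp add: power2_eq_square power3_eq_cube algebra_simps)
    also have "\<dots> \<le> \<bar>\<gamma> k\<bar> * ((gap k)\<^sup>2 + gap k * g + g\<^sup>2)"
      using gp g by (intro mult_right_mono) auto
    also have "\<dots> \<le> (307 * H\<^sup>2 * q) * ((6 * H)\<^sup>2 + (6 * H) * (6 * H) + (6 * H)\<^sup>2)"
      using gp g gam H(1) q by (intro mult_mono add_mono power_mono) auto
    also have "\<dots> = 33156 * (H\<^sup>2 * q * H\<^sup>2)" by (simp add: power2_eq_square)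
    finally show ?thesis unfolding q4 .
  qed
  have S: "0 \<le> S" "S \<le> H\<^sup>2 * (98/25)"
  proof -
    have "x\<^sup>2 \<le> (7/5)\<^sup>2" "y\<^sup>2 \<le> (7/5)\<^sup>2" using xy by (auto intro!: power_mono)
    hence "x\<^sup>2 + y\<^sup>2 \<le> 98/25" by (simp add: power_divide)
    moreover have "\<mu>\<^sup>2 \<le> H\<^sup>2" using mu by (intro power_mono) auto
    ultimately show "S \<le> H\<^sup>2 * (98/25)" unfolding S_def by (intro mult_mono) auto
  qed (simp add: S_def)
  have 2: "\<gamma> k * S \<le> 1204 * (H ^ 4 * q)"
  proof -
    have "\<gamma> k * S \<le> \<bar>\<gamma> k\<bar> * S" using S by (intro mult_right_mono) auto
    also have "\<dots> \<le> (307 * H\<^sup>2 * q) * (H\<^sup>2 * (98/25))" using gam S q by (intro mult_mono) auto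
    also have "\<dots> = 307 * 98 / 25 * (H\<^sup>2 * q * H\<^sup>2)" by simp
    also have "\<dots> \<le> 1204 * (H ^ 4 * q)" unfolding q4 using q by (intro mult_right_mono) auto
    finally show ?thesis .
  qed
  have 3: "gap k * (2580 * H ^ 3 * q + 579200 * H ^ 4) \<le> 15480 * (H ^ 4 * q) + 3475200 * H ^ 5"
  proof -
    have "gap k * (2580 * H ^ 3 * q + 579200 * H ^ 4) \<le> (6 * H) * (2580 * H ^ 3 * q + 579200 * H ^ 4)"
      using gp H(1) q by (intro mult_right_mono) auto
    also have "\<dots> = 15480 * (H ^ 4 * q) + 3475200 * H ^ 5"
      by (simp add: power3_eq_cube power4_eq_xxxx numeral_eq_Suc algebra_simps)
    finally show ?thesis .
  qed
  have "gap k * ((slope k)\<^sup>2 + (slope (Suc k))\<^sup>2) \<le> gap k * (S + (2580 * H ^ 3 * q + 579200 * H ^ 4))"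
    using slope_squares[OF k] gp(1) unfolding x_def[symmetric] y_def[symmetric] q_def[symmetric] S_def[symmetric]
    by (intro mult_left_mono) (simp_all only: add.assoc)
  also have "\<dots> = g * S + \<gamma> k * S + gap k * (2580 * H ^ 3 * q + 579200 * H ^ 4)"
    unfolding g(3) by (simp add: algebra_simps)
  finally have "gap k ^ 3 / 12 + gap k * ((slope k)\<^sup>2 + (slope (Suc k))\<^sup>2)
     \<le> (g ^ 3 / 12 + g * S) + 33156 / 12 * (H ^ 4 * q) + 1204 * (H ^ 4 * q) + 15480 * (H ^ 4 * q) + 3475200 * H ^ 5"
    using 1 2 3 by argo
  moreover have "H ^ 4 * q \<ge> 0" using q by simp
  ultimately have "gap k ^ 3 / 12 + gap k * ((slope k)\<^sup>2 + (slope (Suc k))\<^sup>2)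
     \<le> (g ^ 3 / 12 + g * S) + 20000 * (H ^ 4 * q) + 3475200 * H ^ 5" by argo
  thus ?thesis unfolding main x_def y_def q_def by (simp only: mult.assoc)
qed

lemma total_cost:
  "(\<Sum>k<h. gap k ^ 3 / 12 + gap k * ((slope k)\<^sup>2 + (slope (Suc k))\<^sup>2))
     \<le> \<mu> ^ 3 * (4 * tau + 20 * w_node h - 80 / 3 * real h) + 3600000 * H ^ 4"
proof -
  have "(\<Sum>k<h. gap k ^ 3 / 12 + gap k * ((slope k)\<^sup>2 + (slope (Suc k))\<^sup>2))
    \<le> (\<Sum>k<h. \<mu> ^ 3 * (4 * phi (prev0 w_star k) (w_star k) + 20 * w_gap k - 80 / 3)
       + 20000 * H ^ 4 * (3/4) ^ k + 3475200 * H ^ 5)"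
    by (intro sum_mono gap_cost) auto
  also have "\<dots> = \<mu> ^ 3 * (\<Sum>k<h. 4 * phi (prev0 w_star k) (w_star k) + 20 * w_gap k - 80 / 3)
       + 20000 * H ^ 4 * (\<Sum>k<h. (3/4) ^ k) + real h * (3475200 * H ^ 5)"
    by (simp add: sum.distrib sum_distrib_left)
  also have "(\<Sum>k<h. 4 * phi (prev0 w_star k) (w_star k) + 20 * w_gap k - 80 / 3)
     = 4 * (\<Sum>k<h. phi (prev0 w_star k) (w_star k)) + 20 * w_node h - 80 / 3 * real h"
    by (simp add: sum.distrib sum_subtractf sum_distrib_left[symmetric] w_node_def)
  also have "real h * (3475200 * H ^ 5) = 3475200 * (real h * H) * H ^ 4"
    by (simp add: power4_eq_xxxx numeral_eq_Suc)
  also have "\<mu> ^ 3 * (4 * (\<Sum>k<h. phi (prev0 w_star k) (w_star k)) + 20 * w_node h - 80 / 3 * real h)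
     + 20000 * H ^ 4 * (\<Sum>k<h. (3/4) ^ k) + 3475200 * (real h * H) * H ^ 4
    \<le> \<mu> ^ 3 * (4 * tau + 20 * w_node h - 80 / 3 * real h) + 20000 * H ^ 4 * 4 + 3475200 * (real h * H) * H ^ 4"
    using mu(1) tau_ge_atoms[of h] sum_geometric34[of h]
    by (intro add_mono mult_left_mono order_refl diff_mono) auto
  also have "\<dots> \<le> \<mu> ^ 3 * (4 * tau + 20 * w_node h - 80 / 3 * real h) + 3600000 * H ^ 4"
    unfolding H(3) by simp
  finally show ?thesis .
qed

end

text \<open>The cost is \<open>\<pi>\<^sup>3 / 64\<close> times \<open>4 t / y\<^sup>3 + (20 y - 40 N / 3) / y\<^sup>3\<close>. As a function of \<open>y\<close> the second fraction is
maximal for \<open>y = N\<close>, with the value \<open>20 / (3 N\<^sup>2)\<close>; in the first fraction \<open>y\<close> may be replaced by \<open>N\<close> at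
the cost of an error of order \<open>N\<^sup>-\<^sup>4\<close>.\<close>

lemma main_term_bound:
  fixes y N t :: real
  assumes N: "N > 0" and y: "y \<ge> N / 2" "y \<ge> N - 10" and t: "0 \<le> t" "t \<le> 2"
  shows "(pi / (4 * y)) ^ 3 * (4 * t + 20 * y - 40 / 3 * N)
     \<le> 5 * pi ^ 3 / (48 * N\<^sup>2) + t * pi ^ 3 / (16 * N ^ 3) + 1920 / N ^ 4"
proof -
  have y0: "y > 0" using N y by linarith
  have inv: "1 / y ^ 3 \<le> 1 / N ^ 3 + 240 / N ^ 4"
  proof -
    have "y ^ 3 * (N + 240) \<ge> N ^ 4"
    proof (cases "y \<ge> N")
      case True
      hence "y ^ 3 * (N + 240) \<ge> N ^ 3 * N" using N by (intro mult_mono power_mono) auto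
      thus ?thesis by (simp add: power3_eq_cube power4_eq_xxxx)
    next
      case False
      \<comment> \<open>Here \<open>y\<^sup>3 \<ge> N\<^sup>3 - 3 N\<^sup>2 s\<close> with \<open>s \<le> 10\<close>, and \<open>y\<^sup>3 \<ge> N\<^sup>3 / 8\<close>, so \<open>240 y\<^sup>3\<close> compensates the loss of \<open>3 s N\<^sup>3\<close>.\<close>
      define s where "s = N - y"
      have s: "0 \<le> s" "s \<le> 10" "s \<le> N" "y = N - s" using False y N by (auto simp: s_def)
      have "y ^ 3 = N ^ 3 - 3 * N\<^sup>2 * s + s\<^sup>2 * (3 * N - s)"
        unfolding s(4) by (simp add: power2_eq_square power3_eq_cube algebra_simps)
      moreover have "s\<^sup>2 * (3 * N - s) \<ge> 0" using s N by (intro mult_nonneg_nonneg) auto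
      ultimately have a: "y ^ 3 \<ge> N ^ 3 - 3 * N\<^sup>2 * s" by linarith
      have "y ^ 3 \<ge> (N / 2) ^ 3" using y N by (intro power_mono) auto
      hence b: "y ^ 3 \<ge> N ^ 3 / 8" by (simp add: power_divide)
      have "y ^ 3 * N \<ge> (N ^ 3 - 3 * N\<^sup>2 * s) * N" using a N by (intro mult_right_mono) auto
      moreover have "(N ^ 3 - 3 * N\<^sup>2 * s) * N = N ^ 4 - 3 * (s * N ^ 3)"
        by (simp add: power2_eq_square power3_eq_cube power4_eq_xxxx algebra_simps)
      moreover have "s * N ^ 3 \<le> 10 * N ^ 3" using s N by (intro mult_right_mono) auto
      ultimately have "y ^ 3 * N + 240 * y ^ 3 \<ge> N ^ 4" using b by linarith
      thus ?thesis by (simp add: algebra_simps)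
    qed
    hence "1 / y ^ 3 \<le> (N + 240) / N ^ 4" using y0 N by (simp add: divide_simps mult.commute)
    also have "\<dots> = 1 / N ^ 3 + 240 / N ^ 4" using N by (simp add: add_divide_distrib power3_eq_cube power4_eq_xxxx)
    finally show ?thesis .
  qed
  have "20 * y - 40 / 3 * N \<le> 20 / 3 * y ^ 3 / N\<^sup>2"
  proof -
    have "y ^ 3 \<ge> 3 * N\<^sup>2 * y - 2 * N ^ 3" using y0 N by (intro cube_tangent_numeral) auto
    hence "20 / 3 * y ^ 3 \<ge> (20 * y - 40 / 3 * N) * N\<^sup>2"
      by (simp add: power2_eq_square power3_eq_cube algebra_simps)
    thus ?thesis using N by (simp add: pos_le_divide_eq)
  qed
  hence "(pi / (4 * y)) ^ 3 * (4 * t + 20 * y - 40 / 3 * N) \<le> (pi / (4 * y)) ^ 3 * (4 * t + 20 / 3 * y ^ 3 / N\<^sup>2)"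
    using y0 by (intro mult_left_mono) auto
  also have "\<dots> = t * pi ^ 3 / 16 * (1 / y ^ 3) + 5 * pi ^ 3 / (48 * N\<^sup>2)"
    using y0 N by (simp add: power_divide power_mult_distrib field_simps)
  also have "t * pi ^ 3 / 16 * (1 / y ^ 3) \<le> t * pi ^ 3 / 16 * (1 / N ^ 3 + 240 / N ^ 4)"
    using inv t by (intro mult_left_mono) auto
  also have "\<dots> = t * pi ^ 3 / (16 * N ^ 3) + (t * pi ^ 3) * (15 / N ^ 4)" by (simp add: field_simps)
  also have "(t * pi ^ 3) * (15 / N ^ 4) \<le> (2 * 4 ^ 3) * (15 / N ^ 4)"
    using t N pi_less_4 by (intro mult_right_mono mult_mono power_mono) auto
  finally show ?thesis by (simp add: add.commute add.left_commute)
qed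

lemma tau_nonneg: "tau \<ge> 0"
  using tau_ge_atoms[of 0] by simp

text \<open>The error term collects those of \<open>total_cost\<close> and \<open>main_term_bound\<close>, and the square of the bound for the primitive of the slope, which is
\<open>9900 h\<^sup>-\<^sup>2\<close>.\<close>

theorem small_polygon_lower:
  assumes h: "h \<ge> 10000"
  obtains P where "small_polygon (2 * h) P"
    "polygon_area (2 * h) P \<ge> pi / 4 - 5 * pi ^ 3 / (48 * (2 * real h)\<^sup>2)
       - tau * pi ^ 3 / (16 * (2 * real h) ^ 3) - 7000000000 / real h ^ 4"
proof -
  interpret competitor h by unfold_locales (rule h)
  have drift: "\<bar>\<Sum>j<k. slope (Suc j) * ((\<alpha> j + \<alpha> (Suc j)) / 2)\<bar> \<le> 6600 * H\<^sup>2" if "k < 2 * h" for k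
    using drift_bound[OF that] by (simp only: drift_def)
  obtain P where P: "small_polygon (2 * h) P"
    "polygon_area (2 * h) P \<ge> (\<Sum>k<h. sin (\<alpha> k)) / 2
       - (\<Sum>k<h. \<alpha> k * ((slope k)\<^sup>2 + (slope (Suc k))\<^sup>2)) - (3 / 2 * (6600 * H\<^sup>2))\<^sup>2 * (pi\<^sup>2 + 1) * pi"
    using polygon[OF drift] by blast
  have "(\<Sum>k<h. sin (\<alpha> k)) / 2 - (\<Sum>k<h. \<alpha> k * ((slope k)\<^sup>2 + (slope (Suc k))\<^sup>2))
     = (\<Sum>k<h. sin (gap k) / 2 - gap k * ((slope k)\<^sup>2 + (slope (Suc k))\<^sup>2))"
    unfolding sum_divide_distrib sum_subtractf[symmetric] by (rule sum.cong[OF refl]) (simp add: \<alpha>_eq)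
  also have "\<dots> \<ge> (\<Sum>k<h. gap k / 2 - (gap k ^ 3 / 12 + gap k * ((slope k)\<^sup>2 + (slope (Suc k))\<^sup>2)))"
  proof (rule sum_mono)
    fix k
    have "sin (gap k) \<ge> gap k - gap k ^ 3 / 6" using gap_bounds[of k] by (intro sin_cubic_lower) auto
    thus "gap k / 2 - (gap k ^ 3 / 12 + gap k * ((slope k)\<^sup>2 + (slope (Suc k))\<^sup>2))
      \<le> sin (gap k) / 2 - gap k * ((slope k)\<^sup>2 + (slope (Suc k))\<^sup>2)" by linarith
  qed
  finally have A: "(\<Sum>k<h. sin (\<alpha> k)) / 2 - (\<Sum>k<h. \<alpha> k * ((slope k)\<^sup>2 + (slope (Suc k))\<^sup>2))
     \<ge> (\<Sum>k<h. gap k) / 2 - (\<Sum>k<h. gap k ^ 3 / 12 + gap k * ((slope k)\<^sup>2 + (slope (Suc k))\<^sup>2))"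
    by (simp only: sum_subtractf sum_divide_distrib)
  have B: "(\<Sum>k<h. gap k) = pi / 2" using gap_sum by (simp add: \<alpha>_eq)
  have "\<mu> ^ 3 * (4 * tau + 20 * w_node h - 40 / 3 * (2 * real h))
     \<le> 5 * pi ^ 3 / (48 * (2 * real h)\<^sup>2) + tau * pi ^ 3 / (16 * (2 * real h) ^ 3) + 1920 / (2 * real h) ^ 4"
    unfolding \<mu>_def using w_node_h h tau_nonneg tau_le by (intro main_term_bound) auto
  also have "1920 / (2 * real h) ^ 4 = 120 * H ^ 4" by (simp add: H_def power_mult_distrib power_divide)
  finally have C: "\<mu> ^ 3 * (4 * tau + 20 * w_node h - 80 / 3 * real h)
     \<le> 5 * pi ^ 3 / (48 * (2 * real h)\<^sup>2) + tau * pi ^ 3 / (16 * (2 * real h) ^ 3) + 120 * H ^ 4"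
    by simp
  have "(3 / 2 * (6600 * H\<^sup>2))\<^sup>2 * (pi\<^sup>2 + 1) * pi \<le> (3 / 2 * (6600 * H\<^sup>2))\<^sup>2 * (4\<^sup>2 + 1) * 4"
    using pi_less_4 by (intro mult_mono add_mono power_mono order_refl) auto
  also have "\<dots> = 6664680000 * H ^ 4" by (simp add: power_mult_distrib)
  finally have D: "(3 / 2 * (6600 * H\<^sup>2))\<^sup>2 * (pi\<^sup>2 + 1) * pi \<le> 6664680000 * H ^ 4" .
  have E: "7000000000 / real h ^ 4 = 7000000000 * H ^ 4" by (simp add: H_def power_divide)
  have F: "H ^ 4 \<ge> 0" by simp
  have "polygon_area (2 * h) P \<ge> pi / 4 - 5 * pi ^ 3 / (48 * (2 * real h)\<^sup>2)
       - tau * pi ^ 3 / (16 * (2 * real h) ^ 3) - 7000000000 / real h ^ 4"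
    using P(2) A total_cost C D F unfolding B E by linarith
  with P(1) show ?thesis by (rule that)
qed

section \<open>The asymptotic expansion\<close>

text \<open>The first two terms of the expansion of \<open>\<pi>/4 - A\<^sub>n\<close>.\<close>

definition deficit :: "nat \<Rightarrow> real" where
  "deficit n = 5 * pi ^ 3 / (48 * real n ^ 2) + tau * pi ^ 3 / (16 * real n ^ 3)"

lemma geometric34_le: "(3/4 :: real) ^ h \<le> 4 / real h" if "h > 0"
proof -
  have "real h * (3/4) ^ h = (\<Sum>j<h. (3/4 :: real) ^ h)" by simp
  also have "\<dots> \<le> (\<Sum>j<h. (3/4) ^ j)" by (intro sum_mono power_decreasing) auto
  also have "\<dots> \<le> 4" by (rule sum_geometric34)
  finally show ?thesis using that by (simp add: pos_le_divide_eq mult.commute)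
qed

lemma deficit_bounds:
  assumes n: "n \<ge> 20000" shows "0 \<le> deficit n" "deficit n \<le> 8 / real n ^ 2"
proof -
  have n0: "real n > 0" "1 / real n \<le> 1 / 20000" using n by (auto simp: divide_simps)
  have p3: "pi ^ 3 \<le> 4 ^ 3" using pi_less_4 by (intro power_mono) auto
  show "0 \<le> deficit n" using tau_nonneg by (simp add: deficit_def)
  have "5 * pi ^ 3 / (48 * real n ^ 2) \<le> 5 * 4 ^ 3 / (48 * real n ^ 2)"
    using p3 by (intro divide_right_mono mult_left_mono) auto
  also have "\<dots> = 20 / 3 * (1 / real n ^ 2)" by simp
  finally have a: "5 * pi ^ 3 / (48 * real n ^ 2) \<le> 20 / 3 * (1 / real n ^ 2)" .
  have "tau * pi ^ 3 / (16 * real n ^ 3) \<le> 2 * 4 ^ 3 / (16 * real n ^ 3)"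
    using p3 tau_le tau_nonneg by (intro divide_right_mono mult_mono) auto
  also have "\<dots> = 8 * (1 / real n) * (1 / real n ^ 2)" by (simp add: power2_eq_square power3_eq_cube)
  also have "\<dots> \<le> 8 * (1 / 20000) * (1 / real n ^ 2)" using n0 by (intro mult_right_mono mult_left_mono) auto
  finally have "tau * pi ^ 3 / (16 * real n ^ 3) \<le> 8 * (1 / 20000) * (1 / real n ^ 2)" .
  moreover have "0 \<le> 1 / real n ^ 2" by simp
  ultimately have "deficit n \<le> 8 * (1 / real n ^ 2)" using a unfolding deficit_def by linarith
  thus "deficit n \<le> 8 / real n ^ 2" by simp
qed

text \<open>The choice \<open>\<nu> = \<pi> / (4 n)\<close> in \<open>hull_area_upper\<close> gives exactly the \<open>deficit\<close>. The factor \<open>1 + 20 \<nu>\<^sup>2\<close> changes it by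
\<open>O(n\<^sup>-\<^sup>4)\<close>, and so does the exponentially small term.\<close>

lemma small_polygon_upper:
  assumes P: "small_polygon n v" and n: "n = 2 * h" "h \<ge> 10000"
  shows "polygon_area n v \<le> pi / 4 - deficit n + 13000 / real n ^ 4"
proof -
  define m where "m = measure lebesgue (convex hull (v ` {..<n}))"
  define N where "N = real n"
  have N: "N > 0" "N = 2 * real h" "1 / N \<le> 1 / 20000" using n by (auto simp: N_def divide_simps)
  have nn: "n \<ge> 20000" using n by simp
  have le: "polygon_area n v \<le> m" unfolding m_def by (rule polygon_area_le_hull)
  have N2: "1 / N ^ 2 \<le> 1 / 400000000"
    using power_mono[OF N(3), of 2] N(1) by (simp add: power_divide)
  have "m = 0 \<or> (pi / 4 - m) * (1 + 20 * (pi / (4 * real n))\<^sup>2)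
       \<ge> 2 * (pi / (4 * real n)) ^ 3 * (2 * tau - 800 * (3/4) ^ h) - 40/3 * real n * (pi / (4 * real n)) ^ 3 + 5 * (pi / (4 * real n))\<^sup>2 * pi"
    unfolding m_def
  proof (rule hull_area_upper)
    show "card (v ` {..<n}) \<le> n" using card_image_le[of "{..<n}" v] by simp
    show "dist x y \<le> 1" if "x \<in> v ` {..<n}" "y \<in> v ` {..<n}" for x y
      using P that by (auto simp: small_polygon_def)
    show "n = 2 * h" by (rule n)
    show "3 \<le> h" using n by simp
    show "0 < pi / (4 * real n)" using N by (simp add: N_def)
  qed simp
  thus ?thesis
  proof
    assume "m = 0"
    hence "polygon_area n v \<le> 0" using le by simp
    moreover have "deficit n \<le> 8 * (1 / N ^ 2)" using deficit_bounds(2)[OF nn] by (simp add: N_def)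
    moreover have "13000 / real n ^ 4 \<ge> 0" by simp
    ultimately show ?thesis using N2 pi_gt3 by linarith
  next
    define \<nu> where "\<nu> = pi / (4 * N)"
    define R where "R = 2 * \<nu> ^ 3 * (2 * tau - 800 * (3/4) ^ h) - 40/3 * N * \<nu> ^ 3 + 5 * \<nu>\<^sup>2 * pi"
    define x where "x = 20 * \<nu>\<^sup>2"
    assume "(pi / 4 - m) * (1 + 20 * (pi / (4 * real n))\<^sup>2)
       \<ge> 2 * (pi / (4 * real n)) ^ 3 * (2 * tau - 800 * (3/4) ^ h) - 40/3 * real n * (pi / (4 * real n)) ^ 3 + 5 * (pi / (4 * real n))\<^sup>2 * pi"
    hence main: "R \<le> (pi / 4 - m) * (1 + x)" by (simp only: R_def x_def \<nu>_def N_def)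
    have nu: "0 \<le> \<nu>" "\<nu> \<le> 1 / N" using N(1) pi_less_4 by (auto simp: \<nu>_def divide_simps)
    define T where "T = 1600 * \<nu> ^ 3 * (3/4) ^ h"
    have R: "R = deficit n - T"
    proof -
      have "R = 4 * tau * \<nu> ^ 3 - 40/3 * N * \<nu> ^ 3 + 5 * \<nu>\<^sup>2 * pi - T"
        by (simp add: R_def T_def algebra_simps)
      also have "4 * tau * \<nu> ^ 3 - 40/3 * N * \<nu> ^ 3 + 5 * \<nu>\<^sup>2 * pi = deficit n"
        using N(1) unfolding \<nu>_def deficit_def N_def[symmetric]
        by (simp add: power2_eq_square power3_eq_cube field_simps)
      finally show ?thesis .
    qed
    have n3: "\<nu> ^ 3 \<le> (1 / N) ^ 3" using nu by (intro power_mono)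
    have T0: "0 \<le> T" using nu by (simp add: T_def)
    have T4: "T \<le> 12800 / N ^ 4"
    proof -
      have "T \<le> 1600 * (1 / N) ^ 3 * (4 / real h)"
        unfolding T_def using n3 geometric34_le[of h] n N(1) nu by (intro mult_mono) auto
      also have "\<dots> = 12800 / N ^ 4" using n unfolding N(2) by (simp add: power3_eq_cube power4_eq_xxxx field_simps)
      finally show ?thesis .
    qed
    have T2: "T \<le> 1 / N ^ 2"
    proof -
      have "T \<le> 1600 * (1 / N) ^ 3 * 1"
        unfolding T_def using n3 N(1) nu power_le_one[of "3/4 :: real" h] by (intro mult_mono) auto
      also have "\<dots> = 1600 * (1 / N) * (1 / N ^ 2)" by (simp add: power2_eq_square power3_eq_cube)
      also have "\<dots> \<le> 1600 * (1 / 20000) * (1 / N ^ 2)" using N by (intro mult_right_mono mult_left_mono) auto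
      also have "\<dots> \<le> 1 * (1 / N ^ 2)" by (rule mult_right_mono) auto
      also have "\<dots> = 1 / N ^ 2" by simp
      finally show ?thesis .
    qed
    have absR: "\<bar>R\<bar> \<le> 9 / N ^ 2"
      using deficit_bounds[OF nn] T0 T2 unfolding R N_def by (simp add: abs_le_iff)
    have x: "0 \<le> x" "x \<le> 20 / N ^ 2"
      using power_mono[OF nu(2,1), of 2] by (auto simp: x_def power_divide)
    have "x * \<bar>R\<bar> \<le> (20 / N ^ 2) * (9 / N ^ 2)" using x absR by (intro mult_mono) auto
    hence xR: "x * \<bar>R\<bar> \<le> 180 / N ^ 4" by (simp add: power2_eq_square power4_eq_xxxx)
    have "R - x * \<bar>R\<bar> \<le> pi / 4 - m"
    proof -
      have "R / (1 + x) \<le> pi / 4 - m" using main x by (simp add: pos_divide_le_eq)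
      moreover have "(R - x * \<bar>R\<bar>) * (1 + x) \<le> R"
      proof -
        have "(R - x * \<bar>R\<bar>) * (1 + x) = R + x * (R - \<bar>R\<bar>) - x * (x * \<bar>R\<bar>)" by (simp add: algebra_simps)
        moreover have "x * (R - \<bar>R\<bar>) \<le> 0" using x by (intro mult_nonneg_nonpos) auto
        moreover have "x * (x * \<bar>R\<bar>) \<ge> 0" using x by simp
        ultimately show ?thesis by linarith
      qed
      hence "R - x * \<bar>R\<bar> \<le> R / (1 + x)" using x by (simp add: pos_le_divide_eq)
      ultimately show ?thesis by linarith
    qed
    moreover have "12800 / N ^ 4 + 180 / N ^ 4 \<le> 13000 / N ^ 4" by (simp add: add_divide_distrib[symmetric] divide_right_mono)
    ultimately show ?thesis using le xR T4 unfolding R N_def[symmetric] by linarith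
  qed
qed

theorem max_small_area_estimate:
  assumes "even n" "n \<ge> 20000"
  shows "\<bar>max_small_area n - (pi / 4 - deficit n)\<bar> \<le> 112000000000 / real n ^ 4"
proof -
  define h where "h = n div 2"
  have h: "n = 2 * h" "h \<ge> 10000" using assms by (auto simp: h_def)
  have up: "polygon_area n v \<le> pi / 4 - deficit n + 13000 / real n ^ 4" if "small_polygon n v" for v
    using that h by (rule small_polygon_upper)
  obtain P where P: "small_polygon n P" "polygon_area n P \<ge> pi / 4 - 5 * pi ^ 3 / (48 * (2 * real h)\<^sup>2)
       - tau * pi ^ 3 / (16 * (2 * real h) ^ 3) - 7000000000 / real h ^ 4"
    using small_polygon_lower[OF h(2)] h(1) by metis
  have hn: "real n = 2 * real h" using h(1) by simp
  have "7000000000 / real h ^ 4 = 112000000000 / real n ^ 4" unfolding hn by (simp add: power_mult_distrib)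
  hence "polygon_area n P \<ge> pi / 4 - deficit n - 112000000000 / real n ^ 4"
    using P(2) unfolding deficit_def hn by linarith
  moreover have "polygon_area n P \<le> max_small_area n"
    unfolding max_small_area_def using P(1) up by (intro cSUP_upper bdd_aboveI2) auto
  moreover have "max_small_area n \<le> pi / 4 - deficit n + 13000 / real n ^ 4"
    unfolding max_small_area_def using P(1) up by (intro cSUP_least) auto
  moreover have "13000 / real n ^ 4 \<le> 112000000000 / real n ^ 4" by (intro divide_right_mono) auto
  ultimately show ?thesis by linarith
qed

text \<open>Insert the expansions of sine and tangent at \<open>0\<close>, and then replace \<open>n - 1\<close> by \<open>n\<close>.\<close>

lemma Foster_Szabo_expansion:
  "(\<lambda>n. Foster_Szabo_bound n - (pi / 4 - 5 * pi ^ 3 / (48 * real n ^ 2) - pi ^ 3 / (24 * real n ^ 3)))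
     \<in> O(\<lambda>n. 1 / real n ^ 4)"
proof -
  have sin0: "(\<lambda>x::real. sin x - x + x ^ 3 / 6) \<in> O[at_right 0](\<lambda>x. x ^ 5)" by real_asymp
  have tan0: "(\<lambda>x::real. tan x - x - x ^ 3 / 3) \<in> O[at_right 0](\<lambda>x. x ^ 5)" by real_asymp
  have lim: "filterlim (\<lambda>n. pi / real n) (at_right 0) sequentially"
    "filterlim (\<lambda>n. pi / (2 * real n - 2)) (at_right 0) sequentially"
    by real_asymp+
  have "(\<lambda>n. real n / 2 * (sin (pi / real n) - pi / real n + (pi / real n) ^ 3 / 6)) \<in> O(\<lambda>n. real n * (pi / real n) ^ 5)"
    by (intro landau_o.big.mult landau_o.big.compose[OF sin0 lim(1)]) simp
  also have "(\<lambda>n. real n * (pi / real n) ^ 5) \<in> O(\<lambda>n. 1 / real n ^ 4)" by real_asymp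
  finally have s: "(\<lambda>n. real n / 2 * (sin (pi / real n) - pi / real n + (pi / real n) ^ 3 / 6)) \<in> O(\<lambda>n. 1 / real n ^ 4)" .
  have "(\<lambda>n. (real n - 1) / 2 * (tan (pi / (2 * real n - 2)) - pi / (2 * real n - 2) - (pi / (2 * real n - 2)) ^ 3 / 3))
     \<in> O(\<lambda>n. real n * (pi / (2 * real n - 2)) ^ 5)"
    by (intro landau_o.big.mult landau_o.big.compose[OF tan0 lim(2)]) real_asymp
  also have "(\<lambda>n. real n * (pi / (2 * real n - 2)) ^ 5) \<in> O(\<lambda>n. 1 / real n ^ 4)" by real_asymp
  finally have t: "(\<lambda>n. (real n - 1) / 2 * (tan (pi / (2 * real n - 2)) - pi / (2 * real n - 2) - (pi / (2 * real n - 2)) ^ 3 / 3))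
     \<in> O(\<lambda>n. 1 / real n ^ 4)" .
  have r: "(\<lambda>n. pi ^ 3 / 48 * (1 / (real n - 1) ^ 2 - 1 / real n ^ 2 - 2 / real n ^ 3)) \<in> O(\<lambda>n. 1 / real n ^ 4)"
    by real_asymp
  show ?thesis
  proof (rule iffD2[OF landau_o.big.in_cong sum_in_bigo(2)[OF sum_in_bigo(2)[OF s t] r]])
    show "\<forall>\<^sub>F n in sequentially. Foster_Szabo_bound n - (pi / 4 - 5 * pi ^ 3 / (48 * real n ^ 2) - pi ^ 3 / (24 * real n ^ 3))
      = real n / 2 * (sin (pi / real n) - pi / real n + (pi / real n) ^ 3 / 6)
        - (real n - 1) / 2 * (tan (pi / (2 * real n - 2)) - pi / (2 * real n - 2) - (pi / (2 * real n - 2)) ^ 3 / 3)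
        - pi ^ 3 / 48 * (1 / (real n - 1) ^ 2 - 1 / real n ^ 2 - 2 / real n ^ 3)"
    proof (rule eventually_mono[OF eventually_ge_at_top[of 2]])
      fix n :: nat assume n: "n \<ge> 2"
      define k where "k = real n - 1"
      have k: "k > 0" "real n > 0" using n by (auto simp: k_def)
      have e: "2 * real n - 2 = 2 * k" by (simp add: k_def)
      have 1: "k / 2 * (pi / (2 * k) + (pi / (2 * k)) ^ 3 / 3) = pi / 4 + pi ^ 3 / (48 * k ^ 2)"
        using k by (simp add: power2_eq_square power3_eq_cube field_simps)
      have 2: "real n / 2 * (pi / real n - (pi / real n) ^ 3 / 6) = pi / 2 - pi ^ 3 / (12 * real n ^ 2)"
        using k by (simp add: power2_eq_square power3_eq_cube field_simps)
      show "Foster_Szabo_bound n - (pi / 4 - 5 * pi ^ 3 / (48 * real n ^ 2) - pi ^ 3 / (24 * real n ^ 3))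
      = real n / 2 * (sin (pi / real n) - pi / real n + (pi / real n) ^ 3 / 6)
        - (real n - 1) / 2 * (tan (pi / (2 * real n - 2)) - pi / (2 * real n - 2) - (pi / (2 * real n - 2)) ^ 3 / 3)
        - pi ^ 3 / 48 * (1 / (real n - 1) ^ 2 - 1 / real n ^ 2 - 2 / real n ^ 3)"
        unfolding Foster_Szabo_bound_def e k_def[symmetric] using 1 2 by (simp add: algebra_simps)
    qed
  qed
qed

theorem theorem1p4:
  shows "(\<lambda>n. max_small_area n -
            (pi / 4 - 5 * pi ^ 3 / (48 * real n ^ 2) - q_star * pi ^ 3 / real n ^ 3))
           \<in> O[even_at_top](\<lambda>n. 1 / real n ^ 4)
       \<and> (\<lambda>n. (Foster_Szabo_bound n - max_small_area n) -
            (q_star - 1 / 24) * pi ^ 3 / real n ^ 3)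
           \<in> O[even_at_top](\<lambda>n. 1 / real n ^ 4)"
proof -
  have A: "(\<lambda>n. max_small_area n -
            (pi / 4 - 5 * pi ^ 3 / (48 * real n ^ 2) - q_star * pi ^ 3 / real n ^ 3))
           \<in> O[even_at_top](\<lambda>n. 1 / real n ^ 4)"
  proof (rule bigoI)
    show "\<forall>\<^sub>F n in even_at_top. norm (max_small_area n -
            (pi / 4 - 5 * pi ^ 3 / (48 * real n ^ 2) - q_star * pi ^ 3 / real n ^ 3))
           \<le> 112000000000 * norm (1 / real n ^ 4)"
      unfolding eventually_inf_principal
    proof (rule eventually_mono[OF eventually_ge_at_top[of 20000]], rule impI)
      fix n :: nat assume "n \<ge> 20000" "n \<in> {n. even n}"
      thus "norm (max_small_area n -
            (pi / 4 - 5 * pi ^ 3 / (48 * real n ^ 2) - q_star * pi ^ 3 / real n ^ 3))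
           \<le> 112000000000 * norm (1 / real n ^ 4)"
        using max_small_area_estimate[of n] by (simp add: deficit_def q_star_eq diff_diff_eq)
    qed
  qed
  have "even_at_top \<le> at_top" by simp
  hence "(\<lambda>n. Foster_Szabo_bound n - (pi / 4 - 5 * pi ^ 3 / (48 * real n ^ 2) - pi ^ 3 / (24 * real n ^ 3)))
     \<in> O[even_at_top](\<lambda>n. 1 / real n ^ 4)"
    using Foster_Szabo_expansion by (rule landau_o.big.filter_mono)
  from sum_in_bigo(2)[OF this A]
  have "(\<lambda>n. (Foster_Szabo_bound n - max_small_area n) - (q_star - 1 / 24) * pi ^ 3 / real n ^ 3)
           \<in> O[even_at_top](\<lambda>n. 1 / real n ^ 4)"
    by (simp add: algebra_simps diff_divide_distrib)
  with A show ?thesis by blast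
qed

end
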